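(* Let $(X,d,\mathfrak m)$ be a metric measure space and let $\varnothing\neq\Omega\subset X$ be open with $\mathfrak m(\Omega)<\infty$. Suppose there exist constants $C>0$, $Q>1$ such that $$\mathrm{Per}(E,\Omega)\ge C\,\omega_Q^{1/Q}\,Q\,\min\big(\mathfrak m(E),\mathfrak m(\Omega\setminus E)\big)^{\frac{Q-1}Q}\qquad\text{for all Borel }E\subset\Omega.$$ Then for all $p\in(1,\infty)$ $$\lambda_p^{\mathcal N}(\Omega)\ge C^p\,2^{p/Q}\,\lambda^{\mathcal D}_{p,Q,R},$$ where $R>0$ is such that $\mathfrak m_{0,Q}([0,R))=\mathfrak m(\Omega)$.
   Context: Metric measure space: $(X,d)$ complete separable, $\mathfrak m\neq 0$ non-negative Borel, finite on bounded sets, $\operatorname{supp}\mathfrak m=X$. $\omega_Q=\pi^{Q/2}/\Gamma(Q/2+1)$, $\mathfrak m_{0,Q}=Q\omega_Qt^{Q-1}dt$ on $[0,\infty)$. Sobolev spaces: $u\in W^{1,p}(X)$ iff $u\in L^p(X)$ and $\mathrm{Ch}_p(u)=\inf\{\liminf_n\int(\mathrm{lip}\,u_n)^p\,d\mathfrak m:u_n\in\mathrm{Lip}(X),u_n\to u\text{ in }L^p\}<\infty$ ($\mathrm{lip}$ the local Lipschitz constant), and $|Du|_p$ is the minimal $p$-weak upper gradient, $\mathrm{Ch}_p(u)=\int|Du|_p^p\,d\mathfrak m$. $u\in W^{1,p}_{loc}(\Omega)$ iff $u\in L^p_{loc}(\Omega)$ and $\eta u\in W^{1,p}(X)$ for all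 Lipschitz $\eta$ with bounded support contained in $\Omega$, with $|Du|_p:=|D(\eta u)|_p$ a.e. on $\{\eta=1\}$. $W^{1,p}(\Omega)=\{u\in W^{1,p}_{loc}(\Omega):u,|Du|_p\in L^p(\Omega)\}$. $W^{1,p}_0(\Omega)$ is the $W^{1,p}(X)$-closure of the Lipschitz functions with bounded support contained in $\Omega$. Perimeter: $\mathrm{Per}(E,\Omega)=\inf\{\liminf_n\int_\Omega\mathrm{lip}\,v_n\,d\mathfrak m:v_n\in\mathrm{Lip}_{loc}(\Omega),v_n\to\chi_E\text{ in }L^1_{loc}(\Omega)\}$. Eigenvalues: $\lambda_p^{\mathcal N}(\Omega)=\inf\{\int_\Omega|Du|_p^p\,d\mathfrak m:u\in W^{1,p}(\Omega),\int_\Omega|u|^p\,d\mathfrak m=1,\int_\Omega|u|^{p-2}u\,d\mathfrak m=0\}$ ($+\infty$ if the set is empty); $\lambda_p^{\mathcal D}(\Omega)=\inf\{\int_\Omega|Du|_p^p\,d\mathfrak m:u\in W_0^{1,p}(\Omega),\int_\Omega|u|^p\,d\mathfrak m=1\}$. $\lambda^{\mathcal D}_{p,Q,R}$ is the Dirichlet $p$-eigenvalue of $[0,R)$ in the metric measure space $([0,\infty),|\cdot|,\mathfrak m_{0,Q})$. *)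

theory Defs
  imports "HOL-Analysis.Analysis"
begin

section \<open>Metric measure spaces\<close>

text \<open>The class \<^class>\<open>polish_space\<close> is that of complete, second countable metric spaces; for
  metric spaces second countability is separability.\<close>

definition msupport :: "'a::metric_space measure \<Rightarrow> 'a set" where
  "msupport m = {x. \<forall>U. open U \<and> x \<in> U \<longrightarrow> emeasure m U > 0}"

definition metric_measure_space :: "'a::polish_space measure \<Rightarrow> bool" where
  "metric_measure_space m \<longleftrightarrow>
     sets m = sets borel \<and>
     emeasure m UNIV \<noteq> 0 \<and>
     (\<forall>A \<in> sets borel. bounded A \<longrightarrow> emeasure m A < \<infinity>) \<and>
     msupport m = UNIV"


section \<open>Lebesgue spaces\<close>

definition epowr :: "ennreal \<Rightarrow> real \<Rightarrow> ennreal" where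
  "epowr x p = (if x = \<infinity> then \<infinity> else ennreal (enn2real x powr p))"

definition in_Lp :: "real \<Rightarrow> 'a measure \<Rightarrow> ('a \<Rightarrow> real) \<Rightarrow> bool" where
  "in_Lp p M u \<longleftrightarrow>
     u \<in> borel_measurable M \<and> (\<integral>\<^sup>+x. ennreal (\<bar>u x\<bar> powr p) \<partial>M) < \<infinity>"

definition Lp_tendsto :: "real \<Rightarrow> 'a measure \<Rightarrow> (nat \<Rightarrow> 'a \<Rightarrow> real) \<Rightarrow> ('a \<Rightarrow> real) \<Rightarrow> bool" where
  "Lp_tendsto p M v u \<longleftrightarrow>
     (\<lambda>n. \<integral>\<^sup>+x. ennreal (\<bar>v n x - u x\<bar> powr p) \<partial>M) \<longlonglongrightarrow> 0"

text \<open>Functions on an open set \<open>\<Omega>\<close> are total functions whose values outside \<open>\<Omega>\<close> are ignored.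
  The index ``loc'' always means: on some neighbourhood of each point of \<open>\<Omega>\<close>.\<close>

definition in_Lp_loc :: "real \<Rightarrow> 'a::metric_space measure \<Rightarrow> 'a set \<Rightarrow> ('a \<Rightarrow> real) \<Rightarrow> bool" where
  "in_Lp_loc p m \<Omega> u \<longleftrightarrow>
     u \<in> borel_measurable (restrict_space m \<Omega>) \<and>
     (\<forall>x\<in>\<Omega>. \<exists>r>0. in_Lp p (restrict_space m (ball x r \<inter> \<Omega>)) u)"

definition L1_loc_tendsto ::
    "'a::metric_space measure \<Rightarrow> 'a set \<Rightarrow> (nat \<Rightarrow> 'a \<Rightarrow> real) \<Rightarrow> ('a \<Rightarrow> real) \<Rightarrow> bool" where
  "L1_loc_tendsto m \<Omega> v u \<longleftrightarrow>
     (\<forall>x\<in>\<Omega>. \<exists>r>0. Lp_tendsto 1 (restrict_space m (ball x r \<inter> \<Omega>)) v u)"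


section \<open>Lipschitz functions, Cheeger energy and perimeter\<close>

text \<open>At an isolated point \<open>at x\<close> is the trivial filter and the value is 0.\<close>

definition lip :: "('a::metric_space \<Rightarrow> real) \<Rightarrow> 'a \<Rightarrow> ennreal" where
  "lip u x = Limsup (at x) (\<lambda>y. ennreal (\<bar>u y - u x\<bar> / dist y x))"

definition lipschitz_fun :: "('a::metric_space \<Rightarrow> real) \<Rightarrow> bool" where
  "lipschitz_fun u \<longleftrightarrow> (\<exists>L. L-lipschitz_on UNIV u)"

definition loc_lipschitz_fun :: "'a::metric_space set \<Rightarrow> ('a \<Rightarrow> real) \<Rightarrow> bool" where
  "loc_lipschitz_fun \<Omega> u \<longleftrightarrow> (\<forall>x\<in>\<Omega>. \<exists>r>0. \<exists>L. L-lipschitz_on (ball x r \<inter> \<Omega>) u)"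

definition lipschitz_bs :: "'a::metric_space set \<Rightarrow> ('a \<Rightarrow> real) \<Rightarrow> bool" where
  "lipschitz_bs \<Omega> \<eta> \<longleftrightarrow>
     lipschitz_fun \<eta> \<and> bounded (closure {x. \<eta> x \<noteq> 0}) \<and> closure {x. \<eta> x \<noteq> 0} \<subseteq> \<Omega>"

definition cheeger_energy :: "real \<Rightarrow> 'a::metric_space measure \<Rightarrow> ('a \<Rightarrow> real) \<Rightarrow> ennreal" where
  "cheeger_energy p m u =
     (INF v \<in> {v. (\<forall>n. lipschitz_fun (v n)) \<and> Lp_tendsto p m v u}.
        liminf (\<lambda>n. \<integral>\<^sup>+x. epowr (lip (v n) x) p \<partial>m))"

definition perimeter :: "'a::metric_space measure \<Rightarrow> 'a set \<Rightarrow> 'a set \<Rightarrow> ennreal" where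
  "perimeter m E \<Omega> =
     (INF v \<in> {v. (\<forall>n. loc_lipschitz_fun \<Omega> (v n)) \<and> L1_loc_tendsto m \<Omega> v (indicat_real E)}.
        liminf (\<lambda>n. \<integral>\<^sup>+x\<in>\<Omega>. lip (v n) x \<partial>m))"


section \<open>Weak upper gradients\<close>

definition curve_length :: "(real \<Rightarrow> 'a::metric_space) \<Rightarrow> real \<Rightarrow> real \<Rightarrow> ennreal" where
  "curve_length \<gamma> a b =
     (SUP ts \<in> {ts. sorted ts \<and> set ts \<subseteq> {a..b}}.
        \<Sum>i < length ts - 1. ennreal (dist (\<gamma> (ts ! i)) (\<gamma> (ts ! Suc i))))"

text \<open>Non-constant rectifiable curves, given by their arc length parametrization on \<open>[0, L]\<close>.
  Such a parametrization is 1-Lipschitz, and the line integral of \<open>\<rho>\<close> along the curve is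
  \<open>\<integral> \<rho> (\<gamma> t) dt\<close> over \<open>[0, L]\<close>.\<close>

definition rect_curves :: "(real \<times> (real \<Rightarrow> 'a::metric_space)) set" where
  "rect_curves =
     {(L, \<gamma>). 0 < L \<and> (\<forall>s t. 0 \<le> s \<and> s \<le> t \<and> t \<le> L \<longrightarrow> curve_length \<gamma> s t = ennreal (t - s))}"

definition curve_integral :: "real \<times> (real \<Rightarrow> 'a) \<Rightarrow> ('a \<Rightarrow> ennreal) \<Rightarrow> ennreal" where
  "curve_integral c \<rho> = (\<integral>\<^sup>+t\<in>{0..fst c}. \<rho> (snd c t) \<partial>lborel)"

definition modulus ::
    "real \<Rightarrow> 'a::metric_space measure \<Rightarrow> (real \<times> (real \<Rightarrow> 'a)) set \<Rightarrow> ennreal" where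
  "modulus p m \<Gamma> =
     (INF \<rho> \<in> {\<rho>. \<rho> \<in> borel_measurable borel \<and> (\<forall>c\<in>\<Gamma>. 1 \<le> curve_integral c \<rho>)}.
        \<integral>\<^sup>+x. epowr (\<rho> x) p \<partial>m)"

text \<open>As \<open>u\<close> stands for its class modulo equality almost everywhere, the upper gradient inequality
  along \<open>p\<close>-almost every curve is required for some representative of \<open>u\<close>.\<close>

definition weak_upper_gradient ::
    "real \<Rightarrow> 'a::metric_space measure \<Rightarrow> ('a \<Rightarrow> real) \<Rightarrow> ('a \<Rightarrow> ennreal) \<Rightarrow> bool" where
  "weak_upper_gradient p m u g \<longleftrightarrow>
     g \<in> borel_measurable borel \<and>
     (\<exists>v. (AE x in m. v x = u x) \<and>
          modulus p m {(L, \<gamma>) \<in> rect_curves.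
             \<not> ennreal \<bar>v (\<gamma> L) - v (\<gamma> 0)\<bar> \<le> curve_integral (L, \<gamma>) g} = 0)"

text \<open>\<open>minimal_wug p m u g\<close> says that \<open>g\<close> is \<open>|Du|\<^sub>p\<close>, which is unique up to equality almost
  everywhere. The last clause is the representation of the Cheeger energy by \<open>|Du|\<^sub>p\<close>; on the
  metric measure spaces above and for \<open>1 < p < \<infinity>\<close> it holds for the minimal weak upper gradient of
  every \<open>u\<close> in \<open>W\<^sup>1\<^sup>,\<^sup>p(X)\<close>, by the Ambrosio--Gigli--Savare theorem on the density in energy of
  Lipschitz functions.\<close>

definition minimal_wug ::
    "real \<Rightarrow> 'a::metric_space measure \<Rightarrow> ('a \<Rightarrow> real) \<Rightarrow> ('a \<Rightarrow> ennreal) \<Rightarrow> bool" where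
  "minimal_wug p m u g \<longleftrightarrow>
     weak_upper_gradient p m u g \<and> (\<integral>\<^sup>+x. epowr (g x) p \<partial>m) < \<infinity> \<and>
     (\<forall>h. weak_upper_gradient p m u h \<and> (\<integral>\<^sup>+x. epowr (h x) p \<partial>m) < \<infinity> \<longrightarrow>
        (AE x in m. g x \<le> h x)) \<and>
     cheeger_energy p m u = (\<integral>\<^sup>+x. epowr (g x) p \<partial>m)"


section \<open>Sobolev spaces\<close>

definition in_W1p :: "real \<Rightarrow> 'a::metric_space measure \<Rightarrow> ('a \<Rightarrow> real) \<Rightarrow> bool" where
  "in_W1p p m u \<longleftrightarrow> in_Lp p m u \<and> cheeger_energy p m u < \<infinity>"

definition in_W1p_loc ::
    "real \<Rightarrow> 'a::metric_space measure \<Rightarrow> 'a set \<Rightarrow> ('a \<Rightarrow> real) \<Rightarrow> bool" where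
  "in_W1p_loc p m \<Omega> u \<longleftrightarrow>
     in_Lp_loc p m \<Omega> u \<and> (\<forall>\<eta>. lipschitz_bs \<Omega> \<eta> \<longrightarrow> in_W1p p m (\<lambda>x. \<eta> x * u x))"

text \<open>\<open>local_minimal_wug p m \<Omega> u g\<close> says that \<open>g\<close> is \<open>|Du|\<^sub>p\<close> on \<open>\<Omega>\<close> for \<open>u\<close> in
  \<open>W\<^sup>1\<^sup>,\<^sup>p\<^sub>l\<^sub>o\<^sub>c(\<Omega>)\<close>.\<close>

definition local_minimal_wug ::
    "real \<Rightarrow> 'a::metric_space measure \<Rightarrow> 'a set \<Rightarrow> ('a \<Rightarrow> real) \<Rightarrow> ('a \<Rightarrow> ennreal) \<Rightarrow> bool" where
  "local_minimal_wug p m \<Omega> u g \<longleftrightarrow>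
     g \<in> borel_measurable (restrict_space m \<Omega>) \<and>
     (\<forall>\<eta>. lipschitz_bs \<Omega> \<eta> \<longrightarrow>
        (\<exists>h. minimal_wug p m (\<lambda>x. \<eta> x * u x) h \<and> (AE x in m. \<eta> x = 1 \<longrightarrow> g x = h x)))"

text \<open>\<open>u\<close> belongs to \<open>W\<^sup>1\<^sup>,\<^sup>p(\<Omega>)\<close> and \<open>g\<close> is \<open>|Du|\<^sub>p\<close>.\<close>

definition W1p_on ::
    "real \<Rightarrow> 'a::metric_space measure \<Rightarrow> 'a set \<Rightarrow> ('a \<Rightarrow> real) \<Rightarrow> ('a \<Rightarrow> ennreal) \<Rightarrow> bool" where
  "W1p_on p m \<Omega> u g \<longleftrightarrow>
     in_W1p_loc p m \<Omega> u \<and> local_minimal_wug p m \<Omega> u g \<and>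
     in_Lp p (restrict_space m \<Omega>) u \<and> (\<integral>\<^sup>+x\<in>\<Omega>. epowr (g x) p \<partial>m) < \<infinity>"

text \<open>Closure in the norm with \<open>p\<close>-th power \<open>\<parallel>u\<parallel>\<^sup>p + Ch\<^sub>p(u)\<close>.\<close>

definition in_W1p0 ::
    "real \<Rightarrow> 'a::metric_space measure \<Rightarrow> 'a set \<Rightarrow> ('a \<Rightarrow> real) \<Rightarrow> bool" where
  "in_W1p0 p m \<Omega> u \<longleftrightarrow>
     in_W1p p m u \<and>
     (\<exists>\<phi>. (\<forall>n. lipschitz_bs \<Omega> (\<phi> n)) \<and> Lp_tendsto p m \<phi> u \<and>
          (\<lambda>n. cheeger_energy p m (\<lambda>x. \<phi> n x - u x)) \<longlonglongrightarrow> 0)"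


section \<open>Eigenvalues\<close>

text \<open>The infimum of the empty set in \<^typ>\<open>ennreal\<close> is \<open>\<infinity>\<close>.\<close>

definition neumann_eigenvalue :: "real \<Rightarrow> 'a::metric_space measure \<Rightarrow> 'a set \<Rightarrow> ennreal" where
  "neumann_eigenvalue p m \<Omega> =
     (INF (u, g) \<in> {(u, g). W1p_on p m \<Omega> u g \<and>
          (\<integral>\<^sup>+x\<in>\<Omega>. ennreal (\<bar>u x\<bar> powr p) \<partial>m) = 1 \<and>
          set_integrable m \<Omega> (\<lambda>x. \<bar>u x\<bar> powr (p - 2) * u x) \<and>
          (LINT x:\<Omega>|m. \<bar>u x\<bar> powr (p - 2) * u x) = 0}.
        \<integral>\<^sup>+x\<in>\<Omega>. epowr (g x) p \<partial>m)"

definition dirichlet_eigenvalue :: "real \<Rightarrow> 'a::metric_space measure \<Rightarrow> 'a set \<Rightarrow> ennreal" where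
  "dirichlet_eigenvalue p m \<Omega> =
     (INF (u, g) \<in> {(u, g). in_W1p0 p m \<Omega> u \<and> minimal_wug p m u g \<and>
          (\<integral>\<^sup>+x\<in>\<Omega>. ennreal (\<bar>u x\<bar> powr p) \<partial>m) = 1}.
        \<integral>\<^sup>+x\<in>\<Omega>. epowr (g x) p \<partial>m)"


section \<open>The half-line\<close>

typedef halfline = "{0::real..}" morphisms coord Halfline
  by auto

instantiation halfline :: metric_space
begin

definition dist_halfline :: "halfline \<Rightarrow> halfline \<Rightarrow> real" where
  "dist_halfline x y = \<bar>coord x - coord y\<bar>"

definition uniformity_halfline :: "(halfline \<times> halfline) filter" where
  "uniformity_halfline = (INF e\<in>{0 <..}. principal {(x, y). dist x y < e})"

definition open_halfline :: "halfline set \<Rightarrow> bool" where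
  "open_halfline U \<longleftrightarrow> (\<forall>x\<in>U. eventually (\<lambda>(x', y). x' = x \<longrightarrow> y \<in> U) uniformity)"

instance
proof
  show "uniformity = (INF e\<in>{0<..}. principal {(x::halfline, y). dist x y < e})"
    by (rule uniformity_halfline_def)
  show "open U \<longleftrightarrow> (\<forall>x\<in>U. eventually (\<lambda>(x', y). x' = x \<longrightarrow> y \<in> U) uniformity)"
    for U :: "halfline set"
    by (rule open_halfline_def)
  show "dist x y = 0 \<longleftrightarrow> x = y" for x y :: halfline
    by (simp add: dist_halfline_def coord_inject)
  show "dist x y \<le> dist x z + dist y z" for x y z :: halfline
    by (simp add: dist_halfline_def)
qed

end

lemma dist_coord: "dist (coord x) (coord y) = dist x y"
  by (simp add: dist_halfline_def dist_real_def)

lemma continuous_on_coord: "continuous_on A coord"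
  by (auto simp: continuous_on_iff dist_coord)

lemma continuous_on_Halfline: "continuous_on {0..} Halfline"
  by (auto simp: continuous_on_iff dist_halfline_def dist_real_def Halfline_inverse)

instance halfline :: complete_space
proof
  fix X :: "nat \<Rightarrow> halfline"
  assume "Cauchy X"
  then have "Cauchy (\<lambda>n. coord (X n))"
    by (simp add: Cauchy_def dist_coord)
  then obtain l where l: "(\<lambda>n. coord (X n)) \<longlonglongrightarrow> l"
    using Cauchy_convergent convergent_def by blast
  have "0 \<le> l"
    using coord by (intro LIMSEQ_le_const[OF l]) auto
  then have "X \<longlonglongrightarrow> Halfline l"
    using l by (simp add: tendsto_dist_iff[of X] tendsto_dist_iff[of _ l] dist_halfline_def
        dist_real_def Halfline_inverse)
  then show "convergent X"
    by (auto simp: convergent_def)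
qed

instance halfline :: second_countable_topology
proof
  obtain B :: "real set set" where B: "countable B" "topological_basis B"
    using ex_countable_basis by blast
  have "topological_basis ((\<lambda>V. coord -` V) ` B)"
  proof (rule topological_basisI)
    show "open U" if "U \<in> (\<lambda>V. coord -` V) ` B" for U
      using that topological_basis_open[OF B(2)] continuous_on_coord[of UNIV]
      by (auto intro!: open_vimage)
  next
    fix U :: "halfline set" and x assume "open U" "x \<in> U"
    then obtain e where e: "e > 0" "\<And>y. dist y x < e \<Longrightarrow> y \<in> U"
      by (auto simp: open_dist)
    obtain V where V: "V \<in> B" "coord x \<in> V" "V \<subseteq> ball (coord x) e"
      using topological_basisE[OF B(2) open_ball centre_in_ball[THEN iffD2, OF e(1)]] by blast
    have "coord -` V \<subseteq> U"
      using V(3) e(2) by (auto simp: subset_iff dist_coord dist_commute)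
    then show "\<exists>W \<in> (\<lambda>V. coord -` V) ` B. x \<in> W \<and> W \<subseteq> U"
      using V(1,2) by auto
  qed
  then show "\<exists>B :: halfline set set. countable B \<and> open = generate_topology B"
    using B(1) topological_basis_imp_subbasis by (meson countable_image)
qed

instance halfline :: polish_space ..

text \<open>\<^const>\<open>unit_ball_vol\<close> is \<open>\<omega>\<^sub>Q = \<pi>\<^bsup>Q/2\<^esup> / \<Gamma>(Q/2 + 1)\<close> for real \<open>Q\<close>.\<close>

definition model_measure :: "real \<Rightarrow> halfline measure" where
  "model_measure Q =
     distr (density (restrict_space lborel {0..})
             (\<lambda>t. ennreal (Q * unit_ball_vol Q * t powr (Q - 1)))) borel Halfline"

definition model_dirichlet_eigenvalue :: "real \<Rightarrow> real \<Rightarrow> real \<Rightarrow> ennreal" where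
  "model_dirichlet_eigenvalue p Q R =
     dirichlet_eigenvalue p (model_measure Q) {x. coord x < R}"

end

theory Submission imports Defs
begin

text \<open>
  Meyers--Serrin approximation replaces a competitor for the Neumann problem by a locally Lipschitz
  function \<open>v\<close> on \<open>\<Omega>\<close>, up to errors that are small in \<open>L\<^sup>p\<close>. Subtracting a median instead of
  using the constraint loses nothing, since by convexity the constraint says that 0 minimizes
  \<open>c \<mapsto> \<integral>|u - c|\<^sup>p\<close>. The positive and negative parts of \<open>v\<close> then live on sets of measure at most
  \<open>m(\<Omega>)/2\<close>, where the isoperimetric inequality is the one of the half-line scaled by \<open>C\<close>. A
  Faber--Krahn argument compares each of them with a Dirichlet competitor on the half-line, on the ball
  of radius \<open>R/2\<^bsup>1/Q\<^esup>\<close>; dilating this ball to radius \<open>R\<close> gives the factor \<open>2\<^bsup>p/Q\<^esup>\<close>.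

  Instead of the decreasing rearrangement the comparison uses piecewise linear radial functions whose
  nodes are the radii \<open>r q\<^sup>-\<^sup>j\<close> and whose values are the levels at which the superlevel sets of \<open>v\<close>
  have the measures of the corresponding balls. Coarea and Hoelder's inequality on each ring lose only
  powers of \<open>q\<close>, and \<open>q\<close> tends to 1. The minimal weak upper gradient of such a function is its slope:
  uniform convexity of \<open>L\<^sup>p\<close> makes slopes of an optimal sequence for the Cheeger energy converge
  strongly, so by Fuglede's lemma their limit is a weak upper gradient, and a segment of the half-line
  away from the origin is never an exceptional curve. The same strong convergence yields the
  Meyers--Serrin approximation.
\<close>

section \<open>Powers of extended nonnegative reals\<close>

text \<open>The comparison is shaped by \<open>dirichlet_eigenvalue\<close>: a competitor comes with
  a function satisfying \<open>minimal_wug\<close>, so every clause of that predicate, the Cheeger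
  energy included, has to be proved for each test function. For a function that is affine on
  finitely many rings this can be done by hand; for a rearrangement, absolute continuity and a
  coarea identity would have to come first. Here the perimeter of a superlevel set is only bounded
  from above, by slopes of \<open>v\<close> on thin strips, and level sets of positive measure need
  no separate treatment.

  The constant: on the ball of radius \<open>r\<close> the comparison yields, up to powers of q, at
  most \<open>C powr (- p)\<close> times the energy of \<open>v\<close>. A dilation by
  \<open>a\<close> multiplies energies by \<open>a powr (Q - p)\<close> and p-th powers of norms by
  \<open>a powr Q\<close>, so the quotient gains \<open>a powr (- p)\<close>, with \<open>a\<close>
  close to \<open>2 powr (1 / Q)\<close>.

  The median of the approximating function changes with the approximation. Its limit never matters,
  because the constraint bounds the integral of \<open>|u - c| powr p\<close> from below for all c
  at once.\<close>

lemma epowr_ennreal: "0 \<le> a \<Longrightarrow> epowr (ennreal a) p = ennreal (a powr p)"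
  by (simp add: epowr_def)

lemma epowr_top [simp]: "epowr \<infinity> p = \<infinity>" "epowr top p = \<infinity>"
  by (simp_all add: epowr_def)

lemma epowr_0 [simp]: "epowr 0 p = 0"
  by (simp add: epowr_def)

lemma epowr_mono: "0 \<le> p \<Longrightarrow> x \<le> y \<Longrightarrow> epowr x p \<le> epowr y p"
  by (cases x; cases y) (auto simp: epowr_ennreal top_unique intro!: ennreal_leI powr_mono2)

lemma epowr_mult:
  assumes "0 < p"
  shows "epowr (x * y) p = epowr x p * epowr y p"
proof (cases x; cases y)
  fix a b assume *: "x = ennreal a" "0 \<le> a" "y = ennreal b" "0 \<le> b"
  then show ?thesis
    by (simp add: epowr_ennreal powr_mult flip: ennreal_mult)
next
  fix a assume *: "x = ennreal a" "0 \<le> a" "y = top"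
  then show ?thesis
    by (cases "a = 0") (simp_all add: epowr_ennreal ennreal_mult_top)
next
  fix b assume *: "x = top" "y = ennreal b" "0 \<le> b"
  then show ?thesis
    by (cases "b = 0") (simp_all add: epowr_ennreal ennreal_top_mult)
next
  assume *: "x = top" "y = top"
  then show ?thesis
    by simp
qed

lemma epowr_inverse:
  assumes "0 < p"
  shows "epowr (epowr x p) (1 / p) = x" "epowr (epowr x (1 / p)) p = x"
  using assms by (cases x; simp add: epowr_ennreal powr_powr)+

lemma borel_measurable_epowr [measurable]:
  assumes [measurable]: "f \<in> borel_measurable M"
  shows "(\<lambda>x. epowr (f x) p) \<in> borel_measurable M"
  unfolding epowr_def by measurable

text \<open>Replaces Minkowski's inequality throughout: if b is at most \<tau> a, the sum is at most
  (1 + \<tau>) a, otherwise at most (1 + 1 / \<tau>) b. Infinite values are covered, and the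
  coefficient of the main term tends to 1 with \<tau>.\<close>

lemma epowr_add_le:
  assumes "0 < p" "0 < \<tau>"
  shows "epowr (a + b) p \<le> ennreal ((1 + \<tau>) powr p) * epowr a p + ennreal ((1 + 1 / \<tau>) powr p) * epowr b p"
proof -
  define c d where "c = ennreal (1 + \<tau>)" and "d = ennreal (1 + 1 / \<tau>)"
  have cd: "c = 1 + ennreal \<tau>" "d = 1 + ennreal (1 / \<tau>)"
    using assms by (simp_all add: c_def d_def)
  have "a + b \<le> c * a \<or> a + b \<le> d * b"
  proof (cases "b \<le> ennreal \<tau> * a")
    case True
    then show ?thesis
      by (simp add: cd distrib_right)
  next
    case False
    then have "ennreal (1 / \<tau>) * (ennreal \<tau> * a) \<le> ennreal (1 / \<tau>) * b"
      by (intro mult_left_mono) auto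
    moreover have "ennreal (1 / \<tau>) * (ennreal \<tau> * a) = a"
      using assms by (simp add: mult.assoc[symmetric] flip: ennreal_mult)
    ultimately show ?thesis
      by (simp add: cd distrib_right add.commute)
  qed
  then have "epowr (a + b) p \<le> epowr c p * epowr a p \<or> epowr (a + b) p \<le> epowr d p * epowr b p"
    using assms by (auto simp flip: epowr_mult intro: epowr_mono)
  moreover have "epowr c p = ennreal ((1 + \<tau>) powr p)" "epowr d p = ennreal ((1 + 1 / \<tau>) powr p)"
    using assms unfolding c_def d_def by (intro epowr_ennreal; simp)+
  ultimately show ?thesis
    by (elim disjE) (simp_all add: add_increasing add_increasing2)
qed

text \<open>The term \<open>b k\<close> alone shows that it is at most \<open>(1/2) ^ Suc k\<close>
  times the p-th root of the weighted sum on the right, and these geometric weights add up to 1. The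
  exponential loss is harmless where the summands decay fast enough.\<close>

lemma epowr_suminf_le:
  assumes "0 < p"
  shows "epowr (\<Sum>k. b k) p \<le> (\<Sum>k. ennreal (2 powr (real (Suc k) * p)) * epowr (b k) p)"
    (is "_ \<le> ?S")
proof -
  have le: "b k \<le> ennreal ((1/2) ^ Suc k) * epowr ?S (1 / p)" for k
  proof -
    have "ennreal (2 powr (real (Suc k) * p)) * epowr (b k) p \<le> ?S"
      using sum_le_suminf[of "\<lambda>k. ennreal (2 powr (real (Suc k) * p)) * epowr (b k) p" "{k}"]
      by simp
    moreover have "ennreal (2 powr (real (Suc k) * p)) * epowr (b k) p = epowr (ennreal (2 ^ Suc k) * b k) p"
    proof -
      have "(2::real) ^ Suc k = 2 powr real (Suc k)"
        by (rule powr_realpow[symmetric]) simp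
      then show ?thesis
        using assms by (simp only: epowr_mult epowr_ennreal[OF powr_ge_zero] powr_powr)
    qed
    ultimately have "epowr (epowr (ennreal (2 ^ Suc k) * b k) p) (1 / p) \<le> epowr ?S (1 / p)"
      using assms by (intro epowr_mono) (simp_all del: power_Suc)
    then have "ennreal (2 ^ Suc k) * b k \<le> epowr ?S (1 / p)"
      by (simp only: epowr_inverse[OF assms])
    then have "ennreal ((1/2) ^ Suc k) * (ennreal (2 ^ Suc k) * b k) \<le> ennreal ((1/2) ^ Suc k) * epowr ?S (1 / p)"
      by (intro mult_left_mono) auto
    moreover have "ennreal ((1/2) ^ Suc k) * (ennreal (2 ^ Suc k) * b k) = b k"
    proof -
      have "(1/2::real) ^ Suc k * 2 ^ Suc k = 1"
        by (simp only: power_mult_distrib[symmetric]) simp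
      then show ?thesis
        by (simp only: mult.assoc[symmetric] ennreal_mult[symmetric] zero_le_power
            zero_le_numeral zero_le_divide_1_iff ennreal_1 mult_1)
    qed
    ultimately show ?thesis by (simp only:)
  qed
  have "(\<Sum>k. b k) \<le> (\<Sum>k. ennreal ((1/2) ^ Suc k) * epowr ?S (1 / p))"
    using le by (intro suminf_le) auto
  also have "\<dots> = (\<Sum>k. ennreal ((1/2) ^ Suc k)) * epowr ?S (1 / p)"
    by (rule ennreal_suminf_multc)
  also have "(\<Sum>k. ennreal ((1/2) ^ Suc k)) = 1"
    by (subst suminf_ennreal_eq[OF _ power_half_series]) (auto simp only: ennreal_1 intro: zero_le_power)
  finally have "epowr (\<Sum>k. b k) p \<le> epowr (epowr ?S (1 / p)) p"
    using assms by (intro epowr_mono) auto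
  then show ?thesis
    using epowr_inverse[OF assms] by simp
qed

text \<open>A pointwise form of uniform convexity without a distinction between p below and above 2.
  By homogeneity only b = x a with x in [0, 1] matters. The midpoint defect \<open>D x\<close>
  decreases strictly to \<open>D 1 = 0\<close>: away from x = 1 a large multiple of it exceeds
  \<open>(1 - x) powr p\<close>, and near x = 1 this power is itself at most \<epsilon>.\<close>

lemma uniform_convexity_powr:
  fixes p \<epsilon> :: real
  assumes p: "1 < p" and e: "0 < \<epsilon>"
  obtains C where "0 < C" "\<And>a b. 0 \<le> a \<Longrightarrow> 0 \<le> b \<Longrightarrow>
    \<bar>a - b\<bar> powr p + C * ((a + b) / 2) powr p \<le> \<epsilon> * (a powr p + b powr p) + C * ((a powr p + b powr p) / 2)"
proof -
  define D where "D x = (1 + x powr p) / 2 - ((1 + x) / 2) powr p" for x :: real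
  have dec: "D y < D x" if "0 \<le> x" "x < y" "y \<le> 1" for x y
  proof (rule DERIV_neg_imp_decreasing_open[OF that(2)])
    fix z assume z: "x < z" "z < y"
    have "(D has_real_derivative (p * z powr (p - 1) / 2 - p * ((1 + z) / 2) powr (p - 1) / 2)) (at z)"
      unfolding D_def using z that p
      by (auto intro!: derivative_eq_intros simp: field_simps powr_diff)
    moreover have "z powr (p - 1) < ((1 + z) / 2) powr (p - 1)"
      using z that p by (intro powr_less_mono2) auto
    ultimately show "\<exists>y. (D has_real_derivative y) (at z) \<and> y < 0"
      using p by (intro exI conjI) (auto simp: field_simps)
  next
    show "continuous_on {x..y} D"
      unfolding D_def using that p by (intro continuous_on_diff continuous_on_divide continuous_on_add
          continuous_on_powr' continuous_on_const continuous_on_id) auto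
  qed
  have D1: "D 1 = 0" by (simp add: D_def)
  have D0: "0 \<le> D x" if "0 \<le> x" "x \<le> 1" for x
    using dec[of x 1] that D1 by (cases "x = 1") auto
  \<comment> \<open>From \<open>x0\<close> on, \<open>(1 - x) powr p\<close> is at most
    \<open>min \<epsilon> 1\<close>; to the left of it, \<open>C\<close> makes
    \<open>C * D x\<close> at least 1.\<close>
  define x0 where "x0 = max 0 (1 - (min \<epsilon> 1) powr (1 / p))"
  have x0: "0 \<le> x0" "x0 < 1"
    using e by (auto simp: x0_def)
  have Dx0: "0 < D x0"
    using dec[of x0 1] x0 D1 by auto
  define C where "C = 1 / D x0"
  have C: "0 < C" using Dx0 by (simp add: C_def)
  have unit: "(1 - x) powr p \<le> \<epsilon> * (1 + x powr p) + C * D x" if x: "0 \<le> x" "x \<le> 1" for x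
  proof (cases "x0 \<le> x")
    case True
    then have "1 - x \<le> (min \<epsilon> 1) powr (1 / p)"
      by (auto simp: x0_def)
    then have "(1 - x) powr p \<le> ((min \<epsilon> 1) powr (1 / p)) powr p"
      using x p by (intro powr_mono2) auto
    also have "\<dots> \<le> \<epsilon>"
      using e p by (auto simp: powr_powr)
    also have "\<epsilon> \<le> \<epsilon> * (1 + x powr p)"
      using e by simp
    finally show ?thesis
      using D0[OF x] C by (simp add: add_increasing2)
  next
    case False
    then have "D x0 \<le> D x"
      using dec[of x x0] x x0 by auto
    then have "1 \<le> C * D x"
      using Dx0 by (simp add: C_def field_simps)
    moreover have "(1 - x) powr p \<le> 1"
      using x p powr_mono2[of p "1 - x" 1] by auto
    moreover have "0 \<le> \<epsilon> * (1 + x powr p)" using e by auto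
    ultimately show ?thesis by linarith
  qed
  have scale: "A * u + C * (A * v) = A * (u + C * v)" for A u v :: real
    by (simp add: distrib_left)
  have scale': "\<epsilon> * (A + A * w) + C * ((A + A * w) / 2) = A * (\<epsilon> * (1 + w) + C * ((1 + w) / 2))" for A w :: real
    by (simp add: distrib_left)
  have ord: "\<bar>a - b\<bar> powr p + C * ((a + b) / 2) powr p \<le> \<epsilon> * (a powr p + b powr p) + C * ((a powr p + b powr p) / 2)"
    if ab: "0 \<le> b" "b \<le> a" for a b
  proof (cases "a = 0")
    case True
    then show ?thesis using ab by simp
  next
    case False
    define x where "x = b / a"
    have a: "a > 0" and x: "0 \<le> x" "x \<le> 1" and b: "b = a * x"
      using False ab by (auto simp: x_def)
    have *: "a powr p * ((1 - x) powr p + C * ((1 + x) / 2) powr p)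
        \<le> a powr p * (\<epsilon> * (1 + x powr p) + C * ((1 + x powr p) / 2))"
      using unit[OF x] unfolding D_def right_diff_distrib by (intro mult_left_mono) (linarith | simp)+
    have 1: "\<bar>a - b\<bar> powr p = a powr p * (1 - x) powr p"
    proof -
      have "\<bar>a - b\<bar> = a * (1 - x)"
        using ab b by (simp add: right_diff_distrib)
      then show ?thesis
        by (simp only: powr_mult)
    qed
    have 2: "((a + b) / 2) powr p = a powr p * ((1 + x) / 2) powr p"
    proof -
      have "(a + b) / 2 = a * ((1 + x) / 2)"
        using b by (simp add: distrib_left)
      then show ?thesis
        by (simp only: powr_mult)
    qed
    have 3: "b powr p = a powr p * x powr p"
      unfolding b by (rule powr_mult)
    show ?thesis
      using * unfolding 1 2 3 scale scale' .
  qed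
  show ?thesis
  proof (rule that[OF C])
    fix a b :: real assume "0 \<le> a" "0 \<le> b"
    then show "\<bar>a - b\<bar> powr p + C * ((a + b) / 2) powr p \<le> \<epsilon> * (a powr p + b powr p) + C * ((a powr p + b powr p) / 2)"
      using ord[of b a] ord[of a b]
      by (cases "b \<le> a") (simp_all only: abs_minus_commute[of a b] add.commute[of a b]
          add.commute[of "a powr p" "b powr p"] not_le less_imp_le)
  qed
qed

section \<open>Local Lipschitz constants\<close>

lemma lip_lessD:
  "lip u x < c \<Longrightarrow> \<forall>\<^sub>F y in at x. ennreal (\<bar>u y - u x\<bar> / dist y x) < c"
  unfolding lip_def by (rule Limsup_lessD)

lemma lip_leI:
  "\<forall>\<^sub>F y in at x. ennreal (\<bar>u y - u x\<bar> / dist y x) \<le> c \<Longrightarrow> lip u x \<le> c"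
  unfolding lip_def by (rule Limsup_bounded)

lemma lip_cong:
  assumes "\<forall>\<^sub>F y in nhds x. u y = v y"
  shows "lip u x = lip v x"
proof -
  have "u x = v x" "\<forall>\<^sub>F y in at x. u y = v y"
    using assms eventually_nhds_x_imp_x eventually_nhds_conv_at by blast+
  then show ?thesis
    unfolding lip_def by (intro Limsup_eq) (auto elim: eventually_mono)
qed

lemma lip_const [simp]: "lip (\<lambda>_. c) x = 0"
proof -
  have "lip (\<lambda>_. c) x \<le> 0"
    by (intro lip_leI) auto
  then show ?thesis by simp
qed

lemma lip_eq_ennrealD:
  assumes "lip u x = ennreal b" "0 \<le> b" "0 < e"
  shows "\<forall>\<^sub>F y in at x. \<bar>u y - u x\<bar> \<le> (b + e) * dist y x"
proof -
  have "lip u x < ennreal (b + e)"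
    using assms by (simp add: ennreal_lessI del: ennreal_plus)
  from lip_lessD[OF this] eventually_neq_at_within[of x x UNIV] show ?thesis
  proof eventually_elim
    case (elim y)
    then have "\<bar>u y - u x\<bar> / dist y x \<le> b + e"
      using assms by (simp add: ennreal_less_iff del: ennreal_plus)
    then show ?case
      using elim(2) by (simp add: field_simps)
  qed
qed

lemma lip_le_ennrealI:
  assumes "\<And>e. 0 < e \<Longrightarrow> \<forall>\<^sub>F y in at x. \<bar>u y - u x\<bar> \<le> (b + e) * dist y x" "0 \<le> b"
  shows "lip u x \<le> ennreal b"
proof (rule ennreal_le_epsilon)
  fix e :: real assume e: "0 < e"
  from assms(1)[OF e] eventually_neq_at_within[of x x UNIV]
  have "\<forall>\<^sub>F y in at x. ennreal (\<bar>u y - u x\<bar> / dist y x) \<le> ennreal (b + e)"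
    by eventually_elim (auto intro!: ennreal_leI simp: field_simps simp del: ennreal_plus)
  then show "lip u x \<le> ennreal b + ennreal e"
    using assms(2) e by (intro lip_leI) simp
qed

lemma lip_mono_increment:
  assumes ev: "\<forall>\<^sub>F y in at x. \<bar>v y - v x\<bar> \<le> c * \<bar>u y - u x\<bar>" and c: "0 \<le> c"
  shows "lip v x \<le> ennreal c * lip u x"
proof (cases "lip u x")
  case (real b)
  have "lip v x \<le> ennreal (c * b)"
  proof (rule lip_le_ennrealI)
    fix e :: real assume e: "0 < e"
    have "\<forall>\<^sub>F y in at x. \<bar>u y - u x\<bar> \<le> (b + e / (c + 1)) * dist y x"
      using real e c by (intro lip_eq_ennrealD) auto
    with ev show "\<forall>\<^sub>F y in at x. \<bar>v y - v x\<bar> \<le> (c * b + e) * dist y x"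
    proof eventually_elim
      case (elim y)
      have "\<bar>v y - v x\<bar> \<le> c * ((b + e / (c + 1)) * dist y x)"
        using elim c by (meson mult_left_mono order_trans)
      also have "\<dots> = (c * b + e * (c / (c + 1))) * dist y x"
        by (simp add: algebra_simps)
      also have "\<dots> \<le> (c * b + e * 1) * dist y x"
        using c e by (intro mult_right_mono add_left_mono mult_left_mono) auto
      finally show ?case by simp
    qed
  qed (use real c in auto)
  then show ?thesis
    using real c by (simp add: ennreal_mult)
next
  case top
  show ?thesis
  \<comment> \<open>For c = 0 the right-hand side is 0 * top = 0, so the increments themselves must
    vanish; for c > 0 it is top.\<close>
  proof (cases "c = 0")
    case True
    with ev have "\<forall>\<^sub>F y in at x. ennreal (\<bar>v y - v x\<bar> / dist y x) \<le> 0"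
      by (auto elim!: eventually_mono)
    then have "lip v x \<le> 0" by (rule lip_leI)
    then show ?thesis by simp
  next
    case False
    then show ?thesis using top c by (simp add: ennreal_mult_top)
  qed
qed

lemma lip_le_lipschitz:
  assumes "L-lipschitz_on A u" "open A" "x \<in> A"
  shows "lip u x \<le> ennreal L"
proof (rule lip_leI)
  have "\<forall>\<^sub>F y in at x. y \<in> A"
    using assms(2,3) by (rule eventually_at_in_open')
  then show "\<forall>\<^sub>F y in at x. ennreal (\<bar>u y - u x\<bar> / dist y x) \<le> ennreal L"
  proof eventually_elim
    case (elim y)
    then have "\<bar>u y - u x\<bar> \<le> L * dist y x"
      using lipschitz_onD[OF assms(1) elim assms(3)] by (simp add: dist_real_def)
    then show ?case
      using lipschitz_on_nonneg[OF assms(1)] by (cases "dist y x = 0") (auto intro!: ennreal_leI simp: field_simps)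
  qed
qed

lemma lip_less_top:
  assumes "lipschitz_fun u"
  shows "lip u x < \<infinity>"
  using assms lip_le_lipschitz[OF _ open_UNIV UNIV_I, of _ u x]
  by (auto simp: lipschitz_fun_def) (meson ennreal_less_top order_le_less_trans)

lemma lip_add_le: "lip (\<lambda>y. u y + v y) x \<le> lip u x + lip v x"
proof (cases "lip u x = top \<or> lip v x = top")
  case False
  then obtain a b where ab: "lip u x = ennreal a" "0 \<le> a" "lip v x = ennreal b" "0 \<le> b"
    by (cases "lip u x"; cases "lip v x") auto
  have "lip (\<lambda>y. u y + v y) x \<le> ennreal (a + b)"
  proof (rule lip_le_ennrealI)
    fix e :: real assume e: "0 < e"
    have "\<forall>\<^sub>F y in at x. \<bar>u y - u x\<bar> \<le> (a + e/2) * dist y x"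
      "\<forall>\<^sub>F y in at x. \<bar>v y - v x\<bar> \<le> (b + e/2) * dist y x"
      using ab e by (auto intro!: lip_eq_ennrealD)
    then show "\<forall>\<^sub>F y in at x. \<bar>(u y + v y) - (u x + v x)\<bar> \<le> (a + b + e) * dist y x"
    proof eventually_elim
      case (elim y)
      then have "\<bar>(u y + v y) - (u x + v x)\<bar> \<le> (a + e/2) * dist y x + (b + e/2) * dist y x"
        by linarith
      then show ?case
        by (simp add: distrib_right)
    qed
  qed (use ab in auto)
  then show ?thesis
    using ab by simp
qed auto

lemma lip_sum_le: "finite I \<Longrightarrow> lip (\<lambda>y. \<Sum>i\<in>I. f i y) x \<le> (\<Sum>i\<in>I. lip (f i) x)"
proof (induction I rule: finite_induct)
  case (insert i I)
  then show ?case
    using order_trans[OF lip_add_le add_left_mono] by simp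
qed simp

text \<open>In f y (g y - g x) + (f y - f x) g x, continuity replaces f y by f x up to e, and
  finiteness of \<open>lip g x\<close> lets e tend to 0. With f x = 0 and an infinite slope of g the
  first term would read 0 * top = 0, and the bound could fail.\<close>

lemma lip_mult_le:
  assumes f: "isCont f x" and fin: "lip g x < \<infinity>"
  shows "lip (\<lambda>y. f y * g y) x \<le> ennreal \<bar>f x\<bar> * lip g x + ennreal \<bar>g x\<bar> * lip f x"
proof -
  have *: "lip (\<lambda>y. f y * g y) x \<le> ennreal (\<bar>f x\<bar> + e) * lip g x + ennreal \<bar>g x\<bar> * lip f x" if e: "0 < e" for e
  proof -
    obtain w where w: "w = (\<lambda>y. f y * (g y - g x))" by simp
    have eq: "(\<lambda>y. f y * g y) = (\<lambda>y. w y + f y * g x)"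
      by (auto simp: w algebra_simps)
    have "lip (\<lambda>y. f y * g y) x \<le> lip w x + lip (\<lambda>y. f y * g x) x"
      unfolding eq by (rule lip_add_le)
    also have "lip w x \<le> ennreal (\<bar>f x\<bar> + e) * lip g x"
    proof (rule lip_mono_increment)
      have "\<forall>\<^sub>F y in at x. \<bar>f y\<bar> < \<bar>f x\<bar> + e"
        using f e by (intro order_tendstoD(2)[of _ "\<bar>f x\<bar>"]) (auto simp: isCont_def intro!: tendsto_intros)
      then show "\<forall>\<^sub>F y in at x. \<bar>w y - w x\<bar> \<le> (\<bar>f x\<bar> + e) * \<bar>g y - g x\<bar>"
        by eventually_elim (auto simp: w abs_mult intro!: mult_right_mono)
    qed (use e in auto)
    also have "lip (\<lambda>y. f y * g x) x \<le> ennreal \<bar>g x\<bar> * lip f x"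
      by (rule lip_mono_increment) (auto simp: left_diff_distrib[symmetric] abs_mult)
    finally show ?thesis by (simp add: add_mono)
  qed
  obtain b where b: "lip g x = ennreal b" "b \<ge> 0"
    using fin by (cases "lip g x") auto
  show ?thesis
  proof (rule ennreal_le_epsilon)
    fix e :: real assume e: "0 < e"
    have "ennreal (\<bar>f x\<bar> + e / (b + 1)) * lip g x = ennreal (\<bar>f x\<bar> * b + e * (b / (b + 1)))"
      using b e by (simp add: algebra_simps flip: ennreal_mult ennreal_plus)
    also have "\<dots> \<le> ennreal (\<bar>f x\<bar> * b + e * 1)"
      using b e by (intro ennreal_leI add_left_mono mult_left_mono) auto
    also have "\<dots> = ennreal \<bar>f x\<bar> * lip g x + ennreal e"
      using b e by (simp add: ennreal_mult)
    finally show "lip (\<lambda>y. f y * g y) x \<le> ennreal \<bar>f x\<bar> * lip g x + ennreal \<bar>g x\<bar> * lip f x + ennreal e"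
      using *[of "e / (b + 1)"] b e by (auto simp: ac_simps intro: order_trans add_left_mono)
  qed
qed

text \<open>Countably many radii determine the limit superior, and by locality the points y may be
  taken from A only. In this form measurability becomes accessible.\<close>

lemma lip_eq_INF:
  assumes "open A" "x \<in> A"
  shows "lip u x = (INF n. SUP y\<in>{y\<in>A. y \<noteq> x \<and> dist y x < 1 / real (Suc n)}. ennreal (\<bar>u y - u x\<bar> / dist y x))"
    (is "_ = (INF n. ?S n)")
proof (rule antisym)
  show "lip u x \<le> (INF n. ?S n)"
  proof (rule INF_greatest, rule lip_leI)
    fix n
    have "\<forall>\<^sub>F y in at x. y \<in> A" "\<forall>\<^sub>F y in at x. y \<noteq> x \<and> dist y x < 1 / real (Suc n)"
      using eventually_at_in_open'[OF assms] by (auto simp: eventually_at intro: exI[of _ "1 / real (Suc n)"])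
    then show "\<forall>\<^sub>F y in at x. ennreal (\<bar>u y - u x\<bar> / dist y x) \<le> ?S n"
      by eventually_elim (auto intro: SUP_upper)
  qed
  show "(INF n. ?S n) \<le> lip u x"
  proof (rule dense_ge)
    fix z assume "lip u x < z"
    from lip_lessD[OF this] obtain d where d: "d > 0"
      "\<And>y. y \<noteq> x \<Longrightarrow> dist y x < d \<Longrightarrow> ennreal (\<bar>u y - u x\<bar> / dist y x) < z"
      by (auto simp: eventually_at)
    obtain n where "1 / real (Suc n) < d"
      using d(1) nat_approx_posE by blast
    then have "?S n \<le> z"
      using d(2) by (intro SUP_least) (auto intro!: less_imp_le)
    then show "(INF n. ?S n) \<le> z"
      by (rule INF_lower2[OF UNIV_I])
  qed
qed

text \<open>For fixed y the difference quotient is continuous in x away from y, so each superlevel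
  set of \<open>S n\<close> is a union over y of open sets. The union is uncountable, but it is
  open.\<close>

lemma borel_measurable_lip_indicator:
  fixes u :: "'a::metric_space \<Rightarrow> real"
  assumes A: "open A" and u: "continuous_on A u"
  shows "(\<lambda>x. lip u x * indicator A x) \<in> borel_measurable borel"
proof -
  define S where "S n x = (SUP y\<in>{y\<in>A. y \<noteq> x \<and> dist y x < 1 / real (Suc n)}. ennreal (\<bar>u y - u x\<bar> / dist y x))" for n x
  have [measurable]: "A \<in> sets borel" using A by simp
  have [measurable]: "(\<lambda>x. S n x * indicator A x) \<in> borel_measurable borel" for n
  proof (rule borel_measurableI_greater)
    fix z
    have eq: "{x \<in> space borel. z < S n x * indicator A x} =
        (\<Union>y\<in>A. {x\<in>A. y \<noteq> x \<and> dist y x < 1 / real (Suc n) \<and> z < ennreal (\<bar>u y - u x\<bar> / dist y x)})"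
      by (auto simp: S_def less_SUP_iff indicator_def split: if_splits)
    have "open {x\<in>A. y \<noteq> x \<and> dist y x < 1 / real (Suc n) \<and> z < ennreal (\<bar>u y - u x\<bar> / dist y x)}" for y
    proof -
      have 1: "open {x\<in>A. x \<noteq> y}" "open {x\<in>A. x \<noteq> y \<and> dist y x < 1 / real (Suc n)}"
        using A open_Int[OF open_Diff[OF A closed_singleton[of y]] open_ball[of y "1 / real (Suc n)"]]
          open_Diff[OF A closed_singleton[of y]]
        by (auto simp: set_diff_eq ball_def Int_def conj_assoc)
      have 2: "continuous_on {x\<in>A. x \<noteq> y \<and> dist y x < 1 / real (Suc n)} (\<lambda>x. ennreal (\<bar>u y - u x\<bar> / dist y x))"
        using continuous_on_subset[OF u]
        by (intro continuous_on_ennreal continuous_intros) auto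
      have "open ({x\<in>A. x \<noteq> y \<and> dist y x < 1 / real (Suc n)} \<inter> (\<lambda>x. ennreal (\<bar>u y - u x\<bar> / dist y x)) -` {z<..})"
        using continuous_on_open_vimage[OF 1(2), THEN iffD1, OF 2] by (auto simp: Int_commute)
      also have "\<dots> = {x\<in>A. y \<noteq> x \<and> dist y x < 1 / real (Suc n) \<and> z < ennreal (\<bar>u y - u x\<bar> / dist y x)}"
        by auto
      finally show ?thesis .
    qed
    then show "{x \<in> space borel. z < S n x * indicator A x} \<in> sets borel"
      unfolding eq by (intro borel_open open_UN) auto
  qed
  have "(\<lambda>x. lip u x * indicator A x) = (\<lambda>x. INF n. S n x * indicator A x)"
    using lip_eq_INF[OF A] by (auto simp: fun_eq_iff S_def indicator_def)
  then show ?thesis by simp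
qed

lemma lipschitz_fun_continuous: "lipschitz_fun u \<Longrightarrow> continuous_on A u"
  unfolding lipschitz_fun_def by (meson continuous_on_subset lipschitz_on_continuous_on subset_UNIV)

lemma borel_measurable_lip: "lipschitz_fun u \<Longrightarrow> lip u \<in> borel_measurable borel"
  using borel_measurable_lip_indicator[OF open_UNIV lipschitz_fun_continuous, of u] by simp

section \<open>Slopes of Lipschitz functions are upper gradients along curves\<close>

lemma ex_antiderivative:
  fixes \<phi> :: "real \<Rightarrow> real"
  assumes "continuous_on UNIV \<phi>"
  obtains \<Phi> where "\<And>x. x \<in> {a<..<b} \<Longrightarrow> (\<Phi> has_real_derivative \<phi> x) (at x)"
proof -
  obtain g where g: "\<And>x. x \<in> {a..b} \<Longrightarrow> (g has_vector_derivative \<phi> x) (at x within {a..b})"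
    using antiderivative_continuous[OF continuous_on_subset[OF assms subset_UNIV]] by metis
  show ?thesis
  proof (rule that[of g])
    fix x assume x: "x \<in> {a<..<b}"
    then have "(g has_vector_derivative \<phi> x) (at x within {a..b})"
      by (intro g) auto
    then show "(g has_real_derivative \<phi> x) (at x)"
      using x at_within_Icc_at[of a x b] by (simp add: has_real_derivative_iff_has_vector_derivative)
  qed
qed

text \<open>The average of the difference quotients of \<open>\<phi>\<close> telescopes, so Fatou's lemma replaces
  differentiation almost everywhere.\<close>

lemma increment_le_nn_integral:
  fixes \<phi> :: "real \<Rightarrow> real"
  assumes lips: "K-lipschitz_on UNIV \<phi>" and "s \<le> t"
    and [measurable]: "f \<in> borel_measurable borel"
    and f: "\<And>\<tau>. s < \<tau> \<Longrightarrow> \<tau> < t \<Longrightarrow> limsup (\<lambda>n. ennreal (real (Suc n) * \<bar>\<phi> (\<tau> + 1 / real (Suc n)) - \<phi> \<tau>\<bar>)) \<le> f \<tau>"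
  shows "ennreal \<bar>\<phi> t - \<phi> s\<bar> \<le> (\<integral>\<^sup>+\<tau>\<in>{s..t}. f \<tau> \<partial>lborel)"
proof -
  define q where "q n \<tau> = real (Suc n) * (\<phi> (\<tau> + 1 / real (Suc n)) - \<phi> \<tau>)" for n \<tau>
  have K: "0 \<le> K" using lips by (rule lipschitz_on_nonneg)
  have cont: "continuous_on UNIV \<phi>" using lips by (rule lipschitz_on_continuous_on)
  have contq: "continuous_on UNIV (q n)" for n
    unfolding q_def by (intro continuous_intros continuous_on_compose2[OF cont]) auto
  have [measurable]: "q n \<in> borel_measurable borel" for n
    by (rule borel_measurable_continuous_onI[OF contq])
  have qK: "\<bar>q n \<tau>\<bar> \<le> K" for n \<tau>
  proof -
    have "\<bar>\<phi> (\<tau> + 1 / real (Suc n)) - \<phi> \<tau>\<bar> \<le> K * (1 / real (Suc n))"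
      using lipschitz_onD[OF lips, of "\<tau> + 1 / real (Suc n)" \<tau>] by (simp add: dist_real_def)
    then have "real (Suc n) * \<bar>\<phi> (\<tau> + 1 / real (Suc n)) - \<phi> \<tau>\<bar> \<le> real (Suc n) * (K * (1 / real (Suc n)))"
      by (intro mult_left_mono) auto
    then show ?thesis
      unfolding q_def abs_mult by simp
  qed
  have step: "ennreal (\<bar>\<phi> t - \<phi> s\<bar> - 2 * K / real (Suc n)) \<le> (\<integral>\<^sup>+\<tau>\<in>{s..t}. ennreal \<bar>q n \<tau>\<bar> \<partial>lborel)" for n
  proof -
    define \<delta> where "\<delta> = 1 / real (Suc n)"
    have d: "0 < \<delta>" "\<delta> \<le> 1" by (auto simp: \<delta>_def)
    obtain \<Phi> where \<Phi>: "\<And>x. x \<in> {s - 1<..<t + 2} \<Longrightarrow> (\<Phi> has_real_derivative \<phi> x) (at x)"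
      using ex_antiderivative[OF cont] by metis
    \<comment> \<open>The mean of \<open>\<phi>\<close> over
      \<open>[\<tau>, \<tau> + \<delta>]\<close>. Its derivative is exactly the difference quotient
      \<open>q n\<close>, and it differs from \<open>\<phi>\<close> by at most
      \<open>K * \<delta>\<close>, once at each endpoint; hence the error
      \<open>2 * K / real (Suc n)\<close>.\<close>
    define \<psi> where "\<psi> \<tau> = (\<Phi> (\<tau> + \<delta>) - \<Phi> \<tau>) / \<delta>" for \<tau>
    have der: "(\<psi> has_real_derivative q n \<tau>) (at \<tau>)" if "s \<le> \<tau>" "\<tau> \<le> t" for \<tau>
    proof -
      have "((\<lambda>\<tau>. \<Phi> (\<tau> + \<delta>)) has_real_derivative \<phi> (\<tau> + \<delta>) * 1) (at \<tau>)"
        by (rule DERIV_chain2[of \<Phi>]) (use that d in \<open>auto intro!: \<Phi> derivative_eq_intros\<close>)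
      then show ?thesis
        unfolding \<psi>_def q_def using that d
        by (auto intro!: derivative_eq_intros \<Phi> simp: \<delta>_def field_simps)
    qed
    have \<psi>: "\<bar>\<psi> \<tau> - \<phi> \<tau>\<bar> \<le> K * \<delta>" if \<tau>: "s \<le> \<tau>" "\<tau> \<le> t" for \<tau>
    proof -
      obtain z where z: "\<tau> < z" "z < \<tau> + \<delta>" "\<Phi> (\<tau> + \<delta>) - \<Phi> \<tau> = (\<tau> + \<delta> - \<tau>) * \<phi> z"
      proof -
        have "\<exists>z>\<tau>. z < \<tau> + \<delta> \<and> \<Phi> (\<tau> + \<delta>) - \<Phi> \<tau> = (\<tau> + \<delta> - \<tau>) * \<phi> z"
          by (rule MVT2) (use \<tau> d in \<open>auto intro!: \<Phi>\<close>)
        then show thesis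
          using that by blast
      qed
      then have "\<psi> \<tau> = \<phi> z" using d by (simp add: \<psi>_def)
      moreover have "\<bar>\<phi> z - \<phi> \<tau>\<bar> \<le> K * (z - \<tau>)"
        using lipschitz_onD[OF lips, of z \<tau>] z by (simp add: dist_real_def)
      moreover have "K * (z - \<tau>) \<le> K * \<delta>"
        using z K by (intro mult_left_mono) auto
      ultimately show ?thesis by simp
    qed
    have "has_bochner_integral lborel (\<lambda>x. q n x * indicator {s..t} x) (\<psi> t - \<psi> s)"
      using contq by (intro has_bochner_integral_FTC_Icc_real \<open>s \<le> t\<close> der)
        (auto simp: continuous_on_eq_continuous_at)
    then have int: "integrable lborel (\<lambda>x. q n x * indicator {s..t} x)"
      "(\<integral>x. q n x * indicator {s..t} x \<partial>lborel) = \<psi> t - \<psi> s"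
      by (auto simp: has_bochner_integral_iff)
    have "ennreal (\<bar>\<phi> t - \<phi> s\<bar> - 2 * K / real (Suc n)) \<le> ennreal \<bar>\<psi> t - \<psi> s\<bar>"
    proof (rule ennreal_leI)
      have "2 * K / real (Suc n) = 2 * (K * \<delta>)"
        by (simp add: \<delta>_def)
      then show "\<bar>\<phi> t - \<phi> s\<bar> - 2 * K / real (Suc n) \<le> \<bar>\<psi> t - \<psi> s\<bar>"
        using \<psi>[of t] \<psi>[of s] \<open>s \<le> t\<close> by linarith
    qed
    also have "\<dots> \<le> (\<integral>\<^sup>+x. ennreal (norm (q n x * indicator {s..t} x)) \<partial>lborel)"
      using integral_norm_bound_ennreal[OF int(1)] int(2) by simp
    also have "\<dots> = (\<integral>\<^sup>+\<tau>\<in>{s..t}. ennreal \<bar>q n \<tau>\<bar> \<partial>lborel)"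
      by (intro nn_integral_cong) (auto simp: indicator_def)
    finally show ?thesis .
  qed
  have "(\<lambda>n. ennreal (\<bar>\<phi> t - \<phi> s\<bar> - 2 * K / real (Suc n))) \<longlonglongrightarrow> ennreal (\<bar>\<phi> t - \<phi> s\<bar> - 0)"
    by (intro tendsto_intros lim_const_over_n[THEN LIMSEQ_Suc])
  then have "ennreal \<bar>\<phi> t - \<phi> s\<bar> = limsup (\<lambda>n. ennreal (\<bar>\<phi> t - \<phi> s\<bar> - 2 * K / real (Suc n)))"
    by (simp add: lim_imp_Limsup)
  also have "\<dots> \<le> limsup (\<lambda>n. \<integral>\<^sup>+\<tau>\<in>{s..t}. ennreal \<bar>q n \<tau>\<bar> \<partial>lborel)"
    using step by (intro Limsup_mono) auto
  also have "\<dots> \<le> (\<integral>\<^sup>+\<tau>. limsup (\<lambda>n. ennreal \<bar>q n \<tau>\<bar> * indicator {s..t} \<tau>) \<partial>lborel)"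
  \<comment> \<open>The Lipschitz bound \<open>qK\<close> supplies the integrable majorant that
    Fatou's lemma for the limit superior requires.\<close>
  proof (rule nn_integral_limsup)
    show "(\<integral>\<^sup>+\<tau>. ennreal K * indicator {s..t} \<tau> \<partial>lborel) < \<infinity>"
      using \<open>s \<le> t\<close> by (simp add: nn_integral_cmult_indicator ennreal_mult_less_top)
    show "AE x in lborel. ennreal \<bar>q i x\<bar> * indicator {s..t} x \<le> ennreal K * indicator {s..t} x" for i
      using qK by (auto intro!: AE_I2 mult_right_mono ennreal_leI)
  qed measurable
  also have "\<dots> \<le> (\<integral>\<^sup>+\<tau>\<in>{s..t}. f \<tau> \<partial>lborel)"
  proof (rule nn_integral_mono_AE)
    have "AE \<tau> in lborel. \<tau> \<noteq> s \<and> \<tau> \<noteq> t"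
      using AE_lborel_singleton by auto
    then show "AE \<tau> in lborel. limsup (\<lambda>n. ennreal \<bar>q n \<tau>\<bar> * indicator {s..t} \<tau>) \<le> f \<tau> * indicator {s..t} \<tau>"
    proof eventually_elim
      case (elim \<tau>)
      then show ?case
        using f[of \<tau>] by (cases "\<tau> \<in> {s..t}") (auto simp: q_def abs_mult Limsup_const)
    qed
  qed
  finally show ?thesis .
qed

lemma lipschitz_clamp: "1-lipschitz_on UNIV (\<lambda>x::real. max a (min b x))"
  by (rule lipschitz_onI) (auto simp: dist_real_def)

text \<open>A 1-Lipschitz curve covers in time h a distance of at most h, so dividing by h gives no
  more than dividing by the distance. Times at which the curve is back at
  \<open>\<gamma> \<tau>\<close> contribute 0 and are treated apart, since \<open>lip\<close> only
  tests points different from x.\<close>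

lemma limsup_difference_quotient_le_lip:
  fixes \<gamma> :: "real \<Rightarrow> 'a::metric_space"
  assumes \<gamma>: "\<And>a b. a \<in> {s..t} \<Longrightarrow> b \<in> {s..t} \<Longrightarrow> dist (\<gamma> a) (\<gamma> b) \<le> \<bar>a - b\<bar>"
    and \<tau>: "s < \<tau>" "\<tau> < t"
  shows "limsup (\<lambda>n. ennreal (real (Suc n) * \<bar>w (\<gamma> (\<tau> + 1 / real (Suc n))) - w (\<gamma> \<tau>)\<bar>)) \<le> lip w (\<gamma> \<tau>)"
proof (rule dense_ge)
  fix z assume "lip w (\<gamma> \<tau>) < z"
  from lip_lessD[OF this] obtain d where d: "d > 0"
    "\<And>y. y \<noteq> \<gamma> \<tau> \<Longrightarrow> dist y (\<gamma> \<tau>) < d \<Longrightarrow> ennreal (\<bar>w y - w (\<gamma> \<tau>)\<bar> / dist y (\<gamma> \<tau>)) < z"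
    by (auto simp: eventually_at)
  have "(\<lambda>n. 1 / real (Suc n)) \<longlonglongrightarrow> 0"
    by (rule lim_const_over_n[THEN LIMSEQ_Suc])
  then have "\<forall>\<^sub>F n in sequentially. 1 / real (Suc n) < min d (t - \<tau>)"
    using d(1) \<tau> by (intro order_tendstoD) auto
  then have "\<forall>\<^sub>F n in sequentially. ennreal (real (Suc n) * \<bar>w (\<gamma> (\<tau> + 1 / real (Suc n))) - w (\<gamma> \<tau>)\<bar>) \<le> z"
  proof eventually_elim
    case (elim n)
    define y where "y = \<gamma> (\<tau> + 1 / real (Suc n))"
    have dist: "dist y (\<gamma> \<tau>) \<le> 1 / real (Suc n)"
      unfolding y_def using \<gamma>[of "\<tau> + 1 / real (Suc n)" \<tau>] \<tau> elim
      by (simp add: add_increasing2 less_imp_le)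
    show ?case
    proof (cases "y = \<gamma> \<tau>")
      case False
      have "real (Suc n) * dist y (\<gamma> \<tau>) \<le> 1"
        using dist by (simp add: field_simps)
      then have "\<bar>w y - w (\<gamma> \<tau>)\<bar> * (real (Suc n) * dist y (\<gamma> \<tau>)) \<le> \<bar>w y - w (\<gamma> \<tau>)\<bar> * 1"
        by (intro mult_left_mono) auto
      then have "real (Suc n) * \<bar>w y - w (\<gamma> \<tau>)\<bar> \<le> \<bar>w y - w (\<gamma> \<tau>)\<bar> / dist y (\<gamma> \<tau>)"
        using False by (simp add: field_simps)
      moreover have "ennreal (\<bar>w y - w (\<gamma> \<tau>)\<bar> / dist y (\<gamma> \<tau>)) < z"
        using False dist elim by (intro d(2)) auto
      ultimately show ?thesis
        by (metis (no_types, lifting) ennreal_leI less_imp_le order_trans y_def)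
    qed (simp add: y_def)
  qed
  then show "limsup (\<lambda>n. ennreal (real (Suc n) * \<bar>w (\<gamma> (\<tau> + 1 / real (Suc n))) - w (\<gamma> \<tau>)\<bar>)) \<le> z"
    by (rule Limsup_bounded)
qed

lemma lip_upper_gradient:
  fixes \<gamma> :: "real \<Rightarrow> 'a::metric_space"
  assumes w: "lipschitz_fun w" and "s \<le> t"
    and \<gamma>: "\<And>a b. a \<in> {s..t} \<Longrightarrow> b \<in> {s..t} \<Longrightarrow> dist (\<gamma> a) (\<gamma> b) \<le> \<bar>a - b\<bar>"
  shows "ennreal \<bar>w (\<gamma> t) - w (\<gamma> s)\<bar> \<le> (\<integral>\<^sup>+\<tau>\<in>{s..t}. lip w (\<gamma> \<tau>) \<partial>lborel)"
proof -
  \<comment> \<open>The curve is controlled on \<open>[s, t]\<close> only. Freezing it outside makes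
    it globally Lipschitz, hence measurable, and leaves the integral unchanged.\<close>
  define c where "c = (\<lambda>x::real. max s (min t x))"
  obtain K where K: "K-lipschitz_on UNIV w"
    using w by (auto simp: lipschitz_fun_def)
  have c: "c x \<in> {s..t}" for x using \<open>s \<le> t\<close> by (auto simp: c_def)
  have c_id: "c x = x" if "x \<in> {s..t}" for x using that by (auto simp: c_def)
  have "1-lipschitz_on (range c) \<gamma>"
    using \<gamma> c by (intro lipschitz_onI) (auto simp: dist_real_def)
  moreover have "1-lipschitz_on UNIV c"
    unfolding c_def by (rule lipschitz_clamp)
  ultimately have lc: "1-lipschitz_on UNIV (\<lambda>x. \<gamma> (c x))"
    using lipschitz_on_compose2[of 1 UNIV c 1 \<gamma>] by simp
  then have cont: "continuous_on UNIV (\<lambda>x. \<gamma> (c x))"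
    by (rule lipschitz_on_continuous_on)
  have l: "K-lipschitz_on UNIV (\<lambda>x. w (\<gamma> (c x)))"
    using lipschitz_on_compose2[OF lc lipschitz_on_subset[OF K subset_UNIV]] by simp
  have [measurable]: "lip w \<in> borel_measurable borel" "(\<lambda>x. \<gamma> (c x)) \<in> borel_measurable borel"
    using borel_measurable_lip[OF w] borel_measurable_continuous_onI[OF cont] by auto
  have "ennreal \<bar>w (\<gamma> (c t)) - w (\<gamma> (c s))\<bar> \<le> (\<integral>\<^sup>+\<tau>\<in>{s..t}. lip w (\<gamma> (c \<tau>)) \<partial>lborel)"
  proof (rule increment_le_nn_integral[OF l \<open>s \<le> t\<close>])
    fix \<tau> assume \<tau>: "s < \<tau>" "\<tau> < t"
    show "limsup (\<lambda>n. ennreal (real (Suc n) * \<bar>w (\<gamma> (c (\<tau> + 1 / real (Suc n)))) - w (\<gamma> (c \<tau>))\<bar>)) \<le> lip w (\<gamma> (c \<tau>))"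
      using \<tau> by (intro limsup_difference_quotient_le_lip[where \<gamma> = "\<lambda>x. \<gamma> (c x)"]) (auto simp: c_id intro: \<gamma>)
  qed measurable
  also have "\<dots> = (\<integral>\<^sup>+\<tau>\<in>{s..t}. lip w (\<gamma> \<tau>) \<partial>lborel)"
    by (intro nn_integral_cong) (auto simp: c_id indicator_def)
  finally show ?thesis using \<open>s \<le> t\<close> by (simp add: c_id)
qed

lemma rect_curves_dist_le:
  assumes "(L, \<gamma>) \<in> rect_curves" "a \<in> {0..L}" "b \<in> {0..L}"
  shows "dist (\<gamma> a) (\<gamma> b) \<le> \<bar>a - b\<bar>"
proof -
  have le: "dist (\<gamma> a) (\<gamma> b) \<le> b - a" if "0 \<le> a" "a \<le> b" "b \<le> L" for a b
  proof -
    have "(\<Sum>i < length [a, b] - 1. ennreal (dist (\<gamma> ([a, b] ! i)) (\<gamma> ([a, b] ! Suc i)))) \<le> curve_length \<gamma> a b"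
      unfolding curve_length_def using that by (intro SUP_upper) auto
    also have "\<dots> = ennreal (b - a)"
      using assms(1) that by (auto simp: rect_curves_def)
    finally show ?thesis using that by (simp add: ennreal_le_iff)
  qed
  show ?thesis
    using le[of a b] le[of b a] assms by (cases "a \<le> b") (auto simp: dist_commute)
qed

section \<open>Fuglede's lemma\<close>

lemma rect_curves_measurable:
  assumes c: "(L, \<gamma>) \<in> rect_curves" and [measurable]: "\<rho> \<in> borel_measurable borel"
  shows "(\<lambda>t. \<rho> (\<gamma> t) * indicator {0..L} t :: ennreal) \<in> borel_measurable borel"
proof -
  define k where "k = (\<lambda>x::real. max 0 (min L x))"
  have L: "0 < L" using c by (auto simp: rect_curves_def)
  have "1-lipschitz_on (range k) \<gamma>"
    using rect_curves_dist_le[OF c] L by (intro lipschitz_onI) (auto simp: dist_real_def k_def)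
  moreover have "1-lipschitz_on UNIV k"
    unfolding k_def by (rule lipschitz_clamp)
  ultimately have "1-lipschitz_on UNIV (\<lambda>x. \<gamma> (k x))"
    using lipschitz_on_compose2[of 1 UNIV k 1 \<gamma>] by simp
  then have [measurable]: "(\<lambda>x. \<gamma> (k x)) \<in> borel_measurable borel"
    by (intro borel_measurable_continuous_onI lipschitz_on_continuous_on)
  have "(\<lambda>t. \<rho> (\<gamma> t) * indicator {0..L} t) = (\<lambda>t. \<rho> (\<gamma> (k t)) * indicator {0..L} t)"
    by (auto simp: fun_eq_iff k_def indicator_def)
  then show ?thesis by simp
qed

text \<open>If \<open>\<rho>\<close> has infinite integral along every curve of
  \<open>\<Gamma>\<close>, so has each positive multiple of it. All multiples are therefore
  admissible, and their energies scale to 0.\<close>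

lemma modulus_eq_0:
  assumes p: "0 < p" and \<rho>: "\<rho> \<in> borel_measurable borel" "(\<integral>\<^sup>+x. epowr (\<rho> x) p \<partial>m) < \<infinity>"
    and [measurable_cong]: "sets m = sets borel"
    and \<Gamma>: "\<Gamma> \<subseteq> rect_curves" "\<And>L \<gamma>. (L, \<gamma>) \<in> \<Gamma> \<Longrightarrow> curve_integral (L, \<gamma>) \<rho> = \<infinity>"
  shows "modulus p m \<Gamma> = 0"
proof -
  note [measurable] = \<rho>(1)
  obtain i where i: "(\<integral>\<^sup>+x. epowr (\<rho> x) p \<partial>m) = ennreal i" "0 \<le> i"
    using \<rho>(2) by (cases "\<integral>\<^sup>+x. epowr (\<rho> x) p \<partial>m") auto
  have "modulus p m \<Gamma> \<le> 0"
  proof (rule ennreal_le_epsilon)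
    fix e :: real assume e: "0 < e"
    define \<epsilon> where "\<epsilon> = (e / (i + 1)) powr (1 / p)"
    have \<epsilon>: "0 < \<epsilon>" "\<epsilon> powr p = e / (i + 1)"
      using e i p by (auto simp: \<epsilon>_def powr_powr)
    have "modulus p m \<Gamma> \<le> (\<integral>\<^sup>+x. epowr (ennreal \<epsilon> * \<rho> x) p \<partial>m)"
      unfolding modulus_def
    proof (rule INF_lower, safe)
      fix L \<gamma> assume c: "(L, \<gamma>) \<in> \<Gamma>"
      then have [measurable]: "(\<lambda>t. \<rho> (\<gamma> t) * indicator {0..L} t) \<in> borel_measurable borel"
        using \<Gamma> by (intro rect_curves_measurable) auto
      have "curve_integral (L, \<gamma>) (\<lambda>x. ennreal \<epsilon> * \<rho> x) = ennreal \<epsilon> * curve_integral (L, \<gamma>) \<rho>"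
        by (simp add: curve_integral_def mult.assoc nn_integral_cmult)
      also have "\<dots> = \<infinity>"
        using \<Gamma>(2)[OF c] \<epsilon> by (simp add: ennreal_mult_top)
      finally show "1 \<le> curve_integral (L, \<gamma>) (\<lambda>x. ennreal \<epsilon> * \<rho> x)"
        by simp
    qed measurable
    also have "\<dots> = ennreal (\<epsilon> powr p) * ennreal i"
      using p \<epsilon> by (simp add: epowr_mult epowr_ennreal nn_integral_cmult i(1))
    also have "\<dots> = ennreal (e * (i / (i + 1)))"
      using \<epsilon> e i by (simp add: ennreal_mult[symmetric])
    also have "\<dots> \<le> ennreal (e * 1)"
      using e i by (intro ennreal_leI mult_left_mono) auto
    finally show "modulus p m \<Gamma> \<le> 0 + ennreal e" by simp
  qed
  then show ?thesis by simp
qed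

lemma AE_interval_ex:
  assumes "AE t in lborel. t \<in> {0..L} \<longrightarrow> P t" "0 \<le> a" "a < b" "b \<le> (L::real)"
  shows "\<exists>t. a < t \<and> t < b \<and> P t"
proof (rule ccontr)
  assume "\<not> ?thesis"
  then have "AE t in lborel. t \<notin> {a<..<b}"
    using assms by (intro eventually_mono[OF assms(1)]) auto
  then have "emeasure lborel {a<..<b} = 0"
    using AE_iff_null_sets[of "{a<..<b}" lborel] by auto
  then show False using \<open>a < b\<close> by simp
qed

text \<open>Absolute continuity of the integral in the form needed along curves: intervals shrinking
  to one point, which is a null set.\<close>

lemma small_interval_nn_integral:
  fixes g :: "real \<Rightarrow> ennreal"
  assumes [measurable]: "g \<in> borel_measurable borel" and fin: "(\<integral>\<^sup>+t. g t \<partial>lborel) < \<infinity>" and e: "0 < (e::ennreal)"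
  obtains d where "0 < d" "(\<integral>\<^sup>+t\<in>{s - d..s + d}. g t \<partial>lborel) < e"
proof -
  define f where "f n t = g t * indicator {s - 1 / real (Suc n)..s + 1 / real (Suc n)} t" for n t
  have [measurable]: "f n \<in> borel_measurable borel" for n unfolding f_def by measurable
  have dec: "decseq f"
  proof (rule decseq_SucI, rule le_funI)
    fix n t
    have "1 / real (Suc (Suc n)) \<le> 1 / real (Suc n)" by (simp add: field_simps)
    then show "f (Suc n) t \<le> f n t"
      unfolding f_def by (intro mult_left_mono) (auto simp: indicator_def)
  qed
  have fin0: "(\<integral>\<^sup>+t. f 0 t \<partial>lborel) < \<infinity>"
    by (rule order_le_less_trans[OF nn_integral_mono fin]) (auto simp: f_def indicator_def)
  have "(INF n. \<integral>\<^sup>+t. f n t \<partial>lborel) = (\<integral>\<^sup>+t. (INF n. f n t) \<partial>lborel)"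
    by (rule nn_integral_monotone_convergence_INF_decseq[symmetric, OF dec _ fin0]) measurable
  also have "\<dots> = (\<integral>\<^sup>+(t::real). 0 \<partial>lborel)"
  proof (rule nn_integral_cong_AE)
    have "AE t in lborel. t \<noteq> s" by (rule AE_lborel_singleton)
    then show "AE t in lborel. (INF n. f n t) = 0"
    proof eventually_elim
      case (elim t)
      then obtain n where "1 / real (Suc n) < \<bar>t - s\<bar>"
        using nat_approx_posE[of "\<bar>t - s\<bar>"] by auto
      then have "f n t = 0" by (auto simp: f_def indicator_def)
      then show ?case by (metis INF_lower UNIV_I le_zero_eq)
    qed
  qed
  finally have "(INF n. \<integral>\<^sup>+t. f n t \<partial>lborel) < e" using e by simp
  then obtain n where "(\<integral>\<^sup>+t. f n t \<partial>lborel) < e" by (auto simp: INF_less_iff)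
  then show ?thesis using that[of "1 / real (Suc n)"] by (simp add: f_def)
qed

lemma ennreal_suminf_tendsto_0:
  fixes e :: "nat \<Rightarrow> ennreal"
  assumes "(\<Sum>n. e n) < \<infinity>"
  shows "e \<longlonglongrightarrow> 0"
proof -
  have e: "e n = ennreal (enn2real (e n))" for n
    using ennreal_suminf_lessD[OF assms] by simp
  have "(\<Sum>n. ennreal (enn2real (e n))) \<noteq> top"
    using assms by (simp flip: e)
  then have "summable (\<lambda>n. enn2real (e n))"
    by (intro summable_suminf_not_top) auto
  then have "(\<lambda>n. ennreal (enn2real (e n))) \<longlonglongrightarrow> ennreal 0"
    by (intro tendsto_ennrealI summable_LIMSEQ_zero)
  then show ?thesis by (simp flip: e)
qed

text \<open>Along a curve, convergence almost everywhere and equi-integrable upper gradients give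
  convergence at the endpoints.\<close>

lemma curve_limit:
  fixes w :: "nat \<Rightarrow> 'a::metric_space \<Rightarrow> real"
  assumes c: "(L, \<gamma>) \<in> rect_curves"
    and w: "\<And>n. lipschitz_fun (w n)"
    and G[measurable]: "G \<in> borel_measurable borel" and d[measurable]: "\<And>n. d n \<in> borel_measurable borel"
    and u[measurable]: "u \<in> borel_measurable borel"
    and le: "\<And>n x. lip (w n) x \<le> G x + d n x"
    and fin: "curve_integral (L, \<gamma>) (\<lambda>x. \<Sum>n. ennreal \<bar>w n x - u x\<bar> + d n x) < \<infinity>"
    and finG: "curve_integral (L, \<gamma>) G < \<infinity>"
  shows "convergent (\<lambda>n. w n (\<gamma> 0))" "convergent (\<lambda>n. w n (\<gamma> L))"
    "ennreal \<bar>lim (\<lambda>n. w n (\<gamma> L)) - lim (\<lambda>n. w n (\<gamma> 0))\<bar> \<le> curve_integral (L, \<gamma>) G"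
proof -
  have L: "0 < L" using c by (auto simp: rect_curves_def)
  have [measurable]: "w n \<in> borel_measurable borel" for n
    by (intro borel_measurable_continuous_onI lipschitz_fun_continuous w)
  define \<rho> where "\<rho> n x = ennreal \<bar>w n x - u x\<bar> + d n x" for n x
  have \<rho>m[measurable]: "\<rho> n \<in> borel_measurable borel" for n unfolding \<rho>_def by measurable
  note [measurable] = rect_curves_measurable[OF c]
  define e where "e n = (\<integral>\<^sup>+t\<in>{0..L}. d n (\<gamma> t) \<partial>lborel)" for n
  define r where "r n = (\<integral>\<^sup>+t\<in>{0..L}. \<rho> n (\<gamma> t) \<partial>lborel)" for n
  have sum: "(\<integral>\<^sup>+t. (\<Sum>n. \<rho> n (\<gamma> t) * indicator {0..L} t) \<partial>lborel) < \<infinity>"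
    using fin unfolding curve_integral_def \<rho>_def ennreal_suminf_multc fst_conv snd_conv .
  also have "(\<integral>\<^sup>+t. (\<Sum>n. \<rho> n (\<gamma> t) * indicator {0..L} t) \<partial>lborel) = (\<Sum>n. r n)"
    unfolding r_def by (intro nn_integral_suminf) measurable
  finally have "(\<Sum>n. r n) < \<infinity>" .
  moreover have "(\<Sum>n. e n) \<le> (\<Sum>n. r n)"
    unfolding e_def r_def by (intro suminf_le nn_integral_mono mult_right_mono) (auto simp: \<rho>_def)
  ultimately have "(\<Sum>n. e n) < \<infinity>" by (rule order_le_less_trans[rotated])
  then have e0: "e \<longlonglongrightarrow> 0"
    by (intro ennreal_suminf_tendsto_0)
  have conv: "AE t in lborel. t \<in> {0..L} \<longrightarrow> (\<lambda>n. w n (\<gamma> t)) \<longlonglongrightarrow> u (\<gamma> t)"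
  proof -
    have "AE t in lborel. (\<Sum>n. \<rho> n (\<gamma> t) * indicator {0..L} t) \<noteq> \<infinity>"
      using sum by (intro nn_integral_PInf_AE) auto
    then show ?thesis
    proof (eventually_elim, safe)
      fix t assume t: "(\<Sum>n. \<rho> n (\<gamma> t) * indicator {0..L} t) \<noteq> \<infinity>" "t \<in> {0..L}"
      have "(\<Sum>n. ennreal \<bar>w n (\<gamma> t) - u (\<gamma> t)\<bar>) \<le> (\<Sum>n. \<rho> n (\<gamma> t) * indicator {0..L} t)"
        using t(2) by (intro suminf_le) (auto simp: \<rho>_def)
      then have "(\<Sum>n. ennreal \<bar>w n (\<gamma> t) - u (\<gamma> t)\<bar>) \<noteq> top"
        using t(1) by (auto simp: top_unique)
      then have "summable (\<lambda>n. \<bar>w n (\<gamma> t) - u (\<gamma> t)\<bar>)"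
        by (intro summable_suminf_not_top) auto
      then have "(\<lambda>n. \<bar>w n (\<gamma> t) - u (\<gamma> t)\<bar>) \<longlonglongrightarrow> 0"
        by (rule summable_LIMSEQ_zero)
      then show "(\<lambda>n. w n (\<gamma> t)) \<longlonglongrightarrow> u (\<gamma> t)"
        by (simp add: LIM_zero_iff tendsto_rabs_zero_iff)
    qed
  qed
  define I where "I a b = (\<integral>\<^sup>+t. (G (\<gamma> t) * indicator {0..L} t) * indicator {a..b} t \<partial>lborel)" for a b
  have inc: "ennreal \<bar>w n (\<gamma> b) - w n (\<gamma> a)\<bar> \<le> I a b + e n" if "0 \<le> a" "a \<le> b" "b \<le> L" for n a b
  proof -
    have "ennreal \<bar>w n (\<gamma> b) - w n (\<gamma> a)\<bar> \<le> (\<integral>\<^sup>+\<tau>\<in>{a..b}. lip (w n) (\<gamma> \<tau>) \<partial>lborel)"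
      using that by (intro lip_upper_gradient w rect_curves_dist_le[OF c]) auto
    also have "\<dots> \<le> (\<integral>\<^sup>+t. (G (\<gamma> t) * indicator {0..L} t) * indicator {a..b} t + d n (\<gamma> t) * indicator {0..L} t \<partial>lborel)"
      using that le by (intro nn_integral_mono) (auto simp: indicator_def)
    also have "\<dots> = I a b + e n"
      unfolding I_def e_def by (rule nn_integral_add) measurable
    finally show ?thesis .
  qed
  have I_sub: "I a b \<le> I a' b'" if "a' \<le> a" "b \<le> b'" for a b a' b'
    unfolding I_def using that by (intro nn_integral_mono mult_left_mono) (auto simp: indicator_def)
  have cauchy: "Cauchy (\<lambda>n. w n (\<gamma> s))" if s: "s \<in> {0..L}" for s
  \<comment> \<open>Close to any parameter s there is a t at which the values converge. Passing from
    s to t costs \<open>I\<close> plus \<open>e n\<close>, at most two fifths of \<epsilon>; this is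
    done for both indices, and the Cauchy property at t costs the last fifth.\<close>
  proof (rule metric_CauchyI)
    fix \<epsilon> :: real assume \<epsilon>: "0 < \<epsilon>"
    have "(\<integral>\<^sup>+t. G (\<gamma> t) * indicator {0..L} t \<partial>lborel) < \<infinity>"
      using finG by (simp add: curve_integral_def)
    then obtain \<delta> where \<delta>: "0 < \<delta>" "I (s - \<delta>) (s + \<delta>) < ennreal (\<epsilon> / 5)"
      using small_interval_nn_integral[of "\<lambda>t. G (\<gamma> t) * indicator {0..L} t" "ennreal (\<epsilon> / 5)" s] \<epsilon>
      unfolding I_def by auto
    have "max 0 (s - \<delta>) < min L (s + \<delta>)" using s \<delta> L by auto
    then obtain t where t: "max 0 (s - \<delta>) < t" "t < min L (s + \<delta>)" "(\<lambda>n. w n (\<gamma> t)) \<longlonglongrightarrow> u (\<gamma> t)"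
      using AE_interval_ex[OF conv, of "max 0 (s - \<delta>)" "min L (s + \<delta>)"] by auto
    have near: "ennreal \<bar>w n (\<gamma> s) - w n (\<gamma> t)\<bar> \<le> ennreal (\<epsilon> / 5) + e n" for n
    proof (cases "s \<le> t")
      case True
      have "ennreal \<bar>w n (\<gamma> t) - w n (\<gamma> s)\<bar> \<le> I s t + e n"
        using inc[of s t n] True s t by auto
      also have "I s t \<le> I (s - \<delta>) (s + \<delta>)" using \<delta> t by (intro I_sub) auto
      also note \<delta>(2)[THEN less_imp_le]
      finally show ?thesis by (simp add: abs_minus_commute add_right_mono)
    next
      case False
      have "ennreal \<bar>w n (\<gamma> s) - w n (\<gamma> t)\<bar> \<le> I t s + e n"
        using inc[of t s n] False s t by auto
      also have "I t s \<le> I (s - \<delta>) (s + \<delta>)" using \<delta> t by (intro I_sub) auto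
      also note \<delta>(2)[THEN less_imp_le]
      finally show ?thesis by (simp add: add_right_mono)
    qed
    have "\<forall>\<^sub>F n in sequentially. e n < ennreal (\<epsilon> / 5)"
      using e0 \<epsilon> by (intro order_tendstoD(2)) auto
    then obtain N where N: "\<And>n. n \<ge> N \<Longrightarrow> e n < ennreal (\<epsilon> / 5)"
      by (auto simp: eventually_sequentially)
    have close: "\<bar>w n (\<gamma> s) - w n (\<gamma> t)\<bar> \<le> 2 * (\<epsilon> / 5)" if "n \<ge> N" for n
    proof -
      have "ennreal \<bar>w n (\<gamma> s) - w n (\<gamma> t)\<bar> \<le> ennreal (\<epsilon> / 5) + ennreal (\<epsilon> / 5)"
        using near[of n] N[OF that] by (meson add_left_mono less_imp_le order_trans)
      also have "\<dots> = ennreal (2 * (\<epsilon> / 5))"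
        using \<epsilon> by (subst ennreal_plus[symmetric]) auto
      finally show ?thesis using \<epsilon> by (subst (asm) ennreal_le_iff) auto
    qed
    obtain M where M: "\<And>m n. m \<ge> M \<Longrightarrow> n \<ge> M \<Longrightarrow> dist (w m (\<gamma> t)) (w n (\<gamma> t)) < \<epsilon> / 5"
      using metric_CauchyD[OF LIMSEQ_imp_Cauchy[OF t(3)], of "\<epsilon> / 5"] \<epsilon> by auto
    show "\<exists>M. \<forall>m\<ge>M. \<forall>n\<ge>M. dist (w m (\<gamma> s)) (w n (\<gamma> s)) < \<epsilon>"
    proof (intro exI allI impI)
      fix m n assume mn: "m \<ge> max M N" "n \<ge> max M N"
      then show "dist (w m (\<gamma> s)) (w n (\<gamma> s)) < \<epsilon>"
        using close[of m] close[of n] M[of m n] unfolding dist_real_def max.bounded_iff by linarith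
    qed
  qed
  then show conv0: "convergent (\<lambda>n. w n (\<gamma> 0))" and convL: "convergent (\<lambda>n. w n (\<gamma> L))"
    using L by (simp_all add: Cauchy_convergent_iff)
  have lim1: "(\<lambda>n. ennreal \<bar>w n (\<gamma> L) - w n (\<gamma> 0)\<bar>) \<longlonglongrightarrow> ennreal \<bar>lim (\<lambda>n. w n (\<gamma> L)) - lim (\<lambda>n. w n (\<gamma> 0))\<bar>"
    using conv0 convL by (intro tendsto_ennrealI tendsto_rabs tendsto_diff) (simp_all add: convergent_LIMSEQ_iff)
  have lim2: "(\<lambda>n. I 0 L + e n) \<longlonglongrightarrow> I 0 L + 0"
    by (intro tendsto_add e0 tendsto_const)
  have "ennreal \<bar>lim (\<lambda>n. w n (\<gamma> L)) - lim (\<lambda>n. w n (\<gamma> 0))\<bar> \<le> I 0 L + 0"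
    using inc[of 0 L] L by (intro LIMSEQ_le[OF lim1 lim2]) simp
  also have "I 0 L + 0 = curve_integral (L, \<gamma>) G"
    unfolding I_def curve_integral_def by (auto intro!: nn_integral_cong simp: indicator_def)
  finally show "ennreal \<bar>lim (\<lambda>n. w n (\<gamma> L)) - lim (\<lambda>n. w n (\<gamma> 0))\<bar> \<le> curve_integral (L, \<gamma>) G" .
qed

text \<open>The representative \<open>v\<close> is the pointwise limit of the Lipschitz functions,
  and the sum \<open>\<rho>\<close> is a single test function for all exceptional curves. Where its
  integral is finite, \<open>curve_limit\<close> gives convergence at both endpoints together with
  the inequality; where \<open>G\<close> has infinite integral there is nothing to show.\<close>

lemma weak_upper_gradient_limit:
  fixes w :: "nat \<Rightarrow> 'a::metric_space \<Rightarrow> real"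
  assumes p: "0 < p" and m[measurable_cong]: "sets m = sets borel"
    and w: "\<And>n. lipschitz_fun (w n)"
    and G[measurable]: "G \<in> borel_measurable borel" and d[measurable]: "\<And>n. d n \<in> borel_measurable borel"
    and u[measurable]: "u \<in> borel_measurable borel"
    and le: "\<And>n x. lip (w n) x \<le> G x + d n x"
    and fin: "(\<integral>\<^sup>+x. epowr (\<Sum>n. ennreal \<bar>w n x - u x\<bar> + d n x) p \<partial>m) < \<infinity>"
  shows "weak_upper_gradient p m u G"
proof -
  have [measurable]: "w n \<in> borel_measurable borel" for n
    by (intro borel_measurable_continuous_onI lipschitz_fun_continuous w)
  define \<rho> where "\<rho> x = (\<Sum>n. ennreal \<bar>w n x - u x\<bar> + d n x)" for x
  have [measurable]: "\<rho> \<in> borel_measurable borel" unfolding \<rho>_def by measurable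
  define v where "v x = lim (\<lambda>n. w n x)" for x
  have "AE x in m. epowr (\<rho> x) p \<noteq> \<infinity>"
    using fin by (intro nn_integral_PInf_AE) (auto simp: \<rho>_def)
  then have AE: "AE x in m. v x = u x"
  proof eventually_elim
    case (elim x)
    then have "\<rho> x \<noteq> \<infinity>" by auto
    moreover have "(\<Sum>n. ennreal \<bar>w n x - u x\<bar>) \<le> \<rho> x"
      unfolding \<rho>_def by (intro suminf_le) auto
    ultimately have "(\<Sum>n. ennreal \<bar>w n x - u x\<bar>) \<noteq> top"
      by (auto simp: top_unique)
    then have "summable (\<lambda>n. \<bar>w n x - u x\<bar>)"
      by (intro summable_suminf_not_top) auto
    then have "(\<lambda>n. \<bar>w n x - u x\<bar>) \<longlonglongrightarrow> 0"
      by (rule summable_LIMSEQ_zero)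
    then have "(\<lambda>n. w n x) \<longlonglongrightarrow> u x"
      by (simp add: LIM_zero_iff tendsto_rabs_zero_iff)
    then show ?case unfolding v_def by (rule limI)
  qed
  have "modulus p m {(L, \<gamma>) \<in> rect_curves. \<not> ennreal \<bar>v (\<gamma> L) - v (\<gamma> 0)\<bar> \<le> curve_integral (L, \<gamma>) G} = 0"
  proof (rule modulus_eq_0[OF p])
    show "(\<integral>\<^sup>+x. epowr (\<rho> x) p \<partial>m) < \<infinity>" using fin by (simp add: \<rho>_def)
    show "\<rho> \<in> borel_measurable borel" by measurable
    show "sets m = sets borel" by (rule m)
    show "{(L, \<gamma>) \<in> rect_curves. \<not> ennreal \<bar>v (\<gamma> L) - v (\<gamma> 0)\<bar> \<le> curve_integral (L, \<gamma>) G} \<subseteq> rect_curves"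
      by blast
  next
    fix L and \<gamma> :: "real \<Rightarrow> 'a"
    assume asm: "(L, \<gamma>) \<in> {(L, \<gamma>) \<in> rect_curves. \<not> ennreal \<bar>v (\<gamma> L) - v (\<gamma> 0)\<bar> \<le> curve_integral (L, \<gamma>) G}"
    have c: "(L, \<gamma>) \<in> rect_curves"
      using asm by simp
    have not: "\<not> ennreal \<bar>v (\<gamma> L) - v (\<gamma> 0)\<bar> \<le> curve_integral (L, \<gamma>) G"
      using asm by simp
    show "curve_integral (L, \<gamma>) \<rho> = \<infinity>"
    proof (rule ccontr)
      assume "curve_integral (L, \<gamma>) \<rho> \<noteq> \<infinity>"
      then have "curve_integral (L, \<gamma>) (\<lambda>x. \<Sum>n. ennreal \<bar>w n x - u x\<bar> + d n x) < \<infinity>"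
        by (simp add: less_top \<rho>_def[abs_def])
      moreover have "curve_integral (L, \<gamma>) G < \<infinity>"
        using not by (cases "curve_integral (L, \<gamma>) G = \<infinity>") (auto simp: less_top)
      ultimately show False
        using curve_limit(3)[where w = w and d = d and u = u and G = G, OF c w G d u le] not
        by (simp add: v_def)
    qed
  qed
  with AE G show ?thesis
    unfolding weak_upper_gradient_def by blast
qed

text \<open>Removes the constants of \<open>epowr_add_le\<close>: n tends to infinity with \<tau>
  fixed, which kills \<open>z\<close>, and only then does \<tau> tend to 0.\<close>

lemma le_of_approx_powr:
  fixes X Y :: ennreal
  assumes p: "0 < p"
    and le: "\<And>n \<tau>. 0 < \<tau> \<Longrightarrow> X \<le> ennreal ((1 + \<tau>) powr p) * y n + ennreal ((1 + 1 / \<tau>) powr p) * z n"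
    and y: "y \<longlonglongrightarrow> Y" and z: "z \<longlonglongrightarrow> (0::ennreal)"
  shows "X \<le> Y"
proof -
  have *: "X \<le> ennreal ((1 + \<tau>) powr p) * Y" if "0 < \<tau>" for \<tau>
  proof -
    have "(\<lambda>n. ennreal ((1 + \<tau>) powr p) * y n + ennreal ((1 + 1 / \<tau>) powr p) * z n)
        \<longlonglongrightarrow> ennreal ((1 + \<tau>) powr p) * Y + ennreal ((1 + 1 / \<tau>) powr p) * 0"
      by (intro tendsto_add ennreal_tendsto_cmult y z) auto
    then show ?thesis
      using le[OF that] by (intro LIMSEQ_le_const[where X = "\<lambda>n. ennreal ((1 + \<tau>) powr p) * y n + ennreal ((1 + 1 / \<tau>) powr p) * z n"]) auto
  qed
  have "(\<lambda>n. (1 + 1 / real (Suc n)) powr p) \<longlonglongrightarrow> (1 + 0) powr p"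
    by (intro tendsto_powr tendsto_add tendsto_const lim_const_over_n[THEN LIMSEQ_Suc]) auto
  then have "(\<lambda>n. ennreal ((1 + 1 / real (Suc n)) powr p)) \<longlonglongrightarrow> ennreal 1"
    by (intro tendsto_ennrealI) simp
  then have "(\<lambda>n. ennreal ((1 + 1 / real (Suc n)) powr p) * Y) \<longlonglongrightarrow> ennreal 1 * Y"
    by (intro tendsto_mult_ennreal tendsto_const) auto
  then show ?thesis
    using * by (intro LIMSEQ_le_const[where X = "\<lambda>n. ennreal ((1 + 1 / real (Suc n)) powr p) * Y"]) auto
qed

text \<open>With this \<open>a\<close> the weight \<open>2 powr (real (Suc k) * p)\<close> of
  \<open>epowr_suminf_le\<close> is the reciprocal of \<open>a ^ Suc k\<close>. It uses up one of
  the four powers of \<open>a\<close> in the hypothesis and leaves a geometric series of ratio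
  \<open>a ^ 3\<close>. The rate \<open>a ^ (4 * n)\<close> survives for the distance to the limit,
  so these distances can be summed in the same way again.\<close>

lemma Lp_fast_Cauchy:
  fixes l :: "nat \<Rightarrow> 'a \<Rightarrow> real"
  assumes p: "0 < p" and a: "a = (1 / 2) powr p"
    and [measurable]: "\<And>n. l n \<in> borel_measurable M"
    and le: "\<And>n. (\<integral>\<^sup>+x. ennreal (\<bar>l n x - l (Suc n) x\<bar> powr p) \<partial>M) \<le> ennreal (a ^ (4 * Suc n))"
  obtains S where "S \<ge> 0" "\<And>n. (\<integral>\<^sup>+x. ennreal (\<bar>l n x - lim (\<lambda>n. l n x)\<bar> powr p) \<partial>M) \<le> ennreal (a ^ (4 * n) * S)"
proof -
  have a01: "0 < a" "a < 1"
    using p powr_less_mono2[of p "1/2" 1] by (auto simp: a)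
  have q: "2 powr (real (Suc k) * p) * a ^ Suc k = 1" for k
  proof -
    have "2 powr (real (Suc k) * p) = (2 powr p) ^ Suc k"
      by (simp add: powr_realpow[symmetric] powr_powr mult.commute[of p] del: power_Suc of_nat_Suc)
    moreover have "2 powr p * a = 1"
      unfolding a powr_mult[symmetric] by simp
    ultimately show ?thesis
      by (simp only: power_mult_distrib[symmetric] power_one)
  qed
  define b where "b n x = ennreal \<bar>l n x - l (Suc n) x\<bar>" for n x
  have [measurable]: "b n \<in> borel_measurable M" for n unfolding b_def by measurable
  define T where "T n x = (\<Sum>k. b (n + k) x)" for n x
  have [measurable]: "T n \<in> borel_measurable M" for n unfolding T_def by measurable
  define S where "S = (\<Sum>k. (a ^ 3) ^ Suc k)"
  have summ: "summable (\<lambda>k. (a ^ 3) ^ Suc k)"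
    using a01 by (subst summable_Suc_iff) (auto intro!: summable_geometric simp: power_less_one_iff)
  have S: "0 \<le> S" unfolding S_def using a01 summ by (intro suminf_nonneg) auto
  have T: "(\<integral>\<^sup>+x. epowr (T n x) p \<partial>M) \<le> ennreal (a ^ (4 * n) * S)" for n
  proof -
    have "(\<integral>\<^sup>+x. epowr (T n x) p \<partial>M) \<le> (\<integral>\<^sup>+x. (\<Sum>k. ennreal (2 powr (real (Suc k) * p)) * epowr (b (n + k) x) p) \<partial>M)"
      unfolding T_def by (intro nn_integral_mono epowr_suminf_le p)
    also have "\<dots> = (\<Sum>k. ennreal (2 powr (real (Suc k) * p)) * (\<integral>\<^sup>+x. epowr (b (n + k) x) p \<partial>M))"
      by (subst nn_integral_suminf) (auto simp: nn_integral_cmult)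
    also have "\<dots> \<le> (\<Sum>k. ennreal (a ^ (4 * n) * (a ^ 3) ^ Suc k))"
    proof (intro suminf_le allI)
      fix k
      have "ennreal (2 powr (real (Suc k) * p)) * (\<integral>\<^sup>+x. epowr (b (n + k) x) p \<partial>M)
          \<le> ennreal (2 powr (real (Suc k) * p)) * ennreal (a ^ (4 * Suc (n + k)))"
        using le[of "n + k"] by (intro mult_left_mono) (auto simp: b_def epowr_ennreal)
      also have "\<dots> = ennreal (2 powr (real (Suc k) * p) * a ^ (4 * Suc (n + k)))"
        using a01 by (intro ennreal_mult[symmetric]) auto
      also have "2 powr (real (Suc k) * p) * a ^ (4 * Suc (n + k))
          = (2 powr (real (Suc k) * p) * a ^ Suc k) * (a ^ (4 * n) * (a ^ 3) ^ Suc k)"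
      proof -
        have "4 * Suc (n + k) = Suc k + (4 * n + 3 * Suc k)" by simp
        then show ?thesis by (simp only: power_add power_mult mult.assoc)
      qed
      finally show "ennreal (2 powr (real (Suc k) * p)) * (\<integral>\<^sup>+x. epowr (b (n + k) x) p \<partial>M)
         \<le> ennreal (a ^ (4 * n) * (a ^ 3) ^ Suc k)"
        by (simp only: q mult_1)
    qed auto
    also have "\<dots> = ennreal (a ^ (4 * n) * S)"
      unfolding S_def using a01 summ
      by (intro suminf_ennreal_eq sums_mult summable_sums) auto
    finally show ?thesis .
  qed
  have fin: "AE x in M. T 0 x \<noteq> \<infinity>"
  proof -
    have "(\<integral>\<^sup>+x. epowr (T 0 x) p \<partial>M) \<noteq> \<infinity>"
      using T[of 0] by (auto simp: top_unique)
    then have "AE x in M. epowr (T 0 x) p \<noteq> \<infinity>"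
      by (intro nn_integral_PInf_AE) auto
    then show ?thesis by eventually_elim auto
  qed
  have conv: "convergent (\<lambda>n. l n x)" and le_T: "\<And>n. ennreal \<bar>l n x - lim (\<lambda>n. l n x)\<bar> \<le> T n x"
    if "T 0 x \<noteq> \<infinity>" for x
  proof -
    have sm: "summable (\<lambda>n. \<bar>l (Suc n) x - l n x\<bar>)"
      using that by (intro summable_suminf_not_top) (auto simp: T_def b_def abs_minus_commute)
    then have sm': "summable (\<lambda>n. l (Suc n) x - l n x)"
      by (rule summable_rabs_cancel)
    have "(\<lambda>n. (\<Sum>k<n. l (Suc k) x - l k x)) \<longlonglongrightarrow> (\<Sum>n. l (Suc n) x - l n x)"
      using sm' by (rule summable_LIMSEQ)
    then have "(\<lambda>n. l n x - l 0 x) \<longlonglongrightarrow> (\<Sum>n. l (Suc n) x - l n x)"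
      by (simp only: sum_lessThan_telescope[of "\<lambda>n. l n x"])
    from tendsto_add[OF this tendsto_const[of "l 0 x"]]
    show conv: "convergent (\<lambda>n. l n x)" by (auto simp: convergent_def)
    fix n
    have tele: "\<bar>l n x - l (n + j) x\<bar> \<le> (\<Sum>k<j. \<bar>l (n + k) x - l (Suc (n + k)) x\<bar>)" for j
      by (induction j) auto
    have "ennreal \<bar>l n x - l (n + j) x\<bar> \<le> T n x" for j
    proof -
      have "ennreal \<bar>l n x - l (n + j) x\<bar> \<le> (\<Sum>k<j. b (n + k) x)"
        using tele[of j] by (simp add: b_def ennreal_leI)
      also have "\<dots> \<le> T n x" unfolding T_def by (intro sum_le_suminf) auto
      finally show ?thesis .
    qed
    moreover have "(\<lambda>j. ennreal \<bar>l n x - l (n + j) x\<bar>) \<longlonglongrightarrow> ennreal \<bar>l n x - lim (\<lambda>n. l n x)\<bar>"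
    proof -
      have "(\<lambda>n. l n x) \<longlonglongrightarrow> lim (\<lambda>n. l n x)"
        using conv by (simp add: convergent_LIMSEQ_iff)
      then have "(\<lambda>j. l (n + j) x) \<longlonglongrightarrow> lim (\<lambda>n. l n x)"
        using LIMSEQ_ignore_initial_segment[of _ _ n] by (simp add: add.commute)
      then show ?thesis by (intro tendsto_intros)
    qed
    ultimately show "ennreal \<bar>l n x - lim (\<lambda>n. l n x)\<bar> \<le> T n x"
      by (intro LIMSEQ_le_const2[where X = "\<lambda>j. ennreal \<bar>l n x - l (n + j) x\<bar>"]) blast+
  qed
  show ?thesis
  proof (rule that[OF S])
    fix n
    have "(\<integral>\<^sup>+x. ennreal (\<bar>l n x - lim (\<lambda>n. l n x)\<bar> powr p) \<partial>M) \<le> (\<integral>\<^sup>+x. epowr (T n x) p \<partial>M)"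
    proof (rule nn_integral_mono_AE)
      show "AE x in M. ennreal (\<bar>l n x - lim (\<lambda>n. l n x)\<bar> powr p) \<le> epowr (T n x) p"
        using fin
      proof eventually_elim
        case (elim x)
        show ?case
          using epowr_mono[OF less_imp_le[OF p] le_T[OF elim, of n]] by (simp add: epowr_ennreal)
      qed
    qed
    also note T[of n]
    finally show "(\<integral>\<^sup>+x. ennreal (\<bar>l n x - lim (\<lambda>n. l n x)\<bar> powr p) \<partial>M) \<le> ennreal (a ^ (4 * n) * S)" .
  qed
qed

section \<open>The Cheeger energy is attained\<close>

definition rlip :: "('a::metric_space \<Rightarrow> real) \<Rightarrow> 'a \<Rightarrow> real" where
  "rlip u x = enn2real (lip u x)"

lemma rlip_nonneg [simp]: "0 \<le> rlip u x"
  by (simp add: rlip_def)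

lemma ennreal_rlip: "lipschitz_fun u \<Longrightarrow> ennreal (rlip u x) = lip u x"
  using lip_less_top[of u x] by (simp add: rlip_def)

lemma borel_measurable_rlip: "lipschitz_fun u \<Longrightarrow> rlip u \<in> borel_measurable borel"
  unfolding rlip_def by (intro borel_measurable_enn2real borel_measurable_lip)

lemma lipschitz_fun_add: "lipschitz_fun u \<Longrightarrow> lipschitz_fun v \<Longrightarrow> lipschitz_fun (\<lambda>x. u x + v x)"
  unfolding lipschitz_fun_def by (metis lipschitz_on_add)

lemma lipschitz_fun_cmult: "lipschitz_fun u \<Longrightarrow> lipschitz_fun (\<lambda>x. c * u x)"
  unfolding lipschitz_fun_def by (metis lipschitz_on_cmult_real)

lemma ennreal_mult_add:
  "0 \<le> c \<Longrightarrow> 0 \<le> s \<Longrightarrow> 0 \<le> t \<Longrightarrow> ennreal c * (ennreal s + ennreal t) = ennreal (c * (s + t))"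
  by (simp add: ennreal_mult)

lemma cheeger_energy_le_liminf:
  "(\<And>n. lipschitz_fun (v n)) \<Longrightarrow> Lp_tendsto p m v u \<Longrightarrow>
    cheeger_energy p m u \<le> liminf (\<lambda>n. \<integral>\<^sup>+x. epowr (lip (v n) x) p \<partial>m)"
  unfolding cheeger_energy_def by (intro INF_lower) auto

text \<open>Were there no such \<delta>, functions within 1 / (n + 1) of u and with energy below E -
  \<epsilon> would form a competitor for the Cheeger energy of u.\<close>

lemma cheeger_energy_lsc:
  assumes fin: "cheeger_energy p m u = ennreal E" "0 \<le> E" and e: "0 < \<epsilon>"
  obtains \<delta> where "0 < \<delta>" "\<And>v. lipschitz_fun v \<Longrightarrow> (\<integral>\<^sup>+x. ennreal (\<bar>v x - u x\<bar> powr p) \<partial>m) \<le> ennreal \<delta> \<Longrightarrow>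
    ennreal E \<le> (\<integral>\<^sup>+x. epowr (lip v x) p \<partial>m) + ennreal \<epsilon>"
proof (rule ccontr)
  note found = that
  assume no: "\<not> thesis"
  have "\<exists>v. lipschitz_fun v \<and> (\<integral>\<^sup>+x. ennreal (\<bar>v x - u x\<bar> powr p) \<partial>m) \<le> ennreal (1 / real (Suc n)) \<and>
     (\<integral>\<^sup>+x. epowr (lip v x) p \<partial>m) + ennreal \<epsilon> < ennreal E" for n
  proof (rule ccontr)
    assume "\<not> ?thesis"
    then have "thesis"
      by (intro found[of "1 / real (Suc n)"]) (auto simp: not_less)
    with no show False ..
  qed
  then have "\<exists>v. \<forall>n. lipschitz_fun (v n) \<and> (\<integral>\<^sup>+x. ennreal (\<bar>v n x - u x\<bar> powr p) \<partial>m) \<le> ennreal (1 / real (Suc n)) \<and>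
     (\<integral>\<^sup>+x. epowr (lip (v n) x) p \<partial>m) + ennreal \<epsilon> < ennreal E"
    by (intro choice allI)
  then obtain v where v: "\<And>n. lipschitz_fun (v n)"
    "\<And>n. (\<integral>\<^sup>+x. ennreal (\<bar>v n x - u x\<bar> powr p) \<partial>m) \<le> ennreal (1 / real (Suc n))"
    "\<And>n. (\<integral>\<^sup>+x. epowr (lip (v n) x) p \<partial>m) + ennreal \<epsilon> < ennreal E"
    by blast
  have lim: "(\<lambda>n. ennreal (1 / real (Suc n))) \<longlonglongrightarrow> ennreal 0"
    by (intro tendsto_ennrealI lim_const_over_n[THEN LIMSEQ_Suc])
  have "Lp_tendsto p m v u"
    unfolding Lp_tendsto_def
  proof (rule tendsto_sandwich[where f = "\<lambda>_. 0" and h = "\<lambda>n. ennreal (1 / real (Suc n))"])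
    show "\<forall>\<^sub>F n in sequentially. (\<integral>\<^sup>+x. ennreal (\<bar>v n x - u x\<bar> powr p) \<partial>m) \<le> ennreal (1 / real (Suc n))"
      by (intro always_eventually allI v(2))
    show "(\<lambda>n. ennreal (1 / real (Suc n))) \<longlonglongrightarrow> 0"
      using lim by (simp only: ennreal_0)
  qed (simp_all only: zero_le eventually_True tendsto_const)
  from cheeger_energy_le_liminf[OF v(1) this]
  have "ennreal E \<le> liminf (\<lambda>n. \<integral>\<^sup>+x. epowr (lip (v n) x) p \<partial>m)"
    by (simp add: fin)
  also have "\<dots> \<le> ennreal (E - \<epsilon>)"
  proof -
    have le: "(\<integral>\<^sup>+x. epowr (lip (v n) x) p \<partial>m) \<le> ennreal (E - \<epsilon>)" for n
    proof -
      obtain r where r: "(\<integral>\<^sup>+x. epowr (lip (v n) x) p \<partial>m) = ennreal r" "0 \<le> r"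
        using v(3)[of n] by (cases "\<integral>\<^sup>+x. epowr (lip (v n) x) p \<partial>m") (auto simp: top_unique)
      then have "ennreal (r + \<epsilon>) < ennreal E"
        using v(3)[of n] e by simp
      then have "r + \<epsilon> < E" using r e by (simp add: ennreal_less_iff del: ennreal_plus)
      then show ?thesis using r by (simp add: ennreal_leI)
    qed
    have "liminf (\<lambda>n. \<integral>\<^sup>+x. epowr (lip (v n) x) p \<partial>m) \<le> liminf (\<lambda>n. ennreal (E - \<epsilon>))"
      using le by (intro Liminf_mono) auto
    then show ?thesis by (simp add: Liminf_const)
  qed
  \<comment> \<open>\<open>ennreal (E - \<epsilon>)\<close> is truncated at 0, hence the maximum; E
    > 0 comes from the strict inequality for \<open>v 0\<close>.\<close>
  finally have E: "E \<le> max 0 (E - \<epsilon>)"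
    using fin(2) by (auto simp: ennreal_le_iff2 max_def split: if_splits)
  moreover have "E > 0"
    using v(3)[of 0] e by (cases "E = 0") (use fin in auto)
  ultimately show False using e by auto
qed

text \<open>Convergence in Lp makes the distance small eventually, whereas a small limit inferior
  makes the energy small only infinitely often; some index serves both.\<close>

lemma cheeger_energy_approx:
  assumes "cheeger_energy p m u < c" and e: "0 < \<delta>"
  obtains v where "lipschitz_fun v" "(\<integral>\<^sup>+x. ennreal (\<bar>v x - u x\<bar> powr p) \<partial>m) \<le> ennreal \<delta>"
    "(\<integral>\<^sup>+x. epowr (lip v x) p \<partial>m) < c"
proof -
  from assms(1) obtain v where v: "\<And>n. lipschitz_fun (v n)" "Lp_tendsto p m v u"
    "liminf (\<lambda>n. \<integral>\<^sup>+x. epowr (lip (v n) x) p \<partial>m) < c"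
    unfolding cheeger_energy_def by (auto simp: INF_less_iff)
  have ev: "\<forall>\<^sub>F n in sequentially. (\<integral>\<^sup>+x. ennreal (\<bar>v n x - u x\<bar> powr p) \<partial>m) < ennreal \<delta>"
    using v(2) e unfolding Lp_tendsto_def by (intro order_tendstoD(2)) auto
  have fr: "\<exists>\<^sub>F n in sequentially. (\<integral>\<^sup>+x. epowr (lip (v n) x) p \<partial>m) < c"
  proof (rule ccontr)
    assume "\<not> ?thesis"
    then have "\<forall>\<^sub>F n in sequentially. c \<le> (\<integral>\<^sup>+x. epowr (lip (v n) x) p \<partial>m)"
      by (simp add: not_frequently not_less)
    then have "c \<le> liminf (\<lambda>n. \<integral>\<^sup>+x. epowr (lip (v n) x) p \<partial>m)"
      by (rule Liminf_bounded)
    then show False using v(3) by simp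
  qed
  have "\<exists>\<^sub>F n in sequentially. (\<integral>\<^sup>+x. epowr (lip (v n) x) p \<partial>m) < c \<and>
     (\<integral>\<^sup>+x. ennreal (\<bar>v n x - u x\<bar> powr p) \<partial>m) < ennreal \<delta>"
    by (rule frequently_rev_mp[OF fr]) (use ev in \<open>auto elim: eventually_mono\<close>)
  then obtain n where "(\<integral>\<^sup>+x. epowr (lip (v n) x) p \<partial>m) < c"
     "(\<integral>\<^sup>+x. ennreal (\<bar>v n x - u x\<bar> powr p) \<partial>m) < ennreal \<delta>"
    using frequently_ex by blast
  then show ?thesis using that v(1) by (meson less_imp_le)
qed

text \<open>The midpoint of two almost optimal functions is a competitor, so uniform convexity makes their
  slopes close.\<close>

lemma almost_minimizers_close:
  fixes u :: "'a::polish_space \<Rightarrow> real"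
  assumes p: "1 < p" and m[measurable_cong]: "sets m = sets borel"
    and u[measurable]: "u \<in> borel_measurable m"
    and fin: "cheeger_energy p m u = ennreal E" "0 \<le> E" and eta: "0 < \<eta>"
  obtains \<delta> where "0 < \<delta>" "\<And>v w. lipschitz_fun v \<Longrightarrow> lipschitz_fun w \<Longrightarrow>
    (\<integral>\<^sup>+x. ennreal (\<bar>v x - u x\<bar> powr p) \<partial>m) \<le> ennreal \<delta> \<Longrightarrow>
    (\<integral>\<^sup>+x. ennreal (\<bar>w x - u x\<bar> powr p) \<partial>m) \<le> ennreal \<delta> \<Longrightarrow>
    (\<integral>\<^sup>+x. epowr (lip v x) p \<partial>m) \<le> ennreal (E + \<delta>) \<Longrightarrow>
    (\<integral>\<^sup>+x. epowr (lip w x) p \<partial>m) \<le> ennreal (E + \<delta>) \<Longrightarrow>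
    (\<integral>\<^sup>+x. ennreal (\<bar>rlip v x - rlip w x\<bar> powr p) \<partial>m) \<le> ennreal \<eta>"
proof -
  \<comment> \<open>The energies of v and w add up to at most 2 E + 2, so the term with \<epsilon>
    costs at most half of \<eta>. The other half pays for \<open>C * \<kappa>\<close> twice: for the
    excess of the two energies over E and for the deficit of the midpoint.\<close>
  define \<epsilon> where "\<epsilon> = \<eta> / (2 * (2 * E + 2))"
  have \<epsilon>: "0 < \<epsilon>" "\<epsilon> * (2 * E + 2) = \<eta> / 2"
  proof -
    have *: "\<eta> / (2 * F) * F = \<eta> / 2" if "0 < F" for F :: real
      using that by simp
    show "\<epsilon> * (2 * E + 2) = \<eta> / 2"
      unfolding \<epsilon>_def using fin(2) by (intro *) simp
  qed (use eta fin(2) in \<open>simp add: \<epsilon>_def\<close>)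
  obtain C where C: "0 < C" "\<And>a b. 0 \<le> a \<Longrightarrow> 0 \<le> b \<Longrightarrow>
    \<bar>a - b\<bar> powr p + C * ((a + b) / 2) powr p \<le> \<epsilon> * (a powr p + b powr p) + C * ((a powr p + b powr p) / 2)"
    using uniform_convexity_powr[OF p \<epsilon>(1)] by metis
  define \<kappa> where "\<kappa> = min 1 (\<eta> / (4 * C))"
  have \<kappa>: "0 < \<kappa>" "\<kappa> \<le> 1" "C * \<kappa> \<le> \<eta> / 4"
    using eta C(1) by (auto simp: \<kappa>_def min_def field_simps)
  obtain d where d: "0 < d" "\<And>v. lipschitz_fun v \<Longrightarrow> (\<integral>\<^sup>+x. ennreal (\<bar>v x - u x\<bar> powr p) \<partial>m) \<le> ennreal d \<Longrightarrow>
    ennreal E \<le> (\<integral>\<^sup>+x. epowr (lip v x) p \<partial>m) + ennreal \<kappa>"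
    using cheeger_energy_lsc[OF fin \<kappa>(1)] by metis
  \<comment> \<open>The p-th power of the distance from the midpoint to u is at most the sum of
    those of v and w, that is \<open>2 * \<delta>\<close>; hence \<open>d / 2\<close>.\<close>
  define \<delta> where "\<delta> = min \<kappa> (d / 2)"
  have \<delta>: "0 < \<delta>" "\<delta> \<le> \<kappa>" "2 * \<delta> \<le> d" using \<kappa> d by (auto simp: \<delta>_def)
  show ?thesis
  proof (rule that[OF \<delta>(1)])
    fix v w assume v: "lipschitz_fun v" and w: "lipschitz_fun w"
      and Nv: "(\<integral>\<^sup>+x. ennreal (\<bar>v x - u x\<bar> powr p) \<partial>m) \<le> ennreal \<delta>"
      and Nw: "(\<integral>\<^sup>+x. ennreal (\<bar>w x - u x\<bar> powr p) \<partial>m) \<le> ennreal \<delta>"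
      and Av: "(\<integral>\<^sup>+x. epowr (lip v x) p \<partial>m) \<le> ennreal (E + \<delta>)"
      and Aw: "(\<integral>\<^sup>+x. epowr (lip w x) p \<partial>m) \<le> ennreal (E + \<delta>)"
    note [measurable] = borel_measurable_rlip[OF v] borel_measurable_rlip[OF w]
    have [measurable]: "v \<in> borel_measurable borel" "w \<in> borel_measurable borel"
      using v w by (auto intro: borel_measurable_continuous_onI lipschitz_fun_continuous)
    define z where "z = (\<lambda>x. 1/2 * v x + 1/2 * w x)"
    have z: "lipschitz_fun z"
      unfolding z_def by (intro lipschitz_fun_add lipschitz_fun_cmult v w)
    have Nz: "(\<integral>\<^sup>+x. ennreal (\<bar>z x - u x\<bar> powr p) \<partial>m) \<le> ennreal d"
    proof -
      have "(\<integral>\<^sup>+x. ennreal (\<bar>z x - u x\<bar> powr p) \<partial>m)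
          \<le> (\<integral>\<^sup>+x. ennreal (\<bar>v x - u x\<bar> powr p) + ennreal (\<bar>w x - u x\<bar> powr p) \<partial>m)"
      proof (rule nn_integral_mono)
        fix x
        have "\<bar>z x - u x\<bar> \<le> max \<bar>v x - u x\<bar> \<bar>w x - u x\<bar>"
          by (simp add: z_def max_def abs_if)
        then have "\<bar>z x - u x\<bar> powr p \<le> (max \<bar>v x - u x\<bar> \<bar>w x - u x\<bar>) powr p"
          using p by (intro powr_mono2) auto
        also have "\<dots> \<le> \<bar>v x - u x\<bar> powr p + \<bar>w x - u x\<bar> powr p"
          by (simp add: max_def)
        finally have "ennreal (\<bar>z x - u x\<bar> powr p) \<le> ennreal (\<bar>v x - u x\<bar> powr p + \<bar>w x - u x\<bar> powr p)"
          by (rule ennreal_leI)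
        then show "ennreal (\<bar>z x - u x\<bar> powr p) \<le> ennreal (\<bar>v x - u x\<bar> powr p) + ennreal (\<bar>w x - u x\<bar> powr p)"
          by simp
      qed
      also have "\<dots> = (\<integral>\<^sup>+x. ennreal (\<bar>v x - u x\<bar> powr p) \<partial>m) + (\<integral>\<^sup>+x. ennreal (\<bar>w x - u x\<bar> powr p) \<partial>m)"
        by (rule nn_integral_add) measurable
      also have "\<dots> \<le> ennreal \<delta> + ennreal \<delta>"
        using Nv Nw by (rule add_mono)
      also have "\<dots> = ennreal (2 * \<delta>)"
        using \<delta> by (subst ennreal_plus[symmetric]) auto
      also have "\<dots> \<le> ennreal d" using \<delta> by (intro ennreal_leI)
      finally show ?thesis .
    qed
    define a b where "a = rlip v" and "b = rlip w"
    have ab: "lip v x = ennreal (a x)" "lip w x = ennreal (b x)" "0 \<le> a x" "0 \<le> b x" for x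
      by (auto simp: a_def b_def ennreal_rlip v w)
    have [measurable]: "a \<in> borel_measurable borel" "b \<in> borel_measurable borel" by (auto simp: a_def b_def)
    have lipz: "lip z x \<le> ennreal ((a x + b x) / 2)" for x
    proof -
      have "lip z x \<le> lip (\<lambda>x. 1/2 * v x) x + lip (\<lambda>x. 1/2 * w x) x"
        unfolding z_def by (rule lip_add_le)
      also have "\<dots> \<le> ennreal (1/2) * lip v x + ennreal (1/2) * lip w x"
      proof (intro add_mono lip_mono_increment always_eventually allI)
        have half: "\<bar>1/2 * s - 1/2 * t\<bar> \<le> 1/2 * \<bar>s - t\<bar>" for s t :: real
          by (simp add: abs_if)
        show "\<bar>1/2 * v y - 1/2 * v x\<bar> \<le> 1/2 * \<bar>v y - v x\<bar>" "\<bar>1/2 * w y - 1/2 * w x\<bar> \<le> 1/2 * \<bar>w y - w x\<bar>" for y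
          by (rule half)+
      qed auto
      also have "\<dots> = ennreal (1/2 * a x + 1/2 * b x)"
        unfolding ab using ab by (simp only: ennreal_mult[symmetric] ennreal_plus[symmetric] zero_le_divide_1_iff zero_le_numeral mult_nonneg_nonneg)
      finally show ?thesis by (simp add: add_divide_distrib)
    qed
    define H where "H = (\<integral>\<^sup>+x. ennreal (((a x + b x) / 2) powr p) \<partial>m)"
    define D where "D = (\<integral>\<^sup>+x. ennreal (\<bar>a x - b x\<bar> powr p) \<partial>m)"
    define A where "A = (\<integral>\<^sup>+x. ennreal (a x powr p) \<partial>m)"
    define B where "B = (\<integral>\<^sup>+x. ennreal (b x powr p) \<partial>m)"
    have AB: "A \<le> ennreal (E + \<delta>)" "B \<le> ennreal (E + \<delta>)"
      using Av Aw by (auto simp: A_def B_def ab epowr_ennreal)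
    have EH: "ennreal E \<le> H + ennreal \<kappa>"
    proof -
      have "ennreal E \<le> (\<integral>\<^sup>+x. epowr (lip z x) p \<partial>m) + ennreal \<kappa>"
        by (rule d(2)[OF z Nz])
      also have "(\<integral>\<^sup>+x. epowr (lip z x) p \<partial>m) \<le> (\<integral>\<^sup>+x. epowr (ennreal ((a x + b x) / 2)) p \<partial>m)"
        using p by (intro nn_integral_mono epowr_mono lipz) auto
      also have "\<dots> = H" unfolding H_def by (intro nn_integral_cong epowr_ennreal) (simp add: ab)
      finally show ?thesis by (simp add: add_right_mono)
    qed
    have main: "D + ennreal C * H \<le> ennreal \<epsilon> * (A + B) + ennreal (C / 2) * (A + B)"
    proof -
      have "D + ennreal C * H = (\<integral>\<^sup>+x. ennreal (\<bar>a x - b x\<bar> powr p) + ennreal C * ennreal (((a x + b x) / 2) powr p) \<partial>m)"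
        unfolding D_def H_def by (simp add: nn_integral_add nn_integral_cmult)
      also have "\<dots> \<le> (\<integral>\<^sup>+x. ennreal \<epsilon> * (ennreal (a x powr p) + ennreal (b x powr p))
          + ennreal (C / 2) * (ennreal (a x powr p) + ennreal (b x powr p)) \<partial>m)"
      proof (rule nn_integral_mono)
        fix x
        have "ennreal (\<bar>a x - b x\<bar> powr p) + ennreal C * ennreal (((a x + b x) / 2) powr p)
          = ennreal (\<bar>a x - b x\<bar> powr p + C * ((a x + b x) / 2) powr p)"
          using C(1) by (simp add: ennreal_mult)
        also have "\<dots> \<le> ennreal (\<epsilon> * (a x powr p + b x powr p) + C / 2 * (a x powr p + b x powr p))"
          using C(2)[OF ab(3) ab(4), of x x] by (intro ennreal_leI) simp
        also have "\<dots> = ennreal \<epsilon> * (ennreal (a x powr p) + ennreal (b x powr p))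
          + ennreal (C / 2) * (ennreal (a x powr p) + ennreal (b x powr p))"
          using C(1) \<epsilon>(1) by (simp only: ennreal_mult_add[of \<epsilon>] ennreal_mult_add[of "C / 2"] powr_ge_zero
              divide_nonneg_nonneg less_imp_le zero_le_numeral ennreal_plus mult_nonneg_nonneg add_nonneg_nonneg)
        finally show "ennreal (\<bar>a x - b x\<bar> powr p) + ennreal C * ennreal (((a x + b x) / 2) powr p)
           \<le> ennreal \<epsilon> * (ennreal (a x powr p) + ennreal (b x powr p))
          + ennreal (C / 2) * (ennreal (a x powr p) + ennreal (b x powr p))" .
      qed
      also have "\<dots> = ennreal \<epsilon> * (A + B) + ennreal (C / 2) * (A + B)"
        unfolding A_def B_def by (simp add: nn_integral_add nn_integral_cmult)
      finally show ?thesis .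
    qed
    obtain A' where A': "A = ennreal A'" "0 \<le> A'" "A' \<le> E + \<delta>"
      using AB(1) fin \<delta> by (cases A) (auto simp: top_unique ennreal_le_iff simp del: ennreal_plus)
    obtain B' where B': "B = ennreal B'" "0 \<le> B'" "B' \<le> E + \<delta>"
      using AB(2) fin \<delta> by (cases B) (auto simp: top_unique ennreal_le_iff simp del: ennreal_plus)
    have rhs: "ennreal \<epsilon> * (A + B) + ennreal (C / 2) * (A + B) = ennreal (\<epsilon> * (A' + B') + C / 2 * (A' + B'))"
      using A' B' C(1) \<epsilon>(1) by (simp only: A'(1) B'(1) ennreal_mult_add[of \<epsilon>] ennreal_mult_add[of "C / 2"]
              divide_nonneg_nonneg less_imp_le zero_le_numeral ennreal_plus mult_nonneg_nonneg add_nonneg_nonneg)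
    have "H \<noteq> top"
      using main C(1) unfolding rhs by (auto simp: ennreal_mult_top top_unique)
    then obtain H' where H': "H = ennreal H'" "0 \<le> H'" by (cases H) auto
    have "D \<noteq> top"
      using main unfolding rhs by (auto simp: top_unique)
    then obtain D' where D': "D = ennreal D'" "0 \<le> D'" by (cases D) auto
    have 1: "D' + C * H' \<le> \<epsilon> * (A' + B') + C / 2 * (A' + B')"
      using main C(1) \<epsilon>(1) A' B' H' D' unfolding rhs
      by (simp add: ennreal_le_iff flip: ennreal_mult ennreal_plus)
    have 2: "E \<le> H' + \<kappa>"
      using EH H' \<kappa> by (simp add: ennreal_le_iff flip: ennreal_plus)
    have "C * E \<le> C * H' + C * \<kappa>"
      using mult_left_mono[OF 2, of C] C(1) by (simp add: distrib_left)
    moreover have "\<epsilon> * (A' + B') \<le> \<eta> / 2"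
      unfolding \<epsilon>(2)[symmetric] using A' B' \<delta> \<kappa> \<epsilon> by (intro mult_left_mono) auto
    moreover have "C / 2 * (A' + B') \<le> C * E + C * \<kappa>"
    proof -
      have "C / 2 * (A' + B') \<le> C / 2 * (2 * E + 2 * \<kappa>)"
        using A' B' \<delta> \<kappa> C by (intro mult_left_mono) auto
      then show ?thesis by (simp add: distrib_left)
    qed
    ultimately have "D' \<le> \<eta> / 2 + 2 * (C * \<kappa>)"
      using 1 by linarith
    also have "\<dots> \<le> \<eta>" using \<kappa>(3) by simp
    finally have "D \<le> ennreal \<eta>" using D' by (simp add: ennreal_leI)
    then show "(\<integral>\<^sup>+x. ennreal (\<bar>rlip v x - rlip w x\<bar> powr p) \<partial>m) \<le> ennreal \<eta>"
      by (simp add: D_def a_def b_def)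
  qed
qed

text \<open>The decay \<open>a ^ (4 * n)\<close> absorbs the weights of
  \<open>epowr_suminf_le\<close>. This supplies the finiteness that
  \<open>weak_upper_gradient_limit\<close> asks for.\<close>

lemma epowr_suminf_finite:
  assumes p: "0 < p" and a: "a = (1 / 2) powr p" and K: "0 \<le> K"
    and [measurable]: "\<And>n. f n \<in> borel_measurable M"
    and le: "\<And>n. (\<integral>\<^sup>+x. epowr (f n x) p \<partial>M) \<le> ennreal (K * a ^ (4 * n))"
  shows "(\<integral>\<^sup>+x. epowr (\<Sum>n. f n x) p \<partial>M) < \<infinity>"
proof -
  have a01: "0 < a" "a < 1"
    using p powr_less_mono2[of p "1/2" 1] by (auto simp: a)
  have "2 powr p * a = 1" unfolding a powr_mult[symmetric] by simp
  then have q: "2 powr (real (Suc n) * p) * (K * a ^ (4 * n)) = 2 powr p * K * (a ^ 3) ^ n" for n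
  proof -
    have "2 powr (real (Suc n) * p) = (2 powr p) ^ Suc n"
      by (simp add: powr_realpow[symmetric] powr_powr mult.commute[of p] del: power_Suc of_nat_Suc)
    moreover have "a ^ (4 * n) = a ^ n * (a ^ 3) ^ n"
      by (simp add: power_mult[symmetric] power_add[symmetric])
    moreover have "(2 powr p) ^ n * a ^ n = 1"
      using \<open>2 powr p * a = 1\<close> by (simp add: power_mult_distrib[symmetric])
    ultimately show ?thesis by simp
  qed
  have summ: "summable (\<lambda>n. 2 powr p * K * (a ^ 3) ^ n)"
    using a01 by (intro summable_mult summable_geometric) (auto simp: power_less_one_iff)
  have "(\<integral>\<^sup>+x. epowr (\<Sum>n. f n x) p \<partial>M) \<le> (\<integral>\<^sup>+x. (\<Sum>n. ennreal (2 powr (real (Suc n) * p)) * epowr (f n x) p) \<partial>M)"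
    by (intro nn_integral_mono epowr_suminf_le p)
  also have "\<dots> = (\<Sum>n. ennreal (2 powr (real (Suc n) * p)) * (\<integral>\<^sup>+x. epowr (f n x) p \<partial>M))"
    by (subst nn_integral_suminf) (auto simp: nn_integral_cmult)
  also have "\<dots> \<le> (\<Sum>n. ennreal (2 powr p * K * (a ^ 3) ^ n))"
  proof (intro suminf_le allI)
    fix n
    have "ennreal (2 powr (real (Suc n) * p)) * (\<integral>\<^sup>+x. epowr (f n x) p \<partial>M)
        \<le> ennreal (2 powr (real (Suc n) * p)) * ennreal (K * a ^ (4 * n))"
      by (intro mult_left_mono le) auto
    also have "\<dots> = ennreal (2 powr (real (Suc n) * p) * (K * a ^ (4 * n)))"
      using a01 K by (intro ennreal_mult[symmetric]) auto
    finally show "ennreal (2 powr (real (Suc n) * p)) * (\<integral>\<^sup>+x. epowr (f n x) p \<partial>M)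
       \<le> ennreal (2 powr p * K * (a ^ 3) ^ n)"
      by (simp only: q)
  qed auto
  also have "\<dots> = ennreal (\<Sum>n. 2 powr p * K * (a ^ 3) ^ n)"
    by (rule suminf_ennreal_eq[OF _ summable_sums[OF summ]]) (use a01 K in simp)
  also have "\<dots> < \<infinity>"
    by (simp only: infinity_ennreal_def ennreal_less_top)
  finally show ?thesis .
qed

text \<open>The almost minimizers are chosen so nearly optimal that their slopes form a
  geometrically fast Cauchy sequence. Strong convergence of the slopes does two things: Fuglede's
  lemma makes the limit a weak upper gradient, and the energies pass to the limit.\<close>

theorem cheeger_energy_attained:
  fixes u :: "'a::polish_space \<Rightarrow> real"
  assumes p: "1 < p" and m[measurable_cong]: "sets m = sets borel"
    and um: "u \<in> borel_measurable m" and fin: "cheeger_energy p m u < \<infinity>"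
  obtains w G where "\<And>n. lipschitz_fun (w n)" "G \<in> borel_measurable borel" "\<And>x. 0 \<le> G x"
    "Lp_tendsto p m w u" "Lp_tendsto p m (\<lambda>n. rlip (w n)) G"
    "weak_upper_gradient p m u (\<lambda>x. ennreal (G x))"
    "(\<integral>\<^sup>+x. ennreal (G x powr p) \<partial>m) = cheeger_energy p m u"
proof -
  have p0: "0 < p" using p by simp
  have u[measurable]: "u \<in> borel_measurable borel"
    using um measurable_cong_sets[OF m refl] by blast
  obtain E where E: "cheeger_energy p m u = ennreal E" "0 \<le> E"
    using fin by (cases "cheeger_energy p m u") auto
  define a where "a = (1 / 2) powr p"
  have a01: "0 < a" "a < 1"
    using p0 powr_less_mono2[of p "1/2" 1] by (auto simp: a_def)
  define ok where "ok \<delta> n \<longleftrightarrow> 0 < \<delta> \<and> (\<forall>v w. lipschitz_fun v \<longrightarrow> lipschitz_fun w \<longrightarrow>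
    (\<integral>\<^sup>+x. ennreal (\<bar>v x - u x\<bar> powr p) \<partial>m) \<le> ennreal \<delta> \<longrightarrow>
    (\<integral>\<^sup>+x. ennreal (\<bar>w x - u x\<bar> powr p) \<partial>m) \<le> ennreal \<delta> \<longrightarrow>
    (\<integral>\<^sup>+x. epowr (lip v x) p \<partial>m) \<le> ennreal (E + \<delta>) \<longrightarrow>
    (\<integral>\<^sup>+x. epowr (lip w x) p \<partial>m) \<le> ennreal (E + \<delta>) \<longrightarrow>
    (\<integral>\<^sup>+x. ennreal (\<bar>rlip v x - rlip w x\<bar> powr p) \<partial>m) \<le> ennreal (a ^ (4 * Suc n)))" for \<delta> n
  have "\<exists>\<delta>. ok \<delta> n" for n
  proof -
    have "0 < a ^ (4 * Suc n)" using a01 by simp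
    then show ?thesis
    proof (rule almost_minimizers_close[OF p m um E])
      fix \<delta> :: real
      assume 1: "0 < \<delta>" and 2: "\<And>v w. lipschitz_fun v \<Longrightarrow> lipschitz_fun w \<Longrightarrow>
        (\<integral>\<^sup>+x. ennreal (\<bar>v x - u x\<bar> powr p) \<partial>m) \<le> ennreal \<delta> \<Longrightarrow>
        (\<integral>\<^sup>+x. ennreal (\<bar>w x - u x\<bar> powr p) \<partial>m) \<le> ennreal \<delta> \<Longrightarrow>
        (\<integral>\<^sup>+x. epowr (lip v x) p \<partial>m) \<le> ennreal (E + \<delta>) \<Longrightarrow>
        (\<integral>\<^sup>+x. epowr (lip w x) p \<partial>m) \<le> ennreal (E + \<delta>) \<Longrightarrow>
        (\<integral>\<^sup>+x. ennreal (\<bar>rlip v x - rlip w x\<bar> powr p) \<partial>m) \<le> ennreal (a ^ (4 * Suc n))"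
      show "\<exists>\<delta>. ok \<delta> n"
        unfolding ok_def by (intro exI[of _ \<delta>] conjI allI impI 1 2)
    qed
  qed
  then have "\<exists>\<delta>. \<forall>n. ok (\<delta> n) n" by (intro choice allI)
  then obtain \<delta> where \<delta>: "\<And>n. ok (\<delta> n) n" by blast
  \<comment> \<open>A running minimum, so that \<open>w n\<close> and \<open>w (Suc n)\<close> both
    meet the tolerance of stage n and \<open>ok\<close> applies to the pair; the second entry forces
    the rate of convergence in Lp.\<close>
  define M where "M n = Min ((\<lambda>i. min (\<delta> i) (a ^ (4 * Suc i))) ` {..n})" for n
  have M0: "0 < M n" for n
    using \<delta> a01 unfolding M_def ok_def by (subst Min_gr_iff) auto
  have M1: "M n \<le> \<delta> n" "M n \<le> a ^ (4 * Suc n)" for n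
  proof -
    have "M n \<le> min (\<delta> n) (a ^ (4 * Suc n))"
      unfolding M_def by (rule Min_le) blast+
    then show "M n \<le> \<delta> n" "M n \<le> a ^ (4 * Suc n)" by simp_all
  qed
  have M2: "M (Suc n) \<le> M n" for n
    unfolding M_def by (rule Min_antimono) auto
  define P where "P n v \<longleftrightarrow> lipschitz_fun v \<and> (\<integral>\<^sup>+x. ennreal (\<bar>v x - u x\<bar> powr p) \<partial>m) \<le> ennreal (M n)
    \<and> (\<integral>\<^sup>+x. epowr (lip v x) p \<partial>m) \<le> ennreal (E + M n)" for n v
  have "\<exists>v. P n v" for n
  proof -
    have "cheeger_energy p m u < ennreal (E + M n)"
      unfolding E(1) using E(2) M0[of n] by (simp add: ennreal_less_iff del: ennreal_plus)
    then obtain v where "lipschitz_fun v" "(\<integral>\<^sup>+x. ennreal (\<bar>v x - u x\<bar> powr p) \<partial>m) \<le> ennreal (M n)"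
      "(\<integral>\<^sup>+x. epowr (lip v x) p \<partial>m) < ennreal (E + M n)"
      by (rule cheeger_energy_approx[OF _ M0[of n]])
    then show ?thesis
      unfolding P_def by (intro exI[of _ v] conjI) (assumption | rule less_imp_le)+
  qed
  then have "\<exists>w. \<forall>n. P n (w n)" by (intro choice allI)
  then obtain w where w: "\<And>n. P n (w n)" by blast
  have lw: "lipschitz_fun (w n)" for n using w[of n] by (simp add: P_def)
  have Ma: "M n \<le> a ^ (4 * n)" for n
  proof (rule order_trans[OF M1(2)])
    show "a ^ (4 * Suc n) \<le> a ^ (4 * n)"
      using a01 by (intro power_decreasing) simp_all
  qed
  have Nw: "(\<integral>\<^sup>+x. ennreal (\<bar>w n x - u x\<bar> powr p) \<partial>m) \<le> ennreal (a ^ (4 * n))" for n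
  proof (rule order_trans)
    show "(\<integral>\<^sup>+x. ennreal (\<bar>w n x - u x\<bar> powr p) \<partial>m) \<le> ennreal (M n)"
      using w[of n] by (simp only: P_def)
    show "ennreal (M n) \<le> ennreal (a ^ (4 * n))"
      by (intro ennreal_leI Ma)
  qed
  have Aw: "(\<integral>\<^sup>+x. epowr (lip (w n) x) p \<partial>m) \<le> ennreal (E + M n)" for n
    using w[of n] by (simp add: P_def)
  have close: "(\<integral>\<^sup>+x. ennreal (\<bar>rlip (w n) x - rlip (w (Suc n)) x\<bar> powr p) \<partial>m) \<le> ennreal (a ^ (4 * Suc n))" for n
  proof -
    have le: "M n \<le> \<delta> n" "M (Suc n) \<le> \<delta> n"
      using M1(1)[of n] M2[of n] by auto
    note R = \<delta>[of n, unfolded ok_def, THEN conjunct2, rule_format]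
    have W: "lipschitz_fun (w k)" "(\<integral>\<^sup>+x. ennreal (\<bar>w k x - u x\<bar> powr p) \<partial>m) \<le> ennreal (M k)"
      "(\<integral>\<^sup>+x. epowr (lip (w k) x) p \<partial>m) \<le> ennreal (E + M k)" for k
      using w[of k] by (simp_all only: P_def)
    have mono: "ennreal (M n) \<le> ennreal (\<delta> n)" "ennreal (M (Suc n)) \<le> ennreal (\<delta> n)"
      "ennreal (E + M n) \<le> ennreal (E + \<delta> n)" "ennreal (E + M (Suc n)) \<le> ennreal (E + \<delta> n)"
      using le by (auto intro!: ennreal_leI simp del: ennreal_plus)
    show ?thesis
      by (rule R[OF W(1) W(1) order_trans[OF W(2) mono(1)] order_trans[OF W(2) mono(2)]
            order_trans[OF W(3) mono(3)] order_trans[OF W(3) mono(4)]])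
  qed
  have wm[measurable]: "w n \<in> borel_measurable borel" for n
    by (intro borel_measurable_continuous_onI lipschitz_fun_continuous lw)
  have rm[measurable]: "rlip (w n) \<in> borel_measurable borel" for n
    by (intro borel_measurable_rlip lw)
  have rm': "rlip (w n) \<in> borel_measurable m" for n by measurable
  obtain S where S: "S \<ge> 0"
    "\<forall>n. (\<integral>\<^sup>+x. ennreal (\<bar>rlip (w n) x - lim (\<lambda>n. rlip (w n) x)\<bar> powr p) \<partial>m) \<le> ennreal (a ^ (4 * n) * S)"
    by (rule Lp_fast_Cauchy[where l = "\<lambda>n. rlip (w n)", OF p0 a_def rm' close]) (rule that, assumption, rule allI)
  \<comment> \<open>\<open>lim\<close> is unspecified where the slopes diverge. The absolute value
    makes \<open>G\<close> nonnegative everywhere and brings it no farther from the nonnegative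
    slopes.\<close>
  define G where "G x = \<bar>lim (\<lambda>n. rlip (w n) x)\<bar>" for x
  have Gm[measurable]: "G \<in> borel_measurable borel" unfolding G_def by measurable
  define d where "d n x = ennreal \<bar>rlip (w n) x - G x\<bar>" for n x
  have dm[measurable]: "d n \<in> borel_measurable borel" for n unfolding d_def by measurable
  have dS: "(\<integral>\<^sup>+x. epowr (d n x) p \<partial>m) \<le> ennreal (a ^ (4 * n) * S)" for n
  proof -
    have "(\<integral>\<^sup>+x. epowr (d n x) p \<partial>m) \<le> (\<integral>\<^sup>+x. ennreal (\<bar>rlip (w n) x - lim (\<lambda>n. rlip (w n) x)\<bar> powr p) \<partial>m)"
    proof (rule nn_integral_mono)
      fix x
      have "\<bar>rlip (w n) x - G x\<bar> \<le> \<bar>rlip (w n) x - lim (\<lambda>n. rlip (w n) x)\<bar>"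
        using rlip_nonneg[of "w n" x] unfolding G_def by linarith
      then show "epowr (d n x) p \<le> ennreal (\<bar>rlip (w n) x - lim (\<lambda>n. rlip (w n) x)\<bar> powr p)"
        using p0 unfolding d_def by (simp add: epowr_ennreal ennreal_leI powr_mono2)
    qed
    also note S(2)[rule_format, of n]
    finally show ?thesis .
  qed
  have a4: "(\<lambda>n. a ^ (4 * n)) \<longlonglongrightarrow> 0"
    unfolding power_mult using a01 by (intro LIMSEQ_power_zero) (simp add: power_less_one_iff)
  have to0: "f \<longlonglongrightarrow> 0" if f: "\<And>n. f n \<le> ennreal (a ^ (4 * n) * K)" for f :: "nat \<Rightarrow> ennreal" and K
  proof (rule tendsto_sandwich[where f = "\<lambda>_. 0" and h = "\<lambda>n. ennreal (a ^ (4 * n) * K)"])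
    have "(\<lambda>n. ennreal (a ^ (4 * n) * K)) \<longlonglongrightarrow> ennreal (0 * K)"
      by (intro tendsto_ennrealI tendsto_mult a4 tendsto_const)
    then show "(\<lambda>n. ennreal (a ^ (4 * n) * K)) \<longlonglongrightarrow> 0" by simp
    show "\<forall>\<^sub>F n in sequentially. f n \<le> ennreal (a ^ (4 * n) * K)"
      by (intro always_eventually allI f)
  qed (simp_all only: zero_le eventually_True tendsto_const)
  have w_u: "Lp_tendsto p m w u"
    unfolding Lp_tendsto_def by (rule to0[where K = 1]) (simp only: mult_1_right Nw)
  have d0: "(\<lambda>n. \<integral>\<^sup>+x. epowr (d n x) p \<partial>m) \<longlonglongrightarrow> 0"
    by (rule to0[where K = S, OF dS])
  then have r_G: "Lp_tendsto p m (\<lambda>n. rlip (w n)) G"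
    unfolding Lp_tendsto_def d_def by (simp add: epowr_ennreal)
  have lip_eq: "lip (w n) x = ennreal (rlip (w n) x)" for n x
    by (rule ennreal_rlip[OF lw, symmetric])
  have le1: "lip (w n) x \<le> ennreal (G x) + d n x" for n x
  proof -
    have "rlip (w n) x \<le> G x + \<bar>rlip (w n) x - G x\<bar>" by linarith
    then have "ennreal (rlip (w n) x) \<le> ennreal (G x + \<bar>rlip (w n) x - G x\<bar>)" by (rule ennreal_leI)
    also have "\<dots> = ennreal (G x) + ennreal \<bar>rlip (w n) x - G x\<bar>"
      by (intro ennreal_plus) (simp_all add: G_def)
    finally show ?thesis unfolding lip_eq d_def .
  qed
  have le2: "ennreal (G x) \<le> lip (w n) x + d n x" for n x
  proof -
    have "G x \<le> rlip (w n) x + \<bar>rlip (w n) x - G x\<bar>" by linarith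
    then have "ennreal (G x) \<le> ennreal (rlip (w n) x + \<bar>rlip (w n) x - G x\<bar>)" by (rule ennreal_leI)
    also have "\<dots> = ennreal (rlip (w n) x) + ennreal \<bar>rlip (w n) x - G x\<bar>"
      by (intro ennreal_plus) simp_all
    finally show ?thesis unfolding lip_eq d_def .
  qed
  have weak: "weak_upper_gradient p m u (\<lambda>x. ennreal (G x))"
  proof (rule weak_upper_gradient_limit[where w = w and d = d, OF p0 m lw _ dm u le1])
    show "(\<integral>\<^sup>+x. epowr (\<Sum>n. ennreal \<bar>w n x - u x\<bar> + d n x) p \<partial>m) < \<infinity>"
    proof (rule epowr_suminf_finite[OF p0 a_def])
      show "(\<integral>\<^sup>+x. epowr (ennreal \<bar>w n x - u x\<bar> + d n x) p \<partial>m) \<le> ennreal (2 powr p * (1 + S) * a ^ (4 * n))" for n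
      proof -
        have "(\<integral>\<^sup>+x. epowr (ennreal \<bar>w n x - u x\<bar> + d n x) p \<partial>m)
            \<le> (\<integral>\<^sup>+x. ennreal (2 powr p) * ennreal (\<bar>w n x - u x\<bar> powr p) + ennreal (2 powr p) * epowr (d n x) p \<partial>m)"
        proof (rule nn_integral_mono)
          fix x
          show "epowr (ennreal \<bar>w n x - u x\<bar> + d n x) p
              \<le> ennreal (2 powr p) * ennreal (\<bar>w n x - u x\<bar> powr p) + ennreal (2 powr p) * epowr (d n x) p"
            using epowr_add_le[OF p0 zero_less_one, of "ennreal \<bar>w n x - u x\<bar>" "d n x"]
            by (simp add: epowr_ennreal)
        qed
        also have "\<dots> = ennreal (2 powr p) * (\<integral>\<^sup>+x. ennreal (\<bar>w n x - u x\<bar> powr p) \<partial>m)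
            + ennreal (2 powr p) * (\<integral>\<^sup>+x. epowr (d n x) p \<partial>m)"
          by (subst nn_integral_add) (auto simp: nn_integral_cmult)
        also have "\<dots> \<le> ennreal (2 powr p) * ennreal (a ^ (4 * n)) + ennreal (2 powr p) * ennreal (a ^ (4 * n) * S)"
          by (intro add_mono mult_left_mono Nw dS) auto
        also have "\<dots> = ennreal (2 powr p * a ^ (4 * n) + 2 powr p * (a ^ (4 * n) * S))"
          using a01 S(1) by (simp add: ennreal_mult)
        also have "2 powr p * a ^ (4 * n) + 2 powr p * (a ^ (4 * n) * S) = 2 powr p * (1 + S) * a ^ (4 * n)"
          by (simp add: algebra_simps)
        finally show ?thesis .
      qed
      show "0 \<le> 2 powr p * (1 + S)" using S(1) by simp
    qed measurable
  qed measurable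
  have en: "epowr (ennreal (G x)) p = ennreal (G x powr p)" for x
    by (rule epowr_ennreal) (simp add: G_def)
  have M_0: "M \<longlonglongrightarrow> 0"
  proof (rule tendsto_sandwich[where f = "\<lambda>_. 0" and h = "\<lambda>n. a ^ (4 * n)"])
    show "\<forall>\<^sub>F n in sequentially. M n \<le> a ^ (4 * n)" by (intro always_eventually allI Ma)
    show "\<forall>\<^sub>F n in sequentially. 0 \<le> M n" by (intro always_eventually allI less_imp_le M0)
  qed (rule tendsto_const, rule a4)
  have upper: "(\<integral>\<^sup>+x. ennreal (G x powr p) \<partial>m) \<le> ennreal E"
  proof (rule le_of_approx_powr[OF p0 _ _ d0])
    have "(\<lambda>n. ennreal (E + M n)) \<longlonglongrightarrow> ennreal (E + 0)"
      by (intro tendsto_ennrealI tendsto_add tendsto_const M_0)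
    then show "(\<lambda>n. ennreal (E + M n)) \<longlonglongrightarrow> ennreal E" by (simp only: add_0_right)
    fix n and \<tau> :: real assume \<tau>: "0 < \<tau>"
    have "(\<integral>\<^sup>+x. ennreal (G x powr p) \<partial>m) \<le> (\<integral>\<^sup>+x. ennreal ((1 + \<tau>) powr p) * epowr (lip (w n) x) p
       + ennreal ((1 + 1 / \<tau>) powr p) * epowr (d n x) p \<partial>m)"
    proof (rule nn_integral_mono)
      fix x
      have "ennreal (G x powr p) \<le> epowr (lip (w n) x + d n x) p"
        unfolding en[symmetric] using p0 by (intro epowr_mono le2) auto
      also note epowr_add_le[OF p0 \<tau>]
      finally show "ennreal (G x powr p) \<le> ennreal ((1 + \<tau>) powr p) * epowr (lip (w n) x) p
       + ennreal ((1 + 1 / \<tau>) powr p) * epowr (d n x) p" .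
    qed
    also have "\<dots> = ennreal ((1 + \<tau>) powr p) * (\<integral>\<^sup>+x. epowr (lip (w n) x) p \<partial>m)
       + ennreal ((1 + 1 / \<tau>) powr p) * (\<integral>\<^sup>+x. epowr (d n x) p \<partial>m)"
      unfolding lip_eq by (subst nn_integral_add) (auto simp: nn_integral_cmult)
    also have "\<dots> \<le> ennreal ((1 + \<tau>) powr p) * ennreal (E + M n)
       + ennreal ((1 + 1 / \<tau>) powr p) * (\<integral>\<^sup>+x. epowr (d n x) p \<partial>m)"
      by (intro add_mono mult_left_mono Aw) auto
    finally show "(\<integral>\<^sup>+x. ennreal (G x powr p) \<partial>m) \<le> ennreal ((1 + \<tau>) powr p) * ennreal (E + M n)
       + ennreal ((1 + 1 / \<tau>) powr p) * (\<integral>\<^sup>+x. epowr (d n x) p \<partial>m)" .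
  qed
  \<comment> \<open>The functions \<open>w n\<close> compete in the infimum that defines the Cheeger
    energy, and the limit inferior of their energies is at most the energy of
    \<open>G\<close>.\<close>
  have lower: "ennreal E \<le> (\<integral>\<^sup>+x. ennreal (G x powr p) \<partial>m)"
  proof (rule le_of_approx_powr[OF p0 _ tendsto_const tendsto_const])
    fix n :: nat and \<tau> :: real assume \<tau>: "0 < \<tau>"
    have "(\<integral>\<^sup>+x. epowr (lip (w n) x) p \<partial>m) \<le> ennreal ((1 + \<tau>) powr p) * (\<integral>\<^sup>+x. ennreal (G x powr p) \<partial>m)
       + ennreal ((1 + 1 / \<tau>) powr p) * (\<integral>\<^sup>+x. epowr (d n x) p \<partial>m)" for n
    proof -
      have "(\<integral>\<^sup>+x. epowr (lip (w n) x) p \<partial>m) \<le> (\<integral>\<^sup>+x. ennreal ((1 + \<tau>) powr p) * ennreal (G x powr p)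
         + ennreal ((1 + 1 / \<tau>) powr p) * epowr (d n x) p \<partial>m)"
      proof (rule nn_integral_mono)
        fix x
        have "epowr (lip (w n) x) p \<le> epowr (ennreal (G x) + d n x) p"
          using p0 by (intro epowr_mono le1) auto
        also note epowr_add_le[OF p0 \<tau>]
        finally show "epowr (lip (w n) x) p \<le> ennreal ((1 + \<tau>) powr p) * ennreal (G x powr p)
         + ennreal ((1 + 1 / \<tau>) powr p) * epowr (d n x) p" unfolding en .
      qed
      also have "\<dots> = ennreal ((1 + \<tau>) powr p) * (\<integral>\<^sup>+x. ennreal (G x powr p) \<partial>m)
         + ennreal ((1 + 1 / \<tau>) powr p) * (\<integral>\<^sup>+x. epowr (d n x) p \<partial>m)"
        by (subst nn_integral_add) (auto simp: nn_integral_cmult)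
      finally show ?thesis .
    qed
    then have "liminf (\<lambda>n. \<integral>\<^sup>+x. epowr (lip (w n) x) p \<partial>m) \<le>
       liminf (\<lambda>n. ennreal ((1 + \<tau>) powr p) * (\<integral>\<^sup>+x. ennreal (G x powr p) \<partial>m)
       + ennreal ((1 + 1 / \<tau>) powr p) * (\<integral>\<^sup>+x. epowr (d n x) p \<partial>m))"
      by (intro Liminf_mono always_eventually allI)
    also have "\<dots> = ennreal ((1 + \<tau>) powr p) * (\<integral>\<^sup>+x. ennreal (G x powr p) \<partial>m) + ennreal ((1 + 1 / \<tau>) powr p) * 0"
      by (intro lim_imp_Liminf tendsto_add tendsto_const ennreal_tendsto_cmult d0) auto
    finally show "ennreal E \<le> ennreal ((1 + \<tau>) powr p) * (\<integral>\<^sup>+x. ennreal (G x powr p) \<partial>m) + ennreal ((1 + 1 / \<tau>) powr p) * 0"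
      using cheeger_energy_le_liminf[OF lw w_u] unfolding E(1) by (rule order_trans[rotated])
  qed
  show ?thesis
  proof (rule that[OF lw Gm _ w_u r_G weak])
    show "(\<integral>\<^sup>+x. ennreal (G x powr p) \<partial>m) = cheeger_energy p m u"
      unfolding E(1) using upper lower by (rule antisym)
    show "0 \<le> G x" for x by (simp only: G_def abs_ge_zero)
  qed
qed

section \<open>Meyers--Serrin approximation\<close>

lemma AE_le_of_nn_integral_eq:
  fixes f g :: "'a \<Rightarrow> ennreal"
  assumes [measurable]: "f \<in> borel_measurable M" "g \<in> borel_measurable M"
    and le: "AE x in M. f x \<le> g x" and eq: "(\<integral>\<^sup>+x. g x \<partial>M) = (\<integral>\<^sup>+x. f x \<partial>M)"
    and fin: "(\<integral>\<^sup>+x. f x \<partial>M) < \<infinity>"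
  shows "AE x in M. g x \<le> f x"
proof -
  have "(\<integral>\<^sup>+x. g x - f x \<partial>M) = (\<integral>\<^sup>+x. g x \<partial>M) - (\<integral>\<^sup>+x. f x \<partial>M)"
    by (rule nn_integral_diff) (use le fin in auto)
  also have "\<dots> = 0" using eq fin by simp
  finally have "AE x in M. g x - f x = 0"
    by (subst (asm) nn_integral_0_iff_AE) auto
  moreover have "AE x in M. f x \<noteq> \<infinity>"
    by (rule nn_integral_PInf_AE) (use fin in auto)
  ultimately show ?thesis
    by eventually_elim (simp add: ennreal_minus_eq_0 diff_eq_0_iff_ennreal less_top)
qed

text \<open>The function \<open>G\<close> that attains the Cheeger energy is a weak upper gradient,
  so h is at most \<open>G\<close> almost everywhere, and by the last clause of
  \<open>minimal_wug\<close> both have the same finite energy. Hence they agree almost everywhere,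
  and the slopes of the optimal sequence converge to h itself.\<close>

lemma minimal_wug_lipschitz_approx:
  fixes f :: "'a::polish_space \<Rightarrow> real"
  assumes p: "1 < p" and m[measurable_cong]: "sets m = sets borel"
    and f: "in_W1p p m f" and h: "minimal_wug p m f h" and e: "0 < \<epsilon>"
  obtains v e where "lipschitz_fun v" "e \<in> borel_measurable borel" "\<And>x. 0 \<le> e x"
    "(\<integral>\<^sup>+x. ennreal (\<bar>v x - f x\<bar> powr p) \<partial>m) \<le> ennreal \<epsilon>"
    "(\<integral>\<^sup>+x. ennreal (e x powr p) \<partial>m) \<le> ennreal \<epsilon>"
    "AE x in m. lip v x \<le> h x + ennreal (e x)"
proof -
  have fm: "f \<in> borel_measurable m" and fin: "cheeger_energy p m f < \<infinity>"
    using f by (auto simp: in_W1p_def in_Lp_def)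
  have p0: "0 < p" using p by simp
  obtain w G where lw: "\<And>n. lipschitz_fun (w n)" and G[measurable]: "G \<in> borel_measurable borel"
    and G0: "\<And>x. 0 \<le> G x" and w_u: "Lp_tendsto p m w f" and r_G: "Lp_tendsto p m (\<lambda>n. rlip (w n)) G"
    and weak: "weak_upper_gradient p m f (\<lambda>x. ennreal (G x))"
    and energy: "(\<integral>\<^sup>+x. ennreal (G x powr p) \<partial>m) = cheeger_energy p m f"
    by (rule cheeger_energy_attained[OF p m fm fin]) (rule that, (assumption | erule meta_spec)+)
  have hm[measurable]: "h \<in> borel_measurable borel"
    using h by (auto simp: minimal_wug_def weak_upper_gradient_def)
  have en: "epowr (ennreal (G x)) p = ennreal (G x powr p)" for x
    by (rule epowr_ennreal[OF G0])
  have hG: "AE x in m. h x \<le> ennreal (G x)"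
    using h weak energy fin unfolding minimal_wug_def by (simp add: en)
  have "AE x in m. epowr (ennreal (G x)) p \<le> epowr (h x) p"
  proof (rule AE_le_of_nn_integral_eq)
    show "AE x in m. epowr (h x) p \<le> epowr (ennreal (G x)) p"
      using hG by eventually_elim (use p0 in \<open>auto intro: epowr_mono\<close>)
    show "(\<integral>\<^sup>+x. epowr (ennreal (G x)) p \<partial>m) = (\<integral>\<^sup>+x. epowr (h x) p \<partial>m)"
      using energy h unfolding minimal_wug_def by (simp add: en)
    show "(\<integral>\<^sup>+x. epowr (h x) p \<partial>m) < \<infinity>"
      using h unfolding minimal_wug_def by blast
  qed measurable
  then have Gh: "AE x in m. ennreal (G x) \<le> h x"
  proof eventually_elim
    case (elim x)
    then have "epowr (epowr (ennreal (G x)) p) (1 / p) \<le> epowr (epowr (h x) p) (1 / p)"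
      using p0 by (intro epowr_mono[of "1 / p"]) auto
    then show ?case by (simp only: epowr_inverse[OF p0])
  qed
  have "\<forall>\<^sub>F n in sequentially. (\<integral>\<^sup>+x. ennreal (\<bar>w n x - f x\<bar> powr p) \<partial>m) < ennreal \<epsilon>"
    "\<forall>\<^sub>F n in sequentially. (\<integral>\<^sup>+x. ennreal (\<bar>rlip (w n) x - G x\<bar> powr p) \<partial>m) < ennreal \<epsilon>"
    using w_u r_G e unfolding Lp_tendsto_def by (auto intro!: order_tendstoD(2))
  then have "\<forall>\<^sub>F n in sequentially. (\<integral>\<^sup>+x. ennreal (\<bar>w n x - f x\<bar> powr p) \<partial>m) < ennreal \<epsilon> \<and>
    (\<integral>\<^sup>+x. ennreal (\<bar>rlip (w n) x - G x\<bar> powr p) \<partial>m) < ennreal \<epsilon>"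
    by (rule eventually_conj)
  then obtain n where n: "(\<integral>\<^sup>+x. ennreal (\<bar>w n x - f x\<bar> powr p) \<partial>m) < ennreal \<epsilon>"
    "(\<integral>\<^sup>+x. ennreal (\<bar>rlip (w n) x - G x\<bar> powr p) \<partial>m) < ennreal \<epsilon>"
    using eventually_happens'[OF sequentially_bot] by blast
  show ?thesis
  proof (rule that[of "w n" "\<lambda>x. \<bar>rlip (w n) x - G x\<bar>"])
    show "(\<lambda>x. \<bar>rlip (w n) x - G x\<bar>) \<in> borel_measurable borel"
      using borel_measurable_rlip[OF lw, of n] by measurable
    show "AE x in m. lip (w n) x \<le> h x + ennreal \<bar>rlip (w n) x - G x\<bar>"
      using Gh
    proof eventually_elim
      case (elim x)
      have "lip (w n) x = ennreal (rlip (w n) x)" by (rule ennreal_rlip[OF lw, symmetric])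
      also have "\<dots> \<le> ennreal (G x + \<bar>rlip (w n) x - G x\<bar>)"
        by (intro ennreal_leI) linarith
      also have "\<dots> = ennreal (G x) + ennreal \<bar>rlip (w n) x - G x\<bar>"
        by (intro ennreal_plus G0) simp
      finally show ?case using elim by (meson add_right_mono order_trans)
    qed
  qed (use n lw in \<open>auto intro: less_imp_le\<close>)
qed

section \<open>Exhaustion and cutoff functions\<close>

lemma ex_exhaustion_function:
  fixes \<Omega> :: "'a::metric_space set"
  assumes "open \<Omega>"
  obtains \<rho> :: "'a \<Rightarrow> real" where "1-lipschitz_on UNIV \<rho>" "\<And>x. 0 \<le> \<rho> x" "\<And>x. x \<in> \<Omega> \<Longrightarrow> 0 < \<rho> x"
    "\<And>c. 0 < c \<Longrightarrow> bounded {x. c \<le> \<rho> x}" "\<And>c. 0 < c \<Longrightarrow> {x. c \<le> \<rho> x} \<subseteq> \<Omega>"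
proof -
  fix x0 :: 'a
  \<comment> \<open>This factor provides bounded level sets, as \<Omega> may be unbounded; the
    distance to the complement will keep the level sets inside \<Omega>.\<close>
  define \<sigma> where "\<sigma> x = 1 / (1 + dist x x0)" for x
  have \<sigma>0: "0 < \<sigma> x" for x using zero_le_dist[of x x0] unfolding \<sigma>_def by (intro divide_pos_pos) linarith+
  have "\<bar>1 / (1 + a) - 1 / (1 + b)\<bar> \<le> \<bar>a - b\<bar>" if "0 \<le> a" "0 \<le> b" for a b :: real
  proof -
    have "1 / (1 + a) - 1 / (1 + b) = (b - a) / ((1 + a) * (1 + b))"
      using that by (simp add: field_simps)
    moreover have pos: "1 \<le> (1 + a) * (1 + b)"
      using that by (simp add: algebra_simps)
    ultimately have "\<bar>1 / (1 + a) - 1 / (1 + b)\<bar> = \<bar>a - b\<bar> / ((1 + a) * (1 + b))"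
      using that by (simp add: abs_minus_commute)
    also have "\<dots> \<le> \<bar>a - b\<bar> / 1"
      using pos by (intro divide_left_mono) auto
    finally show ?thesis by simp
  qed
  note inv = this
  have \<sigma>_lip: "\<bar>\<sigma> x - \<sigma> y\<bar> \<le> dist x y" for x y
  proof -
    have "\<bar>dist x x0 - dist y x0\<bar> \<le> dist x y"
      using dist_triangle[of x x0 y] dist_triangle[of y x0 x] dist_commute[of x y] by linarith
    then show ?thesis
      unfolding \<sigma>_def using inv[of "dist x x0" "dist y x0"] by (meson order_trans zero_le_dist)
  qed
  have \<sigma>_bdd: "bounded {x. c \<le> \<sigma> x}" if "0 < c" for c
  proof (rule bounded_subset[OF bounded_cball[of x0 "1 / c"]], rule subsetI)
    fix x assume "x \<in> {x. c \<le> \<sigma> x}"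
    then have "c \<le> 1 / (1 + dist x x0)" by (simp add: \<sigma>_def)
    moreover have "0 < 1 + dist x x0" using zero_le_dist[of x x0] by linarith
    ultimately have "c * (1 + dist x x0) \<le> 1" by (simp add: pos_le_divide_eq)
    then have "1 + dist x x0 \<le> 1 / c" using that by (simp add: pos_le_divide_eq mult.commute)
    then show "x \<in> cball x0 (1 / c)" by (simp add: dist_commute)
  qed
  show ?thesis
  \<comment> \<open>\<open>infdist\<close> to the empty set is 0, so on the whole space \<sigma> has
    to be used alone.\<close>
  proof (cases "\<Omega> = UNIV")
    case True
    show ?thesis
      by (rule that[of \<sigma>]) (use True \<sigma>0 \<sigma>0[THEN less_imp_le] \<sigma>_lip \<sigma>_bdd in \<open>auto intro!: lipschitz_onI simp: dist_real_def\<close>)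
  next
    case False
    define \<rho> where "\<rho> x = min (infdist x (- \<Omega>)) (\<sigma> x)" for x
    have ne: "- \<Omega> \<noteq> {}" using False by auto
    have "\<bar>\<rho> x - \<rho> y\<bar> \<le> dist x y" for x y
      using infdist_triangle_abs[of x "- \<Omega>" y] \<sigma>_lip[of x y] unfolding \<rho>_def by linarith
    then have l: "1-lipschitz_on UNIV \<rho>" by (intro lipschitz_onI) (auto simp: dist_real_def)
    show ?thesis
    proof (rule that[OF l])
      show "0 \<le> \<rho> x" for x unfolding \<rho>_def using infdist_nonneg[of x "- \<Omega>"] \<sigma>0[of x] by simp
      show "0 < \<rho> x" if "x \<in> \<Omega>" for x
      proof -
        have "infdist x (- \<Omega>) > 0"
          using infdist_pos_not_in_closed[of "- \<Omega>" x] that assms ne by auto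
        then show ?thesis unfolding \<rho>_def using \<sigma>0[of x] by simp
      qed
      show "bounded {x. c \<le> \<rho> x}" if "0 < c" for c
        by (rule bounded_subset[OF \<sigma>_bdd[OF that]]) (auto simp: \<rho>_def)
      show "{x. c \<le> \<rho> x} \<subseteq> \<Omega>" if "0 < c" for c
      proof
        fix x assume "x \<in> {x. c \<le> \<rho> x}"
        then have "infdist x (- \<Omega>) > 0" using that by (simp add: \<rho>_def)
        then show "x \<in> \<Omega>" using infdist_zero[of x "- \<Omega>"] by (cases "x \<in> \<Omega>") auto
      qed
    qed
  qed
qed

text \<open>For k > 0 it rises from 0 at s = \<open>1 / 2 ^ k\<close> to 1 at s =
  \<open>2 / 2 ^ k\<close>. Level 0 is set to 0 so that the sum of the differences of consecutive
  ramps telescopes to the last ramp.\<close>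

definition ramp :: "nat \<Rightarrow> real \<Rightarrow> real" where
  "ramp k s = (if k = 0 then 0 else max 0 (min 1 (2 ^ k * s - 1)))"

lemma ramp_bounds: "0 \<le> ramp k s" "ramp k s \<le> 1"
  by (auto simp: ramp_def)

lemma ramp_0 [simp]: "ramp 0 s = 0"
  by (simp add: ramp_def)

lemma ramp_mono: "0 \<le> s \<Longrightarrow> ramp k s \<le> ramp (Suc k) s"
proof -
  assume "0 \<le> s"
  then have "0 \<le> 2 ^ k * s" by simp
  then have "max 0 (min 1 (2 ^ k * s - 1)) \<le> max 0 (min 1 (2 * (2 ^ k * s) - 1))"
    by linarith
  then show ?thesis
    by (cases "k = 0") (simp_all only: ramp_def power_Suc mult.assoc max.cobounded1 nat.distinct if_True if_False refl)
qed

lemma ramp_eq_0: "2 ^ k * s \<le> 1 \<Longrightarrow> ramp k s = 0"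
  by (auto simp: ramp_def)

lemma ramp_eq_1: "2 \<le> 2 ^ k * s \<Longrightarrow> 0 < k \<Longrightarrow> ramp k s = 1"
  by (auto simp: ramp_def)

lemma ramp_lipschitz: "\<bar>ramp k s - ramp k t\<bar> \<le> 2 ^ k * \<bar>s - t\<bar>"
proof (cases "k = 0")
  case False
  have "\<bar>max 0 (min 1 (2 ^ k * s - 1)) - max 0 (min 1 (2 ^ k * t - 1))\<bar> \<le> \<bar>2 ^ k * s - 2 ^ k * t\<bar>"
    by linarith
  also have "\<dots> = 2 ^ k * \<bar>s - t\<bar>"
    by (simp add: right_diff_distrib[symmetric] abs_mult)
  finally show ?thesis using False by (simp add: ramp_def)
qed simp

lemma lipschitz_on_mult_bounded:
  fixes f g :: "'a::metric_space \<Rightarrow> real"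
  assumes f: "L-lipschitz_on A f" and g: "M-lipschitz_on A g"
    and F: "\<And>x. x \<in> A \<Longrightarrow> \<bar>f x\<bar> \<le> F" and G: "\<And>x. x \<in> A \<Longrightarrow> \<bar>g x\<bar> \<le> G" and "0 \<le> F" "0 \<le> G"
  shows "(F * M + G * L)-lipschitz_on A (\<lambda>x. f x * g x)"
proof (rule lipschitz_onI)
  fix x y assume xy: "x \<in> A" "y \<in> A"
  have "f x * g x - f y * g y = f x * (g x - g y) + g y * (f x - f y)" by (simp add: algebra_simps)
  then have "\<bar>f x * g x - f y * g y\<bar> \<le> \<bar>f x\<bar> * \<bar>g x - g y\<bar> + \<bar>g y\<bar> * \<bar>f x - f y\<bar>"
    by (metis abs_mult abs_triangle_ineq)
  also have "\<dots> \<le> F * (M * dist x y) + G * (L * dist x y)"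
    using lipschitz_onD[OF f xy] lipschitz_onD[OF g xy] F[OF xy(1)] G[OF xy(2)] assms(5,6)
    by (intro add_mono mult_mono) (auto simp: dist_real_def)
  finally show "dist (f x * g x) (f y * g y) \<le> (F * M + G * L) * dist x y"
    by (simp add: dist_real_def algebra_simps)
qed (use assms lipschitz_on_nonneg[OF f] lipschitz_on_nonneg[OF g] in simp)

lemma lipschitz_on_sum_ex:
  fixes f :: "'i \<Rightarrow> 'a::metric_space \<Rightarrow> real"
  assumes "finite I" "\<And>i. i \<in> I \<Longrightarrow> \<exists>L. L-lipschitz_on A (f i)"
  shows "\<exists>L. L-lipschitz_on A (\<lambda>x. \<Sum>i\<in>I. f i x)"
  using assms
proof (induction I rule: finite_induct)
  case empty
  then show ?case by (auto intro: exI[of _ 0] lipschitz_on_constant)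
next
  case (insert i I)
  then obtain L M where "L-lipschitz_on A (f i)" "M-lipschitz_on A (\<lambda>x. \<Sum>i\<in>I. f i x)"
    by blast
  then have "(L + M)-lipschitz_on A (\<lambda>x. f i x + (\<Sum>i\<in>I. f i x))"
    by (rule lipschitz_on_add)
  then show ?case using insert by auto
qed

text \<open>The functions \<open>\<eta> k\<close> below form a locally finite partition of unity on \<open>\<Omega>\<close>, and
  \<open>\<zeta> k\<close> is a cutoff equal to 1 where \<open>\<eta> k\<close> or its slope is nonzero.\<close>

theorem meyers_serrin:
  fixes u :: "'a::polish_space \<Rightarrow> real"
  assumes p: "1 < p" and m[measurable_cong]: "sets m = sets borel" and \<Omega>: "open \<Omega>"
    and W: "W1p_on p m \<Omega> u g" and \<epsilon>: "0 < \<epsilon>"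
  obtains v B where "loc_lipschitz_fun \<Omega> v" "B \<in> borel_measurable m"
    "(\<integral>\<^sup>+x. epowr (B x) p \<partial>m) \<le> ennreal \<epsilon>"
    "AE x in m. x \<in> \<Omega> \<longrightarrow> ennreal \<bar>v x - u x\<bar> \<le> B x \<and> lip v x \<le> g x + B x"
proof -
  have p0: "0 < p" using p by simp
  obtain \<rho> :: "'a \<Rightarrow> real" where \<rho>_lip: "1-lipschitz_on UNIV \<rho>" and \<rho>0: "\<And>x. 0 \<le> \<rho> x"
    and \<rho>_pos: "\<And>x. x \<in> \<Omega> \<Longrightarrow> 0 < \<rho> x"
    and \<rho>_bdd: "\<And>c. 0 < c \<Longrightarrow> bounded {x. c \<le> \<rho> x}" and \<rho>_sub: "\<And>c. 0 < c \<Longrightarrow> {x. c \<le> \<rho> x} \<subseteq> \<Omega>"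
    using ex_exhaustion_function[OF \<Omega>] by blast
  have \<rho>_dist: "\<bar>\<rho> x - \<rho> y\<bar> \<le> dist x y" for x y
    using lipschitz_onD[OF \<rho>_lip, of x y] by (simp add: dist_real_def)
  have \<rho>_cont: "continuous_on UNIV \<rho>" using \<rho>_lip by (rule lipschitz_on_continuous_on)
  define \<theta> where "\<theta> k x = ramp k (\<rho> x)" for k x
  have \<theta>_lip: "(2 ^ k)-lipschitz_on UNIV (\<theta> k)" for k
  proof (rule lipschitz_onI)
    fix x y
    have "\<bar>\<theta> k x - \<theta> k y\<bar> \<le> 2 ^ k * \<bar>\<rho> x - \<rho> y\<bar>"
      unfolding \<theta>_def by (rule ramp_lipschitz)
    also have "\<dots> \<le> 2 ^ k * dist x y"
      by (intro mult_left_mono \<rho>_dist) simp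
    finally show "dist (\<theta> k x) (\<theta> k y) \<le> 2 ^ k * dist x y" by (simp add: dist_real_def)
  qed simp
  define \<eta> where "\<eta> k x = \<theta> (Suc k) x - \<theta> k x" for k x
  \<comment> \<open>A Lipschitz constant of \<open>\<eta> k\<close>. It grows like
    \<open>2 ^ k\<close>, so the k-th piece will have to be approximated correspondingly
    better.\<close>
  define \<Lambda> where "\<Lambda> k = (2 ^ Suc k + 2 ^ k :: real)" for k
  have \<Lambda>: "1 \<le> \<Lambda> k" "0 \<le> \<Lambda> k" for k
    using one_le_power[of "2::real" k] unfolding \<Lambda>_def power_Suc by linarith+
  have \<eta>_lip: "(\<Lambda> k)-lipschitz_on UNIV (\<eta> k)" for k
    unfolding \<eta>_def \<Lambda>_def by (intro lipschitz_on_diff \<theta>_lip)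
  have \<eta>0: "0 \<le> \<eta> k x" and \<eta>1: "\<eta> k x \<le> 1" for k x
    using ramp_mono[OF \<rho>0, of k x] ramp_bounds[of k "\<rho> x"] ramp_bounds[of "Suc k" "\<rho> x"]
    unfolding \<eta>_def \<theta>_def by linarith+
  define D where "D k = {x. 1 \<le> 2 ^ Suc k * \<rho> x}" for k
  have D_closed: "closed (D k)" for k
    unfolding D_def using \<rho>_cont by (intro closed_Collect_le continuous_intros) auto
  have [measurable]: "D k \<in> sets m" for k using D_closed[of k] m by auto
  have D_eq: "{x. 1 \<le> 2 ^ k * \<rho> x} = {x. 1 / 2 ^ k \<le> \<rho> x}" for k :: nat
    by (simp add: pos_divide_le_eq mult.commute)
  have \<eta>_D: "\<eta> k x = 0" if "x \<notin> D k" for k x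
  proof -
    have "2 ^ Suc k * \<rho> x \<le> 1" using that by (simp add: D_def)
    moreover have "2 ^ k * \<rho> x \<le> 2 ^ Suc k * \<rho> x"
      using \<rho>0[of x] by (intro mult_right_mono) simp_all
    ultimately show ?thesis unfolding \<eta>_def \<theta>_def by (simp add: ramp_eq_0)
  qed
  \<comment> \<open>Index k + 2, because \<open>2 ^ (k + 2) * \<rho> x\<close> is at least 2 exactly
    on \<open>D k\<close>, and there the ramp has reached 1.\<close>
  define \<zeta> where "\<zeta> k = \<theta> (Suc (Suc k))" for k
  have \<zeta>1: "\<zeta> k x = 1" if "x \<in> D k" for k x
  proof -
    have "2 ^ Suc (Suc k) * \<rho> x = 2 * (2 ^ Suc k * \<rho> x)" by (simp only: power_Suc mult.assoc)
    moreover have "1 \<le> 2 ^ Suc k * \<rho> x" using that by (simp only: D_def mem_Collect_eq)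
    ultimately have "2 \<le> 2 ^ Suc (Suc k) * \<rho> x" by linarith
    then show ?thesis unfolding \<zeta>_def \<theta>_def by (rule ramp_eq_1) simp
  qed
  have \<zeta>_bs: "lipschitz_bs \<Omega> (\<zeta> k)" for k
  proof -
    have "{x. \<zeta> k x \<noteq> 0} \<subseteq> {x. 1 \<le> 2 ^ Suc (Suc k) * \<rho> x}"
    proof (rule subsetI, rule CollectI, rule ccontr)
      fix x assume x: "x \<in> {x. \<zeta> k x \<noteq> 0}" and "\<not> 1 \<le> 2 ^ Suc (Suc k) * \<rho> x"
      then have "ramp (Suc (Suc k)) (\<rho> x) = 0" by (intro ramp_eq_0) linarith
      with x show False by (simp add: \<zeta>_def \<theta>_def)
    qed
    moreover have "closed {x. 1 \<le> 2 ^ Suc (Suc k) * \<rho> x}"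
      using \<rho>_cont by (intro closed_Collect_le continuous_intros) auto
    ultimately have sub: "closure {x. \<zeta> k x \<noteq> 0} \<subseteq> {x. 1 \<le> 2 ^ Suc (Suc k) * \<rho> x}"
      by (rule closure_minimal)
    show ?thesis
      unfolding lipschitz_bs_def
    proof (intro conjI)
      show "lipschitz_fun (\<zeta> k)"
        unfolding lipschitz_fun_def \<zeta>_def using \<theta>_lip by blast
      show "bounded (closure {x. \<zeta> k x \<noteq> 0})"
        by (rule bounded_subset[OF _ sub]) (unfold D_eq, rule \<rho>_bdd, simp)
      have "{x. 1 \<le> 2 ^ Suc (Suc k) * \<rho> x} \<subseteq> \<Omega>" unfolding D_eq by (rule \<rho>_sub) simp
      with sub show "closure {x. \<zeta> k x \<noteq> 0} \<subseteq> \<Omega>" by (rule subset_trans)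
    qed
  qed
  define f where "f k = (\<lambda>x. \<zeta> k x * u x)" for k
  have fW: "in_W1p p m (f k)" for k
    using W \<zeta>_bs unfolding W1p_on_def in_W1p_loc_def f_def by blast
  have fm[measurable]: "f k \<in> borel_measurable m" for k
    using fW[of k] by (simp add: in_W1p_def in_Lp_def)
  have fu: "f k x = u x" if "x \<in> D k" for k x
    using \<zeta>1[OF that] by (simp add: f_def)
  have "\<exists>h. minimal_wug p m (f k) h \<and> (AE x in m. \<zeta> k x = 1 \<longrightarrow> g x = h x)" for k
    using W \<zeta>_bs unfolding W1p_on_def local_minimal_wug_def f_def by blast
  then have "\<exists>h. \<forall>k. minimal_wug p m (f k) (h k) \<and> (AE x in m. \<zeta> k x = 1 \<longrightarrow> g x = h k x)"
    by (intro choice allI)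
  then obtain h where h: "\<And>k. minimal_wug p m (f k) (h k)"
    and gh: "\<And>k. AE x in m. \<zeta> k x = 1 \<longrightarrow> g x = h k x" by blast
  \<comment> \<open>The first factor is the price of summation in \<open>epowr_suminf_le\<close>,
    the second that of splitting \<open>b k\<close> by \<open>epowr_add_le\<close> with \<tau> = 1.
    Dividing by \<open>c k\<close> turns the total error into \<epsilon> times a geometric series of
    sum 1.\<close>
  define c where "c k = 2 powr (real (Suc k) * p) * (2 powr p * (1 + \<Lambda> k powr p))" for k
  have c0: "0 < c k" for k
    unfolding c_def by (intro mult_pos_pos add_pos_nonneg) simp_all
  define \<delta> where "\<delta> k = \<epsilon> * (1 / 2) ^ Suc k / c k" for k
  have \<delta>0: "0 < \<delta> k" for k using c0[of k] \<epsilon> by (simp add: \<delta>_def)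
  define good where "good k v e \<longleftrightarrow> lipschitz_fun v \<and> e \<in> borel_measurable borel \<and> (\<forall>x. 0 \<le> e x) \<and>
    (\<integral>\<^sup>+x. ennreal (\<bar>v x - f k x\<bar> powr p) \<partial>m) \<le> ennreal (\<delta> k) \<and>
    (\<integral>\<^sup>+x. ennreal (e x powr p) \<partial>m) \<le> ennreal (\<delta> k) \<and>
    (AE x in m. lip v x \<le> h k x + ennreal (e x))" for k and v e :: "'a \<Rightarrow> real"
  have "\<exists>ve. good k (fst ve) (snd ve)" for k
  proof (rule minimal_wug_lipschitz_approx[OF p m fW h \<delta>0])
    fix v e :: "'a \<Rightarrow> real"
    assume 1: "lipschitz_fun v" "e \<in> borel_measurable borel" "\<And>x. 0 \<le> e x"
      "(\<integral>\<^sup>+x. ennreal (\<bar>v x - f k x\<bar> powr p) \<partial>m) \<le> ennreal (\<delta> k)"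
      "(\<integral>\<^sup>+x. ennreal (e x powr p) \<partial>m) \<le> ennreal (\<delta> k)"
      "AE x in m. lip v x \<le> h k x + ennreal (e x)"
    have "good k v e" unfolding good_def by (intro conjI allI 1)
    then show "\<exists>ve. good k (fst ve) (snd ve)" by (intro exI[of _ "(v, e)"]) (simp only: fst_conv snd_conv)
  qed
  then have "\<exists>ve. \<forall>k. good k (fst (ve k)) (snd (ve k))" by (intro choice allI)
  then obtain ve where ve: "\<And>k. good k (fst (ve k)) (snd (ve k))" by blast
  define w where "w k = fst (ve k)" for k
  define e where "e k = snd (ve k)" for k
  have good: "good k (w k) (e k)" for k unfolding w_def e_def by (rule ve)
  have lw: "lipschitz_fun (w k)" and em[measurable]: "e k \<in> borel_measurable borel" and e0: "0 \<le> e k x"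
    and Nw: "(\<integral>\<^sup>+x. ennreal (\<bar>w k x - f k x\<bar> powr p) \<partial>m) \<le> ennreal (\<delta> k)"
    and Ne: "(\<integral>\<^sup>+x. ennreal (e k x powr p) \<partial>m) \<le> ennreal (\<delta> k)"
    and wh: "AE x in m. lip (w k) x \<le> h k x + ennreal (e k x)" for k x
    using good[of k] unfolding good_def by blast+
  have wm[measurable]: "w k \<in> borel_measurable borel" for k
    by (intro borel_measurable_continuous_onI lipschitz_fun_continuous lw)
  define b where "b k x = ennreal (e k x + \<Lambda> k * \<bar>w k x - f k x\<bar>) * indicator (D k) x" for k x
  have bm[measurable]: "b k \<in> borel_measurable m" for k unfolding b_def by measurable
  define B where "B x = (\<Sum>k. b k x)" for x
  have Bm: "B \<in> borel_measurable m" unfolding B_def by measurable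
  have b_int: "ennreal (2 powr (real (Suc k) * p)) * (\<integral>\<^sup>+x. epowr (b k x) p \<partial>m) \<le> ennreal (\<epsilon> * (1 / 2) ^ Suc k)" for k
  proof -
    have "(\<integral>\<^sup>+x. epowr (b k x) p \<partial>m) \<le> (\<integral>\<^sup>+x. ennreal (2 powr p) * ennreal (e k x powr p)
        + ennreal (2 powr p * \<Lambda> k powr p) * ennreal (\<bar>w k x - f k x\<bar> powr p) \<partial>m)"
    proof (rule nn_integral_mono)
      fix x
      have "b k x \<le> ennreal (e k x + \<Lambda> k * \<bar>w k x - f k x\<bar>)"
        unfolding b_def by (simp add: indicator_def)
      also have "\<dots> = ennreal (e k x) + ennreal (\<Lambda> k * \<bar>w k x - f k x\<bar>)"
        by (intro ennreal_plus e0 mult_nonneg_nonneg \<Lambda>(2) abs_ge_zero)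
      finally have "epowr (b k x) p \<le> epowr (ennreal (e k x) + ennreal (\<Lambda> k * \<bar>w k x - f k x\<bar>)) p"
        using p0 by (intro epowr_mono) simp_all
      also have "\<dots> \<le> ennreal ((1 + 1) powr p) * epowr (ennreal (e k x)) p
          + ennreal ((1 + 1 / 1) powr p) * epowr (ennreal (\<Lambda> k * \<bar>w k x - f k x\<bar>)) p"
        by (rule epowr_add_le[OF p0 zero_less_one])
      also have "\<dots> = ennreal (2 powr p) * ennreal (e k x powr p)
          + ennreal (2 powr p) * (ennreal (\<Lambda> k powr p) * ennreal (\<bar>w k x - f k x\<bar> powr p))"
        by (simp only: epowr_ennreal[OF e0] epowr_ennreal[OF mult_nonneg_nonneg[OF \<Lambda>(2) abs_ge_zero]]
            powr_mult ennreal_mult[OF powr_ge_zero powr_ge_zero] one_add_one div_by_1)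
      also have "ennreal (2 powr p) * (ennreal (\<Lambda> k powr p) * ennreal (\<bar>w k x - f k x\<bar> powr p))
          = ennreal (2 powr p * \<Lambda> k powr p) * ennreal (\<bar>w k x - f k x\<bar> powr p)"
        by (simp only: ennreal_mult[OF powr_ge_zero powr_ge_zero] mult.assoc)
      finally show "epowr (b k x) p \<le> ennreal (2 powr p) * ennreal (e k x powr p)
        + ennreal (2 powr p * \<Lambda> k powr p) * ennreal (\<bar>w k x - f k x\<bar> powr p)" .
    qed
    also have "\<dots> = ennreal (2 powr p) * (\<integral>\<^sup>+x. ennreal (e k x powr p) \<partial>m)
        + ennreal (2 powr p * \<Lambda> k powr p) * (\<integral>\<^sup>+x. ennreal (\<bar>w k x - f k x\<bar> powr p) \<partial>m)"
      by (subst nn_integral_add) (measurable, simp_all add: nn_integral_cmult)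
    also have "\<dots> \<le> ennreal (2 powr p) * ennreal (\<delta> k) + ennreal (2 powr p * \<Lambda> k powr p) * ennreal (\<delta> k)"
      by (intro add_mono mult_left_mono Ne Nw zero_le)
    also have "\<dots> = ennreal (2 powr p * (1 + \<Lambda> k powr p) * \<delta> k)"
    proof -
      have "ennreal (2 powr p) * ennreal (\<delta> k) + ennreal (2 powr p * \<Lambda> k powr p) * ennreal (\<delta> k)
        = ennreal (2 powr p * \<delta> k + 2 powr p * \<Lambda> k powr p * \<delta> k)"
        using \<delta>0[of k] by (subst ennreal_plus) (simp_all add: ennreal_mult)
      then show ?thesis by (simp add: algebra_simps)
    qed
    finally have "ennreal (2 powr (real (Suc k) * p)) * (\<integral>\<^sup>+x. epowr (b k x) p \<partial>m)
       \<le> ennreal (2 powr (real (Suc k) * p)) * ennreal (2 powr p * (1 + \<Lambda> k powr p) * \<delta> k)"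
      by (intro mult_left_mono zero_le)
    also have "\<dots> = ennreal (c k * \<delta> k)"
      using \<delta>0[of k] unfolding c_def by (subst ennreal_mult[symmetric]) (simp_all add: mult.assoc)
    also have "c k * \<delta> k = \<epsilon> * (1 / 2) ^ Suc k"
      using c0[of k] unfolding \<delta>_def by simp
    finally show ?thesis .
  qed
  have B_int: "(\<integral>\<^sup>+x. epowr (B x) p \<partial>m) \<le> ennreal \<epsilon>"
  proof -
    have "(\<integral>\<^sup>+x. epowr (B x) p \<partial>m) \<le> (\<integral>\<^sup>+x. (\<Sum>k. ennreal (2 powr (real (Suc k) * p)) * epowr (b k x) p) \<partial>m)"
      unfolding B_def by (intro nn_integral_mono epowr_suminf_le p0)
    also have "\<dots> = (\<Sum>k. \<integral>\<^sup>+x. ennreal (2 powr (real (Suc k) * p)) * epowr (b k x) p \<partial>m)"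
      by (rule nn_integral_suminf) measurable
    also have "\<dots> = (\<Sum>k. ennreal (2 powr (real (Suc k) * p)) * (\<integral>\<^sup>+x. epowr (b k x) p \<partial>m))"
      by (intro arg_cong[where f = suminf] ext nn_integral_cmult) measurable
    also have "\<dots> \<le> (\<Sum>k. ennreal (\<epsilon> * (1 / 2) ^ Suc k))"
      by (intro suminf_le b_int summableI)
    also have "\<dots> = ennreal (\<epsilon> * 1)"
      by (rule suminf_ennreal_eq[OF _ sums_mult[OF power_half_series]]) (use \<epsilon> in simp)
    finally show ?thesis by (simp only: mult_1_right)
  qed
  define v where "v x = (\<Sum>k. \<eta> k x * w k x)" for x
  \<comment> \<open>Beyond N both ramps in \<open>\<eta> k\<close> equal 1, so near each point of
    \<Omega> only finitely many terms remain.\<close>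
  have far: "\<eta> k x = 0" if "1 < 2 ^ N * \<rho> x" "N < k" for k N x
  proof -
    have "2 ^ Suc N \<le> (2::real) ^ k" using that by (intro power_increasing) simp_all
    then have *: "2 ^ Suc N * \<rho> x \<le> 2 ^ k * \<rho> x" by (rule mult_right_mono) (rule \<rho>0)
    have "2 * (2 ^ N * \<rho> x) \<le> 2 ^ k * \<rho> x" using * by (simp only: power_Suc mult.assoc)
    then have 2: "2 \<le> 2 ^ k * \<rho> x" using that by linarith
    have "2 ^ k * \<rho> x \<le> 2 ^ Suc k * \<rho> x"
      using \<rho>0[of x] by (intro mult_right_mono) simp_all
    then have "2 \<le> 2 ^ Suc k * \<rho> x" using 2 by linarith
    then show ?thesis unfolding \<eta>_def \<theta>_def using 2 that by (simp only: ramp_eq_1 zero_less_Suc)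
  qed
  have v_eq: "v x = (\<Sum>k<Suc N. \<eta> k x * w k x)" if "1 < 2 ^ N * \<rho> x" for N x
    unfolding v_def using far[OF that] by (intro suminf_finite) (auto simp: not_less_eq)
  have one: "(\<Sum>k<Suc N. \<eta> k x) = 1" if "1 < 2 ^ N * \<rho> x" for N x
  proof -
    have "(\<Sum>k<Suc N. \<eta> k x) = \<theta> (Suc N) x - \<theta> 0 x"
      unfolding \<eta>_def by (rule sum_lessThan_telescope)
    moreover have "\<theta> (Suc N) x = 1"
      unfolding \<theta>_def using that by (intro ramp_eq_1) simp_all
    ultimately show ?thesis by (simp add: \<theta>_def)
  qed
  have nbhd: "\<exists>N r. 0 < r \<and> (\<forall>y\<in>ball x r. 1 < 2 ^ N * \<rho> y)" if "x \<in> \<Omega>" for x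
  proof -
    obtain N where N: "1 / \<rho> x < 2 ^ N" using real_arch_pow[of 2 "1 / \<rho> x"] by auto
    then have N': "1 < 2 ^ N * \<rho> x" using \<rho>_pos[OF that] by (simp add: pos_divide_less_eq)
    have "1 < 2 ^ N * \<rho> y" if "y \<in> ball x (\<rho> x - 1 / 2 ^ N)" for y
    proof -
      have "1 / 2 ^ N < \<rho> y" using that \<rho>_dist[of x y] by simp
      then show ?thesis by (simp add: pos_divide_less_eq mult.commute)
    qed
    moreover have "0 < \<rho> x - 1 / 2 ^ N" using N' by (simp add: pos_divide_less_eq mult.commute)
    ultimately show ?thesis by blast
  qed
  have loc: "loc_lipschitz_fun \<Omega> v"
    unfolding loc_lipschitz_fun_def
  proof
    fix x assume "x \<in> \<Omega>"
    then obtain N r where r: "0 < r" "\<And>y. y \<in> ball x r \<Longrightarrow> 1 < 2 ^ N * \<rho> y" using nbhd by blast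
    have "\<exists>L. L-lipschitz_on (ball x r \<inter> \<Omega>) (\<lambda>y. \<eta> k y * w k y)" for k
    proof -
      obtain L where L: "L-lipschitz_on UNIV (w k)" using lw[of k] by (auto simp: lipschitz_fun_def)
      have L0: "0 \<le> L" using L by (rule lipschitz_on_nonneg)
      have "(1 * L + (\<bar>w k x\<bar> + L * r) * \<Lambda> k)-lipschitz_on (ball x r \<inter> \<Omega>) (\<lambda>y. \<eta> k y * w k y)"
      proof (rule lipschitz_on_mult_bounded)
        show "(\<Lambda> k)-lipschitz_on (ball x r \<inter> \<Omega>) (\<eta> k)" by (rule lipschitz_on_subset[OF \<eta>_lip]) simp
        show "L-lipschitz_on (ball x r \<inter> \<Omega>) (w k)" by (rule lipschitz_on_subset[OF L]) simp
        show "\<bar>\<eta> k y\<bar> \<le> 1" for y using \<eta>0[of k y] \<eta>1[of k y] by simp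
        show "\<bar>w k y\<bar> \<le> \<bar>w k x\<bar> + L * r" if "y \<in> ball x r \<inter> \<Omega>" for y
        proof -
          have "\<bar>w k x - w k y\<bar> \<le> L * dist x y"
            using lipschitz_onD[OF L, of x y] by (simp add: dist_real_def)
          also have "\<dots> \<le> L * r" using that L0 by (intro mult_left_mono) simp_all
          finally show ?thesis by linarith
        qed
        show "0 \<le> \<bar>w k x\<bar> + L * r" using L0 r(1) by (intro add_nonneg_nonneg mult_nonneg_nonneg) simp_all
      qed simp
      then show ?thesis by blast
    qed
    then have "\<exists>L. L-lipschitz_on (ball x r \<inter> \<Omega>) (\<lambda>y. \<Sum>k<Suc N. \<eta> k y * w k y)"
      by (intro lipschitz_on_sum_ex) auto
    then obtain L where "L-lipschitz_on (ball x r \<inter> \<Omega>) (\<lambda>y. \<Sum>k<Suc N. \<eta> k y * w k y)" by blast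
    then have "L-lipschitz_on (ball x r \<inter> \<Omega>) v"
      by (rule lipschitz_on_transform) (use v_eq r(2) in simp)
    then show "\<exists>r>0. \<exists>L. L-lipschitz_on (ball x r \<inter> \<Omega>) v" using r(1) by blast
  qed
  have "AE x in m. \<forall>k. (\<zeta> k x = 1 \<longrightarrow> g x = h k x) \<and> lip (w k) x \<le> h k x + ennreal (e k x)"
    unfolding AE_all_countable
  proof
    fix k
    show "AE x in m. (\<zeta> k x = 1 \<longrightarrow> g x = h k x) \<and> lip (w k) x \<le> h k x + ennreal (e k x)"
      using gh[of k] wh[of k] by eventually_elim blast
  qed
  then have AE: "AE x in m. x \<in> \<Omega> \<longrightarrow> ennreal \<bar>v x - u x\<bar> \<le> B x \<and> lip v x \<le> g x + B x"
  proof (eventually_elim, safe)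
    fix x assume x: "x \<in> \<Omega>"
      and A: "\<forall>k. (\<zeta> k x = 1 \<longrightarrow> g x = h k x) \<and> lip (w k) x \<le> h k x + ennreal (e k x)"
    obtain N r where r: "0 < r" "\<And>y. y \<in> ball x r \<Longrightarrow> 1 < 2 ^ N * \<rho> y" using nbhd[OF x] by blast
    have xN: "1 < 2 ^ N * \<rho> x" using r by simp
    have b_le_B: "(\<Sum>k<Suc N. b k x) \<le> B x"
      unfolding B_def by (intro sum_le_suminf summableI) auto
    have "v x - u x = (\<Sum>k<Suc N. \<eta> k x * w k x) - (\<Sum>k<Suc N. \<eta> k x) * u x"
      using v_eq[OF xN] one[OF xN] by simp
    also have "\<dots> = (\<Sum>k<Suc N. \<eta> k x * (w k x - u x))"
      by (simp only: sum_distrib_right sum_subtractf[symmetric] right_diff_distrib)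
    finally have "\<bar>v x - u x\<bar> \<le> (\<Sum>k<Suc N. \<bar>\<eta> k x * (w k x - u x)\<bar>)"
      by (simp only: sum_abs)
    then have "ennreal \<bar>v x - u x\<bar> \<le> ennreal (\<Sum>k<Suc N. \<bar>\<eta> k x * (w k x - u x)\<bar>)" by (rule ennreal_leI)
    also have "\<dots> = (\<Sum>k<Suc N. ennreal \<bar>\<eta> k x * (w k x - u x)\<bar>)"
      by (rule sum_ennreal[symmetric]) simp
    also have "\<dots> \<le> (\<Sum>k<Suc N. b k x)"
    proof (rule sum_mono)
      fix k
      show "ennreal \<bar>\<eta> k x * (w k x - u x)\<bar> \<le> b k x"
      proof (cases "x \<in> D k")
        case True
        have "\<bar>\<eta> k x * (w k x - u x)\<bar> = \<eta> k x * \<bar>w k x - f k x\<bar>"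
          using \<eta>0[of k x] fu[OF True] by (simp add: abs_mult)
        also have "\<dots> \<le> \<Lambda> k * \<bar>w k x - f k x\<bar>"
          using \<eta>1[of k x] \<Lambda>(1)[of k] by (intro mult_right_mono) linarith+
        also have "\<dots> \<le> e k x + \<Lambda> k * \<bar>w k x - f k x\<bar>" using e0[of k x] by linarith
        finally show ?thesis using True by (simp add: b_def ennreal_leI)
      qed (simp add: \<eta>_D)
    qed
    also note b_le_B
    finally show "ennreal \<bar>v x - u x\<bar> \<le> B x" .
    \<comment> \<open>The \<open>\<eta> k\<close> sum to 1 near x, so the number \<open>u x\<close>
      may be subtracted from every \<open>w k\<close>. The slopes of the partition then multiply the
      small differences \<open>w k x - u x\<close>, and u enters only through its value at the fixed
      x.\<close>
    have "lip v x = lip (\<lambda>y. (\<Sum>k<Suc N. \<eta> k y * (w k y - u x)) + u x) x"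
    proof (rule lip_cong)
      have "\<forall>\<^sub>F y in nhds x. y \<in> ball x r"
        using r(1) by (intro eventually_nhds_in_open) auto
      then show "\<forall>\<^sub>F y in nhds x. v y = (\<Sum>k<Suc N. \<eta> k y * (w k y - u x)) + u x"
      proof eventually_elim
        case (elim y)
        have "(\<Sum>k<Suc N. \<eta> k y * (w k y - u x)) = (\<Sum>k<Suc N. \<eta> k y * w k y) - (\<Sum>k<Suc N. \<eta> k y) * u x"
          by (simp only: sum_distrib_right sum_subtractf[symmetric] right_diff_distrib)
        then show ?case using v_eq[OF r(2)[OF elim]] one[OF r(2)[OF elim]] by simp
      qed
    qed
    also have "\<dots> \<le> lip (\<lambda>y. \<Sum>k<Suc N. \<eta> k y * (w k y - u x)) x + lip (\<lambda>y. u x) x"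
      by (rule lip_add_le)
    also have "\<dots> \<le> (\<Sum>k<Suc N. lip (\<lambda>y. \<eta> k y * (w k y - u x)) x)"
      by (simp only: lip_const add_0_right) (rule lip_sum_le, simp)
    also have "\<dots> \<le> (\<Sum>k<Suc N. ennreal (\<eta> k x) * g x + b k x)"
    proof (rule sum_mono)
      fix k
      show "lip (\<lambda>y. \<eta> k y * (w k y - u x)) x \<le> ennreal (\<eta> k x) * g x + b k x"
      proof (cases "x \<in> D k")
        \<comment> \<open>\<open>D k\<close> is closed, so \<open>\<eta> k\<close> vanishes on a
          whole neighbourhood of x.\<close>
        case False
        have "lip (\<lambda>y. \<eta> k y * (w k y - u x)) x = lip (\<lambda>y. 0) x"
        proof (rule lip_cong)
          have "\<forall>\<^sub>F y in nhds x. y \<in> - D k"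
            using D_closed[of k] False by (intro eventually_nhds_in_open) auto
          then show "\<forall>\<^sub>F y in nhds x. \<eta> k y * (w k y - u x) = 0"
            by eventually_elim (simp add: \<eta>_D)
        qed
        then show ?thesis by simp
      next
        case True
        have cont: "isCont (\<eta> k) x"
          using lipschitz_on_continuous_on[OF \<eta>_lip, of k] by (simp add: continuous_on_eq_continuous_at)
        have lipw: "lip (\<lambda>y. w k y - u x) x \<le> lip (w k) x"
          using lip_mono_increment[where v = "\<lambda>y. w k y - u x" and c = 1 and u = "w k" and x = x] by simp
        have "lip (\<lambda>y. \<eta> k y * (w k y - u x)) x
           \<le> ennreal \<bar>\<eta> k x\<bar> * lip (\<lambda>y. w k y - u x) x + ennreal \<bar>w k x - u x\<bar> * lip (\<eta> k) x"
          by (rule lip_mult_le[OF cont order_le_less_trans[OF lipw lip_less_top[OF lw]]])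
        also have "\<dots> \<le> ennreal (\<eta> k x) * (g x + ennreal (e k x)) + ennreal \<bar>w k x - u x\<bar> * ennreal (\<Lambda> k)"
        proof (intro add_mono mult_mono zero_le)
          show "ennreal \<bar>\<eta> k x\<bar> \<le> ennreal (\<eta> k x)" using \<eta>0[of k x] by simp
          have "lip (w k) x \<le> g x + ennreal (e k x)"
            using A \<zeta>1[OF True] by metis
          then show "lip (\<lambda>y. w k y - u x) x \<le> g x + ennreal (e k x)"
            using lipw by (rule order_trans[rotated])
          show "lip (\<eta> k) x \<le> ennreal (\<Lambda> k)"
            by (rule lip_le_lipschitz[OF \<eta>_lip open_UNIV UNIV_I])
        qed simp_all
        also have "\<dots> \<le> ennreal (\<eta> k x) * g x + (ennreal (e k x) + ennreal (\<Lambda> k * \<bar>w k x - f k x\<bar>))"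
        proof -
          have "ennreal (\<eta> k x) * ennreal (e k x) \<le> 1 * ennreal (e k x)"
            using \<eta>1[of k x] by (intro mult_right_mono) (simp_all add: ennreal_le_1)
          moreover have "ennreal \<bar>w k x - u x\<bar> * ennreal (\<Lambda> k) = ennreal (\<Lambda> k * \<bar>w k x - f k x\<bar>)"
            using \<Lambda>(2)[of k] fu[OF True] by (simp add: ennreal_mult mult.commute)
          ultimately show ?thesis
            by (simp add: distrib_left add.assoc add_left_mono add_right_mono)
        qed
        also have "ennreal (e k x) + ennreal (\<Lambda> k * \<bar>w k x - f k x\<bar>) = b k x"
          using True e0[of k x] \<Lambda>(2)[of k] by (simp add: b_def)
        finally show ?thesis .
      qed
    qed
    also have "\<dots> = (\<Sum>k<Suc N. ennreal (\<eta> k x)) * g x + (\<Sum>k<Suc N. b k x)"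
      by (simp only: sum.distrib sum_distrib_right)
    also have "(\<Sum>k<Suc N. ennreal (\<eta> k x)) = ennreal (\<Sum>k<Suc N. \<eta> k x)"
      by (rule sum_ennreal) (rule \<eta>0)
    also have "\<dots> = 1" by (simp only: one[OF xN] ennreal_1)
    also have "1 * g x + (\<Sum>k<Suc N. b k x) \<le> g x + B x"
      using b_le_B by (simp only: mult_1 add_left_mono)
    finally show "lip v x \<le> g x + B x" .
  qed
  show ?thesis by (rule that[OF loc Bm B_int AE])
qed

section \<open>Coarea inequality\<close>

lemma loc_lipschitz_fun_continuous:
  assumes "open \<Omega>" "loc_lipschitz_fun \<Omega> v"
  shows "continuous_on \<Omega> v"
proof (rule continuous_at_imp_continuous_on, rule ballI)
  fix x assume x: "x \<in> \<Omega>"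
  then obtain r L where r: "0 < r" "L-lipschitz_on (ball x r \<inter> \<Omega>) v"
    using assms(2) unfolding loc_lipschitz_fun_def by blast
  have "continuous_on (ball x r \<inter> \<Omega>) v" using r(2) by (rule lipschitz_on_continuous_on)
  then show "isCont v x"
    using assms(1) x r(1) by (simp add: continuous_on_eq_continuous_at open_Int)
qed

lemma loc_lipschitz_fun_compose:
  assumes v: "loc_lipschitz_fun \<Omega> v" and h: "K-lipschitz_on UNIV h"
  shows "loc_lipschitz_fun \<Omega> (\<lambda>x. h (v x))"
  unfolding loc_lipschitz_fun_def
proof
  fix x assume "x \<in> \<Omega>"
  then obtain r L where r: "0 < r" "L-lipschitz_on (ball x r \<inter> \<Omega>) v"
    using v unfolding loc_lipschitz_fun_def by blast
  have "(K * L)-lipschitz_on (ball x r \<inter> \<Omega>) (\<lambda>x. h (v x))"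
    by (rule lipschitz_on_compose2[OF r(2) lipschitz_on_subset[OF h subset_UNIV]])
  then show "\<exists>r>0. \<exists>L. L-lipschitz_on (ball x r \<inter> \<Omega>) (\<lambda>x. h (v x))" using r(1) by blast
qed

text \<open>The competitors are v cut off between t and t + 1 / (n + 1) and rescaled to run from 0
  to 1. They are locally constant off the closed strip, so their slopes live on it; at v = t they
  vanish, like the indicator of the strict superlevel set.\<close>

lemma perimeter_superlevel_le:
  fixes v :: "'a::polish_space \<Rightarrow> real"
  assumes m[measurable_cong]: "sets m = sets borel" and \<Omega>: "open \<Omega>" and fin: "emeasure m \<Omega> < \<infinity>"
    and v: "loc_lipschitz_fun \<Omega> v"
  shows "perimeter m {x\<in>\<Omega>. t < v x} \<Omega> \<le> liminf (\<lambda>n. \<integral>\<^sup>+x. ennreal (real (Suc n)) *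
     (lip v x * indicator \<Omega> x * indicator {t..t + 1 / real (Suc n)} (v x)) \<partial>m)"
proof -
  define \<phi> where "\<phi> n x = max 0 (min 1 (real (Suc n) * (v x - t)))" for n x
  have cont: "continuous_on \<Omega> v" by (rule loc_lipschitz_fun_continuous[OF \<Omega> v])
  have [measurable]: "\<Omega> \<in> sets borel" using \<Omega> by simp
  define v' where "v' x = (if x \<in> \<Omega> then v x else 0)" for x
  have [measurable]: "v' \<in> borel_measurable borel"
    unfolding v'_def by (rule borel_measurable_continuous_on_if[OF _ cont continuous_on_const]) simp
  have loc: "loc_lipschitz_fun \<Omega> (\<phi> n)" for n
  proof -
    have "(real (Suc n))-lipschitz_on UNIV (\<lambda>s. max 0 (min 1 (real (Suc n) * (s - t))))"
    proof (rule lipschitz_onI)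
      fix x y
      have "\<bar>max 0 (min 1 (real (Suc n) * (x - t))) - max 0 (min 1 (real (Suc n) * (y - t)))\<bar>
         \<le> \<bar>real (Suc n) * (x - t) - real (Suc n) * (y - t)\<bar>" by linarith
      also have "\<dots> = real (Suc n) * \<bar>x - y\<bar>"
        by (simp only: right_diff_distrib[symmetric] abs_mult) simp
      finally show "dist (max 0 (min 1 (real (Suc n) * (x - t)))) (max 0 (min 1 (real (Suc n) * (y - t))))
        \<le> real (Suc n) * dist x y" by (simp only: dist_real_def)
    qed simp
    then show ?thesis unfolding \<phi>_def by (rule loc_lipschitz_fun_compose[OF v])
  qed
  have conv: "L1_loc_tendsto m \<Omega> \<phi> (indicat_real {x\<in>\<Omega>. t < v x})"
    unfolding L1_loc_tendsto_def Lp_tendsto_def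
  proof (intro ballI exI conjI)
    fix x
    define A where "A = ball x 1 \<inter> \<Omega>"
    have [measurable]: "A \<in> sets borel" unfolding A_def by measurable
    define \<psi> where "\<psi> n y = \<bar>max 0 (min 1 (real (Suc n) * (v' y - t))) - (if t < v' y then 1 else 0)\<bar>" for n y
    have [measurable]: "\<psi> n \<in> borel_measurable borel" for n unfolding \<psi>_def by measurable
    have eq: "(\<integral>\<^sup>+ y. ennreal (\<bar>\<phi> n y - indicat_real {x \<in> \<Omega>. t < v x} y\<bar> powr 1) \<partial>restrict_space m A)
        = (\<integral>\<^sup>+ y. ennreal (\<psi> n y) * indicator A y \<partial>m)" for n
    proof -
      have "(\<integral>\<^sup>+ y. ennreal (\<bar>\<phi> n y - indicat_real {x \<in> \<Omega>. t < v x} y\<bar> powr 1) \<partial>restrict_space m A)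
        = (\<integral>\<^sup>+ y. ennreal (\<bar>\<phi> n y - indicat_real {x \<in> \<Omega>. t < v x} y\<bar> powr 1) * indicator A y \<partial>m)"
        by (rule nn_integral_restrict_space) (simp add: m)
      also have "\<dots> = (\<integral>\<^sup>+ y. ennreal (\<psi> n y) * indicator A y \<partial>m)"
        by (intro nn_integral_cong) (auto simp: \<psi>_def \<phi>_def v'_def A_def indicator_def)
      finally show ?thesis .
    qed
    have "(\<lambda>n. \<integral>\<^sup>+ y. ennreal (\<psi> n y) * indicator A y \<partial>m) \<longlonglongrightarrow> (\<integral>\<^sup>+ y. 0 \<partial>m)"
    proof (rule nn_integral_dominated_convergence)
      show "AE y in m. ennreal (\<psi> n y) * indicator A y \<le> indicator \<Omega> y" for n
      proof (rule AE_I2)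
        fix y
        have "\<psi> n y \<le> 1" unfolding \<psi>_def by auto
        then show "ennreal (\<psi> n y) * indicator A y \<le> indicator \<Omega> y"
          by (auto simp: A_def indicator_def ennreal_le_1)
      qed
      show "AE y in m. (\<lambda>n. ennreal (\<psi> n y) * indicator A y) \<longlonglongrightarrow> 0"
      proof (rule AE_I2)
        fix y
        have "\<forall>\<^sub>F n in sequentially. \<psi> n y = 0"
        proof (cases "t < v' y")
          case True
          obtain N where N: "1 / (v' y - t) < real N" using reals_Archimedean2 by blast
          show ?thesis
          proof (rule eventually_sequentiallyI[of N])
            fix n assume "N \<le> n"
            then have "1 / (v' y - t) \<le> real (Suc n)" using N by simp
            then have "1 \<le> real (Suc n) * (v' y - t)" using True by (simp add: pos_divide_le_eq)
            then show "\<psi> n y = 0" using True unfolding \<psi>_def by simp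
          qed
        next
          case False
          have "\<psi> n y = 0" for n
          proof -
            have "real (Suc n) * (v' y - t) \<le> 0" using False by (intro mult_nonneg_nonpos) simp_all
            then have "max 0 (min 1 (real (Suc n) * (v' y - t))) = 0" by linarith
            then show ?thesis using False unfolding \<psi>_def by (simp only: if_False diff_0_right abs_zero)
          qed
          then show ?thesis by (intro always_eventually allI)
        qed
        then have "\<forall>\<^sub>F n in sequentially. ennreal (\<psi> n y) * indicator A y = 0"
          by eventually_elim simp
        then show "(\<lambda>n. ennreal (\<psi> n y) * indicator A y) \<longlonglongrightarrow> 0" by (rule tendsto_eventually)
      qed
      show "(\<integral>\<^sup>+ y. indicator \<Omega> y \<partial>m) < \<infinity>" using fin by simp
    qed measurable
    then show "(\<lambda>n. \<integral>\<^sup>+ y. ennreal (\<bar>\<phi> n y - indicat_real {x \<in> \<Omega>. t < v x} y\<bar> powr 1) \<partial>restrict_space m (ball x 1 \<inter> \<Omega>)) \<longlonglongrightarrow> 0"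
      unfolding eq[unfolded A_def] A_def by simp
  qed simp
  have "perimeter m {x\<in>\<Omega>. t < v x} \<Omega> \<le> liminf (\<lambda>n. \<integral>\<^sup>+x\<in>\<Omega>. lip (\<phi> n) x \<partial>m)"
    unfolding perimeter_def by (rule INF_lower) (use loc conv in blast)
  also have "\<dots> \<le> liminf (\<lambda>n. \<integral>\<^sup>+x. ennreal (real (Suc n)) * (lip v x * indicator \<Omega> x * indicator {t..t + 1 / real (Suc n)} (v x)) \<partial>m)"
  proof (intro Liminf_mono always_eventually allI nn_integral_mono)
    fix n x
    have "lip (\<phi> n) x \<le> ennreal (real (Suc n)) * (lip v x * indicator {t..t + 1 / real (Suc n)} (v x))" if x: "x \<in> \<Omega>"
    proof -
      have open1: "open {x\<in>\<Omega>. v x < t}" "open {x\<in>\<Omega>. t + 1 / real (Suc n) < v x}"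
        using continuous_on_open_vimage[OF \<Omega>, THEN iffD1, OF cont, rule_format, of "{..<t}"]
          continuous_on_open_vimage[OF \<Omega>, THEN iffD1, OF cont, rule_format, of "{t + 1 / real (Suc n)<..}"]
        by (simp_all add: vimage_def Int_def conj_commute)
      consider "v x < t" | "t + 1 / real (Suc n) < v x" | "v x \<in> {t..t + 1 / real (Suc n)}" by fastforce
      then show ?thesis
      proof cases
        case 1
        have "lip (\<phi> n) x = lip (\<lambda>_. 0) x"
        proof (rule lip_cong)
          have "\<forall>\<^sub>F y in nhds x. y \<in> {x\<in>\<Omega>. v x < t}"
            using open1(1) x 1 by (intro eventually_nhds_in_open) auto
          then show "\<forall>\<^sub>F y in nhds x. \<phi> n y = 0"
          proof eventually_elim
            case (elim y)
            then have "real (Suc n) * (v y - t) \<le> 0" by (intro mult_nonneg_nonpos) simp_all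
            then show ?case by (simp add: \<phi>_def)
          qed
        qed
        then show ?thesis by simp
      next
        case 2
        have "lip (\<phi> n) x = lip (\<lambda>_. 1) x"
        proof (rule lip_cong)
          have "\<forall>\<^sub>F y in nhds x. y \<in> {x\<in>\<Omega>. t + 1 / real (Suc n) < v x}"
            using open1(2) x 2 by (intro eventually_nhds_in_open) auto
          then show "\<forall>\<^sub>F y in nhds x. \<phi> n y = 1"
          proof eventually_elim
            case (elim y)
            then have "1 / real (Suc n) \<le> v y - t" by simp
            then have "1 \<le> real (Suc n) * (v y - t)"
              by (subst (asm) pos_divide_le_eq) (simp_all add: mult.commute)
            then show ?case by (simp add: \<phi>_def)
          qed
        qed
        then show ?thesis by simp
      next
        case 3
        have "lip (\<phi> n) x \<le> ennreal (real (Suc n)) * lip v x"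
        proof (rule lip_mono_increment)
          have "\<bar>\<phi> n y - \<phi> n x\<bar> \<le> real (Suc n) * \<bar>v y - v x\<bar>" for y
          proof -
            have "\<bar>\<phi> n y - \<phi> n x\<bar> \<le> \<bar>real (Suc n) * (v y - t) - real (Suc n) * (v x - t)\<bar>"
              unfolding \<phi>_def by linarith
            also have "\<dots> = real (Suc n) * \<bar>v y - v x\<bar>"
              by (simp only: right_diff_distrib[symmetric] abs_mult) simp
            finally show ?thesis .
          qed
          then show "\<forall>\<^sub>F y in at x. \<bar>\<phi> n y - \<phi> n x\<bar> \<le> real (Suc n) * \<bar>v y - v x\<bar>"
            by (intro always_eventually allI)
        qed simp
        then show ?thesis using 3 by simp
      qed
    qed
    then show "lip (\<phi> n) x * indicator \<Omega> x
        \<le> ennreal (real (Suc n)) * (lip v x * indicator \<Omega> x * indicator {t..t + 1 / real (Suc n)} (v x))"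
      by (cases "x \<in> \<Omega>") simp_all
  qed
  finally show ?thesis .
qed

text \<open>Averaging \<open>perimeter_superlevel_le\<close> over the level \<open>t\<close>: by Tonelli the integral over \<open>t\<close> of the
  right-hand side does not depend on \<open>n\<close>.\<close>

lemma coarea_lower_bound:
  fixes v :: "'a::polish_space \<Rightarrow> real"
  assumes m[measurable_cong]: "sets m = sets borel" and \<Omega>: "open \<Omega>" and fin: "emeasure m \<Omega> < \<infinity>"
    and v: "loc_lipschitz_fun \<Omega> v" and ab: "a \<le> b"
    and \<kappa>: "\<And>t. a < t \<Longrightarrow> t < b \<Longrightarrow> \<kappa> \<le> perimeter m {x\<in>\<Omega>. t < v x} \<Omega>"
  shows "\<kappa> * ennreal (b - a) \<le> (\<integral>\<^sup>+x\<in>{x\<in>\<Omega>. a < v x \<and> v x < b}. lip v x \<partial>m)"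
proof -
  have cont: "continuous_on \<Omega> v" by (rule loc_lipschitz_fun_continuous[OF \<Omega> v])
  have [measurable]: "\<Omega> \<in> sets borel" using \<Omega> by simp
  define v' where "v' x = (if x \<in> \<Omega> then v x else 0)" for x
  have [measurable]: "v' \<in> borel_measurable borel"
    unfolding v'_def by (rule borel_measurable_continuous_on_if[OF _ cont continuous_on_const]) simp
  define l where "l x = lip v x * indicator \<Omega> x" for x
  have [measurable]: "l \<in> borel_measurable borel"
    unfolding l_def by (rule borel_measurable_lip_indicator[OF \<Omega> cont])
  \<comment> \<open>The finite measure that m induces on \<Omega>, to which Tonelli's theorem
    applies.\<close>
  define N where "N = density m (indicator \<Omega>)"
  have sN[measurable_cong]: "sets N = sets borel" by (simp add: N_def m)
  have "emeasure N (space N) = emeasure m \<Omega>"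
    unfolding N_def by (subst emeasure_density) (auto simp: sets_eq_imp_space_eq[OF m] m)
  then interpret N: finite_measure N using fin by (intro finite_measureI) simp
  interpret P: pair_sigma_finite lborel N by standard
  have intN: "(\<integral>\<^sup>+x. f x \<partial>N) = (\<integral>\<^sup>+x. f x * indicator \<Omega> x \<partial>m)" if [measurable]: "f \<in> borel_measurable borel" for f
    unfolding N_def by (subst nn_integral_density) (auto intro!: nn_integral_cong simp: mult.commute)
  \<comment> \<open>A level counts only if its whole strip lies in \<open>(a, b)\<close>.
    Integration over t then picks up no slopes outside \<open>a < v < b\<close>, and every fixed t
    counts for large n.\<close>
  define k where "k n t x = ennreal (real (Suc n)) * (l x * (if t \<le> v' x \<and> v' x \<le> t + 1 / real (Suc n) \<and> a < t \<and> t + 1 / real (Suc n) < b then 1 else 0))" for n t x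
  have [measurable]: "(\<lambda>(t, x). k n t x) \<in> borel_measurable (lborel \<Otimes>\<^sub>M N)" for n
    unfolding k_def by measurable
  have [measurable]: "k n t \<in> borel_measurable borel" for n t unfolding k_def by measurable
  have [measurable]: "(\<lambda>t. k n t x) \<in> borel_measurable borel" for n x unfolding k_def by measurable
  have [measurable]: "(\<lambda>t. \<integral>\<^sup>+x. k n t x \<partial>N) \<in> borel_measurable lborel" for n
    by (rule N.borel_measurable_nn_integral) measurable
  have low: "\<kappa> \<le> liminf (\<lambda>n. \<integral>\<^sup>+x. k n t x \<partial>N)" if t: "a < t" "t < b" for t
  proof -
    have "\<kappa> \<le> liminf (\<lambda>n. \<integral>\<^sup>+x. ennreal (real (Suc n)) *
     (lip v x * indicator \<Omega> x * indicator {t..t + 1 / real (Suc n)} (v x)) \<partial>m)"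
      using \<kappa>[OF t] perimeter_superlevel_le[OF m \<Omega> fin v] by (rule order_trans)
    also have "\<dots> = liminf (\<lambda>n. \<integral>\<^sup>+x. k n t x \<partial>N)"
    proof (rule Liminf_eq)
      have "(\<lambda>n. 1 / real (Suc n)) \<longlonglongrightarrow> 0" by (rule lim_const_over_n[THEN LIMSEQ_Suc])
      then have "\<forall>\<^sub>F n in sequentially. 1 / real (Suc n) < b - t"
        using t by (intro order_tendstoD) auto
      then show "\<forall>\<^sub>F n in sequentially. (\<integral>\<^sup>+x. ennreal (real (Suc n)) *
         (lip v x * indicator \<Omega> x * indicator {t..t + 1 / real (Suc n)} (v x)) \<partial>m) = (\<integral>\<^sup>+x. k n t x \<partial>N)"
      proof eventually_elim
        case (elim n)
        then have elim': "t + 1 / real (Suc n) < b" by linarith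
        show ?case
          unfolding intN[OF \<open>k n t \<in> borel_measurable borel\<close>]
        proof (rule nn_integral_cong)
          fix x
          show "ennreal (real (Suc n)) * (lip v x * indicator \<Omega> x * indicator {t..t + 1 / real (Suc n)} (v x))
              = k n t x * indicator \<Omega> x"
            using elim' t(1) by (cases "x \<in> \<Omega>") (simp_all add: k_def l_def v'_def indicator_def del: of_nat_Suc)
        qed
      qed
    qed
    finally show ?thesis .
  qed
  have up: "(\<integral>\<^sup>+t. (\<integral>\<^sup>+x. k n t x \<partial>N) \<partial>lborel) \<le> (\<integral>\<^sup>+x\<in>{x\<in>\<Omega>. a < v x \<and> v x < b}. lip v x \<partial>m)" for n
  proof -
    have "(\<integral>\<^sup>+t. (\<integral>\<^sup>+x. k n t x \<partial>N) \<partial>lborel) = (\<integral>\<^sup>+x. (\<integral>\<^sup>+t. k n t x \<partial>lborel) \<partial>N)"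
      by (rule P.Fubini'[symmetric]) measurable
    also have "\<dots> \<le> (\<integral>\<^sup>+x. l x * (if a < v' x \<and> v' x < b then 1 else 0) \<partial>N)"
    proof (rule nn_integral_mono)
      fix x
      have "(\<integral>\<^sup>+t. k n t x \<partial>lborel)
         \<le> (\<integral>\<^sup>+t. (ennreal (real (Suc n)) * (l x * (if a < v' x \<and> v' x < b then 1 else 0)))
             * indicator {v' x - 1 / real (Suc n)..v' x} t \<partial>lborel)"
        by (intro nn_integral_mono) (auto simp: k_def indicator_def simp del: of_nat_Suc)
      also have "\<dots> = (ennreal (real (Suc n)) * (l x * (if a < v' x \<and> v' x < b then 1 else 0)))
          * emeasure lborel {v' x - 1 / real (Suc n)..v' x}"
        by (rule nn_integral_cmult_indicator) simp
      also have "emeasure lborel {v' x - 1 / real (Suc n)..v' x} = ennreal (1 / real (Suc n))"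
        by (subst emeasure_lborel_Icc) (simp_all del: of_nat_Suc)
      also have "(ennreal (real (Suc n)) * (l x * (if a < v' x \<and> v' x < b then 1 else 0))) * ennreal (1 / real (Suc n))
         = (ennreal (real (Suc n)) * ennreal (1 / real (Suc n))) * (l x * (if a < v' x \<and> v' x < b then 1 else 0))"
        by (simp only: ac_simps)
      also have "ennreal (real (Suc n)) * ennreal (1 / real (Suc n)) = 1"
        by (subst ennreal_mult[symmetric]) (simp_all del: of_nat_Suc)
      finally show "(\<integral>\<^sup>+t. k n t x \<partial>lborel) \<le> l x * (if a < v' x \<and> v' x < b then 1 else 0)"
        by (simp only: mult_1)
    qed
    also have "\<dots> = (\<integral>\<^sup>+x\<in>{x\<in>\<Omega>. a < v x \<and> v x < b}. lip v x \<partial>m)"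
      by (subst intN) (measurable, auto intro!: nn_integral_cong simp: l_def v'_def indicator_def)
    finally show ?thesis .
  qed
  have "\<kappa> * ennreal (b - a) = (\<integral>\<^sup>+t. \<kappa> * indicator {a<..<b} t \<partial>lborel)"
    using ab by (simp add: nn_integral_cmult_indicator)
  also have "\<dots> \<le> (\<integral>\<^sup>+t. liminf (\<lambda>n. \<integral>\<^sup>+x. k n t x \<partial>N) \<partial>lborel)"
    using low by (intro nn_integral_mono) (simp add: indicator_def)
  also have "\<dots> \<le> liminf (\<lambda>n. \<integral>\<^sup>+t. (\<integral>\<^sup>+x. k n t x \<partial>N) \<partial>lborel)"
    by (rule nn_integral_liminf) measurable
  also have "\<dots> \<le> liminf (\<lambda>n. (\<integral>\<^sup>+x\<in>{x\<in>\<Omega>. a < v x \<and> v x < b}. lip v x \<partial>m))"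
    by (intro Liminf_mono always_eventually allI up)
  also have "\<dots> = (\<integral>\<^sup>+x\<in>{x\<in>\<Omega>. a < v x \<and> v x < b}. lip v x \<partial>m)"
    by (rule Liminf_const) simp
  finally show ?thesis .
qed

section \<open>The half-line\<close>

text \<open>Averaging over translates avoids cutting U into intervals: the bound for
  \<open>[t, t + \<delta>]\<close> is integrated over those t that lie deeper than \<delta> in U,
  and the integrals are exchanged; each s is reached from t in an interval of length \<delta> at
  most. As \<delta> tends to 0 these t exhaust U.\<close>

lemma nn_integral_open_lower_bound:
  fixes g :: "real \<Rightarrow> ennreal"
  assumes [measurable]: "g \<in> borel_measurable borel" and k: "0 \<le> k"
    and le: "\<And>a b. c < a \<Longrightarrow> a < b \<Longrightarrow> b < d \<Longrightarrow> ennreal (k * (b - a)) \<le> (\<integral>\<^sup>+s\<in>{a..b}. g s \<partial>lborel)"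
    and U: "open U" "U \<subseteq> {c<..<d}"
  shows "ennreal k * emeasure lborel U \<le> (\<integral>\<^sup>+s\<in>U. g s \<partial>lborel)"
proof -
  define V where "V n = {t. 1 / real (Suc n) < infdist t (- U)}" for n
  have ne: "- U \<noteq> {}" using U(2) by (metis Compl_empty_eq Compl_eq_Compl_iff greaterThanLessThan_iff less_irrefl subset_iff UNIV_I double_complement)
  have V_open: "open (V n)" for n
    unfolding V_def by (intro open_Collect_less continuous_intros)
  have [measurable]: "V n \<in> sets borel" for n using V_open by simp
  have [measurable]: "U \<in> sets borel" using U(1) by simp
  have V_U: "s \<in> U" if "t \<in> V n" "\<bar>s - t\<bar> \<le> 1 / real (Suc n)" for s t n
  proof (rule ccontr)
    assume "s \<notin> U"
    then have "infdist t (- U) \<le> dist t s" by (intro infdist_le) simp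
    then show False using that unfolding V_def by (simp add: dist_real_def abs_minus_commute del: of_nat_Suc)
  qed
  have step: "ennreal k * emeasure lborel (V n) \<le> (\<integral>\<^sup>+s\<in>U. g s \<partial>lborel)" for n
  proof -
    define \<delta> where "\<delta> = 1 / real (Suc n)"
    have d: "0 < \<delta>" by (simp add: \<delta>_def)
    define f where "f t s = (if t \<in> V n \<and> t \<le> s \<and> s \<le> t + \<delta> then g s else 0)" for t s
    have [measurable]: "(\<lambda>(t, s). f t s) \<in> borel_measurable (lborel \<Otimes>\<^sub>M lborel)" unfolding f_def by measurable
    have "ennreal \<delta> * (ennreal k * emeasure lborel (V n)) = (\<integral>\<^sup>+t. ennreal (k * \<delta>) * indicator (V n) t \<partial>lborel)"
    proof -
      have eq: "(\<integral>\<^sup>+t. ennreal (k * \<delta>) * indicator (V n) t \<partial>lborel) = ennreal (k * \<delta>) * emeasure lborel (V n)"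
        by (rule nn_integral_cmult_indicator) simp
      have eq2: "ennreal (k * \<delta>) = ennreal \<delta> * ennreal k"
        using ennreal_mult[OF k less_imp_le[OF d]] by (simp only: mult.commute)
      show ?thesis unfolding eq unfolding eq2 by (simp only: mult.assoc)
    qed
    also have "\<dots> \<le> (\<integral>\<^sup>+t. (\<integral>\<^sup>+s. f t s \<partial>lborel) \<partial>lborel)"
    proof (rule nn_integral_mono)
      fix t
      show "ennreal (k * \<delta>) * indicator (V n) t \<le> (\<integral>\<^sup>+s. f t s \<partial>lborel)"
      proof (cases "t \<in> V n")
        case True
        have "t \<in> U" "t + \<delta> \<in> U" using V_U[OF True, of t] V_U[OF True, of "t + \<delta>"] d by (simp_all add: \<delta>_def)
        then have "ennreal (k * (t + \<delta> - t)) \<le> (\<integral>\<^sup>+s\<in>{t..t + \<delta>}. g s \<partial>lborel)"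
          using U(2) d by (intro le) auto
        also have "\<dots> = (\<integral>\<^sup>+s. f t s \<partial>lborel)"
          using True by (intro nn_integral_cong) (simp add: f_def indicator_def)
        finally show ?thesis using True by simp
      qed simp
    qed
    also have "\<dots> = (\<integral>\<^sup>+s. (\<integral>\<^sup>+t. f t s \<partial>lborel) \<partial>lborel)"
      by (rule lborel_pair.Fubini'[symmetric]) measurable
    also have "\<dots> \<le> (\<integral>\<^sup>+s. ennreal \<delta> * (g s * indicator U s) \<partial>lborel)"
    proof (rule nn_integral_mono)
      fix s
      have "(\<integral>\<^sup>+t. f t s \<partial>lborel) \<le> (\<integral>\<^sup>+t. (g s * indicator U s) * indicator {s - \<delta>..s} t \<partial>lborel)"
      proof (rule nn_integral_mono)
        fix t
        show "f t s \<le> (g s * indicator U s) * indicator {s - \<delta>..s} t"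
          using V_U[of t n s] by (cases "t \<in> V n \<and> t \<le> s \<and> s \<le> t + \<delta>") (auto simp: f_def \<delta>_def indicator_def simp del: of_nat_Suc)
      qed
      also have "\<dots> = (g s * indicator U s) * ennreal \<delta>"
        using d by (simp add: nn_integral_cmult_indicator)
      finally show "(\<integral>\<^sup>+t. f t s \<partial>lborel) \<le> ennreal \<delta> * (g s * indicator U s)" by (simp add: ac_simps)
    qed
    also have "\<dots> = ennreal \<delta> * (\<integral>\<^sup>+s\<in>U. g s \<partial>lborel)"
      by (rule nn_integral_cmult) measurable
    finally have "ennreal (1 / \<delta>) * (ennreal \<delta> * (ennreal k * emeasure lborel (V n)))
        \<le> ennreal (1 / \<delta>) * (ennreal \<delta> * (\<integral>\<^sup>+s\<in>U. g s \<partial>lborel))"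
      by (rule mult_left_mono) simp
    moreover have "ennreal (1 / \<delta>) * (ennreal \<delta> * X) = X" for X
      using d by (simp add: mult.assoc[symmetric] ennreal_mult[symmetric])
    ultimately show ?thesis by (simp only:)
  qed
  have "(SUP n. emeasure lborel (V n)) = emeasure lborel (\<Union>n. V n)"
  proof (rule SUP_emeasure_incseq)
    show "incseq V"
    proof (rule incseq_SucI, rule subsetI)
      fix n t assume "t \<in> V n"
      moreover have "1 / real (Suc (Suc n)) \<le> 1 / real (Suc n)" by (intro divide_left_mono) simp_all
      ultimately show "t \<in> V (Suc n)" unfolding V_def mem_Collect_eq by linarith
    qed
  qed (use V_open in auto)
  also have "(\<Union>n. V n) = U"
  proof safe
    fix t n assume "t \<in> V n" then show "t \<in> U" by (rule V_U) simp
  next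
    fix t assume t: "t \<in> U"
    have "0 < infdist t (- U)"
      using infdist_pos_not_in_closed[of "- U" t] t U(1) ne by auto
    then obtain n where "1 / real (Suc n) < infdist t (- U)" using nat_approx_posE by blast
    then show "t \<in> (\<Union>n. V n)" unfolding V_def by blast
  qed
  finally have eq: "emeasure lborel U = (SUP n. emeasure lborel (V n))" by (rule sym)
  have "ennreal k * emeasure lborel U = (SUP n. ennreal k * emeasure lborel (V n))"
    unfolding eq by (rule SUP_mult_left_ennreal)
  also have "\<dots> \<le> (\<integral>\<^sup>+s\<in>U. g s \<partial>lborel)" by (intro SUP_least step)
  finally show ?thesis .
qed

text \<open>Takes the place of Lebesgue's differentiation theorem. The measure with density g on the
  interval is finite and hence outer regular, so the bound passes from open sets to the Borel set A
  where g < k. There it forces g = k almost everywhere, so A is a null set.\<close>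

lemma AE_ge_of_interval_integrals:
  fixes g :: "real \<Rightarrow> ennreal"
  assumes gm[measurable]: "g \<in> borel_measurable borel" and k: "0 \<le> k"
    and le: "\<And>a b. c < a \<Longrightarrow> a < b \<Longrightarrow> b < d \<Longrightarrow> ennreal (k * (b - a)) \<le> (\<integral>\<^sup>+s\<in>{a..b}. g s \<partial>lborel)"
    and fin: "(\<integral>\<^sup>+s\<in>{c<..<d}. g s \<partial>lborel) < \<infinity>"
  shows "AE s in lborel. c < s \<and> s < d \<longrightarrow> ennreal k \<le> g s"
proof -
  define M where "M = density lborel (\<lambda>s. g s * indicator {c<..<d} s)"
  have eM: "emeasure M A = (\<integral>\<^sup>+s\<in>A. g s * indicator {c<..<d} s \<partial>lborel)" if "A \<in> sets borel" for A
    unfolding M_def by (rule emeasure_density) (use that in simp_all)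
  define A where "A = {s \<in> {c<..<d}. g s < ennreal k}"
  have [measurable]: "A \<in> sets borel" unfolding A_def by measurable
  have "emeasure lborel A \<le> emeasure lborel {c<..<d}" by (intro emeasure_mono) (auto simp: A_def)
  also have "\<dots> < \<infinity>" by (cases "c \<le> d") simp_all
  finally have finA: "emeasure lborel A < \<infinity>" .
  have "emeasure M A = (INF U\<in>{U. A \<subseteq> U \<and> open U}. emeasure M U)"
  proof (rule outer_regular)
    show "sets M = sets borel" by (simp add: M_def)
    show "emeasure M (space M) \<noteq> \<infinity>" using fin eM[of UNIV] by (simp add: M_def less_top)
  qed simp
  also have "ennreal k * emeasure lborel A \<le> \<dots>"
    proof (rule INF_greatest)
      fix U assume "U \<in> {U. A \<subseteq> U \<and> open U}"
      then have U: "A \<subseteq> U \<inter> {c<..<d}" "open (U \<inter> {c<..<d})" "open U" by (auto simp: A_def)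
      have "ennreal k * emeasure lborel A \<le> ennreal k * emeasure lborel (U \<inter> {c<..<d})"
        using U by (intro mult_left_mono emeasure_mono) auto
      also have "\<dots> \<le> (\<integral>\<^sup>+s\<in>U \<inter> {c<..<d}. g s \<partial>lborel)"
        by (rule nn_integral_open_lower_bound[OF gm k le U(2)]) auto
      also have "\<dots> = emeasure M U"
        using U(3) by (subst eM) (auto intro!: nn_integral_cong simp: indicator_def)
      finally show "ennreal k * emeasure lborel A \<le> emeasure M U" .
    qed
  also have "emeasure M A = (\<integral>\<^sup>+s. g s * indicator A s \<partial>lborel)"
    by (subst eM) (auto intro!: nn_integral_cong simp: indicator_def A_def)
  finally have ge: "ennreal k * emeasure lborel A \<le> (\<integral>\<^sup>+s. g s * indicator A s \<partial>lborel)" .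
  have le': "(\<integral>\<^sup>+s. g s * indicator A s \<partial>lborel) \<le> (\<integral>\<^sup>+s. ennreal k * indicator A s \<partial>lborel)"
    by (intro nn_integral_mono) (auto simp: indicator_def A_def)
  have eq: "(\<integral>\<^sup>+s. ennreal k * indicator A s \<partial>lborel) = ennreal k * emeasure lborel A"
    by (rule nn_integral_cmult_indicator) simp
  have "AE s in lborel. ennreal k * indicator A s \<le> g s * indicator A s"
  proof (rule AE_le_of_nn_integral_eq)
    show "AE s in lborel. g s * indicator A s \<le> ennreal k * indicator A s"
      by (intro AE_I2) (auto simp: indicator_def A_def)
    show "(\<integral>\<^sup>+s. ennreal k * indicator A s \<partial>lborel) = (\<integral>\<^sup>+s. g s * indicator A s \<partial>lborel)"
      using ge le' unfolding eq by (rule antisym)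
    have "ennreal k * emeasure lborel A < \<infinity>" using finA by (simp add: ennreal_mult_less_top)
    then show "(\<integral>\<^sup>+s. g s * indicator A s \<partial>lborel) < \<infinity>" using le' unfolding eq by (rule order_le_less_trans[rotated])
  qed measurable
  then show ?thesis
  proof eventually_elim
    case (elim s)
    show ?case
    proof (rule impI, rule ccontr)
      assume "c < s \<and> s < d" "\<not> ennreal k \<le> g s"
      then have "s \<in> A" "g s < ennreal k" by (auto simp: A_def not_le)
      with elim show False by simp
    qed
  qed
qed

section \<open>Integration on the half-line\<close>

definition hl :: "real \<Rightarrow> halfline" where
  "hl t = Halfline (max 0 t)"

lemma coord_hl [simp]: "coord (hl t) = max 0 t"
  by (simp add: hl_def Halfline_inverse)

lemma hl_coord [simp]: "hl (coord x) = x"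
  using coord[of x] by (simp add: hl_def coord_inverse)

lemma coord_nonneg [simp]: "0 \<le> coord x"
  using coord[of x] by simp

lemma dist_hl: "dist (hl s) (hl t) = \<bar>max 0 s - max 0 t\<bar>"
  by (simp add: dist_halfline_def)

lemma continuous_on_hl: "continuous_on A hl"
  unfolding hl_def by (intro continuous_on_compose2[OF continuous_on_Halfline] continuous_intros) auto

lemma borel_measurable_hl [measurable]: "hl \<in> borel_measurable borel"
  by (intro borel_measurable_continuous_onI continuous_on_hl)

lemma borel_measurable_coord [measurable]: "coord \<in> borel_measurable borel"
  by (intro borel_measurable_continuous_onI continuous_on_coord)

lemma sets_model_measure [simp, measurable_cong]: "sets (model_measure Q) = sets borel"
  by (simp add: model_measure_def)

lemma space_model_measure [simp]: "space (model_measure Q) = UNIV"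
  by (simp add: model_measure_def)

definition mweight :: "real \<Rightarrow> real \<Rightarrow> real" where
  "mweight Q t = Q * unit_ball_vol Q * t powr (Q - 1)"

lemma borel_measurable_mweight [measurable]: "mweight Q \<in> borel_measurable borel"
  unfolding mweight_def by measurable

lemma nn_integral_model_measure:
  assumes [measurable]: "f \<in> borel_measurable borel"
  shows "(\<integral>\<^sup>+x. f x \<partial>model_measure Q) = (\<integral>\<^sup>+t. ennreal (mweight Q t) * f (hl t) * indicator {0..} t \<partial>lborel)"
proof -
  have H: "Halfline \<in> borel_measurable (restrict_space lborel {0..})"
    using borel_measurable_continuous_on_restrict[OF continuous_on_Halfline]
    by (simp cong: measurable_cong_sets add: measurable_cong_sets[OF sets_restrict_space_cong[OF sets_lborel] refl])
  have [measurable]: "(\<lambda>t. ennreal (Q * unit_ball_vol Q * t powr (Q - 1))) \<in> borel_measurable (restrict_space lborel {0..})"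
    by (intro measurable_restrict_space1) measurable
  have "(\<integral>\<^sup>+x. f x \<partial>model_measure Q) = (\<integral>\<^sup>+t. f (Halfline t)
      \<partial>density (restrict_space lborel {0..}) (\<lambda>t. ennreal (Q * unit_ball_vol Q * t powr (Q - 1))))"
    unfolding model_measure_def by (rule nn_integral_distr) (use H in simp_all)
  also have "\<dots> = (\<integral>\<^sup>+t. ennreal (Q * unit_ball_vol Q * t powr (Q - 1)) * f (Halfline t) \<partial>restrict_space lborel {0..})"
    by (rule nn_integral_density) (use H in \<open>measurable\<close>)
  also have "\<dots> = (\<integral>\<^sup>+t. ennreal (Q * unit_ball_vol Q * t powr (Q - 1)) * f (Halfline t) * indicator {0..} t \<partial>lborel)"
    by (rule nn_integral_restrict_space) simp
  also have "\<dots> = (\<integral>\<^sup>+t. ennreal (mweight Q t) * f (hl t) * indicator {0..} t \<partial>lborel)"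
    by (intro nn_integral_cong) (simp add: mweight_def hl_def indicator_def)
  finally show ?thesis .
qed

lemma mweight_pos: "0 < Q \<Longrightarrow> 0 < t \<Longrightarrow> 0 < mweight Q t"
  unfolding mweight_def by (intro mult_pos_pos) simp_all

lemma mweight_nonneg: "0 < Q \<Longrightarrow> 0 \<le> mweight Q t"
  unfolding mweight_def by (intro mult_nonneg_nonneg) simp_all

lemma mweight_mono: "1 < Q \<Longrightarrow> 0 \<le> s \<Longrightarrow> s \<le> t \<Longrightarrow> mweight Q s \<le> mweight Q t"
  unfolding mweight_def by (intro mult_left_mono powr_mono2 mult_nonneg_nonneg) simp_all

lemma nn_integral_mweight_Icc:
  assumes Q: "1 < Q" and ab: "0 < a" "a \<le> b"
  shows "(\<integral>\<^sup>+t. ennreal (mweight Q t) * indicator {a..b} t \<partial>lborel)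
    = ennreal (unit_ball_vol Q * (b powr Q - a powr Q))"
proof -
  have "(\<integral>\<^sup>+t. ennreal (mweight Q t) * indicator {a..b} t \<partial>lborel)
      = ennreal (unit_ball_vol Q * b powr Q - unit_ball_vol Q * a powr Q)"
  proof (rule nn_integral_FTC_Icc[OF borel_measurable_mweight _ _ ab(2)])
    fix t assume t: "t \<in> {a..b}"
    then have "t > 0" using ab by simp
    then show "((\<lambda>t. unit_ball_vol Q * t powr Q) has_real_derivative mweight Q t) (at t)"
      unfolding mweight_def by (auto intro!: derivative_eq_intros)
    show "0 \<le> mweight Q t" using Q by (intro mweight_nonneg) simp
  qed
  then show ?thesis by (simp only: right_diff_distrib)
qed

lemma emeasure_model_measure_ball:
  assumes Q: "1 < Q" and s: "0 \<le> s"
  shows "emeasure (model_measure Q) {x. coord x < s} = ennreal (unit_ball_vol Q * s powr Q)"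
proof -
  have [measurable]: "{x. coord x < s} \<in> sets borel" by measurable
  have "emeasure (model_measure Q) {x. coord x < s} = (\<integral>\<^sup>+x. indicator {x. coord x < s} x \<partial>model_measure Q)"
    by (rule nn_integral_indicator[symmetric]) simp
  also have "\<dots> = (\<integral>\<^sup>+t. ennreal (mweight Q t) * indicator {x. coord x < s} (hl t) * indicator {0..} t \<partial>lborel)"
    by (rule nn_integral_model_measure) measurable
  also have "\<dots> = (\<integral>\<^sup>+t. ennreal (Q * unit_ball_vol Q) * ennreal (if t \<in> {0..s} then t powr (Q - 1) else 0) \<partial>lborel)"
  proof (rule nn_integral_cong_AE)
    have "AE t in lborel. t \<noteq> s" by (rule AE_lborel_singleton)
    then show "AE t in lborel. ennreal (mweight Q t) * indicator {x. coord x < s} (hl t) * indicator {0..} t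
        = ennreal (Q * unit_ball_vol Q) * ennreal (if t \<in> {0..s} then t powr (Q - 1) else 0)"
    proof eventually_elim
      case (elim t)
      show ?case
      proof (cases "t \<in> {0..s}")
        case True
        then show ?thesis
          using elim Q by (simp add: indicator_def mweight_def ennreal_mult)
      next
        case False
        then show ?thesis by (auto simp: indicator_def)
      qed
    qed
  qed
  also have "\<dots> = ennreal (Q * unit_ball_vol Q) * (\<integral>\<^sup>+t. ennreal (if t \<in> {0..s} then t powr (Q - 1) else 0) \<partial>lborel)"
    by (rule nn_integral_cmult) measurable
  also have "(\<integral>\<^sup>+t. ennreal (if t \<in> {0..s} then t powr (Q - 1) else 0) \<partial>lborel) = ennreal (s powr Q / Q)"
  proof (rule nn_integral_has_integral_lborel)
    have "((\<lambda>t. t powr (Q - 1)) has_integral (s powr (Q - 1 + 1) / (Q - 1 + 1))) {0..s}"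
      using Q s by (intro has_integral_powr_from_0) simp_all
    then show "((\<lambda>t. if t \<in> {0..s} then t powr (Q - 1) else 0) has_integral s powr Q / Q) UNIV"
      unfolding has_integral_restrict_UNIV by simp
  qed simp_all
  also have "ennreal (Q * unit_ball_vol Q) * ennreal (s powr Q / Q) = ennreal (unit_ball_vol Q * s powr Q)"
    using Q by (subst ennreal_mult[symmetric]) simp_all
  finally show ?thesis .
qed

text \<open>The weight is positive away from the origin, so null sets of the model measure are
  Lebesgue null sets there.\<close>

lemma AE_model_measureD:
  assumes Q: "1 < Q" and P: "AE x in model_measure Q. P x"
  shows "AE t in lborel. 0 < t \<longrightarrow> P (hl t)"
proof -
  from P obtain N where N: "{x. \<not> P x} \<subseteq> N" "N \<in> sets borel" "emeasure (model_measure Q) N = 0"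
    by (elim AE_E) auto
  note [measurable] = N(2)
  have "(\<integral>\<^sup>+t. ennreal (mweight Q t) * indicator N (hl t) * indicator {0..} t \<partial>lborel) = (\<integral>\<^sup>+x. indicator N x \<partial>model_measure Q)"
    by (rule nn_integral_model_measure[symmetric]) measurable
  also have "\<dots> = 0" using N(2,3) by simp
  finally have "AE t in lborel. ennreal (mweight Q t) * indicator N (hl t) * indicator {0..} t = 0"
    by (subst (asm) nn_integral_0_iff_AE) measurable
  then show ?thesis
  proof eventually_elim
    case (elim t)
    show ?case
    proof
      assume t: "0 < t"
      then have "0 < mweight Q t" using Q by (intro mweight_pos) simp_all
      with elim t have "indicator N (hl t) = (0::ennreal)" by simp
      then have "hl t \<notin> N" by (simp add: indicator_def split: if_splits)
      then show "P (hl t)" using N(1) by auto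
    qed
  qed
qed

lemma AE_model_measureI:
  assumes Q: "1 < Q" and [measurable]: "{x. \<not> P x} \<in> sets borel"
    and P: "AE t in lborel. 0 < t \<longrightarrow> P (hl t)"
  shows "AE x in model_measure Q. P x"
proof (rule AE_I[OF subset_refl])
  have "emeasure (model_measure Q) {x. \<not> P x} = (\<integral>\<^sup>+x. indicator {x. \<not> P x} x \<partial>model_measure Q)"
    by (rule nn_integral_indicator[symmetric]) simp
  also have "\<dots> = (\<integral>\<^sup>+t. ennreal (mweight Q t) * indicator {x. \<not> P x} (hl t) * indicator {0..} t \<partial>lborel)"
    by (rule nn_integral_model_measure) measurable
  also have "\<dots> = (\<integral>\<^sup>+(t::real). 0 \<partial>lborel)"
  proof (rule nn_integral_cong_AE)
    have "AE t in lborel. t \<noteq> (0::real)" by (rule AE_lborel_singleton)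
    with P show "AE t in lborel. ennreal (mweight Q t) * indicator {x. \<not> P x} (hl t) * indicator {0..} t = 0"
      by eventually_elim (auto simp: indicator_def)
  qed
  finally show "emeasure (model_measure Q) {x \<in> space (model_measure Q). \<not> P x} = 0" by simp
qed simp

section \<open>Segments of the half-line as curves, and their modulus\<close>

lemma sum_dist_sorted_le:
  fixes ts :: "real list"
  assumes "sorted ts" "set ts \<subseteq> {s..t}" "s \<le> t"
  shows "(\<Sum>i<length ts - 1. ts ! Suc i - ts ! i) \<le> t - s"
proof (cases ts)
  case Nil
  then show ?thesis using assms by simp
next
  case (Cons a as)
  have "(\<Sum>i<length ts - 1. ts ! Suc i - ts ! i) = ts ! (length ts - 1) - ts ! 0"
    by (rule sum_lessThan_telescope)
  moreover have "ts ! (length ts - 1) \<in> {s..t}"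
    by (intro subsetD[OF assms(2)] nth_mem) (simp add: Cons)
  moreover have "ts ! 0 \<in> {s..t}"
    by (intro subsetD[OF assms(2)] nth_mem) (simp add: Cons)
  ultimately show ?thesis by simp
qed

lemma hl_segment_rect_curve:
  assumes "0 \<le> a" "a < b"
  shows "(b - a, \<lambda>t. hl (a + t)) \<in> rect_curves"
proof -
  have "curve_length (\<lambda>t. hl (a + t)) s t = ennreal (t - s)" if st: "0 \<le> s" "s \<le> t" "t \<le> b - a" for s t
    unfolding curve_length_def
  proof (rule antisym)
    show "(SUP ts\<in>{ts. sorted ts \<and> set ts \<subseteq> {s..t}}. \<Sum>i<length ts - 1. ennreal (dist (hl (a + ts ! i)) (hl (a + ts ! Suc i)))) \<le> ennreal (t - s)"
    proof (rule SUP_least, clarify)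
      fix ts :: "real list" assume ts: "sorted ts" "set ts \<subseteq> {s..t}"
      have dist_eq: "dist (hl (a + ts ! i)) (hl (a + ts ! Suc i)) = ts ! Suc i - ts ! i" if "i < length ts - 1" for i
      proof -
        have "ts ! i \<in> set ts" "ts ! Suc i \<in> set ts" using that by auto
        then have "0 \<le> ts ! i" "0 \<le> ts ! Suc i" using ts(2) st(1) by force+
        moreover have "ts ! i \<le> ts ! Suc i" using ts(1) that by (intro sorted_nth_mono) auto
        ultimately show ?thesis using assms by (simp add: dist_hl)
      qed
      have "(\<Sum>i<length ts - 1. ennreal (dist (hl (a + ts ! i)) (hl (a + ts ! Suc i))))
          = ennreal (\<Sum>i<length ts - 1. dist (hl (a + ts ! i)) (hl (a + ts ! Suc i)))"
        by (intro sum_ennreal) simp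
      also have "(\<Sum>i<length ts - 1. dist (hl (a + ts ! i)) (hl (a + ts ! Suc i))) = (\<Sum>i<length ts - 1. ts ! Suc i - ts ! i)"
        by (intro sum.cong refl dist_eq) (simp only: lessThan_iff)
      also have "ennreal \<dots> \<le> ennreal (t - s)"
        by (intro ennreal_leI sum_dist_sorted_le ts st)
      finally show "(\<Sum>i<length ts - 1. ennreal (dist (hl (a + ts ! i)) (hl (a + ts ! Suc i)))) \<le> ennreal (t - s)" .
    qed
    have "ennreal (t - s) = (\<Sum>i<length [s, t] - 1. ennreal (dist (hl (a + [s, t] ! i)) (hl (a + [s, t] ! Suc i))))"
      using st assms by (simp add: dist_hl)
    also have "\<dots> \<le> (SUP ts\<in>{ts. sorted ts \<and> set ts \<subseteq> {s..t}}. \<Sum>i<length ts - 1. ennreal (dist (hl (a + ts ! i)) (hl (a + ts ! Suc i))))"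
      by (rule SUP_upper) (use st in simp)
    finally show "ennreal (t - s) \<le> (SUP ts\<in>{ts. sorted ts \<and> set ts \<subseteq> {s..t}}. \<Sum>i<length ts - 1. ennreal (dist (hl (a + ts ! i)) (hl (a + ts ! Suc i))))" .
  qed
  then show ?thesis using assms unfolding rect_curves_def by simp
qed

lemma curve_integral_hl_segment:
  assumes [measurable]: "\<rho> \<in> borel_measurable borel"
  shows "curve_integral (b - a, \<lambda>t. hl (a + t)) \<rho> = (\<integral>\<^sup>+s\<in>{a..b}. \<rho> (hl s) \<partial>lborel)"
proof -
  have "(\<integral>\<^sup>+s\<in>{a..b}. \<rho> (hl s) \<partial>lborel)
     = ennreal \<bar>1\<bar> * (\<integral>\<^sup>+t. \<rho> (hl (a + 1 * t)) * indicator {a..b} (a + 1 * t) \<partial>lborel)"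
  proof (rule nn_integral_real_affine)
    show "(\<lambda>s. \<rho> (hl s) * indicator {a..b} s) \<in> borel_measurable borel" by measurable
  qed simp
  also have "\<dots> = (\<integral>\<^sup>+t\<in>{0..b - a}. \<rho> (hl (a + t)) \<partial>lborel)"
    by (auto intro!: nn_integral_cong simp: indicator_def)
  finally show ?thesis by (simp add: curve_integral_def)
qed

text \<open>Either x is at most \<theta>, or \<open>(x / \<theta>) powr (p - 1)\<close> is at least
  1. The free threshold \<theta> does the work of Hoelder's inequality, for infinite x as
  well.\<close>

lemma le_add_epowr:
  assumes "1 < p" "0 < \<theta>"
  shows "x \<le> ennreal \<theta> + ennreal (\<theta> powr (1 - p)) * epowr x p"
proof (cases "x \<le> ennreal \<theta>")
  case True
  then show ?thesis by (simp add: add_increasing2)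
next
  case False
  show ?thesis
  proof (cases x)
    case (real r)
    then have r: "\<theta> < r" using False assms by (simp add: ennreal_less_iff not_le)
    have "\<theta> powr (p - 1) \<le> r powr (p - 1)" using r assms by (intro powr_mono2) auto
    then have "\<theta> powr (1 - p) * \<theta> powr (p - 1) * r \<le> \<theta> powr (1 - p) * r powr (p - 1) * r"
      using r assms by (intro mult_right_mono mult_left_mono) auto
    moreover have "\<theta> powr (1 - p) * \<theta> powr (p - 1) = 1"
      using assms by (simp add: powr_add[symmetric])
    moreover have "r powr (p - 1) * r = r powr p"
      using r assms by (simp add: powr_mult_base powr_diff)
    ultimately have "r \<le> \<theta> powr (1 - p) * r powr p" by (simp add: mult.assoc)
    then have "ennreal r \<le> ennreal (\<theta> powr (1 - p)) * ennreal (r powr p)"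
      by (simp add: ennreal_mult[symmetric] ennreal_leI)
    then show ?thesis using real by (simp add: epowr_ennreal add_increasing)
  next
    case top
    then show ?thesis using assms by (simp add: ennreal_mult_top)
  qed
qed

text \<open>Since Q > 1 the weight increases, so it is at least \<open>mweight Q a\<close> on the
  segment, and Lebesgue integrals along the segment are controlled by the energy in the model space.
  At the origin the weight vanishes and the control is lost; hence a > 0.\<close>

lemma segment_integral_le_energy:
  assumes Q: "1 < Q" and p: "1 < p" and \<theta>: "0 < \<theta>" and ab: "0 < a" "a \<le> b"
    and [measurable]: "\<rho> \<in> borel_measurable borel"
  shows "(\<integral>\<^sup>+s\<in>{a..b}. \<rho> (hl s) \<partial>lborel)
    \<le> ennreal (\<theta> * (b - a)) + ennreal (\<theta> powr (1 - p) / mweight Q a) * (\<integral>\<^sup>+x. epowr (\<rho> x) p \<partial>model_measure Q)"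
proof -
  have wa: "0 < mweight Q a" using Q ab by (intro mweight_pos) simp_all
  have "(\<integral>\<^sup>+s\<in>{a..b}. \<rho> (hl s) \<partial>lborel) \<le> (\<integral>\<^sup>+s. ennreal \<theta> * indicator {a..b} s
      + ennreal (\<theta> powr (1 - p) / mweight Q a) * (ennreal (mweight Q s) * epowr (\<rho> (hl s)) p * indicator {0..} s) \<partial>lborel)"
  proof (rule nn_integral_mono)
    fix s
    show "\<rho> (hl s) * indicator {a..b} s \<le> ennreal \<theta> * indicator {a..b} s
      + ennreal (\<theta> powr (1 - p) / mweight Q a) * (ennreal (mweight Q s) * epowr (\<rho> (hl s)) p * indicator {0..} s)"
    proof (cases "s \<in> {a..b}")
      case True
      have "mweight Q a \<le> mweight Q s" using Q ab True by (intro mweight_mono) auto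
      then have "\<theta> powr (1 - p) \<le> \<theta> powr (1 - p) / mweight Q a * mweight Q s"
        using wa by (simp add: pos_le_divide_eq mult_left_mono)
      then have "ennreal (\<theta> powr (1 - p)) \<le> ennreal (\<theta> powr (1 - p) / mweight Q a) * ennreal (mweight Q s)"
        using wa Q by (subst ennreal_mult[symmetric]) (simp_all add: mweight_nonneg ennreal_leI)
      then have "ennreal (\<theta> powr (1 - p)) * epowr (\<rho> (hl s)) p
          \<le> (ennreal (\<theta> powr (1 - p) / mweight Q a) * ennreal (mweight Q s)) * epowr (\<rho> (hl s)) p"
        by (rule mult_right_mono) simp
      then have "\<rho> (hl s) \<le> ennreal \<theta> + (ennreal (\<theta> powr (1 - p) / mweight Q a) * ennreal (mweight Q s)) * epowr (\<rho> (hl s)) p"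
        using le_add_epowr[OF p \<theta>, of "\<rho> (hl s)"] by (meson add_left_mono order_trans)
      then show ?thesis using True ab by (simp add: mult.assoc)
    qed simp
  qed
  also have "\<dots> = (\<integral>\<^sup>+s. ennreal \<theta> * indicator {a..b} s \<partial>lborel)
      + (\<integral>\<^sup>+s. ennreal (\<theta> powr (1 - p) / mweight Q a) * (ennreal (mweight Q s) * epowr (\<rho> (hl s)) p * indicator {0..} s) \<partial>lborel)"
    by (rule nn_integral_add) measurable
  also have "(\<integral>\<^sup>+s. ennreal \<theta> * indicator {a..b} s \<partial>lborel) = ennreal \<theta> * emeasure lborel {a..b}"
    by (rule nn_integral_cmult_indicator) simp
  also have "\<dots> = ennreal (\<theta> * (b - a))"
    using ab \<theta> by (simp add: ennreal_mult)
  also have "(\<integral>\<^sup>+s. ennreal (\<theta> powr (1 - p) / mweight Q a) * (ennreal (mweight Q s) * epowr (\<rho> (hl s)) p * indicator {0..} s) \<partial>lborel)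
     = ennreal (\<theta> powr (1 - p) / mweight Q a) * (\<integral>\<^sup>+s. ennreal (mweight Q s) * epowr (\<rho> (hl s)) p * indicator {0..} s \<partial>lborel)"
    by (rule nn_integral_cmult) measurable
  also have "(\<integral>\<^sup>+s. ennreal (mweight Q s) * epowr (\<rho> (hl s)) p * indicator {0..} s \<partial>lborel) = (\<integral>\<^sup>+x. epowr (\<rho> x) p \<partial>model_measure Q)"
    by (rule nn_integral_model_measure[symmetric]) measurable
  finally show ?thesis .
qed

lemma segment_not_exceptional:
  assumes Q: "1 < Q" and p: "1 < p" and ab: "0 < a" "a < b" and \<Gamma>: "modulus p (model_measure Q) \<Gamma> = 0"
  shows "(b - a, \<lambda>t. hl (a + t)) \<notin> \<Gamma>"
proof
  assume in\<Gamma>: "(b - a, \<lambda>t. hl (a + t)) \<in> \<Gamma>"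
  \<comment> \<open>With this threshold the two parts of the bound are 1/2 and at most 1/4, so an
    admissible \<open>\<rho>\<close> of energy below \<open>1 / (4 * K)\<close> would make 1 at most
    3/4.\<close>
  define \<theta> where "\<theta> = 1 / (2 * (b - a))"
  have \<theta>: "0 < \<theta>" "\<theta> * (b - a) = 1 / 2" using ab by (simp_all add: \<theta>_def)
  define K where "K = \<theta> powr (1 - p) / mweight Q a"
  have K: "0 < K" unfolding K_def using \<theta> mweight_pos[of Q a] Q ab by simp
  have "modulus p (model_measure Q) \<Gamma> < ennreal (1 / (4 * K))" unfolding \<Gamma> using K by simp
  then obtain \<rho> where \<rho>: "\<rho> \<in> borel_measurable borel" "\<And>c. c \<in> \<Gamma> \<Longrightarrow> 1 \<le> curve_integral c \<rho>"
    "(\<integral>\<^sup>+x. epowr (\<rho> x) p \<partial>model_measure Q) < ennreal (1 / (4 * K))"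
    unfolding modulus_def by (auto simp: INF_less_iff)
  have "1 \<le> (\<integral>\<^sup>+s\<in>{a..b}. \<rho> (hl s) \<partial>lborel)"
    using \<rho>(2)[OF in\<Gamma>] by (simp only: curve_integral_hl_segment[OF \<rho>(1)])
  also have "\<dots> \<le> ennreal (\<theta> * (b - a)) + ennreal K * (\<integral>\<^sup>+x. epowr (\<rho> x) p \<partial>model_measure Q)"
    unfolding K_def using ab by (intro segment_integral_le_energy Q p \<theta> \<rho>(1)) simp_all
  also have "\<dots> \<le> ennreal (1 / 2) + ennreal K * ennreal (1 / (4 * K))"
    unfolding \<theta>(2) using \<rho>(3) by (intro add_left_mono mult_left_mono) simp_all
  also have "ennreal K * ennreal (1 / (4 * K)) = ennreal (1 / 4)"
    using K by (subst ennreal_mult[symmetric]) simp_all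
  also have "ennreal (1 / 2) + ennreal (1 / 4) = ennreal (3 / 4)"
    by (subst ennreal_plus[symmetric]) simp_all
  finally have "ennreal 1 \<le> ennreal (3 / 4)" by (simp only: ennreal_1)
  then show False by (subst (asm) ennreal_le_iff) simp_all
qed

text \<open>The representative for which the inequality holds along curves agrees with F only almost
  everywhere. The endpoints are therefore moved inwards to points of agreement; the segment between
  these is not exceptional, and the lost length costs at most e.\<close>

lemma weak_upper_gradient_segment:
  assumes Q: "1 < Q" and p: "1 < p" and F: "weak_upper_gradient p (model_measure Q) F h"
    and cd: "0 < c" and k: "0 \<le> k" and aff: "\<And>t. c < t \<Longrightarrow> t < d \<Longrightarrow> F (hl t) = \<alpha> - k * t"
    and ab: "c < a" "a < b" "b < d"
  shows "ennreal (k * (b - a)) \<le> (\<integral>\<^sup>+s\<in>{a..b}. h (hl s) \<partial>lborel)"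
proof (rule ennreal_le_epsilon)
  fix e :: real assume e: "0 < e"
  from F obtain v where v: "AE x in model_measure Q. v x = F x" and hm: "h \<in> borel_measurable borel"
    and mod: "modulus p (model_measure Q) {(L, \<gamma>) \<in> rect_curves. \<not> ennreal \<bar>v (\<gamma> L) - v (\<gamma> 0)\<bar> \<le> curve_integral (L, \<gamma>) h} = 0"
    unfolding weak_upper_gradient_def by blast
  have AE: "AE t in lborel. t \<in> {0..d} \<longrightarrow> (0 < t \<longrightarrow> v (hl t) = F (hl t))"
    using AE_model_measureD[OF Q v] by eventually_elim blast
  define \<epsilon> where "\<epsilon> = min ((b - a) / 4) (e / (2 * (k + 1)))"
  have \<epsilon>: "0 < \<epsilon>" "\<epsilon> \<le> (b - a) / 4" unfolding \<epsilon>_def using ab e k by (simp_all only: min.cobounded1) simp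
  have "\<epsilon> * (2 * (k + 1)) \<le> e"
    using k unfolding \<epsilon>_def by (simp add: pos_le_divide_eq[symmetric])
  then have k\<epsilon>: "2 * (k * \<epsilon>) \<le> e" using \<epsilon>(1) by (simp add: algebra_simps)
  obtain a' where a': "a < a'" "a' < a + \<epsilon>" "0 < a' \<longrightarrow> v (hl a') = F (hl a')"
    using AE_interval_ex[OF AE, of a "a + \<epsilon>"] ab cd \<epsilon> by auto
  obtain b' where b': "b - \<epsilon> < b'" "b' < b" "0 < b' \<longrightarrow> v (hl b') = F (hl b')"
    using AE_interval_ex[OF AE, of "b - \<epsilon>" b] ab cd \<epsilon> by auto
  have ord1: "a' < b'" using a'(1,2) b'(1,2) \<epsilon> ab(2) by (simp add: field_simps)
  have ord2: "0 < a'" using a'(1) ab(1) cd by linarith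
  have ord: "a' < b'" "0 < a'" "0 < b'" using ord1 ord2 by simp_all
  have "(b' - a', \<lambda>t. hl (a' + t)) \<in> rect_curves"
    using ord by (intro hl_segment_rect_curve) simp_all
  moreover have "(b' - a', \<lambda>t. hl (a' + t)) \<notin> {(L, \<gamma>) \<in> rect_curves. \<not> ennreal \<bar>v (\<gamma> L) - v (\<gamma> 0)\<bar> \<le> curve_integral (L, \<gamma>) h}"
    by (rule segment_not_exceptional[OF Q p ord(2) ord(1) mod])
  ultimately have "ennreal \<bar>v (hl b') - v (hl a')\<bar> \<le> curve_integral (b' - a', \<lambda>t. hl (a' + t)) h"
    by simp
  also have "curve_integral (b' - a', \<lambda>t. hl (a' + t)) h = (\<integral>\<^sup>+s\<in>{a'..b'}. h (hl s) \<partial>lborel)"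
    by (rule curve_integral_hl_segment[OF hm])
  also have "\<dots> \<le> (\<integral>\<^sup>+s\<in>{a..b}. h (hl s) \<partial>lborel)"
    using a' b' by (intro nn_integral_mono mult_left_mono) (auto simp: indicator_def)
  also have "\<bar>v (hl b') - v (hl a')\<bar> = k * (b' - a')"
  proof -
    have "v (hl b') = \<alpha> - k * b'" "v (hl a') = \<alpha> - k * a'"
      using a' b' ord aff[of a'] aff[of b'] ab \<epsilon> by simp_all
    then have "v (hl b') - v (hl a') = - (k * (b' - a'))" by (simp add: algebra_simps)
    then show ?thesis using k ord by simp
  qed
  finally have "ennreal (k * (b' - a')) \<le> (\<integral>\<^sup>+s\<in>{a..b}. h (hl s) \<partial>lborel)" .
  moreover have "ennreal (k * (b - a)) \<le> ennreal (k * (b' - a') + e)"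
  proof (rule ennreal_leI)
    have "k * (b - a) \<le> k * (b' - a' + 2 * \<epsilon>)"
      using a' b' k by (intro mult_left_mono) linarith+
    then show "k * (b - a) \<le> k * (b' - a') + e" using k\<epsilon> by (simp add: algebra_simps)
  qed
  moreover have "ennreal (k * (b' - a') + e) = ennreal (k * (b' - a')) + ennreal e"
    using k ord e by (intro ennreal_plus) simp_all
  ultimately show "ennreal (k * (b - a)) \<le> (\<integral>\<^sup>+s\<in>{a..b}. h (hl s) \<partial>lborel) + ennreal e"
    by (metis (no_types, lifting) add_right_mono order_trans)
qed

section \<open>Minimal weak upper gradients of piecewise affine functions\<close>

lemma modulus_empty: "modulus p m {} = 0"
proof -
  have "modulus p m {} \<le> (\<integral>\<^sup>+x. epowr 0 p \<partial>m)"
    unfolding modulus_def by (rule INF_lower) simp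
  then show ?thesis by simp
qed

lemma weak_upper_gradient_lip:
  assumes "lipschitz_fun w"
  shows "weak_upper_gradient p m w (lip w)"
proof -
  have eq: "{(L, \<gamma>) \<in> rect_curves. \<not> ennreal \<bar>w (\<gamma> L) - w (\<gamma> 0)\<bar> \<le> curve_integral (L, \<gamma>) (lip w)} = {}"
  proof safe
    fix L and \<gamma> :: "real \<Rightarrow> 'a" assume c: "(L, \<gamma>) \<in> rect_curves"
      and no: "\<not> ennreal \<bar>w (\<gamma> L) - w (\<gamma> 0)\<bar> \<le> curve_integral (L, \<gamma>) (lip w)"
    have "0 < L" using c by (simp add: rect_curves_def)
    then have "ennreal \<bar>w (\<gamma> L) - w (\<gamma> 0)\<bar> \<le> curve_integral (L, \<gamma>) (lip w)"
      unfolding curve_integral_def fst_conv snd_conv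
      by (intro lip_upper_gradient assms rect_curves_dist_le[OF c]) simp_all
    with no show "(L, \<gamma>) \<in> {}" by blast
  qed
  show ?thesis
    unfolding weak_upper_gradient_def
  proof (intro conjI exI[of _ w])
    show "modulus p m {(L, \<gamma>) \<in> rect_curves. \<not> ennreal \<bar>w (\<gamma> L) - w (\<gamma> 0)\<bar> \<le> curve_integral (L, \<gamma>) (lip w)} = 0"
      unfolding eq by (rule modulus_empty)
  qed (simp_all add: borel_measurable_lip[OF assms])
qed

text \<open>The slope of a Lipschitz function is an upper gradient along every curve, so minimality
  is the only question, and it also settles the energy clause: the constant sequence bounds the
  Cheeger energy by the energy of the slope, and by minimality the slope lies below the
  \<open>G\<close> that attains the Cheeger energy.\<close>

lemma minimal_wug_lipI:
  fixes F :: "'a::polish_space \<Rightarrow> real"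
  assumes p: "1 < p" and m: "sets m = sets borel" and F: "lipschitz_fun F"
    and fin: "(\<integral>\<^sup>+x. epowr (lip F x) p \<partial>m) < \<infinity>"
    and min: "\<And>h. weak_upper_gradient p m F h \<Longrightarrow> (\<integral>\<^sup>+x. epowr (h x) p \<partial>m) < \<infinity> \<Longrightarrow> AE x in m. lip F x \<le> h x"
  shows "minimal_wug p m F (lip F)" "cheeger_energy p m F < \<infinity>"
proof -
  have Fm: "F \<in> borel_measurable m"
    using borel_measurable_continuous_onI[OF lipschitz_fun_continuous[OF F]] by (simp add: measurable_cong_sets[OF m refl])
  have "cheeger_energy p m F \<le> liminf (\<lambda>n::nat. \<integral>\<^sup>+x. epowr (lip F x) p \<partial>m)"
    by (rule cheeger_energy_le_liminf) (simp_all add: F Lp_tendsto_def)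
  then have le: "cheeger_energy p m F \<le> (\<integral>\<^sup>+x. epowr (lip F x) p \<partial>m)"
    by (simp add: Liminf_const)
  then show ch: "cheeger_energy p m F < \<infinity>" using fin by (rule order_le_less_trans)
  obtain w G where G: "\<And>x. 0 \<le> G x" "weak_upper_gradient p m F (\<lambda>x. ennreal (G x))"
    "(\<integral>\<^sup>+x. ennreal (G x powr p) \<partial>m) = cheeger_energy p m F"
    by (rule cheeger_energy_attained[OF p m Fm ch]) (rule that, (assumption | erule meta_spec)+)
  have en: "epowr (ennreal (G x)) p = ennreal (G x powr p)" for x by (rule epowr_ennreal[OF G(1)])
  have "AE x in m. lip F x \<le> ennreal (G x)"
    using G(2,3) ch by (intro min) (simp_all add: en)
  then have "AE x in m. epowr (lip F x) p \<le> epowr (ennreal (G x)) p"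
    by eventually_elim (use p in \<open>auto intro: epowr_mono\<close>)
  then have "(\<integral>\<^sup>+x. epowr (lip F x) p \<partial>m) \<le> (\<integral>\<^sup>+x. epowr (ennreal (G x)) p \<partial>m)"
    by (rule nn_integral_mono_AE)
  then have "cheeger_energy p m F = (\<integral>\<^sup>+x. epowr (lip F x) p \<partial>m)"
    using le G(3) by (simp add: en)
  then show "minimal_wug p m F (lip F)"
    unfolding minimal_wug_def using weak_upper_gradient_lip[OF F] fin min by blast
qed

lemma lip_affine_hl_le:
  assumes aff: "\<And>s. c < s \<Longrightarrow> s < d \<Longrightarrow> F (hl s) = \<alpha> - k * s" and "0 \<le> c" "c < t" "t < d" "0 \<le> k"
  shows "lip F (hl t) \<le> ennreal k"
proof (rule lip_le_lipschitz)
  show "open {x. c < coord x \<and> coord x < d}"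
    by (intro open_Collect_conj open_Collect_less continuous_on_const continuous_on_coord)
  show "k-lipschitz_on {x. c < coord x \<and> coord x < d} F"
  proof (rule lipschitz_onI)
    fix x y assume "x \<in> {x. c < coord x \<and> coord x < d}" "y \<in> {x. c < coord x \<and> coord x < d}"
    then have "F x = \<alpha> - k * coord x" "F y = \<alpha> - k * coord y"
      using aff[of "coord x"] aff[of "coord y"] by simp_all
    then have "F x - F y = - (k * (coord x - coord y))" by (simp add: right_diff_distrib)
    then show "dist (F x) (F y) \<le> k * dist x y"
      using \<open>0 \<le> k\<close> by (simp add: dist_real_def dist_halfline_def abs_mult)
  qed fact
qed (use assms in simp)

text \<open>Where F is affine, a weak upper gradient of finite energy has integral at least slope
  times length over each subinterval, hence is at least the slope almost everywhere. Segments
  reaching the origin are not controlled, so each interval starts at some \<open>c i > 0\<close>,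
  and \<open>cover\<close> asks for zero slope off the intervals.\<close>

lemma minimal_wug_piecewise:
  fixes N :: nat
  assumes Q: "1 < Q" and p: "1 < p" and F: "lipschitz_fun F"
    and fin: "(\<integral>\<^sup>+x. epowr (lip F x) p \<partial>model_measure Q) < \<infinity>"
    and c: "\<And>i. i < N \<Longrightarrow> 0 < c i" and k: "\<And>i. i < N \<Longrightarrow> 0 \<le> k i"
    and aff: "\<And>i t. i < N \<Longrightarrow> c i < t \<Longrightarrow> t < d i \<Longrightarrow> F (hl t) = \<alpha> i - k i * t"
    and cover: "AE t in lborel. 0 < t \<longrightarrow> lip F (hl t) = 0 \<or> (\<exists>i<N. c i < t \<and> t < d i)"
  shows "minimal_wug p (model_measure Q) F (lip F)" "cheeger_energy p (model_measure Q) F < \<infinity>"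
proof -
  have min: "AE x in model_measure Q. lip F x \<le> h x"
    if h: "weak_upper_gradient p (model_measure Q) F h" and hfin: "(\<integral>\<^sup>+x. epowr (h x) p \<partial>model_measure Q) < \<infinity>" for h
  proof -
    have [measurable]: "h \<in> borel_measurable borel" using h unfolding weak_upper_gradient_def by blast
    have [measurable]: "lip F \<in> borel_measurable borel" by (rule borel_measurable_lip[OF F])
    have "AE t in lborel. c i < t \<and> t < d i \<longrightarrow> ennreal (k i) \<le> h (hl t)" if i: "i < N" for i
    proof (rule AE_ge_of_interval_integrals)
      show "ennreal (k i * (b - a)) \<le> (\<integral>\<^sup>+s\<in>{a..b}. h (hl s) \<partial>lborel)" if "c i < a" "a < b" "b < d i" for a b
        by (rule weak_upper_gradient_segment[OF Q p h c[OF i] k[OF i] aff[OF i] that])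
      have "(\<integral>\<^sup>+s\<in>{c i<..<d i}. h (hl s) \<partial>lborel) \<le> (\<integral>\<^sup>+s\<in>{c i..max (c i) (d i)}. h (hl s) \<partial>lborel)"
        by (intro nn_integral_mono mult_left_mono) (auto simp: indicator_def)
      also have "\<dots> \<le> ennreal (1 * (max (c i) (d i) - c i)) + ennreal (1 powr (1 - p) / mweight Q (c i)) * (\<integral>\<^sup>+x. epowr (h x) p \<partial>model_measure Q)"
        by (rule segment_integral_le_energy[OF Q p]) (use c[OF i] in simp_all)
      also have "\<dots> < \<infinity>" using hfin by (simp add: ennreal_mult_less_top)
      finally show "(\<integral>\<^sup>+s\<in>{c i<..<d i}. h (hl s) \<partial>lborel) < \<infinity>" .
    qed (use k[OF i] in simp_all)
    then have "AE t in lborel. \<forall>i\<in>{..<N}. c i < t \<and> t < d i \<longrightarrow> ennreal (k i) \<le> h (hl t)"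
      by (intro AE_finite_allI) simp_all
    with cover have "AE t in lborel. 0 < t \<longrightarrow> lip F (hl t) \<le> h (hl t)"
    proof eventually_elim
      case (elim t)
      show ?case
      proof
        assume "0 < t"
        with elim(1) consider "lip F (hl t) = 0" | i where "i < N" "c i < t" "t < d i" by blast
        then show "lip F (hl t) \<le> h (hl t)"
        proof cases
          case (2 i)
          have "lip F (hl t) \<le> ennreal (k i)"
            by (rule lip_affine_hl_le[OF aff[OF 2(1)] less_imp_le[OF c[OF 2(1)]] 2(2,3) k[OF 2(1)]])
          also have "\<dots> \<le> h (hl t)" using elim(2) 2 by blast
          finally show ?thesis .
        qed simp
      qed
    qed
    then show ?thesis by (intro AE_model_measureI Q) measurable
  qed
  show "minimal_wug p (model_measure Q) F (lip F)" "cheeger_energy p (model_measure Q) F < \<infinity>"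
    by (rule minimal_wug_lipI[OF p sets_model_measure F fin min]; assumption)+
qed

section \<open>Piecewise linear radial competitors\<close>

definition hat :: "(nat \<Rightarrow> real) \<Rightarrow> nat \<Rightarrow> real \<Rightarrow> real" where
  "hat S j s = max 0 (min 1 ((S j - s) / (S j - S (Suc j))))"

text \<open>For decreasing nodes \<open>hat S j\<close> falls from 1 to 0 as the coordinate runs
  outwards from \<open>S (Suc j)\<close> to \<open>S j\<close>. Thus \<open>\<Delta> j\<close> is
  the height gained when ring j is crossed inwards, and the function is constant inside
  \<open>S N\<close>.\<close>

definition pwl :: "nat \<Rightarrow> (nat \<Rightarrow> real) \<Rightarrow> (nat \<Rightarrow> real) \<Rightarrow> halfline \<Rightarrow> real" where
  "pwl N S \<Delta> x = (\<Sum>j<N. \<Delta> j * hat S j (coord x))"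

locale nodes =
  fixes Q p R :: real and N :: nat and S \<Delta> :: "nat \<Rightarrow> real"
  assumes Q: "1 < Q" and p: "1 < p" and R: "S 0 < R"
    and S0: "\<And>j. 0 < S j" and dec: "\<And>j. S (Suc j) < S j" and \<Delta>: "\<And>j. 0 \<le> \<Delta> j"
begin

definition "slope j = \<Delta> j / (S j - S (Suc j))"

text \<open>\<open>unit_ball_vol Q * (S j powr Q - S (Suc j) powr Q)\<close> is the model measure of
  ring j, so this is the p-energy summed ring by ring.\<close>

definition "energy = (\<Sum>j<N. slope j powr p * (unit_ball_vol Q * (S j powr Q - S (Suc j) powr Q)))"

lemma slope_nonneg: "0 \<le> slope j"
  unfolding slope_def using \<Delta>[of j] dec[of j] by simp

lemma S_mono: "i \<le> j \<Longrightarrow> S j \<le> S i"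
  by (rule lift_Suc_antimono_le) (use dec less_imp_le in blast)+

lemma hat_bounds: "0 \<le> hat S j s" "hat S j s \<le> 1"
  by (auto simp: hat_def)

lemma hat_eq_0: "S j \<le> s \<Longrightarrow> hat S j s = 0"
  unfolding hat_def using dec[of j] divide_nonpos_pos[of "S j - s" "S j - S (Suc j)"] by simp

lemma hat_eq_1: "s \<le> S (Suc j) \<Longrightarrow> hat S j s = 1"
  unfolding hat_def using dec[of j] by (simp add: le_divide_eq)

lemma hat_linear: "S (Suc j) \<le> s \<Longrightarrow> s \<le> S j \<Longrightarrow> hat S j s = (S j - s) / (S j - S (Suc j))"
  unfolding hat_def using dec[of j] by (simp add: divide_le_eq le_divide_eq)

abbreviation "F \<equiv> pwl N S \<Delta>"

lemma F_nonneg: "0 \<le> F x"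
  unfolding pwl_def by (intro sum_nonneg mult_nonneg_nonneg \<Delta> hat_bounds)

lemma F_le: "F x \<le> (\<Sum>j<N. \<Delta> j)"
  unfolding pwl_def by (intro sum_mono mult_left_le \<Delta> hat_bounds)

lemma F_eq_0: "S 0 \<le> coord x \<Longrightarrow> F x = 0"
proof -
  assume x: "S 0 \<le> coord x"
  have "hat S j (coord x) = 0" for j
    using S_mono[of 0 j] x by (intro hat_eq_0) simp
  then show ?thesis unfolding pwl_def by simp
qed

lemma F_affine:
  assumes "i < N" "S (Suc i) < t" "t < S i"
  shows "F (hl t) = ((\<Sum>j<i. \<Delta> j) + slope i * S i) - slope i * t"
proof -
  have t: "0 < t" using S0[of "Suc i"] assms by linarith
  have "F (hl t) = (\<Sum>j<N. (if j < i then \<Delta> j else 0) + (if j = i then slope i * (S i - t) else 0))"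
    unfolding pwl_def
  proof (rule sum.cong[OF refl])
    fix j
    consider "j < i" | "j = i" | "i < j" by linarith
    then show "\<Delta> j * hat S j (coord (hl t)) = (if j < i then \<Delta> j else 0) + (if j = i then slope i * (S i - t) else 0)"
    proof cases
      case 1
      then have "S i \<le> S (Suc j)" by (intro S_mono) simp
      then show ?thesis using 1 t assms by (simp add: hat_eq_1)
    next
      case 2
      then show ?thesis using t assms by (simp add: hat_linear slope_def)
    next
      case 3
      then have "S j \<le> S (Suc i)" by (intro S_mono) simp
      then show ?thesis using 3 t assms by (simp add: hat_eq_0)
    qed
  qed
  also have "\<dots> = (\<Sum>j<N. if j < i then \<Delta> j else 0) + slope i * (S i - t)"
    using assms(1) by (simp add: sum.distrib)
  also have "(\<Sum>j<N. if j < i then \<Delta> j else 0) = (\<Sum>j<i. \<Delta> j)"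
    using assms(1) by (intro sum.mono_neutral_cong_right) auto
  finally show ?thesis by (simp add: right_diff_distrib)
qed

lemma F_const: "t \<le> S N \<Longrightarrow> F (hl t) = (\<Sum>j<N. \<Delta> j)"
proof -
  assume t: "t \<le> S N"
  have "hat S j (coord (hl t)) = 1" if "j < N" for j
  proof -
    have "S N \<le> S (Suc j)" using that by (intro S_mono) simp
    then show ?thesis using t S0[of "Suc j"] by (intro hat_eq_1) simp
  qed
  then show ?thesis unfolding pwl_def by simp
qed

lemma F_lipschitz: "lipschitz_fun F"
proof -
  have "\<exists>L. L-lipschitz_on UNIV (\<lambda>x. \<Delta> j * hat S j (coord x))" for j
  proof -
    have "(slope j)-lipschitz_on UNIV (\<lambda>x. \<Delta> j * hat S j (coord x))"
    proof (rule lipschitz_onI)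
      fix x y
      have "\<bar>hat S j (coord x) - hat S j (coord y)\<bar> \<le> \<bar>(S j - coord x) / (S j - S (Suc j)) - (S j - coord y) / (S j - S (Suc j))\<bar>"
        unfolding hat_def by linarith
      also have "\<dots> = dist x y / (S j - S (Suc j))"
        using dec[of j] by (simp add: diff_divide_distrib[symmetric] dist_halfline_def abs_minus_commute)
      finally have "\<Delta> j * \<bar>hat S j (coord x) - hat S j (coord y)\<bar> \<le> \<Delta> j * (dist x y / (S j - S (Suc j)))"
        by (rule mult_left_mono) (rule \<Delta>)
      then show "dist (\<Delta> j * hat S j (coord x)) (\<Delta> j * hat S j (coord y)) \<le> slope j * dist x y"
        using \<Delta>[of j] by (simp add: dist_real_def right_diff_distrib[symmetric] abs_mult slope_def)
    qed (rule slope_nonneg)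
    then show ?thesis by blast
  qed
  then have "\<exists>L. L-lipschitz_on UNIV (\<lambda>x. \<Sum>j<N. \<Delta> j * hat S j (coord x))"
    by (intro lipschitz_on_sum_ex) simp_all
  then show ?thesis unfolding lipschitz_fun_def pwl_def[abs_def] .
qed

lemma F_measurable [measurable]: "F \<in> borel_measurable borel"
  by (intro borel_measurable_continuous_onI lipschitz_fun_continuous F_lipschitz)

lemma cover: "AE t in lborel. 0 < t \<longrightarrow> lip F (hl t) = 0 \<or> (\<exists>i<N. S (Suc i) < t \<and> t < S i)"
proof -
  have "AE t in lborel. \<forall>j\<in>{..N}. t \<noteq> S j"
    by (intro AE_finite_allI AE_lborel_singleton) simp
  then show ?thesis
  proof eventually_elim
    case (elim t)
    show ?case
    proof
      assume t: "0 < t"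
      consider "S 0 < t" | "t < S N" | "S N \<le> t" "t \<le> S 0" by linarith
      then show "lip F (hl t) = 0 \<or> (\<exists>i<N. S (Suc i) < t \<and> t < S i)"
      proof cases
        case 1
        have "lip F (hl t) \<le> ennreal 0"
          by (rule lip_affine_hl_le[where c = "S 0" and d = "t + 1" and \<alpha> = 0])
            (use 1 S0[of 0] in \<open>simp_all add: F_eq_0\<close>)
        then show ?thesis by simp
      next
        case 2
        have "lip F (hl t) \<le> ennreal 0"
          by (rule lip_affine_hl_le[where c = 0 and d = "S N" and \<alpha> = "\<Sum>j<N. \<Delta> j"])
            (use 2 t in \<open>simp_all add: F_const\<close>)
        then show ?thesis by simp
      next
        case 3
        define i where "i = (LEAST i. S (Suc i) < t)"
        have N: "S N < t" "t < S 0" using 3 elim by force+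
        then have "N \<noteq> 0" by (intro notI) simp
        then obtain M where M: "N = Suc M" by (cases N) auto
        have i: "S (Suc i) < t" unfolding i_def by (rule LeastI[of _ M]) (use N M in simp)
        have iN: "i < N" unfolding i_def using Least_le[of "\<lambda>i. S (Suc i) < t" M] N M by simp
        have "t \<le> S i"
        proof (cases i)
          case 0
          then show ?thesis using N by simp
        next
          case (Suc l)
          then have "\<not> S (Suc l) < t" unfolding i_def by (intro not_less_Least) simp
          then show ?thesis using Suc by simp
        qed
        moreover have "t \<noteq> S i" using elim iN by simp
        ultimately show ?thesis using i iN by (intro disjI2 exI[of _ i]) simp
      qed
    qed
  qed
qed

lemma energy_bound: "(\<integral>\<^sup>+x. epowr (lip F x) p \<partial>model_measure Q) \<le> ennreal energy"
proof -
  note [measurable] = borel_measurable_lip[OF F_lipschitz]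
  have "(\<integral>\<^sup>+x. epowr (lip F x) p \<partial>model_measure Q)
      = (\<integral>\<^sup>+t. ennreal (mweight Q t) * epowr (lip F (hl t)) p * indicator {0..} t \<partial>lborel)"
    by (rule nn_integral_model_measure) measurable
  also have "\<dots> \<le> (\<integral>\<^sup>+t. (\<Sum>i<N. ennreal (slope i powr p) * (ennreal (mweight Q t) * indicator {S (Suc i)..S i} t)) \<partial>lborel)"
  proof (rule nn_integral_mono_AE)
    have "AE t in lborel. t \<noteq> (0::real)" by (rule AE_lborel_singleton)
    with cover show "AE t in lborel. ennreal (mweight Q t) * epowr (lip F (hl t)) p * indicator {0..} t
      \<le> (\<Sum>i<N. ennreal (slope i powr p) * (ennreal (mweight Q t) * indicator {S (Suc i)..S i} t))"
    proof eventually_elim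
      case (elim t)
      show ?case
      proof (cases "0 < t \<and> lip F (hl t) \<noteq> 0")
        case False
        then show ?thesis using elim(2) by (cases "t < 0") auto
      next
        case True
        with elim obtain i where i: "i < N" "S (Suc i) < t" "t < S i" by blast
        have "lip F (hl t) \<le> ennreal (slope i)"
          by (rule lip_affine_hl_le[OF F_affine[OF i(1)] less_imp_le[OF S0] i(2,3) slope_nonneg])
        then have "epowr (lip F (hl t)) p \<le> epowr (ennreal (slope i)) p" using p by (intro epowr_mono) simp_all
        also have "\<dots> = ennreal (slope i powr p)" by (rule epowr_ennreal[OF slope_nonneg])
        finally have "ennreal (mweight Q t) * epowr (lip F (hl t)) p * indicator {0..} t
            \<le> ennreal (mweight Q t) * ennreal (slope i powr p) * 1"
          by (intro mult_mono) (simp_all add: indicator_def)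
        also have "\<dots> = ennreal (slope i powr p) * (ennreal (mweight Q t) * indicator {S (Suc i)..S i} t)"
          using i by (simp add: mult.commute)
        also have "\<dots> \<le> (\<Sum>i<N. ennreal (slope i powr p) * (ennreal (mweight Q t) * indicator {S (Suc i)..S i} t))"
          by (rule member_le_sum[where f = "\<lambda>i. ennreal (slope i powr p) * (ennreal (mweight Q t) * indicator {S (Suc i)..S i} t)"])
            (use i in simp_all)
        finally show ?thesis .
      qed
    qed
  qed
  also have "\<dots> = (\<Sum>i<N. \<integral>\<^sup>+t. ennreal (slope i powr p) * (ennreal (mweight Q t) * indicator {S (Suc i)..S i} t) \<partial>lborel)"
    by (rule nn_integral_sum) measurable
  also have "\<dots> = (\<Sum>i<N. ennreal (slope i powr p * (unit_ball_vol Q * (S i powr Q - S (Suc i) powr Q))))"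
  proof (rule sum.cong[OF refl])
    fix i
    have "0 \<le> S i powr Q - S (Suc i) powr Q"
      using dec[of i] S0[of "Suc i"] Q by (simp add: powr_mono2 less_imp_le)
    then show "(\<integral>\<^sup>+t. ennreal (slope i powr p) * (ennreal (mweight Q t) * indicator {S (Suc i)..S i} t) \<partial>lborel)
        = ennreal (slope i powr p * (unit_ball_vol Q * (S i powr Q - S (Suc i) powr Q)))"
      using Q by (subst nn_integral_cmult)
        (simp_all add: nn_integral_mweight_Icc[OF Q S0 less_imp_le[OF dec]] ennreal_mult)
  qed
  also have "\<dots> = ennreal energy"
    unfolding energy_def
  proof (rule sum_ennreal)
    fix i
    have "0 \<le> S i powr Q - S (Suc i) powr Q"
      using dec[of i] S0[of "Suc i"] Q by (simp add: powr_mono2 less_imp_le)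
    then show "0 \<le> slope i powr p * (unit_ball_vol Q * (S i powr Q - S (Suc i) powr Q))"
      using Q by (intro mult_nonneg_nonneg) simp_all
  qed
  finally show ?thesis .
qed

lemma F_minimal_wug:
  shows "minimal_wug p (model_measure Q) F (lip F)" "cheeger_energy p (model_measure Q) F < \<infinity>"
proof -
  have fin: "(\<integral>\<^sup>+x. epowr (lip F x) p \<partial>model_measure Q) < \<infinity>"
    using energy_bound by (rule order_le_less_trans) simp
  show "minimal_wug p (model_measure Q) F (lip F)"
    by (rule minimal_wug_piecewise(1)[where N = N and c = "\<lambda>i. S (Suc i)" and d = S and k = slope
        and \<alpha> = "\<lambda>i. (\<Sum>j<i. \<Delta> j) + slope i * S i", OF Q p F_lipschitz fin S0 slope_nonneg F_affine cover])
  show "cheeger_energy p (model_measure Q) F < \<infinity>"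
    by (rule minimal_wug_piecewise(2)[where N = N and c = "\<lambda>i. S (Suc i)" and d = S and k = slope
        and \<alpha> = "\<lambda>i. (\<Sum>j<i. \<Delta> j) + slope i * S i", OF Q p F_lipschitz fin S0 slope_nonneg F_affine cover])
qed

lemma F_power_integral_finite: "(\<integral>\<^sup>+x. ennreal (F x powr p) \<partial>model_measure Q) < \<infinity>"
proof -
  have "(\<integral>\<^sup>+x. ennreal (F x powr p) \<partial>model_measure Q)
      \<le> (\<integral>\<^sup>+x. ennreal ((\<Sum>j<N. \<Delta> j) powr p) * indicator {x. coord x < R} x \<partial>model_measure Q)"
  proof (rule nn_integral_mono)
    fix x
    have "F x powr p \<le> (\<Sum>j<N. \<Delta> j) powr p"
      using p by (intro powr_mono2 F_le F_nonneg) simp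
    then show "ennreal (F x powr p) \<le> ennreal ((\<Sum>j<N. \<Delta> j) powr p) * indicator {x. coord x < R} x"
      using F_eq_0[of x] R p by (cases "coord x < R") (simp_all add: ennreal_leI)
  qed
  also have "\<dots> = ennreal ((\<Sum>j<N. \<Delta> j) powr p) * emeasure (model_measure Q) {x. coord x < R}"
    by (rule nn_integral_cmult_indicator) simp
  also have "\<dots> < \<infinity>"
    using R S0[of 0] by (simp add: emeasure_model_measure_ball[OF Q] ennreal_mult_less_top)
  finally show ?thesis .
qed

text \<open>The support of F lies in the closed ball of radius \<open>S 0 < R\<close>, so F belongs
  to the class whose closure is taken, and the constant sequence approximates it.\<close>

lemma F_in_W1p0: "in_W1p0 p (model_measure Q) {x. coord x < R} F"
proof -
  have "in_W1p p (model_measure Q) F"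
    unfolding in_W1p_def in_Lp_def using F_minimal_wug(2) F_power_integral_finite
    by (simp add: F_nonneg cong: measurable_cong_sets)
  moreover have "lipschitz_bs {x. coord x < R} F"
  proof -
    have "{x. F x \<noteq> 0} \<subseteq> {x. coord x \<le> S 0}" 
    proof (rule subsetI, rule CollectI, rule ccontr)
      fix x assume "x \<in> {x. F x \<noteq> 0}" and "\<not> coord x \<le> S 0"
      then show False using F_eq_0[of x] by simp
    qed
    moreover have "closed {x. coord x \<le> S 0}"
      by (intro closed_Collect_le continuous_on_coord continuous_on_const)
    ultimately have sub: "closure {x. F x \<noteq> 0} \<subseteq> {x. coord x \<le> S 0}" by (rule closure_minimal)
    have "{x. coord x \<le> S 0} \<subseteq> cball (hl 0) (S 0)"
      by (auto simp: dist_halfline_def)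
    then have "bounded {x. coord x \<le> S 0}" by (rule bounded_subset[OF bounded_cball])
    then have "bounded (closure {x. F x \<noteq> 0})" using sub by (rule bounded_subset)
    moreover have "{x. coord x \<le> S 0} \<subseteq> {x. coord x < R}" using R by auto
    ultimately show ?thesis unfolding lipschitz_bs_def using F_lipschitz sub by blast
  qed
  moreover have "cheeger_energy p (model_measure Q) (\<lambda>x. F x - F x) = 0"
  proof -
    have "lipschitz_fun (\<lambda>x::halfline. 0)" unfolding lipschitz_fun_def using lipschitz_on_constant by blast
    then have "cheeger_energy p (model_measure Q) (\<lambda>x. 0) \<le> liminf (\<lambda>n::nat. \<integral>\<^sup>+x. epowr (lip (\<lambda>_::halfline. 0) x) p \<partial>model_measure Q)"
      by (intro cheeger_energy_le_liminf) (simp_all add: Lp_tendsto_def)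
    then show ?thesis by (simp add: Liminf_const)
  qed
  ultimately show ?thesis
    unfolding in_W1p0_def Lp_tendsto_def by (intro conjI exI[of _ "\<lambda>_. F"]) simp_all
qed

lemma eigenvalue_le_normalized:
  assumes "(\<integral>\<^sup>+x. ennreal (F x powr p) \<partial>model_measure Q) = 1"
  shows "model_dirichlet_eigenvalue p Q R \<le> ennreal energy"
proof -
  have "(\<integral>\<^sup>+x\<in>{x. coord x < R}. ennreal (\<bar>F x\<bar> powr p) \<partial>model_measure Q) = (\<integral>\<^sup>+x. ennreal (F x powr p) \<partial>model_measure Q)"
  proof (rule nn_integral_cong)
    fix x
    show "ennreal (\<bar>F x\<bar> powr p) * indicator {x. coord x < R} x = ennreal (F x powr p)"
      using F_eq_0[of x] F_nonneg[of x] R p by (cases "coord x < R") simp_all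
  qed
  then have "model_dirichlet_eigenvalue p Q R \<le> (\<integral>\<^sup>+x\<in>{x. coord x < R}. epowr (lip F x) p \<partial>model_measure Q)"
    unfolding model_dirichlet_eigenvalue_def dirichlet_eigenvalue_def
    using assms F_in_W1p0 F_minimal_wug(1) by (intro INF_lower2[of "(F, lip F)"]) simp_all
  also have "\<dots> \<le> (\<integral>\<^sup>+x. epowr (lip F x) p \<partial>model_measure Q)"
    by (intro nn_integral_mono) (simp add: indicator_def)
  also note energy_bound
  finally show ?thesis .
qed

end

text \<open>Both sides are homogeneous of degree p in the heights \<open>\<Delta> j\<close>, so
  scaling reduces the claim to integral 1. The product form includes integral 0, for instance when
  all heights vanish.\<close>

lemma (in nodes) eigenvalue_le:
  "model_dirichlet_eigenvalue p Q R * (\<integral>\<^sup>+x. ennreal (pwl N S \<Delta> x powr p) \<partial>model_measure Q) \<le> ennreal energy"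
proof (cases "(\<integral>\<^sup>+x. ennreal (F x powr p) \<partial>model_measure Q) = 0")
  case False
  then obtain I where I: "(\<integral>\<^sup>+x. ennreal (F x powr p) \<partial>model_measure Q) = ennreal I" "0 < I"
    using F_power_integral_finite by (cases "\<integral>\<^sup>+x. ennreal (F x powr p) \<partial>model_measure Q") auto
  define c where "c = I powr (- (1 / p))"
  have c: "0 < c" "c powr p = 1 / I"
  proof -
    have "c powr p = I powr (- (1 / p) * p)" by (simp only: c_def powr_powr)
    also have "- (1 / p) * p = - 1" using p by simp
    also have "I powr - 1 = 1 / I" using I(2) by (simp add: powr_minus_divide)
    finally show "c powr p = 1 / I" .
  qed (use I(2) in \<open>simp add: c_def\<close>)
  interpret B: nodes Q p R N S "\<lambda>j. c * \<Delta> j"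
    by standard (use Q p R S0 dec \<Delta> c in simp_all)
  have F': "pwl N S (\<lambda>j. c * \<Delta> j) x = c * F x" for x
    by (simp add: pwl_def sum_distrib_left mult.assoc)
  have "(\<integral>\<^sup>+x. ennreal (pwl N S (\<lambda>j. c * \<Delta> j) x powr p) \<partial>model_measure Q)
      = (\<integral>\<^sup>+x. ennreal (c powr p) * ennreal (F x powr p) \<partial>model_measure Q)"
    unfolding F' using c(1) by (simp add: powr_mult ennreal_mult F_nonneg)
  also have "\<dots> = ennreal (c powr p) * ennreal I"
    unfolding I(1)[symmetric] by (rule nn_integral_cmult) measurable
  also have "\<dots> = 1"
    unfolding c(2) using I(2) by (subst ennreal_mult[symmetric]) simp_all
  finally have "model_dirichlet_eigenvalue p Q R \<le> ennreal B.energy"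
    by (rule B.eigenvalue_le_normalized)
  also have "B.energy = c powr p * energy"
  proof -
    have "B.slope j = c * slope j" for j unfolding B.slope_def slope_def by simp
    then show ?thesis
      unfolding B.energy_def energy_def sum_distrib_left
      using c(1) by (intro sum.cong refl) (simp add: powr_mult slope_nonneg mult.assoc)
  qed
  finally have "model_dirichlet_eigenvalue p Q R * ennreal I \<le> ennreal (c powr p * energy) * ennreal I"
    by (rule mult_right_mono) simp
  also have "\<dots> = ennreal (energy * (1 / I * I))"
    unfolding c(2) using I(2) by (subst ennreal_mult''[symmetric]) (simp_all add: ac_simps)
  also have "\<dots> = ennreal energy" using I(2) by simp
  finally show ?thesis unfolding I(1) .
qed simp

section \<open>Inequalities of Young and Hoelder, layer cake formula\<close>

lemma young_powr:
  assumes p: "1 < p" and "0 \<le> l" "0 \<le> (\<theta>::real)"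
  shows "p * \<theta> powr (p - 1) * l \<le> l powr p + (p - 1) * \<theta> powr p"
proof -
  define q where "q = p / (p - 1)"
  have q: "1 < q" "1 / p + 1 / q = 1" "(p - 1) * q = p" "1 / q = (p - 1) / p"
    using p by (simp_all add: q_def field_simps)
  \<comment> \<open>Equality holds at l = \<theta>: after multiplication by p this is the tangent to
    \<open>l powr p\<close> at \<theta>.\<close>
  have "l * \<theta> powr (p - 1) \<le> l powr p / p + (\<theta> powr (p - 1)) powr q / q"
    by (rule Youngs_inequality) (use p q assms in simp_all)
  also have "(\<theta> powr (p - 1)) powr q / q = \<theta> powr p * ((p - 1) / p)"
    using q(3,4) by (simp add: powr_powr divide_inverse)
  finally have "p * (l * \<theta> powr (p - 1)) \<le> p * (l powr p / p + \<theta> powr p * ((p - 1) / p))"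
    using p by (intro mult_left_mono) simp_all
  then show ?thesis using p by (simp add: distrib_left ac_simps)
qed

text \<open>Young's inequality is integrated at the constant \<theta> = X / W, the mean value that
  the data force. X is only a lower bound of the integral and W only an upper bound of the measure,
  which is all that coarea and the ring estimate provide.\<close>

lemma holder_set:
  fixes l :: "'a \<Rightarrow> ennreal"
  assumes p: "1 < p" and [measurable]: "A \<in> sets M" "(\<lambda>x. l x * indicator A x) \<in> borel_measurable M"
    and W: "0 < W" "emeasure M A \<le> ennreal W" and X: "0 \<le> X" "ennreal X \<le> (\<integral>\<^sup>+x\<in>A. l x \<partial>M)"
  shows "ennreal ((X / W) powr p * W) \<le> (\<integral>\<^sup>+x\<in>A. epowr (l x) p \<partial>M)"
proof (cases "(\<integral>\<^sup>+x\<in>A. epowr (l x) p \<partial>M) = top")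
  case False
  then obtain J where J: "(\<integral>\<^sup>+x\<in>A. epowr (l x) p \<partial>M) = ennreal J" "0 \<le> J"
    by (cases "\<integral>\<^sup>+x\<in>A. epowr (l x) p \<partial>M") auto
  define \<theta> where "\<theta> = X / W"
  have \<theta>: "0 \<le> \<theta>" using W X by (simp add: \<theta>_def)
  have eA: "epowr (l x) p * indicator A x = epowr (l x * indicator A x) p" for x
    by (simp add: indicator_def)
  have [measurable]: "(\<lambda>x. epowr (l x) p * indicator A x) \<in> borel_measurable M"
    unfolding eA by measurable
  have pt: "ennreal (p * \<theta> powr (p - 1)) * y \<le> epowr y p + ennreal ((p - 1) * \<theta> powr p)" for y
  proof (cases y)
    case (real r)
    have "ennreal (p * \<theta> powr (p - 1)) * ennreal r = ennreal (p * \<theta> powr (p - 1) * r)"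
      using real p by (simp add: ennreal_mult)
    also have "\<dots> \<le> ennreal (r powr p + (p - 1) * \<theta> powr p)"
      by (intro ennreal_leI young_powr p real \<theta>)
    also have "\<dots> = ennreal (r powr p) + ennreal ((p - 1) * \<theta> powr p)"
      using p by (intro ennreal_plus) simp_all
    finally show ?thesis using real by (simp add: epowr_ennreal)
  qed simp
  have "ennreal (p * \<theta> powr (p - 1) * X) = ennreal (p * \<theta> powr (p - 1)) * ennreal X"
    using p X by (intro ennreal_mult) simp_all
  also have "\<dots> \<le> ennreal (p * \<theta> powr (p - 1)) * (\<integral>\<^sup>+x\<in>A. l x \<partial>M)"
    by (intro mult_left_mono X) simp
  also have "\<dots> = (\<integral>\<^sup>+x. ennreal (p * \<theta> powr (p - 1)) * (l x * indicator A x) \<partial>M)"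
    by (rule nn_integral_cmult[symmetric]) measurable
  also have "\<dots> \<le> (\<integral>\<^sup>+x. epowr (l x) p * indicator A x + ennreal ((p - 1) * \<theta> powr p) * indicator A x \<partial>M)"
    using pt by (intro nn_integral_mono) (simp add: indicator_def)
  also have "\<dots> = ennreal J + (\<integral>\<^sup>+x. ennreal ((p - 1) * \<theta> powr p) * indicator A x \<partial>M)"
    unfolding J(1)[symmetric] by (rule nn_integral_add) measurable
  also have "(\<integral>\<^sup>+x. ennreal ((p - 1) * \<theta> powr p) * indicator A x \<partial>M) = ennreal ((p - 1) * \<theta> powr p) * emeasure M A"
    by (rule nn_integral_cmult_indicator) simp
  also have "\<dots> \<le> ennreal ((p - 1) * \<theta> powr p) * ennreal W"
    by (intro mult_left_mono W) simp
  also have "\<dots> = ennreal ((p - 1) * \<theta> powr p * W)"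
    using p W by (intro ennreal_mult[symmetric]) simp_all
  also have "ennreal J + \<dots> = ennreal (J + (p - 1) * \<theta> powr p * W)"
    using p W J by (intro ennreal_plus[symmetric]) simp_all
  finally have "ennreal (p * \<theta> powr (p - 1) * X) \<le> ennreal (J + (p - 1) * \<theta> powr p * W)" by (simp add: add_left_mono)
  then have le: "p * \<theta> powr (p - 1) * X \<le> J + (p - 1) * \<theta> powr p * W"
    by (subst (asm) ennreal_le_iff) (use p W J in simp_all)
  have eq: "\<theta> powr (p - 1) * X = \<theta> powr p * W"
  proof (cases "X = 0")
    case False
    then have "0 < \<theta>" "X = \<theta> * W" using X W by (simp_all add: \<theta>_def)
    then show ?thesis using p by (simp add: powr_diff)
  qed (use p in \<open>simp add: \<theta>_def\<close>)
  have "p * \<theta> powr (p - 1) * X = p * (\<theta> powr p * W)"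
    by (simp only: mult.assoc eq)
  moreover have "(p - 1) * \<theta> powr p * W = p * (\<theta> powr p * W) - \<theta> powr p * W"
    by (simp only: left_diff_distrib mult.assoc mult_1)
  ultimately have "\<theta> powr p * W \<le> J" using le by linarith
  then show ?thesis unfolding J(1) \<theta>_def by (rule ennreal_leI)
qed simp

text \<open>Tonelli on the finite measure that M induces on A. Measurability in \<tau> is a separate
  conclusion, because distribution functions are later scaled and added under the integral.\<close>

lemma layer_cake:
  assumes [measurable]: "A \<in> sets M" "f \<in> borel_measurable M" and fin: "emeasure M A < \<infinity>"
    and f: "\<And>x. 0 \<le> f x"
  shows "(\<integral>\<^sup>+x\<in>A. ennreal (f x) \<partial>M) = (\<integral>\<^sup>+\<tau>. emeasure M {x\<in>A. \<tau> < f x} * indicator {0..} \<tau> \<partial>lborel)"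
    "(\<lambda>\<tau>. emeasure M {x\<in>A. \<tau> < f x} * indicator {0..} \<tau>) \<in> borel_measurable borel"
proof -
  define N where "N = density M (indicator A)"
  have [measurable_cong]: "sets N = sets M" by (simp add: N_def)
  have "emeasure N (space N) = emeasure M A"
    unfolding N_def by (subst emeasure_density) (auto simp: sets.sets_into_space Int_absorb2)
  then interpret N: finite_measure N using fin by (intro finite_measureI) simp
  interpret P: pair_sigma_finite N lborel by standard
  have [measurable]: "f \<in> borel_measurable N" by measurable
  have slice: "(\<integral>\<^sup>+x. (if 0 \<le> \<tau> \<and> \<tau> < f x then 1 else 0) \<partial>N) = emeasure M {x\<in>A. \<tau> < f x} * indicator {0..} \<tau>" for \<tau> :: real
  proof -
    have "{x\<in>A. \<tau> < f x} = A \<inter> {x\<in>space M. \<tau> < f x}" using sets.sets_into_space[OF assms(1)] by auto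
    then have [measurable]: "{x\<in>A. \<tau> < f x} \<in> sets M" by simp
    have "(\<integral>\<^sup>+x. (if 0 \<le> \<tau> \<and> \<tau> < f x then 1 else 0) \<partial>N)
        = (\<integral>\<^sup>+x. indicator A x * (if 0 \<le> \<tau> \<and> \<tau> < f x then 1 else 0) \<partial>M)"
      unfolding N_def by (rule nn_integral_density) measurable
    also have "\<dots> = (\<integral>\<^sup>+x. indicator {0..} \<tau> * indicator {x\<in>A. \<tau> < f x} x \<partial>M)"
      by (intro nn_integral_cong) (simp add: indicator_def)
    also have "\<dots> = indicator {0..} \<tau> * emeasure M {x\<in>A. \<tau> < f x}"
      by (rule nn_integral_cmult_indicator) measurable
    finally show ?thesis by (simp add: mult.commute)
  qed
  have "(\<lambda>\<tau>. \<integral>\<^sup>+x. (if 0 \<le> \<tau> \<and> \<tau> < f x then 1 else 0) \<partial>N) \<in> borel_measurable borel"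
    by (rule N.borel_measurable_nn_integral) measurable
  then show "(\<lambda>\<tau>. emeasure M {x\<in>A. \<tau> < f x} * indicator {0..} \<tau>) \<in> borel_measurable borel"
    by (simp only: slice)
  have "(\<integral>\<^sup>+x\<in>A. ennreal (f x) \<partial>M) = (\<integral>\<^sup>+x. ennreal (f x) \<partial>N)"
    unfolding N_def by (subst nn_integral_density) (auto intro!: nn_integral_cong simp: mult.commute)
  also have "\<dots> = (\<integral>\<^sup>+x. (\<integral>\<^sup>+\<tau>. (if 0 \<le> \<tau> \<and> \<tau> < f x then 1 else 0) \<partial>lborel) \<partial>N)"
  proof (rule nn_integral_cong)
    fix x
    have "(\<integral>\<^sup>+\<tau>. (if 0 \<le> \<tau> \<and> \<tau> < f x then 1 else 0) \<partial>lborel) = (\<integral>\<^sup>+\<tau>. indicator {0..<f x} \<tau> \<partial>lborel)"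
      by (intro nn_integral_cong) (simp add: indicator_def)
    also have "\<dots> = ennreal (f x)" using f[of x] by simp
    finally show "ennreal (f x) = (\<integral>\<^sup>+\<tau>. (if 0 \<le> \<tau> \<and> \<tau> < f x then 1 else 0) \<partial>lborel)" by simp
  qed
  also have "\<dots> = (\<integral>\<^sup>+\<tau>. (\<integral>\<^sup>+x. (if 0 \<le> \<tau> \<and> \<tau> < f x then 1 else 0) \<partial>N) \<partial>lborel)"
    by (rule P.Fubini'[symmetric]) measurable
  also have "\<dots> = (\<integral>\<^sup>+\<tau>. emeasure M {x\<in>A. \<tau> < f x} * indicator {0..} \<tau> \<partial>lborel)"
    by (simp only: slice)
  finally show "(\<integral>\<^sup>+x\<in>A. ennreal (f x) \<partial>M) = (\<integral>\<^sup>+\<tau>. emeasure M {x\<in>A. \<tau> < f x} * indicator {0..} \<tau> \<partial>lborel)" .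
qed

text \<open>Mean value theorem on [1, q]. It compares the relative measure
  \<open>q powr Q - 1\<close> of a ring with its relative width q - 1; the loss
  \<open>q powr (Q - 1)\<close> tends to 1 with q.\<close>

lemma powr_diff_le:
  assumes Q: "1 < Q" and q: "1 < (q::real)"
  shows "q powr Q - 1 \<le> Q * q powr (Q - 1) * (q - 1)"
proof -
  have "\<exists>z>1. z < q \<and> q powr Q - 1 powr Q = (q - 1) * (Q * z powr (Q - 1))"
    by (rule MVT2) (use q in \<open>auto intro!: derivative_eq_intros\<close>)
  then obtain z where z: "1 < z" "z < q" "q powr Q - 1 = (q - 1) * (Q * z powr (Q - 1))" by auto
  have "(q - 1) * (Q * z powr (Q - 1)) \<le> (q - 1) * (Q * q powr (Q - 1))"
    using z q Q by (intro mult_left_mono powr_mono2) simp_all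
  then show ?thesis unfolding z(3) by (simp add: ac_simps)
qed

section \<open>Comparison with the half-line\<close>

text \<open>Only the part where v is positive is estimated. By \<open>half\<close>, each superlevel
  set at a level t >= 0 is the smaller of the two sets in the isoperimetric inequality. The locale
  is used for v - c and for c - v, with c a median.\<close>

locale one_sided =
  fixes m :: "'a::polish_space measure" and \<Omega> :: "'a set" and v :: "'a \<Rightarrow> real" and C Q p R :: real
  assumes m: "sets m = sets borel" and \<Omega>: "open \<Omega>" and fin: "emeasure m \<Omega> < \<infinity>"
    and v: "loc_lipschitz_fun \<Omega> v" and C: "0 < C" and Q: "1 < Q" and p: "1 < p" and R: "0 < R"
    and vol: "measure m \<Omega> = unit_ball_vol Q * R powr Q"
    and half: "2 * measure m {x\<in>\<Omega>. 0 < v x} \<le> measure m \<Omega>"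
    and iso: "\<And>E. E \<in> sets borel \<Longrightarrow> E \<subseteq> \<Omega> \<Longrightarrow>
      perimeter m E \<Omega> \<ge> ennreal (C * unit_ball_vol Q powr (1 / Q) * Q *
        min (measure m E) (measure m (\<Omega> - E)) powr ((Q - 1) / Q))"
begin

definition "\<omega> = unit_ball_vol Q"
text \<open>Radius of the model ball with measure \<open>measure m \<Omega> / 2\<close>, the largest
  that \<open>half\<close> allows for the positive set.\<close>

definition "r = R / 2 powr (1 / Q)"
definition "\<mu> t = measure m {x\<in>\<Omega>. t < v x}"
definition "D = (\<integral>\<^sup>+x\<in>{x\<in>\<Omega>. 0 < v x}. epowr (lip v x) p \<partial>m)"

lemma \<omega>: "0 < \<omega>" using Q by (simp add: \<omega>_def)

lemma r: "0 < r" using R by (simp add: r_def)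

lemma cont: "continuous_on \<Omega> v" by (rule loc_lipschitz_fun_continuous[OF \<Omega> v])

lemma superlevel_open: "open {x\<in>\<Omega>. t < v x}"
  using continuous_on_open_vimage[OF \<Omega>, THEN iffD1, OF cont, rule_format, of "{t<..}"]
  by (simp add: vimage_def Int_def conj_commute)

lemma superlevel_sets: "{x\<in>\<Omega>. t < v x} \<in> sets m"
  using superlevel_open[of t] m by simp

lemma \<Omega>_sets: "\<Omega> \<in> sets m" using \<Omega> m by simp

lemma emeasure_sub_finite: "A \<subseteq> \<Omega> \<Longrightarrow> emeasure m A \<noteq> \<infinity>"
  using emeasure_mono[of A \<Omega> m] \<Omega>_sets fin by (auto simp: top_unique)

lemma emeasure_superlevel: "emeasure m {x\<in>\<Omega>. t < v x} = ennreal (\<mu> t)"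
  unfolding \<mu>_def by (rule emeasure_eq_ennreal_measure) (use emeasure_sub_finite[of "{x\<in>\<Omega>. t < v x}"] in auto)

lemma lip_measurable: "(\<lambda>x. lip v x * indicator \<Omega> x) \<in> borel_measurable m"
  using borel_measurable_lip_indicator[OF \<Omega> cont] by (simp only: measurable_cong_sets[OF m refl])

lemma \<mu>_nonneg: "0 \<le> \<mu> t" by (simp add: \<mu>_def)

lemma \<mu>_mono: "s \<le> t \<Longrightarrow> \<mu> t \<le> \<mu> s"
  unfolding \<mu>_def using emeasure_sub_finite[of "{x\<in>\<Omega>. s < v x}"] superlevel_sets
  by (intro measure_mono_fmeasurable fmeasurableI) (auto simp: less_top)

lemma r_vol: "\<omega> * r powr Q = measure m \<Omega> / 2"
proof -
  have "r powr Q = R powr Q / (2 powr (1 / Q)) powr Q"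
    unfolding r_def by (rule powr_divide)
  also have "(2 powr (1 / Q)) powr Q = (2::real)" using Q by (simp add: powr_powr)
  finally show ?thesis by (simp add: vol \<omega>_def)
qed

lemma \<mu>_0: "\<mu> 0 \<le> \<omega> * r powr Q" unfolding r_vol using half by (simp add: \<mu>_def)

text \<open>\<open>Q * \<omega> * s powr (Q - 1)\<close> is the area of the model sphere of radius
  s; in terms of the volume V = \<open>\<omega> * s powr Q\<close> it equals
  \<open>Q * \<omega> powr (1 / Q) * V powr ((Q - 1) / Q)\<close>, the form in \<open>iso\<close>.
  The superlevel set has at least this volume and at most half of that of \<Omega>.\<close>

lemma perimeter_ge:
  assumes t: "0 \<le> t" and s: "0 < s" "\<omega> * s powr Q \<le> \<mu> t"
  shows "ennreal (C * (Q * \<omega> * s powr (Q - 1))) \<le> perimeter m {x\<in>\<Omega>. t < v x} \<Omega>"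
proof -
  have diff: "measure m (\<Omega> - {x\<in>\<Omega>. t < v x}) = measure m \<Omega> - \<mu> t"
    unfolding \<mu>_def using fin \<Omega>_sets superlevel_sets[of t]
    by (intro measure_Diff) auto
  have "\<mu> t \<le> \<mu> 0" using t by (rule \<mu>_mono)
  then have min: "min (\<mu> t) (measure m (\<Omega> - {x\<in>\<Omega>. t < v x})) = \<mu> t"
    using \<mu>_0 diff by (simp add: r_vol)
  have "\<omega> powr (1 / Q) * (\<omega> * s powr Q) powr ((Q - 1) / Q) = \<omega> * s powr (Q - 1)"
  proof -
    have "(\<omega> * s powr Q) powr ((Q - 1) / Q) = \<omega> powr ((Q - 1) / Q) * s powr (Q - 1)"
      using \<omega> s Q by (simp add: powr_mult powr_powr)
    moreover have "\<omega> powr (1 / Q) * \<omega> powr ((Q - 1) / Q) = \<omega>"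
      using \<omega> Q by (simp add: powr_add[symmetric] add_divide_distrib[symmetric])
    ultimately show ?thesis by (simp add: mult.assoc[symmetric])
  qed
  then have "C * (Q * \<omega> * s powr (Q - 1)) = C * \<omega> powr (1 / Q) * Q * (\<omega> * s powr Q) powr ((Q - 1) / Q)"
    by (simp add: ac_simps)
  also have "\<dots> \<le> C * \<omega> powr (1 / Q) * Q * \<mu> t powr ((Q - 1) / Q)"
    using C Q \<omega> s by (intro mult_left_mono powr_mono2) simp_all
  finally have "ennreal (C * (Q * \<omega> * s powr (Q - 1))) \<le> ennreal (C * \<omega> powr (1 / Q) * Q * \<mu> t powr ((Q - 1) / Q))"
    by (rule ennreal_leI)
  also have "\<dots> \<le> perimeter m {x\<in>\<Omega>. t < v x} \<Omega>"
    using iso[of "{x\<in>\<Omega>. t < v x}"] superlevel_sets[of t] min m by (simp add: \<omega>_def[symmetric] \<mu>_def[symmetric])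
  finally show ?thesis .
qed

end

text \<open>\<open>T j\<close> is the level, capped at \<open>K\<close>, at which the superlevel sets of \<open>v\<close> shrink to the measure of
  the ball of radius \<open>s j\<close>.\<close>

locale levels = one_sided +
  fixes K q :: real
  assumes K: "0 < K" and q: "1 < q"
begin

definition "s j = r / q ^ j"
definition "T j = Inf {t. 0 \<le> t \<and> (\<mu> t \<le> \<omega> * s j powr Q \<or> K \<le> t)}"
definition "W j = \<omega> * (s j powr Q - s (Suc j) powr Q)"

lemma s_pos: "0 < s j" using r q by (simp add: s_def)

lemma s_Suc: "s j = q * s (Suc j)" using q by (simp add: s_def)

lemma s_dec: "s (Suc j) < s j"
  unfolding s_Suc[of j] using q s_pos[of "Suc j"] by simp

lemma s_powr: "s j powr Q = q powr Q * s (Suc j) powr Q"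
  unfolding s_Suc[of j] using q s_pos[of "Suc j"] by (simp add: powr_mult)

lemma q_powr: "1 < q powr Q" using q Q by simp

lemma W_eq: "W j = \<omega> * s (Suc j) powr Q * (q powr Q - 1)"
  unfolding W_def s_powr[of j] by (simp add: algebra_simps)

lemma W_pos: "0 < W j"
  unfolding W_eq using \<omega> q_powr s_pos[of "Suc j"] by (intro mult_pos_pos) simp_all

lemma T_set: "K \<in> {t. 0 \<le> t \<and> (\<mu> t \<le> \<omega> * s j powr Q \<or> K \<le> t)}" using K by simp

lemma T_bdd: "bdd_below {t. 0 \<le> t \<and> (\<mu> t \<le> \<omega> * s j powr Q \<or> K \<le> t)}" by (rule bdd_belowI[of _ 0]) simp

lemma T_nonneg: "0 \<le> T j" unfolding T_def using T_set by (intro cInf_greatest) auto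

lemma T_le_K: "T j \<le> K" unfolding T_def by (rule cInf_lower[OF T_set T_bdd])

lemma T_0: "T 0 = 0"
proof -
  have "T 0 \<le> 0" unfolding T_def by (rule cInf_lower[OF _ T_bdd]) (simp add: s_def \<mu>_0)
  then show ?thesis using T_nonneg[of 0] by simp
qed

lemma T_mono: "T j \<le> T (Suc j)"
  unfolding T_def
proof (rule cInf_superset_mono[OF _ T_bdd])
  have "s (Suc j) powr Q \<le> s j powr Q" using s_dec[of j] s_pos[of "Suc j"] Q by (intro powr_mono2) simp_all
  then have "\<omega> * s (Suc j) powr Q \<le> \<omega> * s j powr Q" using \<omega> by simp
  then show "{t. 0 \<le> t \<and> (\<mu> t \<le> \<omega> * s (Suc j) powr Q \<or> K \<le> t)} \<subseteq> {t. 0 \<le> t \<and> (\<mu> t \<le> \<omega> * s j powr Q \<or> K \<le> t)}"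
    by auto
qed (use T_set in blast)

text \<open>Together with \<open>above_T\<close> this is all that is used about the levels: below
  \<open>T j\<close> the superlevel set is still larger than the ball, strictly above it and below
  the cap no longer. A jump of \<mu> at \<open>T j\<close> is allowed.\<close>

lemma below_T: "0 \<le> t \<Longrightarrow> t < T j \<Longrightarrow> \<omega> * s j powr Q < \<mu> t"
  using cInf_lower[OF _ T_bdd, of t j] unfolding T_def[symmetric] by (auto simp: not_le[symmetric])

lemma above_T:
  assumes "T j < t" "t < K"
  shows "\<mu> t \<le> \<omega> * s j powr Q"
proof -
  obtain t' where "0 \<le> t'" "\<mu> t' \<le> \<omega> * s j powr Q \<or> K \<le> t'" "t' < t"
    using cInf_lessD[of "{t. 0 \<le> t \<and> (\<mu> t \<le> \<omega> * s j powr Q \<or> K \<le> t)}" t] T_set assms(1)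
    unfolding T_def by blast
  then show ?thesis using assms(2) \<mu>_mono[of t' t] by simp
qed

text \<open>Up to level b the superlevel sets are larger than the ball of radius
  \<open>s (Suc j)\<close>, so their perimeter is at least C times the area of its sphere, and
  coarea bounds the integral of the slope from below. The set \<open>A\<close> has at most the
  measure \<open>W j\<close> of the model ring, and Hoelder's inequality combines the two. The
  strict bounds on a and b are what \<open>above_T\<close> and \<open>below_T\<close>
  require.\<close>

lemma ring_bound_open:
  assumes ab: "T j < a" "a < b" "b < T (Suc j)"
  shows "ennreal ((C * (Q * \<omega> * s (Suc j) powr (Q - 1)) * (b - a) / W j) powr p * W j)
    \<le> (\<integral>\<^sup>+x\<in>{x\<in>\<Omega>. T j < v x \<and> v x < T (Suc j)}. epowr (lip v x) p \<partial>m)"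
proof -
  define A where "A = {x\<in>\<Omega>. a < v x \<and> v x < b}"
  have "open A"
    using continuous_on_open_vimage[OF \<Omega>, THEN iffD1, OF cont, rule_format, of "{a<..<b}"]
    by (simp add: A_def vimage_def Int_def conj_commute)
  then have A[measurable]: "A \<in> sets m" using m by simp
  have a0: "0 \<le> a" using T_nonneg[of j] ab by linarith
  have "C * (Q * \<omega> * s (Suc j) powr (Q - 1)) * (b - a) \<ge> 0"
    using C Q \<omega> ab by simp
  have co: "ennreal (C * (Q * \<omega> * s (Suc j) powr (Q - 1)) * (b - a)) \<le> (\<integral>\<^sup>+x\<in>A. lip v x \<partial>m)"
  proof -
    have "ennreal (C * (Q * \<omega> * s (Suc j) powr (Q - 1))) * ennreal (b - a) \<le> (\<integral>\<^sup>+x\<in>A. lip v x \<partial>m)"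
      unfolding A_def
    proof (rule coarea_lower_bound[OF m \<Omega> fin v])
      show "ennreal (C * (Q * \<omega> * s (Suc j) powr (Q - 1))) \<le> perimeter m {x\<in>\<Omega>. t < v x} \<Omega>" if "a < t" "t < b" for t
        using below_T[of t "Suc j"] that a0 ab s_pos[of "Suc j"] by (intro perimeter_ge) simp_all
    qed (use ab in simp)
    then show ?thesis using C Q \<omega> ab by (subst ennreal_mult) simp_all
  qed
  have mA: "emeasure m A \<le> ennreal (W j)"
  proof -
    have "A \<subseteq> {x\<in>\<Omega>. a < v x} - {x\<in>\<Omega>. b < v x}" by (auto simp: A_def)
    then have "emeasure m A \<le> emeasure m ({x\<in>\<Omega>. a < v x} - {x\<in>\<Omega>. b < v x})"
      using superlevel_sets by (intro emeasure_mono) auto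
    also have "\<dots> = emeasure m {x\<in>\<Omega>. a < v x} - emeasure m {x\<in>\<Omega>. b < v x}"
      using emeasure_sub_finite[of "{x\<in>\<Omega>. b < v x}"] superlevel_sets ab by (intro emeasure_Diff) auto
    also have "\<dots> = ennreal (\<mu> a - \<mu> b)"
      unfolding emeasure_superlevel by (rule ennreal_minus[OF \<mu>_nonneg])
    also have "\<dots> \<le> ennreal (W j)"
    proof (rule ennreal_leI)
      have "\<mu> a \<le> \<omega> * s j powr Q" using ab T_le_K[of "Suc j"] by (intro above_T) simp_all
      moreover have "\<omega> * s (Suc j) powr Q < \<mu> b" using ab a0 by (intro below_T) simp_all
      ultimately show "\<mu> a - \<mu> b \<le> W j" by (simp add: W_def right_diff_distrib)
    qed
    finally show ?thesis .
  qed
  have lm: "(\<lambda>x. lip v x * indicator A x) \<in> borel_measurable m"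
  proof -
    have "(\<lambda>x. (lip v x * indicator \<Omega> x) * indicator A x) \<in> borel_measurable m"
      by (rule borel_measurable_times_ennreal[OF lip_measurable borel_measurable_indicator[OF A]])
    moreover have "(\<lambda>x. (lip v x * indicator \<Omega> x) * indicator A x) = (\<lambda>x. lip v x * indicator A x)"
      by (auto simp: fun_eq_iff A_def indicator_def)
    ultimately show ?thesis by simp
  qed
  have "ennreal ((C * (Q * \<omega> * s (Suc j) powr (Q - 1)) * (b - a) / W j) powr p * W j) \<le> (\<integral>\<^sup>+x\<in>A. epowr (lip v x) p \<partial>m)"
    by (rule holder_set[OF p A lm W_pos mA _ co]) fact
  also have "\<dots> \<le> (\<integral>\<^sup>+x\<in>{x\<in>\<Omega>. T j < v x \<and> v x < T (Suc j)}. epowr (lip v x) p \<partial>m)"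
    using ab by (intro nn_integral_mono) (auto simp: A_def indicator_def)
  finally show ?thesis .
qed

lemma ring_bound:
  "ennreal ((C * (Q * \<omega> * s (Suc j) powr (Q - 1)) * (T (Suc j) - T j) / W j) powr p * W j)
    \<le> (\<integral>\<^sup>+x\<in>{x\<in>\<Omega>. T j < v x \<and> v x < T (Suc j)}. epowr (lip v x) p \<partial>m)"
proof (cases "T j = T (Suc j)")
  case False
  define \<Delta> where "\<Delta> = T (Suc j) - T j"
  have \<Delta>: "0 < \<Delta>" using False T_mono[of j] by (simp add: \<Delta>_def)
  \<comment> \<open>Each end moves inwards by at most a quarter of \<Delta>, so a nonempty interval
    remains.\<close>
  define e where "e n = \<Delta> * (1 / real (Suc n)) / 4" for n
  have e0: "0 < e n" for n unfolding e_def using \<Delta> by simp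
  have e_le: "e n \<le> \<Delta> / 4" for n
  proof -
    have "\<Delta> * (1 / real (Suc n)) \<le> \<Delta> * 1" using \<Delta> by (intro mult_left_mono) simp_all
    then have "\<Delta> * (1 / real (Suc n)) / 4 \<le> \<Delta> * 1 / 4" by (intro divide_right_mono) simp_all
    then show ?thesis unfolding e_def by (simp only: mult_1_right)
  qed
  have lim_e: "e \<longlonglongrightarrow> 0"
  proof -
    have "(\<lambda>n. \<Delta> * (1 / real (Suc n)) / 4) \<longlonglongrightarrow> \<Delta> * 0 / 4"
      by (intro tendsto_intros lim_const_over_n[THEN LIMSEQ_Suc]) simp
    then show ?thesis unfolding e_def[abs_def] by simp
  qed
  have "ennreal ((C * (Q * \<omega> * s (Suc j) powr (Q - 1)) * (\<Delta> - 2 * e n) / W j) powr p * W j)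
     \<le> (\<integral>\<^sup>+x\<in>{x\<in>\<Omega>. T j < v x \<and> v x < T (Suc j)}. epowr (lip v x) p \<partial>m)" for n
  proof -
    have "(T (Suc j) - e n) - (T j + e n) = \<Delta> - 2 * e n" by (simp add: \<Delta>_def)
    moreover have "T j + e n < T (Suc j) - e n" using e_le[of n] \<Delta> unfolding \<Delta>_def by (simp add: field_simps)
    ultimately show ?thesis
      using ring_bound_open[of j "T j + e n" "T (Suc j) - e n"] e0[of n] by simp
  qed
  moreover have "(\<lambda>n. ennreal ((C * (Q * \<omega> * s (Suc j) powr (Q - 1)) * (\<Delta> - 2 * e n) / W j) powr p * W j))
     \<longlonglongrightarrow> ennreal ((C * (Q * \<omega> * s (Suc j) powr (Q - 1)) * (\<Delta> - 2 * 0) / W j) powr p * W j)"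
    using W_pos[of j] C Q \<omega> \<Delta> s_pos[of "Suc j"]
    by (intro tendsto_ennrealI tendsto_mult tendsto_powr tendsto_divide tendsto_diff tendsto_const lim_e) simp_all
  ultimately show ?thesis
    by (intro LIMSEQ_le_const2[where X = "\<lambda>n. ennreal ((C * (Q * \<omega> * s (Suc j) powr (Q - 1)) * (\<Delta> - 2 * e n) / W j) powr p * W j)"])
      (simp_all add: \<Delta>_def)
qed (use p in simp)

text \<open>\<open>T\<close> is monotone, so the open ranges between consecutive levels are
  disjoint, and they lie above 0.\<close>

lemma sum_rings_le: "(\<Sum>j<N. \<integral>\<^sup>+x\<in>{x\<in>\<Omega>. T j < v x \<and> v x < T (Suc j)}. epowr (lip v x) p \<partial>m) \<le> D"
proof -
  have ring_sets: "{x\<in>\<Omega>. T j < v x \<and> v x < T (Suc j)} \<in> sets m" for j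
    using continuous_on_open_vimage[OF \<Omega>, THEN iffD1, OF cont, rule_format, of "{T j<..<T (Suc j)}"] m
    by (simp add: vimage_def Int_def conj_commute)
  have meas: "(\<lambda>x. epowr (lip v x) p * indicator {x\<in>\<Omega>. T j < v x \<and> v x < T (Suc j)} x) \<in> borel_measurable m" for j
  proof -
    have "(\<lambda>x. epowr (lip v x * indicator \<Omega> x) p * indicator {x\<in>\<Omega>. T j < v x \<and> v x < T (Suc j)} x) \<in> borel_measurable m"
      by (rule borel_measurable_times_ennreal[OF borel_measurable_epowr[OF lip_measurable] borel_measurable_indicator[OF ring_sets]])
    moreover have "(\<lambda>x. epowr (lip v x * indicator \<Omega> x) p * indicator {x\<in>\<Omega>. T j < v x \<and> v x < T (Suc j)} x)
       = (\<lambda>x. epowr (lip v x) p * indicator {x\<in>\<Omega>. T j < v x \<and> v x < T (Suc j)} x)"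
      by (auto simp: fun_eq_iff indicator_def)
    ultimately show ?thesis by simp
  qed
  have "(\<Sum>j<N. \<integral>\<^sup>+x\<in>{x\<in>\<Omega>. T j < v x \<and> v x < T (Suc j)}. epowr (lip v x) p \<partial>m)
     = (\<integral>\<^sup>+x. (\<Sum>j<N. epowr (lip v x) p * indicator {x\<in>\<Omega>. T j < v x \<and> v x < T (Suc j)} x) \<partial>m)"
    by (rule nn_integral_sum[symmetric]) (rule meas)
  also have "\<dots> \<le> D"
    unfolding D_def
  proof (rule nn_integral_mono)
    fix x
    show "(\<Sum>j<N. epowr (lip v x) p * indicator {x\<in>\<Omega>. T j < v x \<and> v x < T (Suc j)} x)
       \<le> epowr (lip v x) p * indicator {x\<in>\<Omega>. 0 < v x} x"
    proof (cases "\<exists>j<N. x \<in> \<Omega> \<and> T j < v x \<and> v x < T (Suc j)")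
      case True
      then obtain j where j: "j < N" "x \<in> \<Omega>" "T j < v x" "v x < T (Suc j)" by blast
      have other: "indicator {x\<in>\<Omega>. T i < v x \<and> v x < T (Suc i)} x = (0::ennreal)" if "i \<noteq> j" for i
      proof -
        have mono: "T a \<le> T b" if "a \<le> b" for a b using that by (rule lift_Suc_mono_le[of T, OF T_mono])
        have "\<not> (T i < v x \<and> v x < T (Suc i))"
          using that j mono[of "Suc i" j] mono[of "Suc j" i] by (cases "i < j") auto
        then show ?thesis by (auto simp: indicator_def)
      qed
      have "(\<Sum>j<N. epowr (lip v x) p * indicator {x\<in>\<Omega>. T j < v x \<and> v x < T (Suc j)} x)
         = (\<Sum>i\<in>{j}. epowr (lip v x) p * indicator {x\<in>\<Omega>. T i < v x \<and> v x < T (Suc i)} x)"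
        using j(1) by (intro sum.mono_neutral_right) (auto simp: other)
      also have "\<dots> \<le> epowr (lip v x) p * indicator {x\<in>\<Omega>. 0 < v x} x"
        using j T_nonneg[of j] by (simp add: indicator_def)
      finally show ?thesis .
    next
      case False
      then have "(\<Sum>j<N. epowr (lip v x) p * indicator {x\<in>\<Omega>. T j < v x \<and> v x < T (Suc j)} x) = 0"
      proof (intro sum.neutral ballI)
        fix j assume "j \<in> {..<N}"
        with False have "x \<notin> {x\<in>\<Omega>. T j < v x \<and> v x < T (Suc j)}" by auto
        then have "indicator {x\<in>\<Omega>. T j < v x \<and> v x < T (Suc j)} x = (0::ennreal)"
          by (rule indicator_simps(2))
        then show "epowr (lip v x) p * indicator {x\<in>\<Omega>. T j < v x \<and> v x < T (Suc j)} x = 0"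
          by (simp only: mult_zero_right)
      qed
      then show ?thesis by (simp only: zero_le)
    qed
  qed
  finally show ?thesis .
qed

text \<open>Dilation by \<open>2\<^bsup>1/Q\<^esup>\<close> would put the first node at \<open>R\<close>; the factor \<open>1/q\<close> keeps the support inside
  the open ball.\<close>

definition "a = 2 powr (1 / Q) / q"
definition "S j = a * s j"
definition "\<Delta> j = T (Suc j) - T j"
text \<open>Bound for the quotient of the competitor's slope and the mean slope that Hoelder's
  inequality yields on a ring: 1 / C from the isoperimetric inequality, 1 / a from the dilation, the
  power of q from \<open>powr_diff_le\<close>.\<close>

definition "cq = q powr (Q - 1) / (a * C)"

lemma R_nonneg: "0 \<le> R" using R by simp

lemma a_pos: "0 < a" using q by (simp add: a_def)

lemma S_0: "S 0 = R / q" using q by (simp add: S_def s_def a_def r_def)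

lemma nodes: "nodes Q p R S \<Delta>"
proof
  show "S 0 < R" unfolding S_0 using R q by (simp add: divide_less_eq)
  show "0 < S j" for j unfolding S_def using a_pos s_pos by simp
  show "S (Suc j) < S j" for j unfolding S_def using a_pos s_dec by simp
  show "0 \<le> \<Delta> j" for j unfolding \<Delta>_def using T_mono[of j] by simp
qed (rule Q p)+

text \<open>On ring j the energy of v is at least \<open>(X j / W j) powr p * W j\<close>, while the
  competitor has slope at most \<open>cq * (X j / W j)\<close> on a ring of measure
  \<open>a powr Q * W j\<close>. The energies are thus compared term by term.\<close>

lemma energy_le: "ennreal (nodes.energy Q p N S \<Delta>) \<le> ennreal (cq powr p * a powr Q) * D"
proof -
  interpret nodes Q p R N S \<Delta> by (rule nodes)
  define X where "X j = C * (Q * \<omega> * s (Suc j) powr (Q - 1)) * \<Delta> j" for j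
  have X0: "0 \<le> X j" for j
    unfolding X_def using C Q \<omega> T_mono[of j] by (intro mult_nonneg_nonneg) (simp_all add: \<Delta>_def)
  have cq: "0 < cq" using q a_pos C by (simp add: cq_def)
  have slope_le: "slope j \<le> cq * (X j / W j)" for j
  proof -
    define z where "z = s (Suc j)"
    have z: "0 < z" by (simp add: z_def s_pos)
    have q1: "0 < q powr Q - 1" using q_powr by simp
    have "slope j = \<Delta> j / (a * z * (q - 1))"
      unfolding slope_def S_def s_Suc[of j] z_def by (simp add: algebra_simps)
    also have "\<dots> = \<Delta> j / (a * z) * (1 / (q - 1))" by simp
    also have "\<dots> \<le> \<Delta> j / (a * z) * (Q * q powr (Q - 1) / (q powr Q - 1))"
    proof -
      have "1 / (q - 1) \<le> Q * q powr (Q - 1) / (q powr Q - 1)"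
        using powr_diff_le[OF Q q] q q1 by (simp add: divide_le_eq pos_le_divide_eq)
      then show ?thesis
        using a_pos z T_mono[of j] by (intro mult_left_mono) (simp_all add: \<Delta>_def)
    qed
    also have "\<dots> = cq * (X j / W j)"
    proof -
      have zq: "z powr Q = z powr (Q - 1) * z" using z by (simp add: powr_diff)
      have XW: "X j / W j = C * Q * \<Delta> j / (z * (q powr Q - 1))"
        unfolding X_def W_eq z_def[symmetric] zq using \<omega> z q1 by (simp add: field_simps)
      show ?thesis unfolding cq_def XW using C a_pos z q1 by (simp add: field_simps)
    qed
    finally show ?thesis .
  qed
  have term_le: "slope j powr p * (unit_ball_vol Q * (S j powr Q - S (Suc j) powr Q))
      \<le> (cq powr p * a powr Q) * ((X j / W j) powr p * W j)" for j
  proof -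
    have "unit_ball_vol Q * (S j powr Q - S (Suc j) powr Q) = a powr Q * W j"
      unfolding S_def W_def \<omega>_def using a_pos s_pos[of j] s_pos[of "Suc j"]
      by (simp add: powr_mult algebra_simps)
    moreover have "slope j powr p \<le> cq powr p * (X j / W j) powr p"
    proof -
      have "slope j powr p \<le> (cq * (X j / W j)) powr p"
        using p by (intro powr_mono2 slope_le slope_nonneg) simp
      also have "\<dots> = cq powr p * (X j / W j) powr p"
        by (rule powr_mult)
      finally show ?thesis .
    qed
    then have "slope j powr p * (a powr Q * W j) \<le> cq powr p * (X j / W j) powr p * (a powr Q * W j)"
      using W_pos[of j] by (intro mult_right_mono) simp_all
    ultimately show ?thesis by (simp add: ac_simps)
  qed
  have "energy \<le> (\<Sum>j<N. (cq powr p * a powr Q) * ((X j / W j) powr p * W j))"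
    unfolding energy_def by (intro sum_mono term_le)
  then have "ennreal energy \<le> ennreal ((cq powr p * a powr Q) * (\<Sum>j<N. (X j / W j) powr p * W j))"
    unfolding sum_distrib_left[symmetric] by (rule ennreal_leI)
  also have "\<dots> = ennreal (cq powr p * a powr Q) * ennreal (\<Sum>j<N. (X j / W j) powr p * W j)"
    using W_pos by (intro ennreal_mult sum_nonneg mult_nonneg_nonneg) (simp_all add: less_imp_le)
  also have "ennreal (\<Sum>j<N. (X j / W j) powr p * W j) = (\<Sum>j<N. ennreal ((X j / W j) powr p * W j))"
    using W_pos by (intro sum_ennreal[symmetric] mult_nonneg_nonneg) (simp_all add: less_imp_le)
  also have "\<dots> \<le> (\<Sum>j<N. \<integral>\<^sup>+x\<in>{x\<in>\<Omega>. T j < v x \<and> v x < T (Suc j)}. epowr (lip v x) p \<partial>m)"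
    unfolding X_def \<Delta>_def by (intro sum_mono ring_bound)
  also have "\<dots> \<le> D" by (rule sum_rings_le)
  finally show ?thesis by (simp add: mult_left_mono)
qed

lemma sum_\<Delta>: "(\<Sum>j<n. \<Delta> j) = T n"
proof -
  have "(\<Sum>j<n. \<Delta> j) = T n - T 0" unfolding \<Delta>_def by (rule sum_lessThan_telescope)
  then show ?thesis using T_0 by simp
qed

definition "Fm N = pwl N S \<Delta>"

lemma Fm_ge:
  assumes "j < N" "coord x \<le> S (Suc j)"
  shows "T (Suc j) \<le> Fm N x"
proof -
  interpret nodes Q p R N S \<Delta> by (rule nodes)
  have "T (Suc j) = (\<Sum>i<Suc j. \<Delta> i * hat S i (coord x))"
    unfolding sum_\<Delta>[symmetric]
  proof (rule sum.cong[OF refl])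
    fix i assume "i \<in> {..<Suc j}"
    then have "S (Suc j) \<le> S (Suc i)" by (intro S_mono) simp
    then show "\<Delta> i = \<Delta> i * hat S i (coord x)" using assms(2) by (simp add: hat_eq_1)
  qed
  also have "\<dots> \<le> Fm N x"
    unfolding Fm_def pwl_def using assms(1) by (intro sum_mono2) (auto intro!: mult_nonneg_nonneg nodes.\<Delta>[OF nodes] hat_bounds)
  finally show ?thesis .
qed

lemma level_find:
  assumes "0 \<le> t" "t < T N"
  obtains j where "j < N" "T j \<le> t" "t < T (Suc j)"
proof -
  define n where "n = (LEAST n. t < T n)"
  have n: "t < T n" unfolding n_def by (rule LeastI[of _ N]) (rule assms(2))
  have nN: "n \<le> N" unfolding n_def by (rule Least_le) (rule assms(2))
  have "n \<noteq> 0" using n assms(1) T_0 by (intro notI) simp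
  then obtain j where j: "n = Suc j" by (cases n) auto
  have "\<not> t < T j" unfolding n_def by (rule not_less_Least) (simp add: n_def[symmetric] j)
  then show ?thesis using that[of j] n nN j by simp
qed

text \<open>\<open>a powr Q\<close> is the effect of the dilation on volumes. The other factor is
  the loss of one ring: for levels between \<open>T j\<close> and \<open>T (Suc j)\<close> the
  competitor is only known to exceed the level on the ball of radius \<open>S (Suc j)\<close>, not
  \<open>S j\<close>.\<close>

definition "b = a powr Q * q powr (- Q)"

lemma b_pos: "0 < b" unfolding b_def using a_pos q by simp

lemma v_clip_measurable: "(\<lambda>x. min (max 0 (if x \<in> \<Omega> then v x else 0)) K powr p) \<in> borel_measurable m"
proof -
  have [measurable]: "(\<lambda>x. if x \<in> \<Omega> then v x else 0) \<in> borel_measurable borel"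
    using \<Omega> by (intro borel_measurable_continuous_on_if[OF _ cont continuous_on_const]) simp
  have "(\<lambda>x. min (max 0 (if x \<in> \<Omega> then v x else 0)) K powr p) \<in> borel_measurable borel" by measurable
  then show ?thesis by (simp only: measurable_cong_sets[OF m refl])
qed

lemma Lp_norm_le:
  "ennreal b * (\<integral>\<^sup>+x\<in>\<Omega>. ennreal (min (max 0 (v x)) K powr p) \<partial>m)
    \<le> (\<integral>\<^sup>+x. ennreal (Fm N x powr p) \<partial>model_measure Q) + ennreal (b * (\<omega> * s N powr Q) * K powr p)"
proof -
  interpret nodes Q p R N S \<Delta> by (rule nodes)
  define f where "f x = min (max 0 (if x \<in> \<Omega> then v x else 0)) K powr p" for x
  have fm: "f \<in> borel_measurable m" unfolding f_def by (rule v_clip_measurable)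
  have Fm_eq: "Fm N = pwl N S \<Delta>" by (simp add: Fm_def)
  have Fm_meas[measurable]: "Fm N \<in> borel_measurable borel" unfolding Fm_eq by (rule F_measurable)
  define \<nu> where "\<nu> \<tau> = emeasure m {x\<in>\<Omega>. \<tau> < f x}" for \<tau>
  define \<nu>' where "\<nu>' \<tau> = emeasure (model_measure Q) {x\<in>{x. coord x < R}. \<tau> < Fm N x powr p}" for \<tau>
  have 1: "(\<integral>\<^sup>+x\<in>\<Omega>. ennreal (f x) \<partial>m) = (\<integral>\<^sup>+\<tau>. \<nu> \<tau> * indicator {0..} \<tau> \<partial>lborel)"
    unfolding \<nu>_def by (rule layer_cake[OF \<Omega>_sets fm fin]) (simp add: f_def)
  have 2: "(\<integral>\<^sup>+x\<in>{x. coord x < R}. ennreal (Fm N x powr p) \<partial>model_measure Q) = (\<integral>\<^sup>+\<tau>. \<nu>' \<tau> * indicator {0..} \<tau> \<partial>lborel)"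
    unfolding \<nu>'_def
  proof (rule layer_cake)
    show "(\<lambda>x. Fm N x powr p) \<in> borel_measurable (model_measure Q)" by measurable
    show "emeasure (model_measure Q) {x. coord x < R} < \<infinity>"
      by (simp add: emeasure_model_measure_ball[OF Q R_nonneg])
  qed simp_all
  have f_eq: "(\<integral>\<^sup>+x\<in>\<Omega>. ennreal (min (max 0 (v x)) K powr p) \<partial>m) = (\<integral>\<^sup>+x\<in>\<Omega>. ennreal (f x) \<partial>m)"
    by (intro nn_integral_cong) (simp add: f_def indicator_def)
  \<comment> \<open>Distribution functions are compared level by level. Levels above
    \<open>T N\<close> are out of the competitor's reach; there the superlevel set has measure at
    most \<open>\<omega> * s N powr Q\<close>, the source of the error term. The finitely many
    levels \<open>T j\<close> are left out because \<open>above_T\<close> says nothing at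
    them.\<close>
  have pt: "ennreal b * (\<nu> \<tau> * indicator {0..} \<tau>) \<le> \<nu>' \<tau> * indicator {0..} \<tau> + ennreal (b * (\<omega> * s N powr Q)) * indicator {0..K powr p} \<tau>"
    if not: "\<forall>j\<in>{..N}. \<tau> \<noteq> T j powr p" for \<tau>
  proof (cases "0 \<le> \<tau> \<and> \<tau> < K powr p")
    case False
    have "f x \<le> K powr p" for x unfolding f_def using K p by (intro powr_mono2) simp_all
    then have "{x\<in>\<Omega>. \<tau> < f x} = {}" if "K powr p \<le> \<tau>" using that by (auto simp: not_less intro: order_trans)
    then have "\<nu> \<tau> = 0" if "K powr p \<le> \<tau>" using that unfolding \<nu>_def by (simp only: emeasure_empty)
    then show ?thesis using False by (cases "0 \<le> \<tau>") simp_all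
  next
    case True
    define t where "t = \<tau> powr (1 / p)"
    have t: "0 \<le> t" "\<tau> = t powr p" using True p by (simp_all add: t_def powr_powr)
    have tK: "t < K"
    proof (rule ccontr)
      assume "\<not> t < K"
      then have "K powr p \<le> t powr p" using K p by (intro powr_mono2) simp_all
      then show False using True t by simp
    qed
    have "{x\<in>\<Omega>. \<tau> < f x} = {x\<in>\<Omega>. t < v x}"
    proof (rule Collect_cong)
      fix x
      show "(x \<in> \<Omega> \<and> \<tau> < f x) = (x \<in> \<Omega> \<and> t < v x)"
      proof (cases "x \<in> \<Omega>")
        case True
        define y where "y = min (max 0 (v x)) K"
        have y: "0 \<le> y" "f x = y powr p" using True K by (simp_all add: y_def f_def)
        have "\<tau> < f x \<longleftrightarrow> t < y"
          unfolding y(2) t(2) using y(1) t(1) p powr_less_mono2[of p t y] powr_mono2[of p y t]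
          by (cases "t < y") (simp_all add: not_less)
        then have "\<tau> < f x \<longleftrightarrow> t < min (max 0 (v x)) K" by (simp only: y_def)
        then show ?thesis using True t tK by auto
      qed simp
    qed
    then have \<nu>: "\<nu> \<tau> = ennreal (\<mu> t)" unfolding \<nu>_def by (simp add: emeasure_superlevel)
    have tT: "t \<noteq> T j" if "j \<le> N" for j using not that t by auto
    show ?thesis
    proof (cases "t < T N")
      case True
      then obtain j where j: "j < N" "T j \<le> t" "t < T (Suc j)" using level_find t(1) by blast
      have "T j < t" using j(2) tT[of j] j(1) by simp
      then have \<mu>: "\<mu> t \<le> \<omega> * s j powr Q" using tK by (rule above_T)
      have "b * \<mu> t \<le> b * (\<omega> * s j powr Q)" using \<mu> b_pos by simp
      also have "b * (\<omega> * s j powr Q) = \<omega> * S (Suc j) powr Q"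
      proof -
        have "q powr (- Q) * q powr Q = 1" using q by (simp add: powr_add[symmetric])
        then have "b * (\<omega> * s j powr Q) = \<omega> * (a powr Q * s (Suc j) powr Q)"
          unfolding b_def s_powr[of j] by (simp add: ac_simps)
        then show ?thesis unfolding S_def by (simp add: powr_mult)
      qed
      finally have "ennreal (b * \<mu> t) \<le> ennreal (unit_ball_vol Q * S (Suc j) powr Q)" unfolding \<omega>_def by (rule ennreal_leI)
      also have "\<dots> = emeasure (model_measure Q) {x. coord x < S (Suc j)}"
        by (rule emeasure_model_measure_ball[OF Q, symmetric]) (rule less_imp_le[OF S0])
      also have "\<dots> \<le> \<nu>' \<tau>"
        unfolding \<nu>'_def
      proof (rule emeasure_mono)
        show "{x. coord x < S (Suc j)} \<subseteq> {x\<in>{x. coord x < R}. \<tau> < Fm N x powr p}"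
        proof safe
          fix x assume x: "coord x < S (Suc j)"
          show "coord x < R" using x S_mono[of 0 "Suc j"] nodes.R[OF nodes] by simp
          have "t < Fm N x" using Fm_ge[of j N x] j x by simp
          then show "\<tau> < Fm N x powr p" unfolding t(2) using t(1) p by (intro powr_less_mono2) simp_all
        qed
        show "{x\<in>{x. coord x < R}. \<tau> < Fm N x powr p} \<in> sets (model_measure Q)" by simp
      qed
      finally have "ennreal b * ennreal (\<mu> t) \<le> \<nu>' \<tau>"
        using b_pos \<mu>_nonneg by (simp add: ennreal_mult)
      then show ?thesis using \<open>0 \<le> \<tau> \<and> \<tau> < K powr p\<close> by (simp add: \<nu> add_increasing2)
    next
      case False
      then have "T N < t" using tT[of N] by simp
      then have \<mu>: "\<mu> t \<le> \<omega> * s N powr Q" using tK by (rule above_T)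
      then have "b * \<mu> t \<le> b * (\<omega> * s N powr Q)" using b_pos by simp
      then have "ennreal (b * \<mu> t) \<le> ennreal (b * (\<omega> * s N powr Q))" by (rule ennreal_leI)
      then have "ennreal b * ennreal (\<mu> t) \<le> ennreal (b * (\<omega> * s N powr Q))"
        using b_pos \<mu>_nonneg by (simp add: ennreal_mult)
      then show ?thesis using \<open>0 \<le> \<tau> \<and> \<tau> < K powr p\<close> by (simp add: \<nu> add_increasing)
    qed
  qed
  have "(\<lambda>\<tau>. \<nu> \<tau> * indicator {0..} \<tau>) \<in> borel_measurable borel"
    unfolding \<nu>_def by (rule layer_cake(2)[OF \<Omega>_sets fm fin]) (simp add: f_def)
  then have \<nu>m: "(\<lambda>\<tau>. \<nu> \<tau> * indicator {0..} \<tau>) \<in> borel_measurable lborel"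
    by (simp only: measurable_lborel2)
  have "(\<lambda>\<tau>. \<nu>' \<tau> * indicator {0..} \<tau>) \<in> borel_measurable borel"
    unfolding \<nu>'_def
  proof (rule layer_cake(2))
    show "(\<lambda>x. Fm N x powr p) \<in> borel_measurable (model_measure Q)" by measurable
    show "emeasure (model_measure Q) {x. coord x < R} < \<infinity>"
      by (simp add: emeasure_model_measure_ball[OF Q R_nonneg])
  qed simp_all
  then have \<nu>'m: "(\<lambda>\<tau>. \<nu>' \<tau> * indicator {0..} \<tau>) \<in> borel_measurable lborel"
    by (simp only: measurable_lborel2)
  have "ennreal b * (\<integral>\<^sup>+x\<in>\<Omega>. ennreal (min (max 0 (v x)) K powr p) \<partial>m)
      = (\<integral>\<^sup>+\<tau>. ennreal b * (\<nu> \<tau> * indicator {0..} \<tau>) \<partial>lborel)"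
    unfolding f_eq 1 by (rule nn_integral_cmult[OF \<nu>m, symmetric])
  also have "\<dots> \<le> (\<integral>\<^sup>+\<tau>. \<nu>' \<tau> * indicator {0..} \<tau> + ennreal (b * (\<omega> * s N powr Q)) * indicator {0..K powr p} \<tau> \<partial>lborel)"
  proof (rule nn_integral_mono_AE)
    have "AE \<tau> in lborel. \<forall>j\<in>{..N}. \<tau> \<noteq> T j powr p"
      by (intro AE_finite_allI AE_lborel_singleton) simp
    then show "AE \<tau> in lborel. ennreal b * (\<nu> \<tau> * indicator {0..} \<tau>)
        \<le> \<nu>' \<tau> * indicator {0..} \<tau> + ennreal (b * (\<omega> * s N powr Q)) * indicator {0..K powr p} \<tau>"
      by eventually_elim (rule pt)
  qed
  also have "\<dots> = (\<integral>\<^sup>+\<tau>. \<nu>' \<tau> * indicator {0..} \<tau> \<partial>lborel)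
      + (\<integral>\<^sup>+\<tau>. ennreal (b * (\<omega> * s N powr Q)) * indicator {0..K powr p} \<tau> \<partial>lborel)"
    by (rule nn_integral_add[OF \<nu>'m]) measurable
  also have "(\<integral>\<^sup>+\<tau>. ennreal (b * (\<omega> * s N powr Q)) * indicator {0..K powr p} \<tau> \<partial>lborel)
      = ennreal (b * (\<omega> * s N powr Q)) * emeasure lborel {0..K powr p}"
    by (rule nn_integral_cmult_indicator) simp
  also have "\<dots> = ennreal (b * (\<omega> * s N powr Q) * K powr p)"
    using b_pos \<omega> by (simp add: ennreal_mult)
  also have "(\<integral>\<^sup>+\<tau>. \<nu>' \<tau> * indicator {0..} \<tau> \<partial>lborel) \<le> (\<integral>\<^sup>+x. ennreal (Fm N x powr p) \<partial>model_measure Q)"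
    unfolding 2[symmetric] by (intro nn_integral_mono) (simp add: indicator_def)
  finally show ?thesis by (simp add: add_right_mono)
qed

text \<open>N tends to infinity with q and K fixed: the cap K makes the error term of
  \<open>Lp_norm_le\<close> finite, and \<open>s N\<close> tends to 0. A real number l below the
  eigenvalue stands in for it, so that the error still vanishes after multiplication.\<close>

lemma clipped_bound:
  assumes l: "ennreal l \<le> model_dirichlet_eigenvalue p Q R" "0 \<le> l"
  shows "ennreal (l * q powr (- Q)) * (\<integral>\<^sup>+x\<in>\<Omega>. ennreal (min (max 0 (v x)) K powr p) \<partial>m) \<le> ennreal (cq powr p) * D"
proof -
  define I where "I = (\<integral>\<^sup>+x\<in>\<Omega>. ennreal (min (max 0 (v x)) K powr p) \<partial>m)"
  have le: "ennreal l * (ennreal b * I) \<le> ennreal (cq powr p * a powr Q) * D + ennreal (l * (b * (\<omega> * s N powr Q) * K powr p))" for N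
  proof -
    have "ennreal l * (ennreal b * I) \<le> ennreal l * ((\<integral>\<^sup>+x. ennreal (Fm N x powr p) \<partial>model_measure Q) + ennreal (b * (\<omega> * s N powr Q) * K powr p))"
      unfolding I_def by (intro mult_left_mono Lp_norm_le) simp
    also have "\<dots> = ennreal l * (\<integral>\<^sup>+x. ennreal (Fm N x powr p) \<partial>model_measure Q) + ennreal l * ennreal (b * (\<omega> * s N powr Q) * K powr p)"
      by (rule distrib_left)
    also have "ennreal l * ennreal (b * (\<omega> * s N powr Q) * K powr p) = ennreal (l * (b * (\<omega> * s N powr Q) * K powr p))"
      using l b_pos \<omega> by (intro ennreal_mult[symmetric]) simp_all
    also have "ennreal l * (\<integral>\<^sup>+x. ennreal (Fm N x powr p) \<partial>model_measure Q)
        \<le> model_dirichlet_eigenvalue p Q R * (\<integral>\<^sup>+x. ennreal (Fm N x powr p) \<partial>model_measure Q)"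
      by (intro mult_right_mono l) simp
    also have "\<dots> \<le> ennreal (nodes.energy Q p N S \<Delta>)"
      unfolding Fm_def by (rule nodes.eigenvalue_le[OF nodes])
    also have "\<dots> \<le> ennreal (cq powr p * a powr Q) * D" by (rule energy_le)
    finally show ?thesis by (simp add: add_right_mono)
  qed
  have "s \<longlonglongrightarrow> 0"
  proof -
    have "(\<lambda>j. r * (1 / q) ^ j) \<longlonglongrightarrow> r * 0"
      using q by (intro tendsto_mult tendsto_const LIMSEQ_power_zero) simp
    moreover have "s = (\<lambda>j. r * (1 / q) ^ j)" by (simp add: fun_eq_iff s_def power_divide)
    ultimately show ?thesis by simp
  qed
  moreover have "\<forall>\<^sub>F j in sequentially. 0 \<le> s j" using s_pos by (intro always_eventually allI less_imp_le)
  ultimately have "(\<lambda>j. s j powr Q) \<longlonglongrightarrow> 0"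
    using Q by (intro tendsto_zero_powrI[where b = Q] tendsto_const) simp_all
  then have "(\<lambda>N. ennreal (cq powr p * a powr Q) * D + ennreal (l * (b * (\<omega> * s N powr Q) * K powr p)))
      \<longlonglongrightarrow> ennreal (cq powr p * a powr Q) * D + ennreal (l * (b * (\<omega> * 0) * K powr p))"
    by (intro tendsto_add tendsto_ennrealI tendsto_mult tendsto_const)
  then have "ennreal l * (ennreal b * I) \<le> ennreal (cq powr p * a powr Q) * D + ennreal (l * (b * (\<omega> * 0) * K powr p))"
    by (rule LIMSEQ_le_const) (use le in blast)
  then have main: "ennreal l * (ennreal b * I) \<le> ennreal (cq powr p * a powr Q) * D" by simp
  have A: "0 < a powr Q" using a_pos by simp
  have "ennreal (l * q powr (- Q)) * I = ennreal (1 / a powr Q) * (ennreal l * (ennreal b * I))"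
  proof -
    have "ennreal (1 / a powr Q) * (ennreal l * (ennreal b * I)) = (ennreal (1 / a powr Q) * ennreal l * ennreal b) * I"
      by (simp only: mult.assoc)
    also have "ennreal (1 / a powr Q) * ennreal l * ennreal b = ennreal (1 / a powr Q * l * b)"
    proof -
      have "ennreal (1 / a powr Q * l * b) = ennreal (1 / a powr Q * l) * ennreal b"
        using l A b_pos by (intro ennreal_mult) simp_all
      also have "ennreal (1 / a powr Q * l) = ennreal (1 / a powr Q) * ennreal l"
        using l A by (intro ennreal_mult) simp_all
      finally show ?thesis by (rule sym)
    qed
    also have "1 / a powr Q * l * b = l * q powr (- Q)" unfolding b_def using A by simp
    finally show ?thesis by simp
  qed
  also have "\<dots> \<le> ennreal (1 / a powr Q) * (ennreal (cq powr p * a powr Q) * D)"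
    by (intro mult_left_mono main) simp
  also have "\<dots> = (ennreal (1 / a powr Q) * ennreal (cq powr p * a powr Q)) * D" by (simp only: mult.assoc)
  also have "ennreal (1 / a powr Q) * ennreal (cq powr p * a powr Q) = ennreal (cq powr p)"
    using A by (subst ennreal_mult[symmetric]) simp_all
  finally show ?thesis unfolding I_def .
qed

lemma cq_eq: "cq = q powr Q / (2 powr (1 / Q) * C)"
proof -
  have "q powr (Q - 1) * q = q powr Q" using q by (simp add: powr_diff)
  then show ?thesis unfolding cq_def a_def using C q by (simp add: field_simps)
qed

end

lemma ennreal_le_of_scaled_limit:
  fixes X Y :: ennreal
  assumes f: "f \<longlonglongrightarrow> (1::real)" and g: "g \<longlonglongrightarrow> c" and c: "0 \<le> c"
    and le: "\<And>n. ennreal (l * f n) * X \<le> ennreal (g n) * Y" and l: "0 < l" and Y: "Y \<noteq> top"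
  shows "ennreal l * X \<le> ennreal c * Y"
proof -
  have "(\<lambda>n. ennreal (l * f n) * X) \<longlonglongrightarrow> ennreal (l * 1) * X"
    using l by (intro tendsto_mult_ennreal tendsto_ennrealI tendsto_mult tendsto_const f) simp
  moreover have "(\<lambda>n. ennreal (g n) * Y) \<longlonglongrightarrow> ennreal c * Y"
    using Y by (intro tendsto_mult_ennreal tendsto_ennrealI tendsto_const g) simp
  ultimately have "ennreal (l * 1) * X \<le> ennreal c * Y"
    by (rule LIMSEQ_le) (use le in blast)
  then show ?thesis by simp
qed

text \<open>Lets an infinite L be tested by its finite lower bounds: unless X = 0, arbitrarily large
  l force Y to be infinite.\<close>

lemma ennreal_mult_le_of_real_bounds:
  fixes L X Y :: ennreal
  assumes "\<And>l. 0 < l \<Longrightarrow> ennreal l \<le> L \<Longrightarrow> ennreal l * X \<le> Y"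
  shows "L * X \<le> Y"
proof (cases L)
  case (real l)
  then show ?thesis using assms[of l] by (cases "l = 0") simp_all
next
  case top
  have *: "ennreal l * X \<le> Y" if "0 < l" for l using assms[OF that] top by simp
  show ?thesis
  proof (cases "X = 0 \<or> Y = top")
    case False
    have "X \<le> Y" using *[of 1] by simp
    then obtain x y where xy: "X = ennreal x" "Y = ennreal y" "0 < x" "0 \<le> y"
      using False by (cases X; cases Y) (auto simp: top_unique less_le)
    have "ennreal ((y + 1) / x) * X = ennreal (y + 1)"
      unfolding xy(1) using xy by (subst ennreal_mult[symmetric]) simp_all
    then have "ennreal (y + 1) \<le> ennreal y" using *[of "(y + 1) / x"] xy by simp
    then show ?thesis using xy by (subst (asm) ennreal_le_iff) simp_all
  qed auto
qed

context one_sided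
begin

text \<open>With q = 1 + 1 / (n + 1) tending to 1, the loss \<open>q powr (- Q)\<close> tends to 1
  and \<open>cq\<close> to \<open>1 / (2 powr (1 / Q) * C)\<close>.\<close>

lemma faber_krahn_clipped:
  assumes K: "0 < K" and l: "ennreal l \<le> model_dirichlet_eigenvalue p Q R" "0 < l" and D: "D \<noteq> top"
  shows "ennreal l * (\<integral>\<^sup>+x\<in>\<Omega>. ennreal (min (max 0 (v x)) K powr p) \<partial>m)
    \<le> ennreal ((1 / (2 powr (1 / Q) * C)) powr p) * D"
proof (rule ennreal_le_of_scaled_limit[where f = "\<lambda>n. (1 + 1 / real (Suc n)) powr (- Q)"
      and g = "\<lambda>n. ((1 + 1 / real (Suc n)) powr Q / (2 powr (1 / Q) * C)) powr p"])
  have lim: "(\<lambda>n. 1 + 1 / real (Suc n)) \<longlonglongrightarrow> 1 + 0"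
    by (intro tendsto_add tendsto_const lim_const_over_n[THEN LIMSEQ_Suc])
  have pw: "(\<lambda>n. (1 + 1 / real (Suc n)) powr e) \<longlonglongrightarrow> 1" for e
  proof -
    have "(\<lambda>n. (1 + 1 / real (Suc n)) powr e) \<longlonglongrightarrow> (1 + 0) powr e"
      by (intro tendsto_powr lim tendsto_const) simp
    then show ?thesis by simp
  qed
  show "(\<lambda>n. (1 + 1 / real (Suc n)) powr (- Q)) \<longlonglongrightarrow> 1" by (rule pw)
  show "(\<lambda>n. ((1 + 1 / real (Suc n)) powr Q / (2 powr (1 / Q) * C)) powr p) \<longlonglongrightarrow> (1 / (2 powr (1 / Q) * C)) powr p"
    using C by (intro tendsto_powr tendsto_divide pw tendsto_const) simp_all
  show "ennreal (l * (1 + 1 / real (Suc n)) powr (- Q)) * (\<integral>\<^sup>+x\<in>\<Omega>. ennreal (min (max 0 (v x)) K powr p) \<partial>m)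
     \<le> ennreal (((1 + 1 / real (Suc n)) powr Q / (2 powr (1 / Q) * C)) powr p) * D" for n
  proof -
    interpret levels m \<Omega> v C Q p R K "1 + 1 / real (Suc n)"
      by unfold_locales (use K in simp_all)
    show ?thesis using clipped_bound[OF l(1) less_imp_le[OF l(2)]] unfolding cq_eq .
  qed
qed (use l D in simp_all)

text \<open>The last limit, K to infinity, is monotone convergence, as \<open>D\<close> does not
  depend on K.\<close>

lemma faber_krahn:
  "model_dirichlet_eigenvalue p Q R * (\<integral>\<^sup>+x\<in>\<Omega>. ennreal (max 0 (v x) powr p) \<partial>m)
    \<le> ennreal ((1 / (2 powr (1 / Q) * C)) powr p) * D"
proof (cases "D = top")
  case True
  then show ?thesis using C by (simp add: ennreal_mult_top)
next
  case False
  show ?thesis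
  proof (rule ennreal_mult_le_of_real_bounds)
    fix l assume l: "0 < l" "ennreal l \<le> model_dirichlet_eigenvalue p Q R"
    define h where "h K x = ennreal (min (max 0 (v x)) (real (Suc K)) powr p) * indicator \<Omega> x" for K :: nat and x
    have hm: "h K \<in> borel_measurable m" for K
    proof -
      have [measurable]: "(\<lambda>x. if x \<in> \<Omega> then v x else 0) \<in> borel_measurable borel"
        using \<Omega> by (intro borel_measurable_continuous_on_if[OF _ cont continuous_on_const]) simp
      have [measurable]: "\<Omega> \<in> sets borel" using \<Omega> by simp
      have "(\<lambda>x. ennreal (min (max 0 (if x \<in> \<Omega> then v x else 0)) (real (Suc K)) powr p) * indicator \<Omega> x) \<in> borel_measurable borel"
        by measurable
      moreover have "(\<lambda>x. ennreal (min (max 0 (if x \<in> \<Omega> then v x else 0)) (real (Suc K)) powr p) * indicator \<Omega> x) = h K"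
        by (auto simp: fun_eq_iff h_def indicator_def)
      ultimately show ?thesis by (simp only: measurable_cong_sets[OF m refl])
    qed
    have inc: "incseq h"
    proof (rule incseq_SucI, rule le_funI)
      fix K x
      have "min (max 0 (v x)) (real (Suc K)) powr p \<le> min (max 0 (v x)) (real (Suc (Suc K))) powr p"
        using p by (intro powr_mono2) simp_all
      then show "h K x \<le> h (Suc K) x" unfolding h_def by (intro mult_right_mono ennreal_leI) simp_all
    qed
    have sup: "(SUP K. h K x) = ennreal (max 0 (v x) powr p) * indicator \<Omega> x" for x
    proof (rule antisym)
      have "min (max 0 (v x)) (real (Suc K)) powr p \<le> max 0 (v x) powr p" for K
        using p by (intro powr_mono2) simp_all
      then show "(SUP K. h K x) \<le> ennreal (max 0 (v x) powr p) * indicator \<Omega> x"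
        unfolding h_def by (intro SUP_least mult_right_mono ennreal_leI) simp_all
      obtain K where "max 0 (v x) < real K" using reals_Archimedean2 by blast
      then have "min (max 0 (v x)) (real (Suc K)) = max 0 (v x)" by simp
      then have "ennreal (max 0 (v x) powr p) * indicator \<Omega> x = h K x" unfolding h_def by (simp only:)
      also have "\<dots> \<le> (SUP K. h K x)" by (rule SUP_upper) simp
      finally show "ennreal (max 0 (v x) powr p) * indicator \<Omega> x \<le> (SUP K. h K x)" .
    qed
    have "(\<integral>\<^sup>+x\<in>\<Omega>. ennreal (max 0 (v x) powr p) \<partial>m) = (SUP K. \<integral>\<^sup>+x. h K x \<partial>m)"
      unfolding sup[symmetric] by (rule nn_integral_monotone_convergence_SUP[OF inc hm])
    then have "ennreal l * (\<integral>\<^sup>+x\<in>\<Omega>. ennreal (max 0 (v x) powr p) \<partial>m) = (SUP K. ennreal l * (\<integral>\<^sup>+x. h K x \<partial>m))"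
      by (simp only: SUP_mult_left_ennreal)
    also have "\<dots> \<le> ennreal ((1 / (2 powr (1 / Q) * C)) powr p) * D"
      unfolding h_def by (intro SUP_least faber_krahn_clipped l False) simp
    finally show "ennreal l * (\<integral>\<^sup>+x\<in>\<Omega>. ennreal (max 0 (v x) powr p) \<partial>m) \<le> ennreal ((1 / (2 powr (1 / Q) * C)) powr p) * D" .
  qed
qed

end

section \<open>Medians\<close>

lemma ex_median:
  assumes fin: "emeasure M A < \<infinity>" and [measurable]: "A \<in> sets M" "\<And>c. {x\<in>A. c < v x} \<in> sets M" "\<And>c. {x\<in>A. v x < c} \<in> sets M"
  obtains c :: real where "2 * measure M {x\<in>A. c < v x} \<le> measure M A" "2 * measure M {x\<in>A. v x < c} \<le> measure M A"
proof (cases "measure M A = 0")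
  case True
  have "measure M {x\<in>A. 0 < v x} \<le> measure M A" "measure M {x\<in>A. v x < 0} \<le> measure M A"
    using fin by (intro measure_mono_fmeasurable fmeasurableI; auto)+
  then show ?thesis using that[of 0] True by simp
next
  case False
  define up where "up c = measure M {x\<in>A. c < v x}" for c
  define dn where "dn c = measure M {x\<in>A. v x < c}" for c
  define h where "h = measure M A / 2"
  have h: "0 < h" using False by (simp add: h_def less_le)
  have fm: "B \<in> fmeasurable M" if "B \<subseteq> A" "B \<in> sets M" for B
    using that fin emeasure_mono[of B A M] by (intro fmeasurableI) (auto intro: order_le_less_trans)
  have up_mono: "up d \<le> up c" if "c \<le> d" for c d
    unfolding up_def using that by (intro measure_mono_fmeasurable fm) auto
  have sum_le: "up c + dn c \<le> measure M A" for c
  proof -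
    have "up c + dn c = measure M ({x\<in>A. c < v x} \<union> {x\<in>A. v x < c})"
      unfolding up_def dn_def
    proof (rule measure_Union[symmetric])
      show "emeasure M {x\<in>A. c < v x} \<noteq> \<infinity>" "emeasure M {x\<in>A. v x < c} \<noteq> \<infinity>"
        using fm[of "{x\<in>A. c < v x}"] fm[of "{x\<in>A. v x < c}"] by (auto dest: fmeasurableD2)
    qed auto
    also have "\<dots> \<le> measure M A" by (intro measure_mono_fmeasurable fm) auto
    finally show ?thesis .
  qed
  have dec_cont: "(\<lambda>n. measure M (B n)) \<longlonglongrightarrow> measure M (\<Inter>n. B n)" if "decseq B" "\<And>n. B n \<subseteq> A" "\<And>n. B n \<in> sets M" for B
    using that fm[THEN fmeasurableD2] by (intro Lim_measure_decseq) auto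
  have inc_cont: "(\<lambda>n. measure M (B n)) \<longlonglongrightarrow> measure M (\<Union>n. B n)" if B: "incseq B" "\<And>n. B n \<subseteq> A" "\<And>n. B n \<in> sets M" for B
  proof (rule Lim_measure_incseq)
    have "(\<Union>n. B n) \<in> fmeasurable M" using B by (intro fm) auto
    then show "emeasure M (\<Union>n. B n) \<noteq> \<infinity>" using fmeasurableD2 by auto
  qed (use B in auto)
  have hM: "measure M A = 2 * h" by (simp add: h_def)
  define Z where "Z = {c. up c \<le> h}"
  have "\<exists>c. up c < h"
  proof -
    have "(\<lambda>n. measure M {x\<in>A. real n < v x}) \<longlonglongrightarrow> measure M (\<Inter>n. {x\<in>A. real n < v x})"
      by (rule dec_cont) (auto simp: decseq_def)
    also have "(\<Inter>n. {x\<in>A. real n < v x}) = {}"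
    proof safe
      fix x assume x: "x \<in> (\<Inter>n. {x\<in>A. real n < v x})"
      obtain n where "v x < real n" using reals_Archimedean2 by blast
      moreover have "real n < v x" using x by blast
      ultimately show "x \<in> {}" by simp
    qed
    finally have "\<forall>\<^sub>F n in sequentially. up (real n) < h" using h unfolding up_def by (intro order_tendstoD) simp_all
    then show ?thesis using eventually_happens'[OF sequentially_bot] by blast
  qed
  then obtain c1 where c1: "up c1 < h" by blast
  have "\<exists>c. h < up c"
  proof -
    have "(\<lambda>n. measure M {x\<in>A. - real n < v x}) \<longlonglongrightarrow> measure M (\<Union>n. {x\<in>A. - real n < v x})"
      by (rule inc_cont) (auto simp: incseq_def)
    also have "(\<Union>n. {x\<in>A. - real n < v x}) = A"
    proof safe
      fix x assume "x \<in> A"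
      obtain n where "- v x < real n" using reals_Archimedean2 by blast
      then show "x \<in> (\<Union>n. {x\<in>A. - real n < v x})" using \<open>x \<in> A\<close> by (intro UN_I[of n]) simp_all
    qed
    finally have lim: "(\<lambda>n. up (- real n)) \<longlonglongrightarrow> measure M A" unfolding up_def .
    have "h < measure M A" using h hM by linarith
    with lim have "\<forall>\<^sub>F n in sequentially. h < up (- real n)" by (rule order_tendstoD(1))
    then show ?thesis using eventually_happens'[OF sequentially_bot] by blast
  qed
  then obtain c0 where c0: "h < up c0" by blast
  have bdd: "bdd_below Z"
  proof (rule bdd_belowI[of _ c0])
    fix c assume "c \<in> Z" then show "c0 \<le> c" using c0 up_mono[of c c0] unfolding Z_def by (cases "c0 \<le> c") simp_all
  qed
  have ne: "Z \<noteq> {}" using c1 unfolding Z_def by (auto intro: less_imp_le)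
  define c where "c = Inf Z"
  have above: "up d \<le> h" if cd: "c < d" for d
  proof -
    have "\<exists>z\<in>Z. z < d" using cd unfolding c_def by (rule cInf_lessD[OF ne])
    then obtain z where "z \<in> Z" "z < d" by blast
    then show ?thesis using up_mono[of z d] unfolding Z_def by simp
  qed
  have below: "h < up d" if "d < c" for d
  proof (rule ccontr)
    assume "\<not> h < up d"
    then have "d \<in> Z" by (simp add: Z_def)
    then have "c \<le> d" unfolding c_def by (rule cInf_lower[OF _ bdd])
    with that show False by simp
  qed
  have "up c \<le> h"
  proof -
    have "(\<lambda>n. measure M {x\<in>A. c + 1 / real (Suc n) < v x}) \<longlonglongrightarrow> measure M (\<Union>n. {x\<in>A. c + 1 / real (Suc n) < v x})"
    proof (rule inc_cont)
      show "incseq (\<lambda>n. {x\<in>A. c + 1 / real (Suc n) < v x})"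
      proof (rule incseq_SucI)
        fix n
        have "1 / real (Suc (Suc n)) \<le> 1 / real (Suc n)" by (intro divide_left_mono) simp_all
        then show "{x\<in>A. c + 1 / real (Suc n) < v x} \<subseteq> {x\<in>A. c + 1 / real (Suc (Suc n)) < v x}" by auto
      qed
    qed auto
    also have "(\<Union>n. {x\<in>A. c + 1 / real (Suc n) < v x}) = {x\<in>A. c < v x}"
    proof safe
      fix x n assume "c + 1 / real (Suc n) < v x"
      moreover have "0 < 1 / real (Suc n)" by simp
      ultimately show "c < v x" by linarith
    next
      fix x assume x: "x \<in> A" "c < v x"
      then obtain n where "1 / real (Suc n) < v x - c" using nat_approx_posE[of "v x - c"] by auto
      then show "x \<in> (\<Union>n. {x\<in>A. c + 1 / real (Suc n) < v x})" using x(1) by (intro UN_I[of n]) simp_all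
    qed
    finally have "(\<lambda>n. up (c + 1 / real (Suc n))) \<longlonglongrightarrow> up c" by (simp only: up_def)
    moreover have "up (c + 1 / real (Suc n)) \<le> h" for n by (rule above) simp
    ultimately show ?thesis by (intro LIMSEQ_le_const2[where X = "\<lambda>n. up (c + 1 / real (Suc n))"]) blast+
  qed
  moreover have "dn c \<le> h"
  proof -
    have "(\<lambda>n. measure M {x\<in>A. v x < c - 1 / real (Suc n)}) \<longlonglongrightarrow> measure M (\<Union>n. {x\<in>A. v x < c - 1 / real (Suc n)})"
    proof (rule inc_cont)
      show "incseq (\<lambda>n. {x\<in>A. v x < c - 1 / real (Suc n)})"
      proof (rule incseq_SucI)
        fix n
        have "1 / real (Suc (Suc n)) \<le> 1 / real (Suc n)" by (intro divide_left_mono) simp_all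
        then show "{x\<in>A. v x < c - 1 / real (Suc n)} \<subseteq> {x\<in>A. v x < c - 1 / real (Suc (Suc n))}" by auto
      qed
    qed auto
    also have "(\<Union>n. {x\<in>A. v x < c - 1 / real (Suc n)}) = {x\<in>A. v x < c}"
    proof safe
      fix x n assume "v x < c - 1 / real (Suc n)"
      moreover have "0 < 1 / real (Suc n)" by simp
      ultimately show "v x < c" by linarith
    next
      fix x assume x: "x \<in> A" "v x < c"
      then obtain n where "1 / real (Suc n) < c - v x" using nat_approx_posE[of "c - v x"] by auto
      then show "x \<in> (\<Union>n. {x\<in>A. v x < c - 1 / real (Suc n)})" using x(1) by (intro UN_I[of n]) simp_all
    qed
    finally have "(\<lambda>n. dn (c - 1 / real (Suc n))) \<longlonglongrightarrow> dn c" by (simp only: dn_def)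
    moreover have "dn (c - 1 / real (Suc n)) \<le> h" for n
    proof -
      have "h < up (c - 1 / real (Suc n))" by (rule below) simp
      then show ?thesis using sum_le[of "c - 1 / real (Suc n)"] by (simp add: h_def)
    qed
    ultimately show ?thesis by (intro LIMSEQ_le_const2[where X = "\<lambda>n. dn (c - 1 / real (Suc n))"]) blast+
  qed
  ultimately show ?thesis using that[of c] unfolding up_def dn_def h_def by simp
qed

section \<open>Poincare inequality\<close>

lemma lip_diff_const: "lip (\<lambda>y. v y - c) x = lip v x" "lip (\<lambda>y. c - v y) x = lip v x"
  unfolding lip_def by (simp_all add: abs_minus_commute)

text \<open>With c a median, v - c and c - v both fit \<open>one_sided\<close>. The p-th powers of
  their positive parts add up to \<open>|v - c| powr p\<close>, and the energies sit on the disjoint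
  sets above and below c, so the sum loses no factor 2.\<close>

lemma poincare_loc_lipschitz:
  fixes v :: "'a::polish_space \<Rightarrow> real"
  assumes m: "sets m = sets borel" and \<Omega>: "open \<Omega>" and fin: "emeasure m \<Omega> < \<infinity>"
    and v: "loc_lipschitz_fun \<Omega> v" and C: "0 < C" and Q: "1 < Q" and p: "1 < p" and R: "0 < R"
    and vol: "measure m \<Omega> = unit_ball_vol Q * R powr Q"
    and iso: "\<And>E. E \<in> sets borel \<Longrightarrow> E \<subseteq> \<Omega> \<Longrightarrow>
      perimeter m E \<Omega> \<ge> ennreal (C * unit_ball_vol Q powr (1 / Q) * Q *
        min (measure m E) (measure m (\<Omega> - E)) powr ((Q - 1) / Q))"
  obtains c where "model_dirichlet_eigenvalue p Q R * (\<integral>\<^sup>+x\<in>\<Omega>. ennreal (\<bar>v x - c\<bar> powr p) \<partial>m)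
    \<le> ennreal ((1 / (2 powr (1 / Q) * C)) powr p) * (\<integral>\<^sup>+x\<in>\<Omega>. epowr (lip v x) p \<partial>m)"
proof -
  have cont: "continuous_on \<Omega> v" by (rule loc_lipschitz_fun_continuous[OF \<Omega> v])
  have \<Omega>m: "\<Omega> \<in> sets m" using \<Omega> m by simp
  have up: "{x\<in>\<Omega>. c < v x} \<in> sets m" and dn: "{x\<in>\<Omega>. v x < c} \<in> sets m" for c
    using continuous_on_open_vimage[OF \<Omega>, THEN iffD1, OF cont, rule_format, of "{c<..}"]
      continuous_on_open_vimage[OF \<Omega>, THEN iffD1, OF cont, rule_format, of "{..<c}"] m
    by (simp_all add: vimage_def Int_def conj_commute)
  obtain c where c: "2 * measure m {x\<in>\<Omega>. c < v x} \<le> measure m \<Omega>" "2 * measure m {x\<in>\<Omega>. v x < c} \<le> measure m \<Omega>"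
    by (rule ex_median[OF fin \<Omega>m up dn])
  define \<kappa> where "\<kappa> = ennreal ((1 / (2 powr (1 / Q) * C)) powr p)"
  have l1: "1-lipschitz_on UNIV (\<lambda>t::real. t - c)" and l2: "1-lipschitz_on UNIV (\<lambda>t::real. c - t)"
    by (auto intro!: lipschitz_onI simp: dist_real_def)
  interpret P: one_sided m \<Omega> "\<lambda>x. v x - c" C Q p R
    by (unfold_locales, fact m, fact \<Omega>, fact fin, rule loc_lipschitz_fun_compose[OF v l1], fact C, fact Q, fact p,
        fact R, fact vol, use c(1) in simp, fact iso)
  interpret N: one_sided m \<Omega> "\<lambda>x. c - v x" C Q p R
    by (unfold_locales, fact m, fact \<Omega>, fact fin, rule loc_lipschitz_fun_compose[OF v l2], fact C, fact Q, fact p,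
        fact R, fact vol, use c(2) in simp, fact iso)
  have lm: "(\<lambda>x. lip v x * indicator \<Omega> x) \<in> borel_measurable m"
    using P.lip_measurable by (simp only: lip_diff_const)
  have meas: "(\<lambda>x. ennreal (max 0 (f (v x)) powr p) * indicator \<Omega> x) \<in> borel_measurable m"
    if [measurable]: "f \<in> borel_measurable borel" for f :: "real \<Rightarrow> real"
  proof -
    define v' where "v' x = (if x \<in> \<Omega> then v x else 0)" for x
    have [measurable]: "v' \<in> borel_measurable borel"
      unfolding v'_def using \<Omega> by (intro borel_measurable_continuous_on_if[OF _ cont continuous_on_const]) simp
    have [measurable]: "\<Omega> \<in> sets borel" using \<Omega> by simp
    have "(\<lambda>x. ennreal (max 0 (f (v' x)) powr p) * indicator \<Omega> x) \<in> borel_measurable borel"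
      by measurable
    moreover have "(\<lambda>x. ennreal (max 0 (f (v' x)) powr p) * indicator \<Omega> x)
        = (\<lambda>x. ennreal (max 0 (f (v x)) powr p) * indicator \<Omega> x)"
      by (auto simp: fun_eq_iff v'_def indicator_def)
    ultimately show ?thesis by (simp only: measurable_cong_sets[OF m refl])
  qed
  have emeas: "(\<lambda>x. epowr (lip v x) p * indicator A x) \<in> borel_measurable m" if "A \<in> sets m" "A \<subseteq> \<Omega>" for A
  proof -
    have "(\<lambda>x. epowr (lip v x * indicator \<Omega> x) p * indicator A x) \<in> borel_measurable m"
      by (rule borel_measurable_times_ennreal[OF borel_measurable_epowr[OF lm] borel_measurable_indicator[OF that(1)]])
    moreover have "(\<lambda>x. epowr (lip v x * indicator \<Omega> x) p * indicator A x) = (\<lambda>x. epowr (lip v x) p * indicator A x)"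
      using that(2) by (auto simp: fun_eq_iff indicator_def)
    ultimately show ?thesis by simp
  qed
  have "(\<integral>\<^sup>+x\<in>\<Omega>. ennreal (\<bar>v x - c\<bar> powr p) \<partial>m)
     = (\<integral>\<^sup>+x. ennreal (max 0 (v x - c) powr p) * indicator \<Omega> x + ennreal (max 0 (c - v x) powr p) * indicator \<Omega> x \<partial>m)"
  proof (rule nn_integral_cong)
    fix x
    have "ennreal (\<bar>v x - c\<bar> powr p) = ennreal (max 0 (v x - c) powr p) + ennreal (max 0 (c - v x) powr p)"
      by (cases "c \<le> v x") simp_all
    then show "ennreal (\<bar>v x - c\<bar> powr p) * indicator \<Omega> x
      = ennreal (max 0 (v x - c) powr p) * indicator \<Omega> x + ennreal (max 0 (c - v x) powr p) * indicator \<Omega> x"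
      by (simp only: distrib_right)
  qed
  also have "\<dots> = (\<integral>\<^sup>+x\<in>\<Omega>. ennreal (max 0 (v x - c) powr p) \<partial>m) + (\<integral>\<^sup>+x\<in>\<Omega>. ennreal (max 0 (c - v x) powr p) \<partial>m)"
    by (rule nn_integral_add[OF meas[of "\<lambda>t. t - c"] meas[of "\<lambda>t. c - t"]]) measurable
  finally have "model_dirichlet_eigenvalue p Q R * (\<integral>\<^sup>+x\<in>\<Omega>. ennreal (\<bar>v x - c\<bar> powr p) \<partial>m)
     = model_dirichlet_eigenvalue p Q R * (\<integral>\<^sup>+x\<in>\<Omega>. ennreal (max 0 (v x - c) powr p) \<partial>m)
     + model_dirichlet_eigenvalue p Q R * (\<integral>\<^sup>+x\<in>\<Omega>. ennreal (max 0 (c - v x) powr p) \<partial>m)"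
    by (simp only: distrib_left)
  also have "\<dots> \<le> \<kappa> * P.D + \<kappa> * N.D"
    unfolding \<kappa>_def by (intro add_mono P.faber_krahn N.faber_krahn)
  also have "\<dots> = \<kappa> * (P.D + N.D)" by (simp only: distrib_left)
  also have "P.D + N.D \<le> (\<integral>\<^sup>+x\<in>\<Omega>. epowr (lip v x) p \<partial>m)"
  proof -
    have PD: "P.D = (\<integral>\<^sup>+x\<in>{x\<in>\<Omega>. c < v x}. epowr (lip v x) p \<partial>m)"
      unfolding P.D_def lip_diff_const by simp
    have ND: "N.D = (\<integral>\<^sup>+x\<in>{x\<in>\<Omega>. v x < c}. epowr (lip v x) p \<partial>m)"
      unfolding N.D_def lip_diff_const by simp
    have "P.D + N.D = (\<integral>\<^sup>+x. epowr (lip v x) p * indicator {x\<in>\<Omega>. c < v x} x + epowr (lip v x) p * indicator {x\<in>\<Omega>. v x < c} x \<partial>m)"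
      unfolding PD ND using up dn by (intro nn_integral_add[symmetric] emeas) auto
    also have "\<dots> \<le> (\<integral>\<^sup>+x\<in>\<Omega>. epowr (lip v x) p \<partial>m)"
      by (intro nn_integral_mono) (auto simp: indicator_def)
    finally show ?thesis .
  qed
  finally have "model_dirichlet_eigenvalue p Q R * (\<integral>\<^sup>+x\<in>\<Omega>. ennreal (\<bar>v x - c\<bar> powr p) \<partial>m)
    \<le> \<kappa> * (\<integral>\<^sup>+x\<in>\<Omega>. epowr (lip v x) p \<partial>m)" by (simp add: mult_left_mono)
  then show ?thesis unfolding \<kappa>_def by (rule that)
qed

text \<open>The tangent to \<open>|t| powr p\<close> at a, evaluated at a - c; it is Young's
  inequality with \<theta> = |a|. At a = 0 the linear term is 0 for every p.\<close>

lemma powr_convex_tangent: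
  assumes p: "1 < p"
  shows "\<bar>a\<bar> powr p \<le> \<bar>a - c\<bar> powr p + p * c * (\<bar>a\<bar> powr (p - 2) * (a::real))"
proof (cases "a = 0")
  case False
  define \<theta> where "\<theta> = \<bar>a\<bar>"
  have \<theta>: "0 < \<theta>" using False by (simp add: \<theta>_def)
  have y: "p * \<theta> powr (p - 1) * \<bar>a - c\<bar> \<le> \<bar>a - c\<bar> powr p + (p - 1) * \<theta> powr p"
    by (rule young_powr[OF p]) (simp_all add: \<theta>_def)
  have 1: "\<theta> powr (p - 2) * a * a = \<theta> powr p"
  proof -
    have "a * a = \<theta> powr 2" using \<theta> by (simp add: \<theta>_def power2_eq_square)
    then have "\<theta> powr (p - 2) * a * a = \<theta> powr (p - 2) * \<theta> powr 2" by (simp only: mult.assoc)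
    also have "\<dots> = \<theta> powr p" by (simp add: powr_add[symmetric])
    finally show ?thesis .
  qed
  have 2: "\<theta> powr (p - 2) * \<theta> = \<theta> powr (p - 1)"
  proof -
    have "\<theta> powr (p - 2) * \<theta> powr 1 = \<theta> powr (p - 1)" by (simp only: powr_add[symmetric]) simp
    then show ?thesis using \<theta> by simp
  qed
  have "\<theta> powr (p - 2) * a * (a - c) \<le> \<bar>\<theta> powr (p - 2) * a * (a - c)\<bar>" by simp
  also have "\<dots> = \<theta> powr (p - 1) * \<bar>a - c\<bar>" unfolding 2[symmetric] by (simp add: abs_mult \<theta>_def)
  finally have "p * (\<theta> powr (p - 2) * a * (a - c)) \<le> p * (\<theta> powr (p - 1) * \<bar>a - c\<bar>)"
    using p by (intro mult_left_mono) simp_all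
  moreover have eq: "\<theta> powr (p - 2) * a * (a - c) = \<theta> powr p - c * (\<theta> powr (p - 2) * a)"
    unfolding 1[symmetric] by (simp add: algebra_simps)
  ultimately have "p * (\<theta> powr p - c * (\<theta> powr (p - 2) * a)) \<le> p * (\<theta> powr (p - 1) * \<bar>a - c\<bar>)"
    by (simp only: eq)
  then have "p * \<theta> powr p - p * c * (\<theta> powr (p - 2) * a) \<le> p * \<theta> powr (p - 1) * \<bar>a - c\<bar>"
    by (simp only: right_diff_distrib mult.assoc)
  then have "p * \<theta> powr p - p * c * (\<theta> powr (p - 2) * a) \<le> \<bar>a - c\<bar> powr p + (p * \<theta> powr p - \<theta> powr p)"
    using y by (simp add: left_diff_distrib)
  then show ?thesis unfolding \<theta>_def by linarith
qed simp

lemma neumann_constraint_minimizes: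
  assumes p: "1 < p" and u[measurable]: "u \<in> borel_measurable M"
    and one: "(\<integral>\<^sup>+x. ennreal (\<bar>u x\<bar> powr p) \<partial>M) = 1"
    and int: "integrable M (\<lambda>x. \<bar>u x\<bar> powr (p - 2) * u x)" and zero: "(\<integral>x. \<bar>u x\<bar> powr (p - 2) * u x \<partial>M) = 0"
  shows "1 \<le> (\<integral>\<^sup>+x. ennreal (\<bar>u x - c\<bar> powr p) \<partial>M)"
proof (cases "(\<integral>\<^sup>+x. ennreal (\<bar>u x - c\<bar> powr p) \<partial>M) = \<infinity>")
  case False
  have i1: "integrable M (\<lambda>x. \<bar>u x\<bar> powr p)"
    by (rule integrableI_nonneg) (measurable, simp_all add: one)
  have i2: "integrable M (\<lambda>x. \<bar>u x - c\<bar> powr p)"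
    by (rule integrableI_nonneg) (use False in \<open>measurable, simp_all add: less_top\<close>)
  have "ennreal (\<integral>x. \<bar>u x\<bar> powr p \<partial>M) = 1"
    using nn_integral_eq_integral[OF i1] one by simp
  then have e1: "(\<integral>x. \<bar>u x\<bar> powr p \<partial>M) = 1" by simp
  \<comment> \<open>The linear term of the tangent inequality is a multiple of the constraint and
    integrates to 0.\<close>
  have "(\<integral>x. \<bar>u x\<bar> powr p \<partial>M) \<le> (\<integral>x. \<bar>u x - c\<bar> powr p + p * c * (\<bar>u x\<bar> powr (p - 2) * u x) \<partial>M)"
    by (intro integral_mono i1 Bochner_Integration.integrable_add i2 integrable_mult_right int powr_convex_tangent p)
  also have "\<dots> = (\<integral>x. \<bar>u x - c\<bar> powr p \<partial>M) + (\<integral>x. p * c * (\<bar>u x\<bar> powr (p - 2) * u x) \<partial>M)"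
    by (intro Bochner_Integration.integral_add i2 integrable_mult_right int)
  also have "(\<integral>x. p * c * (\<bar>u x\<bar> powr (p - 2) * u x) \<partial>M) = 0"
    by (simp only: integral_mult_right_zero zero mult_zero_right)
  finally have "1 \<le> (\<integral>x. \<bar>u x - c\<bar> powr p \<partial>M)" using e1 by simp
  then have "ennreal 1 \<le> ennreal (\<integral>x. \<bar>u x - c\<bar> powr p \<partial>M)" by (rule ennreal_leI)
  then show ?thesis using nn_integral_eq_integral[OF i2] by simp
qed simp

lemma nn_integral_epowr_add_le:
  assumes p: "0 < p" and \<tau>: "0 < \<tau>" and a[measurable]: "a \<in> borel_measurable M" and b[measurable]: "b \<in> borel_measurable M"
    and le: "AE x in M. f x \<le> a x + b x"
  shows "(\<integral>\<^sup>+x. epowr (f x) p \<partial>M)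
    \<le> ennreal ((1 + \<tau>) powr p) * (\<integral>\<^sup>+x. epowr (a x) p \<partial>M) + ennreal ((1 + 1 / \<tau>) powr p) * (\<integral>\<^sup>+x. epowr (b x) p \<partial>M)"
proof -
  have "(\<integral>\<^sup>+x. epowr (f x) p \<partial>M)
     \<le> (\<integral>\<^sup>+x. ennreal ((1 + \<tau>) powr p) * epowr (a x) p + ennreal ((1 + 1 / \<tau>) powr p) * epowr (b x) p \<partial>M)"
  proof (rule nn_integral_mono_AE, use le in \<open>rule AE_mp\<close>, rule AE_I2, rule impI)
    fix x assume "f x \<le> a x + b x"
    then have "epowr (f x) p \<le> epowr (a x + b x) p" using p by (intro epowr_mono) simp_all
    also note epowr_add_le[OF p \<tau>]
    finally show "epowr (f x) p \<le> ennreal ((1 + \<tau>) powr p) * epowr (a x) p + ennreal ((1 + 1 / \<tau>) powr p) * epowr (b x) p" .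
  qed
  also have "\<dots> = (\<integral>\<^sup>+x. ennreal ((1 + \<tau>) powr p) * epowr (a x) p \<partial>M) + (\<integral>\<^sup>+x. ennreal ((1 + 1 / \<tau>) powr p) * epowr (b x) p \<partial>M)"
    by (rule nn_integral_add) measurable
  also have "(\<integral>\<^sup>+x. ennreal ((1 + \<tau>) powr p) * epowr (a x) p \<partial>M) = ennreal ((1 + \<tau>) powr p) * (\<integral>\<^sup>+x. epowr (a x) p \<partial>M)"
    by (rule nn_integral_cmult) measurable
  also have "(\<integral>\<^sup>+x. ennreal ((1 + 1 / \<tau>) powr p) * epowr (b x) p \<partial>M) = ennreal ((1 + 1 / \<tau>) powr p) * (\<integral>\<^sup>+x. epowr (b x) p \<partial>M)"
    by (rule nn_integral_cmult) measurable
  finally show ?thesis .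
qed

text \<open>The medians \<open>c n\<close> of the approximations are not controlled as n varies, so
  the lower bound \<open>one\<close> is used for every c. The approximation error enters twice: in
  the norm, with parameter \<tau>, and in the energy, with parameter \<sigma>.\<close>

lemma poincare_W1p:
  fixes u :: "'a::polish_space \<Rightarrow> real"
  assumes m: "sets m = sets borel" and \<Omega>: "open \<Omega>" and fin: "emeasure m \<Omega> < \<infinity>"
    and C: "0 < C" and Q: "1 < Q" and p: "1 < p" and R: "0 < R"
    and vol: "measure m \<Omega> = unit_ball_vol Q * R powr Q"
    and iso: "\<And>E. E \<in> sets borel \<Longrightarrow> E \<subseteq> \<Omega> \<Longrightarrow>
      perimeter m E \<Omega> \<ge> ennreal (C * unit_ball_vol Q powr (1 / Q) * Q *
        min (measure m E) (measure m (\<Omega> - E)) powr ((Q - 1) / Q))"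
    and W: "W1p_on p m \<Omega> u g"
    and one: "\<And>c. 1 \<le> (\<integral>\<^sup>+x\<in>\<Omega>. ennreal (\<bar>u x - c\<bar> powr p) \<partial>m)"
  shows "model_dirichlet_eigenvalue p Q R
    \<le> ennreal ((1 / (2 powr (1 / Q) * C)) powr p) * (\<integral>\<^sup>+x\<in>\<Omega>. epowr (g x) p \<partial>m)"
proof -
  have p0: "0 < p" using p by simp
  define L where "L = model_dirichlet_eigenvalue p Q R"
  define \<kappa> where "\<kappa> = ennreal ((1 / (2 powr (1 / Q) * C)) powr p)"
  define N where "N = restrict_space m \<Omega>"
  have \<Omega>m: "\<Omega> \<inter> space m \<in> sets m" using \<Omega> m sets_eq_imp_space_eq[OF m] by simp
  have rs: "(\<integral>\<^sup>+x\<in>\<Omega>. f x \<partial>m) = (\<integral>\<^sup>+x. f x \<partial>N)" for f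
    unfolding N_def by (rule nn_integral_restrict_space[OF \<Omega>m, symmetric])
  define G where "G = (\<integral>\<^sup>+x. epowr (g x) p \<partial>N)"
  have gm: "g \<in> borel_measurable N"
    using W unfolding N_def W1p_on_def local_minimal_wug_def by simp
  have "\<exists>v B. loc_lipschitz_fun \<Omega> v \<and> B \<in> borel_measurable m \<and>
      (\<integral>\<^sup>+x. epowr (B x) p \<partial>m) \<le> ennreal (1 / real (Suc n)) \<and>
      (AE x in m. x \<in> \<Omega> \<longrightarrow> ennreal \<bar>v x - u x\<bar> \<le> B x \<and> lip v x \<le> g x + B x)" for n
    by (rule meyers_serrin[OF p m \<Omega> W, of "1 / real (Suc n)"]) (simp, intro exI conjI)
  then have "\<exists>v. \<forall>n. \<exists>B. loc_lipschitz_fun \<Omega> (v n) \<and> B \<in> borel_measurable m \<and>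
      (\<integral>\<^sup>+x. epowr (B x) p \<partial>m) \<le> ennreal (1 / real (Suc n)) \<and>
      (AE x in m. x \<in> \<Omega> \<longrightarrow> ennreal \<bar>v n x - u x\<bar> \<le> B x \<and> lip (v n) x \<le> g x + B x)"
    by (intro choice allI)
  then obtain v where v': "\<forall>n. \<exists>B. loc_lipschitz_fun \<Omega> (v n) \<and> B \<in> borel_measurable m \<and>
      (\<integral>\<^sup>+x. epowr (B x) p \<partial>m) \<le> ennreal (1 / real (Suc n)) \<and>
      (AE x in m. x \<in> \<Omega> \<longrightarrow> ennreal \<bar>v n x - u x\<bar> \<le> B x \<and> lip (v n) x \<le> g x + B x)" ..
  obtain B where "\<forall>n. loc_lipschitz_fun \<Omega> (v n) \<and> B n \<in> borel_measurable m \<and>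
      (\<integral>\<^sup>+x. epowr (B n x) p \<partial>m) \<le> ennreal (1 / real (Suc n)) \<and>
      (AE x in m. x \<in> \<Omega> \<longrightarrow> ennreal \<bar>v n x - u x\<bar> \<le> B n x \<and> lip (v n) x \<le> g x + B n x)"
    using choice[OF v'] ..
  then have v: "\<And>n. loc_lipschitz_fun \<Omega> (v n)" and B: "\<And>n. B n \<in> borel_measurable m"
    and z': "\<And>n. (\<integral>\<^sup>+x. epowr (B n x) p \<partial>m) \<le> ennreal (1 / real (Suc n))"
    and ae': "\<And>n. AE x in m. x \<in> \<Omega> \<longrightarrow> ennreal \<bar>v n x - u x\<bar> \<le> B n x \<and> lip (v n) x \<le> g x + B n x"
    by blast+
  have ae: "AE x in N. ennreal \<bar>v n x - u x\<bar> \<le> B n x \<and> lip (v n) x \<le> g x + B n x" for n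
    unfolding N_def AE_restrict_space_iff[OF \<Omega>m] by (rule ae')
  have Bm: "B n \<in> borel_measurable N" for n
    unfolding N_def by (rule measurable_restrict_space1[OF B])
  have vm: "v n \<in> borel_measurable N" for n
  proof -
    have "v n \<in> borel_measurable (restrict_space borel \<Omega>)"
      by (rule borel_measurable_continuous_on_restrict[OF loc_lipschitz_fun_continuous[OF \<Omega> v]])
    then show ?thesis
      unfolding N_def by (simp only: measurable_cong_sets[OF sets_restrict_space_cong[OF m] refl])
  qed
  have z: "(\<integral>\<^sup>+x. epowr (B n x) p \<partial>N) \<le> ennreal (1 / real (Suc n))" for n
  proof -
    have "(\<integral>\<^sup>+x. epowr (B n x) p \<partial>N) \<le> (\<integral>\<^sup>+x. epowr (B n x) p \<partial>m)"
      unfolding rs[symmetric] by (rule nn_integral_mono) (simp add: indicator_def)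
    also note z'
    finally show ?thesis .
  qed
  have "\<exists>c. L * (\<integral>\<^sup>+x. ennreal (\<bar>v n x - c\<bar> powr p) \<partial>N) \<le> \<kappa> * (\<integral>\<^sup>+x. epowr (lip (v n) x) p \<partial>N)" for n
    unfolding rs[symmetric] L_def \<kappa>_def
    by (rule poincare_loc_lipschitz[OF m \<Omega> fin v C Q p R vol]) (rule iso, assumption+, rule exI)
  then have "\<exists>c. \<forall>n. L * (\<integral>\<^sup>+x. ennreal (\<bar>v n x - c n\<bar> powr p) \<partial>N) \<le> \<kappa> * (\<integral>\<^sup>+x. epowr (lip (v n) x) p \<partial>N)"
    by (intro choice allI)
  then obtain c where c: "\<And>n. L * (\<integral>\<^sup>+x. ennreal (\<bar>v n x - c n\<bar> powr p) \<partial>N) \<le> \<kappa> * (\<integral>\<^sup>+x. epowr (lip (v n) x) p \<partial>N)"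
    by blast
  have one': "1 \<le> ennreal ((1 + \<tau>) powr p) * (\<integral>\<^sup>+x. ennreal (\<bar>v n x - c n\<bar> powr p) \<partial>N)
      + ennreal ((1 + 1 / \<tau>) powr p) * ennreal (1 / real (Suc n))" if \<tau>: "0 < \<tau>" for n \<tau>
  proof -
    have eq: "ennreal (\<bar>a\<bar> powr p) = epowr (ennreal \<bar>a\<bar>) p" for a by (simp add: epowr_ennreal)
    have "1 \<le> (\<integral>\<^sup>+x. ennreal (\<bar>u x - c n\<bar> powr p) \<partial>N)" unfolding rs[symmetric] by (rule one)
    also have "\<dots> \<le> ennreal ((1 + \<tau>) powr p) * (\<integral>\<^sup>+x. ennreal (\<bar>v n x - c n\<bar> powr p) \<partial>N)
      + ennreal ((1 + 1 / \<tau>) powr p) * (\<integral>\<^sup>+x. epowr (B n x) p \<partial>N)"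
      unfolding eq
    proof (rule nn_integral_epowr_add_le[OF p0 \<tau> _ Bm])
      show "(\<lambda>x. ennreal \<bar>v n x - c n\<bar>) \<in> borel_measurable N" using vm[of n] by measurable
      show "AE x in N. ennreal \<bar>u x - c n\<bar> \<le> ennreal \<bar>v n x - c n\<bar> + B n x"
      proof (rule AE_mp[OF ae[of n]], rule AE_I2, rule impI)
        fix x assume le: "ennreal \<bar>v n x - u x\<bar> \<le> B n x \<and> lip (v n) x \<le> g x + B n x"
        have "ennreal \<bar>u x - c n\<bar> \<le> ennreal (\<bar>v n x - c n\<bar> + \<bar>v n x - u x\<bar>)" by (intro ennreal_leI) linarith
        also have "\<dots> = ennreal \<bar>v n x - c n\<bar> + ennreal \<bar>v n x - u x\<bar>" by (rule ennreal_plus) simp_all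
        also have "\<dots> \<le> ennreal \<bar>v n x - c n\<bar> + B n x" by (rule add_left_mono[OF le[THEN conjunct1]])
        finally show "ennreal \<bar>u x - c n\<bar> \<le> ennreal \<bar>v n x - c n\<bar> + B n x" .
      qed
    qed
    also have "\<dots> \<le> ennreal ((1 + \<tau>) powr p) * (\<integral>\<^sup>+x. ennreal (\<bar>v n x - c n\<bar> powr p) \<partial>N)
      + ennreal ((1 + 1 / \<tau>) powr p) * ennreal (1 / real (Suc n))"
      by (intro add_left_mono mult_left_mono z) simp
    finally show ?thesis .
  qed
  have lipm: "lip (v n) \<in> borel_measurable N" for n
    unfolding N_def borel_measurable_restrict_space_iff_ennreal[OF \<Omega>m] measurable_cong_sets[OF m refl]
    by (rule borel_measurable_lip_indicator[OF \<Omega> loc_lipschitz_fun_continuous[OF \<Omega> v]])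
  have e: "(\<integral>\<^sup>+x. epowr (lip (v n) x) p \<partial>N)
      \<le> ennreal ((1 + \<sigma>) powr p) * G + ennreal ((1 + 1 / \<sigma>) powr p) * ennreal (1 / real (Suc n))" if \<sigma>: "0 < \<sigma>" for n \<sigma>
  proof -
    have "(\<integral>\<^sup>+x. epowr (lip (v n) x) p \<partial>N)
      \<le> ennreal ((1 + \<sigma>) powr p) * G + ennreal ((1 + 1 / \<sigma>) powr p) * (\<integral>\<^sup>+x. epowr (B n x) p \<partial>N)"
      unfolding G_def
      by (rule nn_integral_epowr_add_le[OF p0 \<sigma> gm Bm], rule AE_mp[OF ae[of n]], rule AE_I2, rule impI, erule conjunct2)
    also have "\<dots> \<le> ennreal ((1 + \<sigma>) powr p) * G + ennreal ((1 + 1 / \<sigma>) powr p) * ennreal (1 / real (Suc n))"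
      by (intro add_left_mono mult_left_mono z) simp
    finally show ?thesis .
  qed
  have small: "(\<lambda>n. ennreal (1 / real (Suc n))) \<longlonglongrightarrow> 0"
  proof -
    have "(\<lambda>n. ennreal (1 / real (Suc n))) \<longlonglongrightarrow> ennreal 0"
      using LIMSEQ_inverse_real_of_nat by (intro tendsto_ennrealI) (simp only: inverse_eq_divide)
    then show ?thesis by (simp only: ennreal_0)
  qed
  have "L * 1 \<le> \<kappa> * G"
  proof (rule ennreal_mult_le_of_real_bounds)
    fix l assume l: "0 < l" "ennreal l \<le> L"
    \<comment> \<open>For fixed \<sigma>, first n tends to infinity and then \<tau> to 0; \<sigma>
      tends to 0 only after this, with constant sequences in place of the errors. Finiteness of l
      makes \<open>l\<close> times the error vanish.\<close>
    have "ennreal l \<le> \<kappa> * (ennreal ((1 + \<sigma>) powr p) * G)" if \<sigma>: "0 < \<sigma>" for \<sigma>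
    proof (rule le_of_approx_powr[OF p0])
      fix n and \<tau> :: real assume \<tau>: "0 < \<tau>"
      define Y where "Y = (\<integral>\<^sup>+x. ennreal (\<bar>v n x - c n\<bar> powr p) \<partial>N)"
      have "ennreal l * Y \<le> L * Y" by (rule mult_right_mono[OF l(2)]) simp
      also have "\<dots> \<le> \<kappa> * (\<integral>\<^sup>+x. epowr (lip (v n) x) p \<partial>N)" unfolding Y_def by (rule c)
      also have "\<dots> \<le> \<kappa> * (ennreal ((1 + \<sigma>) powr p) * G + ennreal ((1 + 1 / \<sigma>) powr p) * ennreal (1 / real (Suc n)))"
        by (rule mult_left_mono[OF e[OF \<sigma>]]) simp
      finally have lY: "ennreal l * Y \<le> \<dots>" .
      have "ennreal l = ennreal l * 1" by simp
      also have "\<dots> \<le> ennreal l * (ennreal ((1 + \<tau>) powr p) * Y + ennreal ((1 + 1 / \<tau>) powr p) * ennreal (1 / real (Suc n)))"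
        unfolding Y_def by (rule mult_left_mono[OF one'[OF \<tau>]]) simp
      also have "\<dots> = ennreal ((1 + \<tau>) powr p) * (ennreal l * Y) + ennreal ((1 + 1 / \<tau>) powr p) * (ennreal l * ennreal (1 / real (Suc n)))"
        by (simp only: distrib_left mult.left_commute[of "ennreal l"])
      also have "\<dots> \<le> ennreal ((1 + \<tau>) powr p) * (\<kappa> * (ennreal ((1 + \<sigma>) powr p) * G + ennreal ((1 + 1 / \<sigma>) powr p) * ennreal (1 / real (Suc n))))
          + ennreal ((1 + 1 / \<tau>) powr p) * (ennreal l * ennreal (1 / real (Suc n)))"
        by (rule add_right_mono[OF mult_left_mono[OF lY]]) simp
      finally show "ennreal l \<le> \<dots>" .
    next
      have "(\<lambda>n. \<kappa> * (ennreal ((1 + \<sigma>) powr p) * G + ennreal ((1 + 1 / \<sigma>) powr p) * ennreal (1 / real (Suc n))))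
        \<longlonglongrightarrow> \<kappa> * (ennreal ((1 + \<sigma>) powr p) * G + ennreal ((1 + 1 / \<sigma>) powr p) * 0)"
        unfolding \<kappa>_def by (intro ennreal_tendsto_cmult tendsto_add tendsto_const small) simp_all
      then show "(\<lambda>n. \<kappa> * (ennreal ((1 + \<sigma>) powr p) * G + ennreal ((1 + 1 / \<sigma>) powr p) * ennreal (1 / real (Suc n))))
        \<longlonglongrightarrow> \<kappa> * (ennreal ((1 + \<sigma>) powr p) * G)" by (simp only: mult_zero_right add_0_right)
      have "(\<lambda>n. ennreal l * ennreal (1 / real (Suc n))) \<longlonglongrightarrow> ennreal l * 0"
        by (intro ennreal_tendsto_cmult small) simp
      then show "(\<lambda>n. ennreal l * ennreal (1 / real (Suc n))) \<longlonglongrightarrow> 0" by (simp only: mult_zero_right)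
    qed
    note l_le = this
    have "ennreal l \<le> \<kappa> * G"
    proof (rule le_of_approx_powr[OF p0 _ tendsto_const tendsto_const])
      fix n :: nat and \<sigma> :: real assume "0 < \<sigma>"
      then show "ennreal l \<le> ennreal ((1 + \<sigma>) powr p) * (\<kappa> * G) + ennreal ((1 + 1 / \<sigma>) powr p) * 0"
        using l_le by (simp only: mult.left_commute[of \<kappa>] mult_zero_right add_0_right)
    qed
    then show "ennreal l * 1 \<le> \<kappa> * G" by simp
  qed
  then show ?thesis unfolding G_def L_def \<kappa>_def rs by simp
qed

theorem theorem1p8:
  fixes m :: "'a::polish_space measure" and \<Omega> :: "'a set" and C Q R p :: real
  assumes "metric_measure_space m"
    and "open \<Omega>" and "\<Omega> \<noteq> {}" and "emeasure m \<Omega> < \<infinity>"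
    and "C > 0" and "Q > 1"
    and "\<And>E. E \<in> sets borel \<Longrightarrow> E \<subseteq> \<Omega> \<Longrightarrow>
      perimeter m E \<Omega> \<ge> ennreal (C * unit_ball_vol Q powr (1 / Q) * Q *
        min (measure m E) (measure m (\<Omega> - E)) powr ((Q - 1) / Q))"
    and "1 < p"
    and "R > 0" and "emeasure (model_measure Q) {x. coord x < R} = emeasure m \<Omega>"
  shows "neumann_eigenvalue p m \<Omega> \<ge>
    ennreal (C powr p * 2 powr (p / Q)) * model_dirichlet_eigenvalue p Q R"
proof -
  note \<Omega> = assms(2) and fin = assms(4) and C = assms(5) and Q = assms(6) and p = assms(8) and R = assms(9)
  have m: "sets m = sets borel" using assms(1) by (simp add: metric_measure_space_def)
  have \<Omega>m: "\<Omega> \<inter> space m \<in> sets m" using \<Omega> m sets_eq_imp_space_eq[OF m] by simp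
  have \<omega>: "0 \<le> unit_ball_vol Q" using Q by (simp add: unit_ball_vol_nonneg)
  have "emeasure m \<Omega> = ennreal (unit_ball_vol Q * R powr Q)"
    using emeasure_model_measure_ball[OF Q, of R] R assms(10) by simp
  then have vol: "measure m \<Omega> = unit_ball_vol Q * R powr Q"
    using \<omega> by (simp add: measure_def)
  define k where "k = C powr p * 2 powr (p / Q)"
  \<comment> \<open>\<open>k\<close> is the p-th power of \<open>2 powr (1 / Q) * C\<close>, so
    multiplying by it cancels the constant of \<open>poincare_W1p\<close>.\<close>
  have k: "ennreal k * ennreal ((1 / (2 powr (1 / Q) * C)) powr p) = 1"
  proof -
    have "(2 powr (1 / Q) * C) powr p = k"
      using C by (simp add: k_def powr_mult powr_powr)
    moreover have "0 < k" using C by (simp add: k_def)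
    ultimately have "k * (1 / (2 powr (1 / Q) * C)) powr p = 1"
      using C by (simp add: powr_divide)
    then show ?thesis using C by (simp add: k_def flip: ennreal_mult)
  qed
  show ?thesis unfolding neumann_eigenvalue_def k_def[symmetric]
  proof (rule INF_greatest, clarify)
    fix u g assume W: "W1p_on p m \<Omega> u g" and one: "(\<integral>\<^sup>+x\<in>\<Omega>. ennreal (\<bar>u x\<bar> powr p) \<partial>m) = 1"
      and int: "set_integrable m \<Omega> (\<lambda>x. \<bar>u x\<bar> powr (p - 2) * u x)"
      and zero: "(LINT x:\<Omega>|m. \<bar>u x\<bar> powr (p - 2) * u x) = 0"
    have "1 \<le> (\<integral>\<^sup>+x\<in>\<Omega>. ennreal (\<bar>u x - c\<bar> powr p) \<partial>m)" for c
      unfolding nn_integral_restrict_space[OF \<Omega>m, symmetric]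
    proof (rule neumann_constraint_minimizes[OF p])
      show "u \<in> borel_measurable (restrict_space m \<Omega>)" using W unfolding W1p_on_def in_Lp_def by simp
      show "(\<integral>\<^sup>+x. ennreal (\<bar>u x\<bar> powr p) \<partial>restrict_space m \<Omega>) = 1"
        unfolding nn_integral_restrict_space[OF \<Omega>m] by (rule one)
      show "integrable (restrict_space m \<Omega>) (\<lambda>x. \<bar>u x\<bar> powr (p - 2) * u x)"
        using int unfolding integrable_restrict_space[OF \<Omega>m] set_integrable_def .
      show "(\<integral>x. \<bar>u x\<bar> powr (p - 2) * u x \<partial>restrict_space m \<Omega>) = 0"
        using zero unfolding integral_restrict_space[OF \<Omega>m] set_lebesgue_integral_def .
    qed
    note min = this
    have "model_dirichlet_eigenvalue p Q R
      \<le> ennreal ((1 / (2 powr (1 / Q) * C)) powr p) * (\<integral>\<^sup>+x\<in>\<Omega>. epowr (g x) p \<partial>m)"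
      by (rule poincare_W1p[OF m \<Omega> fin C Q p R vol _ W min]) (rule assms(7))
    then have "ennreal k * model_dirichlet_eigenvalue p Q R
      \<le> ennreal k * (ennreal ((1 / (2 powr (1 / Q) * C)) powr p) * (\<integral>\<^sup>+x\<in>\<Omega>. epowr (g x) p \<partial>m))"
      by (rule mult_left_mono) simp
    also have "\<dots> = (\<integral>\<^sup>+x\<in>\<Omega>. epowr (g x) p \<partial>m)"
      by (simp only: mult.assoc[symmetric] k mult_1)
    finally show "ennreal k * model_dirichlet_eigenvalue p Q R \<le> (\<integral>\<^sup>+x\<in>\<Omega>. epowr (g x) p \<partial>m)" .
  qed
qed

end
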